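(* Let $G$ be a totally disconnected, locally compact group and $\mathcal{H}\le\operatorname{Aut}G$. Assume that there is $O\in\mathcal{B}(G)$ such that the orbit $\mathcal{H}.O$ is proper, coarsely connected and of polynomial growth. Then there is a subgroup $\mathcal{H}_0$ of finite index in $\mathcal{H}$, a normal subgroup $\mathcal{N}_0\trianglelefteq\mathcal{H}_0$ and $V\in\mathcal{B}(G)$ such that $\mathcal{N}_0$ stabilizes $V$ (i.e. $\varphi(V)=V$ for all $\varphi\in\mathcal{N}_0$) and $\mathcal{H}_0/\mathcal{N}_0$ is a finitely generated nilpotent group.
   Context: Automorphisms are continuous with continuous inverse; $\operatorname{Aut}G$ is the group of automorphisms of $G$. $\mathcal{B}(G)$ is the set of compact, open subgroups of $G$ with metric $d(V,W)=\log\bigl(|V:V\cap W|\cdot|W:W\cap V|\bigr)$; $\operatorname{Aut}G$ acts isometrically by $\varphi.V=\varphi(V)$, and $\mathcal{H}.O=\{\varphi(O):\varphi\in\mathcal{H}\}$ carries the induced metric. A metric space is proper if closed bounded subsets are compact (here: balls in the orbit are finite). For $\delta>0$ a metric space is $\delta$-connected if any two points can be joined by a finite sequence of points whose consecutive terms are at distance at most $\delta$; it is coarsely connected if it is $\delta$-connected for some $\delta>0$. The orbit has polynomial growth (of degree $n$) if there are a point $x_0$ and $C>0$ such that the number of orbit points within distance $r$ of $x_0$ is at most $C(1+r)^n$ for all $r\ge 0$. *)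

theory Defs
  imports "HOL-Analysis.Analysis" "HOL-Algebra.Algebra"
begin

definition topological_group :: "('a, 'b) monoid_scheme \<Rightarrow> 'a topology \<Rightarrow> bool" where
  "topological_group G T \<longleftrightarrow> group G \<and> topspace T = carrier G \<and>
     continuous_map (prod_topology T T) T (\<lambda>(x, y). x \<otimes>\<^bsub>G\<^esub> y) \<and>
     continuous_map T T (\<lambda>x. inv\<^bsub>G\<^esub> x)"

definition totally_disconnected_space :: "'a topology \<Rightarrow> bool" where
  "totally_disconnected_space T \<longleftrightarrow>
     (\<forall>x \<in> topspace T. \<forall>y. connected_component_of T x y \<longrightarrow> y = x)"

(* Automorphisms of a topological group: group automorphisms which are homeomorphisms
   (continuous with continuous inverse), as extensional functions on carrier G.
   Aut G is a group under composition (a subgroup of BijGroup (carrier G)). *)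
definition top_auto :: "('a, 'b) monoid_scheme \<Rightarrow> 'a topology \<Rightarrow> ('a \<Rightarrow> 'a) set" where
  "top_auto G T = {\<phi> \<in> auto G. homeomorphic_map T T \<phi>}"

definition TopAutGroup :: "('a, 'b) monoid_scheme \<Rightarrow> 'a topology \<Rightarrow> ('a \<Rightarrow> 'a) monoid" where
  "TopAutGroup G T = BijGroup (carrier G) \<lparr>carrier := top_auto G T\<rparr>"

definition compact_open_subgroups :: "('a, 'b) monoid_scheme \<Rightarrow> 'a topology \<Rightarrow> 'a set set" where
  "compact_open_subgroups G T = {V. subgroup V G \<and> compactin T V \<and> openin T V}"

definition sg_index :: "('a, 'b) monoid_scheme \<Rightarrow> 'a set \<Rightarrow> 'a set \<Rightarrow> nat" where
  "sg_index G V W = card (rcosets\<^bsub>G\<lparr>carrier := V\<rparr>\<^esub> (V \<inter> W))"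

definition cos_dist :: "('a, 'b) monoid_scheme \<Rightarrow> 'a set \<Rightarrow> 'a set \<Rightarrow> real" where
  "cos_dist G V W = ln (real (sg_index G V W * sg_index G W V))"

definition orbit_of :: "('a \<Rightarrow> 'a) set \<Rightarrow> 'a set \<Rightarrow> 'a set set" where
  "orbit_of H U = {\<phi> ` U | \<phi>. \<phi> \<in> H}"

definition orbit_proper :: "('a, 'b) monoid_scheme \<Rightarrow> 'a set set \<Rightarrow> bool" where
  "orbit_proper G Orb \<longleftrightarrow> (\<forall>x \<in> Orb. \<forall>r::real. finite {y \<in> Orb. cos_dist G x y \<le> r})"

definition delta_connected :: "('a, 'b) monoid_scheme \<Rightarrow> real \<Rightarrow> 'a set set \<Rightarrow> bool" where
  "delta_connected G \<delta> Orb \<longleftrightarrow>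
     (\<forall>x \<in> Orb. \<forall>y \<in> Orb. \<exists>ps. ps \<noteq> [] \<and> hd ps = x \<and> last ps = y \<and> set ps \<subseteq> Orb \<and>
        (\<forall>i < length ps - 1. cos_dist G (ps ! i) (ps ! Suc i) \<le> \<delta>))"

definition coarsely_connected :: "('a, 'b) monoid_scheme \<Rightarrow> 'a set set \<Rightarrow> bool" where
  "coarsely_connected G Orb \<longleftrightarrow> (\<exists>\<delta> > 0. delta_connected G \<delta> Orb)"

definition polynomial_growth :: "('a, 'b) monoid_scheme \<Rightarrow> 'a set set \<Rightarrow> bool" where
  "polynomial_growth G Orb \<longleftrightarrow> (\<exists>x0 \<in> Orb. \<exists>C > 0. \<exists>n::nat. \<forall>r \<ge> 0.
      real (card {y \<in> Orb. cos_dist G x0 y \<le> r}) \<le> C * (1 + r) ^ n)"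

fun lower_central :: "('a, 'b) monoid_scheme \<Rightarrow> nat \<Rightarrow> 'a set" where
  "lower_central G 0 = carrier G"
| "lower_central G (Suc n) = generate G (\<Union>h \<in> lower_central G n. \<Union>g \<in> carrier G.
      {h \<otimes>\<^bsub>G\<^esub> g \<otimes>\<^bsub>G\<^esub> inv\<^bsub>G\<^esub> h \<otimes>\<^bsub>G\<^esub> inv\<^bsub>G\<^esub> g})"

definition nilpotent_group :: "('a, 'b) monoid_scheme \<Rightarrow> bool" where
  "nilpotent_group G \<longleftrightarrow> group G \<and> (\<exists>n. lower_central G n = {\<one>\<^bsub>G\<^esub>})"

definition finitely_generated_group :: "('a, 'b) monoid_scheme \<Rightarrow> bool" where
  "finitely_generated_group G \<longleftrightarrow> group G \<and>
     (\<exists>S. finite S \<and> S \<subseteq> carrier G \<and> generate G S = carrier G)"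

end

theory Submission
  imports Defs "HOL-Real_Asymp.Real_Asymp" "HOL-Computational_Algebra.Fundamental_Theorem_Algebra"
begin

text \<open>The proof adapts the approach of Kleiner and Ozawa to Gromov's theorem, with the orbit in place of a
  Cayley graph. An invariant lazy random walk on an infinite orbit has logarithmic entropy, so the
  gradients of harmonic functions are controlled by their average energy. Hence the Lipschitz harmonic
  functions form, modulo constants, a finite dimensional space with an invariant inner product; it is
  nonzero because normalized differences of heat kernels converge to nonconstant harmonic functions.
  Since commutators contract near the identity, a subgroup of finite index acts on it through an
  abelian group, and some subgroup of finite index has a nonzero homomorphism to the integers that
  kills the stabilizer of the base point. Its kernel is again coarsely connected, and its growth degree
  is smaller by one.

  To make the successive kernels normal and the quotients central, one needs a virtual homomorphism
  whose orbit under conjugation is finite. Polynomial growth bounds the rank of the space of virtual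
  homomorphisms and forces the conjugations to act on it with eigenvalues in the unit disc, hence, by an
  argument of Kronecker, with periodic vectors. Induction on the degree ends with a subgroup
  \<open>N\<close> whose orbit is finite, and \<open>V\<close> is the intersection of that orbit.\<close>

section \<open>Finite index and homomorphisms to the integers\<close>

text \<open>The stabilizer of the base point may be infinite and far from normal, so the group need
  not be finitely generated and the orbit is only a coset space. Hence all counting is of orbit
  points, \<open>conn\<close> asks for generators of bounded displacement, and every homomorphism
  has to vanish on the stabilizer, which thereby lies in every subgroup of the chain. Logarithmic
  entropy matters because its increment at time n is infinitely often at most a constant over n;
  this factor turns the energy accumulated in n steps into a mean. Limits are taken along an
  ultrafilter on such times, and since bounded harmonic functions are constant, they do not depend
  on the starting point and are therefore invariant. A homomorphism to the integers is found on a
  finite index subgroup that bears no relation to the ambient conjugation. Evaluating it at a power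
  \<open>g ^ e\<close> and dividing by \<open>e\<close> extends it to a homogeneous function on the
  whole term of the series; such functions form a space on which conjugation acts, and a finite
  orbit in it costs only a finite index.\<close>

class grp = monoid_mult + inverse +
  assumes grp_left_inverse [simp]: "inverse a * a = 1"
begin

sublocale grp: Groups.group "(*)" 1 inverse
  by standard (simp_all)

lemma grp_right_inverse [simp]: "a * inverse a = 1"
  by (rule grp.right_inverse)

lemma grp_inv_inv [simp]: "inverse (inverse a) = a"
  by (rule grp.inverse_inverse)

lemma grp_inv_one [simp]: "inverse 1 = 1"
  by (rule grp.inverse_neutral)

lemma grp_inv_mult: "inverse (a * b) = inverse b * inverse a"
  by (rule grp.inverse_distrib_swap)

lemma grp_inv_cancel [simp]: "inverse a * (a * b) = b" "a * (inverse a * b) = b"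
  by (simp_all flip: mult.assoc)

lemma grp_cancel_left [simp]: "a * b = a * c \<longleftrightarrow> b = c"
  by (rule grp.left_cancel)

lemma grp_cancel_right [simp]: "b * a = c * a \<longleftrightarrow> b = c"
  by (rule grp.right_cancel)

lemma grp_inv_power: "inverse (a ^ n) = inverse a ^ n"
proof (induction n)
  case (Suc n)
  then show ?case by (simp add: grp_inv_mult power_commutes)
qed simp

lemma grp_conj_power: "(x * g * inverse x) ^ n = x * g ^ n * inverse x"
proof (induction n)
  case (Suc n)
  have "(x * g * inverse x) ^ Suc n = x * g * inverse x * (x * g ^ n * inverse x)"
    by (simp only: power_Suc Suc)
  then show ?case by (simp add: mult.assoc)
qed simp

lemma grp_powi_0 [simp]: "power_int a 0 = 1"
  by (simp add: power_int_def)

end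

lemma grp_powi_Suc: "power_int (a::'a::grp) (k + 1) = a * power_int a k"
proof (cases "k \<ge> 0")
  case True
  then show ?thesis by (simp add: power_int_def nat_add_distrib)
next
  case False
  then obtain n where n: "k = - int (Suc n)"
    by (metis int_cases linorder_not_less of_nat_0_le_iff)
  have "power_int a (k + 1) = inverse a ^ n"
    by (cases n) (auto simp: n power_int_def nat_add_distrib)
  then show ?thesis by (simp add: n power_int_def nat_add_distrib)
qed

lemma grp_powi_minus: "power_int (a::'a::grp) (- k) = inverse (power_int a k)"
  by (auto simp: power_int_def grp_inv_power)

lemma grp_powi_add: "power_int (a::'a::grp) (k + l) = power_int a k * power_int a l"
proof (induction k rule: int_induct[of _ 0])
  case (step1 i)
  have "power_int a (i + 1 + l) = a * power_int a (i + l)"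
    using grp_powi_Suc[of a "i + l"] by (simp add: add_ac)
  then show ?case using step1 by (simp add: grp_powi_Suc mult.assoc)
next
  case (step2 i)
  have "power_int a (i + l) = a * power_int a (i - 1 + l)"
    using grp_powi_Suc[of a "i - 1 + l"] by simp
  moreover have "power_int a i = a * power_int a (i - 1)"
    using grp_powi_Suc[of a "i - 1"] by simp
  ultimately show ?case using step2 by (simp add: mult.assoc)
qed simp

lemma grp_powi_nat [simp]: "power_int (a::'a::grp) (int n) = a ^ n"
  by (simp add: power_int_def)

lemma grp_powi_power: "power_int (a::'a::grp) k ^ n = power_int a (k * int n)"
  by (induction n) (auto simp: distrib_left grp_powi_add)

lemma grp_powi_1 [simp]: "power_int (a::'a::grp) 1 = a"
  by (simp add: power_int_def)

section \<open>Subgroups as sets, generation and finite index\<close>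

definition sgrp :: "'g::grp set \<Rightarrow> bool" where
  "sgrp L \<longleftrightarrow> 1 \<in> L \<and> (\<forall>g\<in>L. \<forall>h\<in>L. g * h \<in> L) \<and> (\<forall>g\<in>L. inverse g \<in> L)"

lemma sgrpI:
  assumes "1 \<in> L" "\<And>g h. g \<in> L \<Longrightarrow> h \<in> L \<Longrightarrow> g * h \<in> L" "\<And>g. g \<in> L \<Longrightarrow> inverse g \<in> L"
  shows "sgrp L"
  using assms by (auto simp: sgrp_def)

lemma sgrp_one: "sgrp L \<Longrightarrow> 1 \<in> L"
  and sgrp_mult: "sgrp L \<Longrightarrow> g \<in> L \<Longrightarrow> h \<in> L \<Longrightarrow> g * h \<in> L"
  and sgrp_inv: "sgrp L \<Longrightarrow> g \<in> L \<Longrightarrow> inverse g \<in> L"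
  by (auto simp: sgrp_def)

lemma sgrp_power: "sgrp L \<Longrightarrow> g \<in> L \<Longrightarrow> g ^ n \<in> L"
  by (induction n) (auto intro: sgrp_one sgrp_mult)

lemma sgrp_powi: "sgrp L \<Longrightarrow> g \<in> L \<Longrightarrow> power_int g k \<in> L"
  by (auto simp: power_int_def intro: sgrp_power sgrp_inv)

lemma sgrp_mult_left_iff: "sgrp L \<Longrightarrow> g \<in> L \<Longrightarrow> g * h \<in> L \<longleftrightarrow> h \<in> L"
  using sgrp_mult[of L g h] sgrp_mult[of L "inverse g" "g * h"] sgrp_inv[of L g] by auto

lemma sgrp_mult_right_iff: "sgrp L \<Longrightarrow> g \<in> L \<Longrightarrow> h * g \<in> L \<longleftrightarrow> h \<in> L"
  using sgrp_mult[of L h g] sgrp_mult[of L "h * g" "inverse g"] sgrp_inv[of L g] by (auto simp: mult.assoc)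

lemma sgrp_Int: "sgrp L \<Longrightarrow> sgrp M \<Longrightarrow> sgrp (L \<inter> M)"
  by (auto simp: sgrp_def)

lemma sgrp_conj: "sgrp L \<Longrightarrow> h \<in> L \<Longrightarrow> g \<in> L \<Longrightarrow> h * g * inverse h \<in> L"
  by (auto intro: sgrp_mult sgrp_inv)

text \<open>Words grow on the right, so inductions peel off the last letter; coset representatives
  are carried through a word in this way, for instance in \<open>conn_fi\<close>.\<close>

inductive_set gen :: "'g::grp set \<Rightarrow> 'g set" for S where
  gen_one: "1 \<in> gen S"
| gen_step: "g \<in> gen S \<Longrightarrow> s \<in> S \<Longrightarrow> g * s \<in> gen S"
| gen_step_inv: "g \<in> gen S \<Longrightarrow> s \<in> S \<Longrightarrow> g * inverse s \<in> gen S"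

lemma gen_incl: "s \<in> S \<Longrightarrow> s \<in> gen S"
  using gen_step[OF gen_one] by fastforce

lemma gen_mult: "h \<in> gen S \<Longrightarrow> g \<in> gen S \<Longrightarrow> g * h \<in> gen S"
  by (induction rule: gen.induct) (auto simp flip: mult.assoc intro: gen.intros)

lemma gen_inv: "g \<in> gen S \<Longrightarrow> inverse g \<in> gen S"
proof (induction rule: gen.induct)
  case (gen_step g s)
  have "inverse s \<in> gen S"
    using gen.gen_step_inv[OF gen_one gen_step(2)] by simp
  then show ?case using gen_step by (auto simp: grp_inv_mult intro: gen_mult)
next
  case (gen_step_inv g s)
  then show ?case by (auto simp: grp_inv_mult intro: gen_mult gen_incl)
qed (simp add: gen_one)

lemma sgrp_gen: "sgrp (gen S)"
  by (rule sgrpI) (auto intro: gen_one gen_mult gen_inv)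

lemma gen_least: "sgrp L \<Longrightarrow> S \<subseteq> L \<Longrightarrow> gen S \<subseteq> L"
proof
  fix x assume L: "sgrp L" "S \<subseteq> L" and "x \<in> gen S"
  from this(3) show "x \<in> L"
    by (induction rule: gen.induct) (use L in \<open>auto intro: sgrp_one sgrp_mult sgrp_inv\<close>)
qed

lemma gen_mono: "S \<subseteq> T \<Longrightarrow> gen S \<subseteq> gen T"
  by (rule gen_least[OF sgrp_gen]) (auto intro: gen_incl)

lemma gen_sgrp: "sgrp L \<Longrightarrow> gen L = L"
  using gen_least[of L L] gen_incl by blast

text \<open>Finitely many left translates of \<open>M\<close> by elements of \<open>L\<close> cover
  \<open>L\<close>. As \<open>M\<close> may stick out of \<open>L\<close>, index statements survive
  every enlargement of \<open>M\<close> (\<open>fi_mono\<close>).\<close>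

definition fi :: "'g::grp set \<Rightarrow> 'g set \<Rightarrow> bool" where
  "fi M L \<longleftrightarrow> (\<exists>C. finite C \<and> C \<subseteq> L \<and> (\<forall>g\<in>L. \<exists>c\<in>C. inverse c * g \<in> M))"

text \<open>A map with finitely many values whose fibres each lie in one left coset yields
  representatives, one per value. Together with the converse \<open>fi_invariant\<close> this
  reduces intersections and restrictions to pairing and restricting maps.\<close>

lemma fiI:
  assumes "finite (f ` L)" "\<And>g h. g \<in> L \<Longrightarrow> h \<in> L \<Longrightarrow> f g = f h \<Longrightarrow> inverse g * h \<in> M"
  shows "fi M L"
proof -
  define c where "c = (\<lambda>v. SOME g. g \<in> L \<and> f g = v)"
  have c: "c v \<in> L \<and> f (c v) = v" if "v \<in> f ` L" for v
    unfolding c_def by (rule someI_ex) (use that in auto)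
  show ?thesis unfolding fi_def
  proof (intro exI[of _ "c ` f ` L"] conjI ballI)
    fix g assume g: "g \<in> L"
    then have "inverse (c (f g)) * g \<in> M" using c[of "f g"] assms(2)[of "c (f g)" g] by auto
    then show "\<exists>d\<in>c ` f ` L. inverse d * g \<in> M" using g by auto
  qed (use assms(1) c in auto)
qed

lemma fi_invariant:
  assumes "fi M L" "sgrp M"
  obtains f :: "'g::grp \<Rightarrow> 'g" where "finite (f ` L)"
    "\<And>g h. g \<in> L \<Longrightarrow> h \<in> L \<Longrightarrow> f g = f h \<Longrightarrow> inverse g * h \<in> M"
proof -
  obtain C where C: "finite C" "\<forall>g\<in>L. \<exists>c\<in>C. inverse c * g \<in> M"
    using assms by (auto simp: fi_def)
  then obtain f where f: "\<forall>g\<in>L. f g \<in> C \<and> inverse (f g) * g \<in> M" by metis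
  show ?thesis
  proof
    show "finite (f ` L)" using f C by (meson finite_subset image_subsetI)
    fix g h assume "g \<in> L" "h \<in> L" "f g = f h"
    then have "inverse (inverse (f g) * g) * (inverse (f g) * h) \<in> M"
      using f assms by (metis sgrp_inv sgrp_mult)
    then show "inverse g * h \<in> M" by (simp add: grp_inv_mult mult.assoc)
  qed
qed

lemma fi_refl: "sgrp L \<Longrightarrow> fi L L"
  by (rule fiI[of "\<lambda>_. ()"]) (auto intro: sgrp_mult sgrp_inv)

lemma fi_mono: "fi M L \<Longrightarrow> M \<subseteq> M' \<Longrightarrow> fi M' L"
  by (meson fi_def subsetD)

lemma fi_Int:
  fixes M :: "'g::grp set"
  assumes "fi M L" "fi M' L" "sgrp M" "sgrp M'" shows "fi (M \<inter> M') L"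
proof -
  obtain f :: "'g \<Rightarrow> 'g" where f: "finite (f ` L)" "\<And>g h. g \<in> L \<Longrightarrow> h \<in> L \<Longrightarrow> f g = f h \<Longrightarrow> inverse g * h \<in> M"
    using fi_invariant[OF assms(1,3)] by blast
  obtain f' :: "'g \<Rightarrow> 'g" where f': "finite (f' ` L)" "\<And>g h. g \<in> L \<Longrightarrow> h \<in> L \<Longrightarrow> f' g = f' h \<Longrightarrow> inverse g * h \<in> M'"
    using fi_invariant[OF assms(2,4)] by blast
  show ?thesis
  proof (rule fiI[of "\<lambda>g. (f g, f' g)"])
    have "(\<lambda>g. (f g, f' g)) ` L \<subseteq> f ` L \<times> f' ` L" by auto
    then show "finite ((\<lambda>g. (f g, f' g)) ` L)" using f f' by (meson finite_SigmaI finite_subset)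
    show "inverse g * h \<in> M \<inter> M'" if "g \<in> L" "h \<in> L" "(f g, f' g) = (f h, f' h)" for g h
      using f(2)[of g h] f'(2)[of g h] that by simp
  qed
qed

lemma fi_restrict:
  fixes M :: "'g::grp set"
  assumes "fi M L" "sgrp M" "sgrp L'" "L' \<subseteq> L" shows "fi (M \<inter> L') L'"
proof -
  obtain f :: "'g \<Rightarrow> 'g" where f: "finite (f ` L)" "\<And>g h. g \<in> L \<Longrightarrow> h \<in> L \<Longrightarrow> f g = f h \<Longrightarrow> inverse g * h \<in> M"
    using fi_invariant[OF assms(1,2)] by blast
  show ?thesis
  proof (rule fiI[of f])
    show "finite (f ` L')" using f assms(4) by (meson finite_subset image_mono)
    show "inverse g * h \<in> M \<inter> L'" if "g \<in> L'" "h \<in> L'" "f g = f h" for g h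
      using f(2)[of g h] that assms by (auto intro: sgrp_mult sgrp_inv)
  qed
qed

lemma fi_trans:
  assumes "fi M L" "fi L K" "M \<subseteq> L" "L \<subseteq> K" "sgrp K" shows "fi M K"
proof -
  obtain C where C: "finite C" "C \<subseteq> L" "\<forall>g\<in>L. \<exists>c\<in>C. inverse c * g \<in> M"
    using assms by (auto simp: fi_def)
  obtain D where D: "finite D" "D \<subseteq> K" "\<forall>g\<in>K. \<exists>c\<in>D. inverse c * g \<in> L"
    using assms by (auto simp: fi_def)
  show ?thesis unfolding fi_def
  proof (intro exI[of _ "(\<lambda>(d, c). d * c) ` (D \<times> C)"] conjI ballI)
    fix g assume "g \<in> K"
    then obtain d where d: "d \<in> D" "inverse d * g \<in> L" using D(3) by meson
    then obtain c where "c \<in> C" "inverse c * (inverse d * g) \<in> M" using C(3) by meson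
    with d show "\<exists>c\<in>(\<lambda>(d, c). d * c) ` (D \<times> C). inverse c * g \<in> M"
      by (intro bexI[of _ "d * c"]) (auto simp: grp_inv_mult mult.assoc)
  next
    show "(\<lambda>(d, c). d * c) ` (D \<times> C) \<subseteq> K"
    proof
      fix x assume "x \<in> (\<lambda>(d, c). d * c) ` (D \<times> C)"
      then obtain d c where x: "x = d * c" "d \<in> D" "c \<in> C" by auto
      then show "x \<in> K" using C(2) D(2) assms(4) sgrp_mult[OF assms(5)] by blast
    qed
  qed (use C D in auto)
qed

lemma fi_right_reps:
  assumes "fi M L" "sgrp L" "sgrp M"
  obtains C where "finite C" "C \<subseteq> L" "\<And>g. g \<in> L \<Longrightarrow> \<exists>c\<in>C. g * inverse c \<in> M"
proof -
  obtain C where C: "finite C" "C \<subseteq> L" "\<forall>g\<in>L. \<exists>c\<in>C. inverse c * g \<in> M"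
    using assms by (auto simp: fi_def)
  show ?thesis
  proof
    fix g assume "g \<in> L"
    then obtain c where "c \<in> C" "inverse c * inverse g \<in> M" using C sgrp_inv[OF assms(2)] by meson
    then have "inverse (inverse c * inverse g) \<in> M" using sgrp_inv[OF assms(3)] by blast
    with \<open>c \<in> C\<close> show "\<exists>c\<in>inverse ` C. g * inverse c \<in> M" by (auto simp: grp_inv_mult)
  next
    show "inverse ` C \<subseteq> L" using C(2) sgrp_inv[OF assms(2)] by auto
  qed (use C in auto)
qed

text \<open>Pigeonhole on the cosets of \<open>g ^ 0, ..., g ^ m\<close> puts some
  \<open>g ^ (j - i)\<close> with \<open>j - i \<le> m\<close> into \<open>M\<close>, and
  \<open>fact m\<close> is a multiple of all such differences. So one exponent serves every
  \<open>g\<close>, also when \<open>M\<close> is not normal.\<close>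

lemma fi_exponent:
  fixes M :: "'g::grp set"
  assumes "fi M L" "sgrp L" "sgrp M"
  obtains e where "e \<ge> 1" "\<And>g. g \<in> L \<Longrightarrow> g ^ e \<in> M"
proof -
  obtain f :: "'g \<Rightarrow> 'g" where f: "finite (f ` L)" "\<And>g h. g \<in> L \<Longrightarrow> h \<in> L \<Longrightarrow> f g = f h \<Longrightarrow> inverse g * h \<in> M"
    using fi_invariant[OF assms(1,3)] by blast
  define m where "m = card (f ` L)"
  show ?thesis
  proof
    show "(fact m :: nat) \<ge> 1" by simp
    fix g assume g: "g \<in> L"
    have "\<not> inj_on (\<lambda>i. f (g ^ i)) {..m}"
    proof
      assume "inj_on (\<lambda>i. f (g ^ i)) {..m}"
      then have "card {..m} \<le> card (f ` L)"
        using f(1) sgrp_power[OF assms(2) g] by (intro card_inj_on_le[of "\<lambda>i. f (g ^ i)"]) auto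
      then show False by (simp add: m_def)
    qed
    then obtain i j where ij: "i \<le> m" "j \<le> m" "i < j" "f (g ^ i) = f (g ^ j)"
      unfolding inj_on_def by (metis atMost_iff linorder_neqE_nat)
    have "inverse (g ^ i) * g ^ j \<in> M" using f(2) ij sgrp_power[OF assms(2) g] by blast
    moreover have "g ^ j = g ^ i * g ^ (j - i)" using ij by (metis less_imp_le power_add le_add_diff_inverse)
    ultimately have "g ^ (j - i) \<in> M" by simp
    moreover have "j - i dvd fact m" using ij by (intro dvd_fact) auto
    then obtain q where "fact m = (j - i) * q" by auto
    ultimately show "g ^ fact m \<in> M" by (simp add: power_mult sgrp_power assms)
  qed
qed

section \<open>Homomorphisms to additive groups and abelian quotients\<close>

definition add_hom :: "'g::grp set \<Rightarrow> ('g \<Rightarrow> 'b::ab_group_add) \<Rightarrow> bool" where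
  "add_hom L \<theta> \<longleftrightarrow> (\<forall>g\<in>L. \<forall>h\<in>L. \<theta> (g * h) = \<theta> g + \<theta> h)"

lemma add_hom_mult: "add_hom L \<theta> \<Longrightarrow> g \<in> L \<Longrightarrow> h \<in> L \<Longrightarrow> \<theta> (g * h) = \<theta> g + \<theta> h"
  by (auto simp: add_hom_def)

lemma add_hom_one:
  assumes "add_hom L \<theta>" "sgrp L" shows "\<theta> 1 = 0"
  using add_hom_mult[OF assms(1) sgrp_one[OF assms(2)] sgrp_one[OF assms(2)]] by simp

lemma add_hom_inv:
  assumes "add_hom L \<theta>" "sgrp L" "g \<in> L" shows "\<theta> (inverse g) = - \<theta> g"
proof -
  have "\<theta> (inverse g) + \<theta> g = \<theta> (inverse g * g)"
    using add_hom_mult[OF assms(1) sgrp_inv[OF assms(2,3)] assms(3)] by simp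
  then show ?thesis by (simp add: add_hom_one[OF assms(1,2)] eq_neg_iff_add_eq_0)
qed

lemma add_hom_subset: "add_hom L \<theta> \<Longrightarrow> M \<subseteq> L \<Longrightarrow> add_hom M \<theta>"
  unfolding add_hom_def by blast

lemma add_hom_power:
  fixes \<theta> :: "'g::grp \<Rightarrow> 'b::ring_1"
  assumes "add_hom L \<theta>" "sgrp L" "g \<in> L" shows "\<theta> (g ^ n) = of_nat n * \<theta> g"
proof (induction n)
  case (Suc n)
  have "\<theta> (g ^ Suc n) = \<theta> g + \<theta> (g ^ n)"
    using add_hom_mult[OF assms(1,3) sgrp_power[OF assms(2,3)]] by simp
  then show ?case by (simp add: Suc distrib_right)
qed (simp add: add_hom_one[OF assms(1,2)])

lemma add_hom_powi:
  fixes \<theta> :: "'g::grp \<Rightarrow> 'b::ring_1"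
  assumes "add_hom L \<theta>" "sgrp L" "g \<in> L" shows "\<theta> (power_int g k) = of_int k * \<theta> g"
proof (cases "k \<ge> 0")
  case True
  then show ?thesis by (simp add: power_int_def add_hom_power[OF assms])
next
  case False
  then have "power_int g k = inverse g ^ nat (- k)" by (simp add: power_int_def)
  then show ?thesis
    using False by (simp add: add_hom_power[OF assms(1,2) sgrp_inv[OF assms(2,3)]] add_hom_inv[OF assms])
qed

lemma sgrp_kernel:
  assumes "add_hom L \<theta>" "sgrp L" shows "sgrp {g \<in> L. \<theta> g = 0}"
proof (rule sgrpI)
  show "1 \<in> {g \<in> L. \<theta> g = 0}" using add_hom_one[OF assms] sgrp_one[OF assms(2)] by simp
  show "g * h \<in> {g \<in> L. \<theta> g = 0}" if "g \<in> {g \<in> L. \<theta> g = 0}" "h \<in> {g \<in> L. \<theta> g = 0}" for g h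
    using that add_hom_mult[OF assms(1), of g h] sgrp_mult[OF assms(2), of g h] by simp
  show "inverse g \<in> {g \<in> L. \<theta> g = 0}" if "g \<in> {g \<in> L. \<theta> g = 0}" for g
    using that add_hom_inv[OF assms, of g] sgrp_inv[OF assms(2), of g] by simp
qed

text \<open>The image is an ideal of the integers and \<open>t\<close> is mapped to its least
  positive element; division with remainder gives the divisibility.\<close>

lemma int_hom_generator:
  fixes \<theta> :: "'g::grp \<Rightarrow> int"
  assumes \<theta>: "add_hom L \<theta>" and L: "sgrp L" and nz: "g \<in> L" "\<theta> g \<noteq> 0"
  obtains t where "t \<in> L" "\<theta> t > 0" "\<And>g. g \<in> L \<Longrightarrow> \<theta> t dvd \<theta> g"
proof -
  define P where "P = (\<lambda>n. n > 0 \<and> (\<exists>t\<in>L. \<theta> t = int n))"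
  have "\<exists>n. P n"
  proof (cases "\<theta> g > 0")
    case True
    then show ?thesis using nz by (intro exI[of _ "nat (\<theta> g)"]) (auto simp: P_def)
  next
    case False
    then have "P (nat (- \<theta> g))" unfolding P_def
      using nz add_hom_inv[OF \<theta> L nz(1)] sgrp_inv[OF L nz(1)] by (auto intro!: bexI[of _ "inverse g"])
    then show ?thesis ..
  qed
  then have least: "P (LEAST n. P n)" by (auto intro: LeastI)
  then obtain t where t: "t \<in> L" "\<theta> t = int (LEAST n. P n)" "\<theta> t > 0" by (auto simp: P_def)
  show ?thesis
  proof
    fix g assume g: "g \<in> L"
    define k where "k = \<theta> g div \<theta> t"
    have "\<theta> (g * power_int t (- k)) = \<theta> g mod \<theta> t"
      using add_hom_mult[OF \<theta> g sgrp_powi[OF L t(1)]] add_hom_powi[OF \<theta> L t(1)]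
      by (simp add: k_def minus_div_mult_eq_mod)
    moreover have "g * power_int t (- k) \<in> L" by (intro sgrp_mult sgrp_powi L g t)
    moreover have "\<theta> g mod \<theta> t < \<theta> t" "\<theta> g mod \<theta> t \<ge> 0" using t(3) by auto
    ultimately have *: "\<exists>s\<in>L. \<theta> s = \<theta> g mod \<theta> t" "\<theta> g mod \<theta> t < \<theta> t" "\<theta> g mod \<theta> t \<ge> 0" by auto
    have "\<theta> g mod \<theta> t = 0"
    proof (rule ccontr)
      assume "\<theta> g mod \<theta> t \<noteq> 0"
      then have "P (nat (\<theta> g mod \<theta> t))" using * by (auto simp: P_def)
      moreover have "nat (\<theta> g mod \<theta> t) < (LEAST n. P n)" using *(2,3) t(2) by linarith
      ultimately show False using not_less_Least by blast
    qed
    then show "\<theta> t dvd \<theta> g" by auto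
  qed (use t in auto)
qed

text \<open>Expresses that \<open>L / N\<close> is an abelian group. Normality of \<open>N\<close>
  follows, since \<open>N\<close> contains the commutators of its elements with \<open>L\<close>
  (\<open>abel_mod_normal\<close>).\<close>

definition abel_mod :: "'g::grp set \<Rightarrow> 'g set \<Rightarrow> bool" where
  "abel_mod L N \<longleftrightarrow> sgrp L \<and> sgrp N \<and> N \<subseteq> L \<and> (\<forall>g\<in>L. \<forall>h\<in>L. g * h * inverse g * inverse h \<in> N)"

lemma abel_mod_commute:
  assumes "abel_mod L N" "g \<in> L" "h \<in> L"
  shows "inverse (g * h) * (h * g) \<in> N"
proof -
  have "inverse h * inverse g * inverse (inverse h) * inverse (inverse g) \<in> N"
    using assms unfolding abel_mod_def by (metis sgrp_inv)
  then show ?thesis by (simp add: grp_inv_mult mult.assoc)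
qed

lemma abel_mod_normal:
  assumes "abel_mod L N" "g \<in> L" "n \<in> N"
  shows "g * n * inverse g \<in> N"
proof -
  have "g * n * inverse g * inverse n \<in> N"
    using assms unfolding abel_mod_def by blast
  then show ?thesis using assms sgrp_mult_right_iff[of N "inverse n"] sgrp_inv[of N n]
    by (auto simp: abel_mod_def)
qed

lemma abel_mod_power:
  assumes A: "abel_mod L N" and g: "g \<in> L" and h: "h \<in> L"
  shows "inverse (g ^ n * h ^ n) * (g * h) ^ n \<in> N"
proof (induction n)
  case 0
  then show ?case using A by (simp add: abel_mod_def sgrp_one)
next
  case (Suc n)
  have L: "sgrp L" and N: "sgrp N" "N \<subseteq> L" using A by (auto simp: abel_mod_def)
  define u where "u = inverse (g ^ n * h ^ n) * (g * h) ^ n"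
  have u: "u \<in> N" using Suc by (simp add: u_def)
  define c where "c = inverse (g * h ^ n) * (h ^ n * g)"
  have c: "c \<in> N" unfolding c_def by (intro abel_mod_commute[OF A] g sgrp_power L h)
  have uc: "(g * h) ^ n = g ^ n * h ^ n * u" "h ^ n * g = g * h ^ n * c"
    by (simp_all add: u_def c_def grp_inv_mult mult.assoc)
  define d where "d = inverse (g * h) * u * (g * h)"
  have "inverse (g * h) \<in> L" by (intro sgrp_inv sgrp_mult L g h)
  from abel_mod_normal[OF A this u] have d: "d \<in> N" by (simp add: d_def)
  define e where "e = inverse h * c * h"
  from abel_mod_normal[OF A sgrp_inv[OF L h] c] have e: "e \<in> N" by (simp add: e_def)
  have "(g * h) ^ Suc n = g ^ n * h ^ n * u * (g * h)" by (simp add: uc power_Suc2 del: power_Suc)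
  also have "\<dots> = g ^ n * (h ^ n * g) * h * d" by (simp add: d_def mult.assoc)
  also have "\<dots> = g ^ n * (g * h ^ n) * h * e * d" unfolding uc(2) by (simp add: e_def mult.assoc)
  also have "\<dots> = g ^ Suc n * h ^ Suc n * (e * d)" by (simp add: mult.assoc power_Suc2 del: power_Suc)
  finally show ?case using sgrp_mult[OF N(1) e d] by simp
qed

lemma sgrp_cyclic_ext:
  assumes A: "abel_mod L N" and g: "g \<in> L"
  shows "sgrp {h \<in> L. \<exists>k. inverse (power_int g k) * h \<in> N}" (is "sgrp ?M")
proof (rule sgrpI)
  have L: "sgrp L" and N: "sgrp N" "N \<subseteq> L" using A by (auto simp: abel_mod_def)
  show "1 \<in> ?M" using sgrp_one[OF L] sgrp_one[OF N(1)] by (auto intro!: exI[of _ 0])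
  show "a * b \<in> ?M" if a: "a \<in> ?M" and b: "b \<in> ?M" for a b
  proof -
    obtain k l where k: "inverse (power_int g k) * a \<in> N" and l: "inverse (power_int g l) * b \<in> N"
      using a b by blast
    have b': "inverse b * (inverse (power_int g k) * a) * inverse (inverse b) \<in> N"
      using abel_mod_normal[OF A _ k, of "inverse b"] b sgrp_inv[OF L] by auto
    have c: "inverse (power_int g k * b) * (b * power_int g k) \<in> N"
      using b by (intro abel_mod_commute[OF A] sgrp_powi L g) auto
    have "inverse (power_int g (k + l)) * (a * b) = inverse (power_int g l) * b *
        (inverse b * (inverse (power_int g k) * a) * inverse (inverse b))"
      by (simp add: grp_powi_add grp_inv_mult mult.assoc)
    also have "\<dots> \<in> N" using l b' sgrp_mult[OF N(1)] by blast
    finally show ?thesis using a b sgrp_mult[OF L] by blast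
  qed
  show "inverse a \<in> ?M" if a: "a \<in> ?M" for a
  proof -
    obtain k where k: "inverse (power_int g k) * a \<in> N" using a by blast
    have "power_int g k * inverse (inverse (power_int g k) * a) * inverse (power_int g k) \<in> N"
      using abel_mod_normal[OF A _ sgrp_inv[OF N(1) k], of "power_int g k"] sgrp_powi[OF L g] by blast
    then have "inverse (power_int g (- k)) * inverse a \<in> N"
      by (simp add: grp_powi_minus grp_inv_mult mult.assoc)
    then show ?thesis using a sgrp_inv[OF L] by blast
  qed
qed

text \<open>An infinite, finitely generated abelian group \<open>L / N\<close> maps nontrivially to
  the integers. Induction on the generators replaces the structure theorem: let \<open>M\<close> be
  generated by \<open>N\<close> and \<open>g\<close>. If \<open>M\<close> has infinite index, it
  takes the place of \<open>N\<close> in the induction hypothesis. Otherwise \<open>g\<close> has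
  infinite order modulo \<open>N\<close>, and with an exponent \<open>e\<close> of
  \<open>L / M\<close> the value at \<open>h\<close> is the \<open>k\<close> for which
  \<open>h ^ e\<close> and \<open>g ^ k\<close> agree modulo \<open>N\<close>; additivity rests on
  \<open>abel_mod_power\<close>.\<close>

lemma exists_int_hom:
  fixes L :: "'g::grp set"
  assumes "finite T" "abel_mod L N" "T \<subseteq> L" "L \<subseteq> gen (T \<union> N)" "\<not> fi N L"
  obtains \<theta> :: "'g \<Rightarrow> int" where "add_hom L \<theta>" "\<And>g. g \<in> N \<Longrightarrow> \<theta> g = 0" "\<exists>g\<in>L. \<theta> g \<noteq> 0"
  using assms
proof (induction T arbitrary: N thesis rule: finite_induct)
  case empty
  then have "sgrp N" "N \<subseteq> L" "L \<subseteq> N" by (auto simp: abel_mod_def gen_sgrp)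
  then show ?case using empty fi_refl by (metis subset_antisym)
next
  case (insert g T)
  note A = \<open>abel_mod L N\<close>
  have L: "sgrp L" and N: "sgrp N" "N \<subseteq> L" using A by (auto simp: abel_mod_def)
  have g: "g \<in> L" using insert by auto
  define M where "M = {h \<in> L. \<exists>k. inverse (power_int g k) * h \<in> N}"
  have M: "sgrp M" unfolding M_def by (rule sgrp_cyclic_ext[OF A g])
  have NM: "N \<subseteq> M" using N by (auto simp: M_def intro!: exI[of _ 0])
  have gM: "g \<in> M" using g sgrp_one[OF N(1)] by (auto simp: M_def intro!: exI[of _ 1])
  have AM: "abel_mod L M" using A M NM by (auto simp: abel_mod_def) (auto simp: M_def)
  show ?case
  proof (cases "fi M L")
    case False
    have "gen (insert g T \<union> N) \<subseteq> gen (T \<union> M)" using gM NM by (intro gen_mono) auto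
    then have "L \<subseteq> gen (T \<union> M)" using insert by auto
    then obtain \<theta> :: "'g \<Rightarrow> int" where "add_hom L \<theta>" "\<And>g. g \<in> M \<Longrightarrow> \<theta> g = 0" "\<exists>g\<in>L. \<theta> g \<noteq> 0"
      using insert.IH[of M] AM False insert by auto
    then show ?thesis using insert.prems(1)[of \<theta>] NM by blast
  next
    case True
    obtain e where e: "e \<ge> 1" "\<And>h. h \<in> L \<Longrightarrow> h ^ e \<in> M" using fi_exponent[OF True L M] by blast
    have inj: "k = 0" if k: "power_int g k \<in> N" for k
    proof (rule ccontr)
      assume "k \<noteq> 0"
      \<comment> \<open>With a nonzero period \<open>k\<close>, the exponent modulo \<open>k\<close>
        takes finitely many values and separates the cosets of \<open>N\<close> in
        \<open>M\<close>.\<close>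
      have "fi N M"
      proof (rule fiI[of "\<lambda>h. (SOME l. inverse (power_int g l) * h \<in> N) mod \<bar>k\<bar>"])
        show "finite ((\<lambda>h. (SOME l. inverse (power_int g l) * h \<in> N) mod \<bar>k\<bar>) ` M)"
          by (rule finite_subset[of _ "{0..<\<bar>k\<bar>}"]) (use \<open>k \<noteq> 0\<close> in auto)
        fix a b assume ab: "a \<in> M" "b \<in> M" and eq: "(SOME l. inverse (power_int g l) * a \<in> N) mod \<bar>k\<bar> =
          (SOME l. inverse (power_int g l) * b \<in> N) mod \<bar>k\<bar>"
        define i j where "i = (SOME l. inverse (power_int g l) * a \<in> N)"
          and "j = (SOME l. inverse (power_int g l) * b \<in> N)"
        have i: "inverse (power_int g i) * a \<in> N" and j: "inverse (power_int g j) * b \<in> N"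
          using ab unfolding i_def j_def M_def by (auto intro: someI_ex)
        have "k dvd j - i" using eq unfolding i_def[symmetric] j_def[symmetric]
          by (metis abs_dvd_iff mod_eq_dvd_iff)
        then obtain q where q: "j - i = k * q" by auto
        have kN: "power_int g (k * q) \<in> N"
        proof (cases "q \<ge> 0")
          case True
          then show ?thesis using sgrp_power[OF N(1) k, of "nat q"] by (simp add: grp_powi_power)
        next
          case False
          then show ?thesis using sgrp_inv[OF N(1) sgrp_power[OF N(1) k, of "nat (- q)"]]
            by (simp add: grp_powi_power flip: grp_powi_minus)
        qed
        have "inverse a * b = inverse (inverse (power_int g i) * a) * (power_int g (k * q) * (inverse (power_int g j) * b))"
        proof -
          have "power_int g j = power_int g i * power_int g (k * q)" using q by (metis grp_powi_add add_diff_cancel_left' diff_add_cancel add.commute)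
          then show ?thesis by (simp add: grp_inv_mult mult.assoc)
        qed
        also have "\<dots> \<in> N" using i j kN by (meson sgrp_inv sgrp_mult N(1))
        finally show "inverse a * b \<in> N" .
      qed
      then have "fi N L" using True NM by (rule fi_trans) (auto simp: M_def L)
      then show False using insert by blast
    qed
    define \<theta> where "\<theta> h = (THE k. inverse (power_int g k) * h ^ e \<in> N)" for h
    have uniq: "k = l" if "inverse (power_int g k) * h \<in> N" "inverse (power_int g l) * h \<in> N" for h k l
    proof -
      have "inverse (power_int g k) * h * inverse (inverse (power_int g l) * h) \<in> N"
        using that by (meson sgrp_inv sgrp_mult N(1))
      then have "power_int g (l - k) \<in> N"
        using grp_powi_add[of g "- k" l] by (simp add: grp_inv_mult mult.assoc grp_powi_minus)
      then show ?thesis using inj by force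
    qed
    have \<theta>I: "\<theta> h = k" if "inverse (power_int g k) * h ^ e \<in> N" for h k
      unfolding \<theta>_def using that uniq by blast
    have \<theta>: "inverse (power_int g (\<theta> h)) * h ^ e \<in> N" if "h \<in> L" for h
      using e(2)[OF that] \<theta>I by (auto simp: M_def)
    have "add_hom L \<theta>" unfolding add_hom_def
    proof (intro ballI)
      fix a b assume a: "a \<in> L" and b: "b \<in> L"
      define u where "u = inverse (power_int g (\<theta> a)) * a ^ e"
      define v where "v = inverse (power_int g (\<theta> b)) * b ^ e"
      define w where "w = inverse (a ^ e * b ^ e) * (a * b) ^ e"
      have uvw: "u \<in> N" "v \<in> N" "w \<in> N"
        using \<theta>[OF a] \<theta>[OF b] abel_mod_power[OF A a b] by (auto simp: u_def v_def w_def)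
      define u' where "u' = inverse (b ^ e) * u * inverse (inverse (b ^ e))"
      have u': "u' \<in> N" unfolding u'_def
        by (rule abel_mod_normal[OF A _ uvw(1)]) (intro sgrp_inv sgrp_power L b)
      have "inverse (power_int g (\<theta> a + \<theta> b)) * (a * b) ^ e = v * u' * w"
        by (simp add: u_def v_def w_def u'_def grp_powi_add grp_inv_mult mult.assoc)
      also have "\<dots> \<in> N" using uvw u' by (meson sgrp_mult N(1))
      finally show "\<theta> (a * b) = \<theta> a + \<theta> b" by (rule \<theta>I)
    qed
    moreover have "\<theta> h = 0" if "h \<in> N" for h
      by (rule \<theta>I) (use sgrp_power[OF N(1) that] in simp)
    moreover have "\<theta> g = int e" by (rule \<theta>I) (simp add: sgrp_one N)
    then have "\<exists>g\<in>L. \<theta> g \<noteq> 0" using g e(1) by (intro bexI[of _ g]) auto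
    ultimately show ?thesis using insert.prems(1) by blast
  qed
qed

text \<open>The transfer homomorphism from \<open>L\<close> to \<open>M\<close> is \<open>[L : M]\<close> times \<open>\<phi>\<close>.\<close>

lemma add_hom_extend:
  fixes \<phi> :: "'g::grp \<Rightarrow> real"
  assumes L: "sgrp L" and M: "sgrp M" "M \<subseteq> L" "fi M L" and hom: "add_hom M \<phi>"
    and pow: "\<And>g n. g \<in> L \<Longrightarrow> \<phi> (g ^ n) = real n * \<phi> g"
    and conj: "\<And>g l. g \<in> L \<Longrightarrow> l \<in> L \<Longrightarrow> \<phi> (l * g * inverse l) = \<phi> g"
  shows "add_hom L \<phi>"
proof -
  \<comment> \<open>The predicate under \<open>SOME\<close> depends only on the right coset
    \<open>M g\<close>, so \<open>r\<close> is constant on right cosets and its range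
    \<open>R\<close> is a transversal.\<close>
  define r where "r g = (SOME h. h \<in> L \<and> g * inverse h \<in> M)" for g
  have r: "r g \<in> L" "g * inverse (r g) \<in> M" if "g \<in> L" for g
  proof -
    have "g \<in> L \<and> g * inverse g \<in> M" using that sgrp_one[OF M(1)] by simp
    then have "r g \<in> L \<and> g * inverse (r g) \<in> M" unfolding r_def by (rule someI)
    then show "r g \<in> L" "g * inverse (r g) \<in> M" by auto
  qed
  have r_eq: "r g = r g'" if "g' * inverse g \<in> M" for g g'
  proof -
    have "g * inverse h \<in> M \<longleftrightarrow> g' * inverse h \<in> M" for h
    proof -
      have "g' * inverse h = (g' * inverse g) * (g * inverse h)" by (simp add: mult.assoc)
      then show ?thesis using sgrp_mult_left_iff[OF M(1) that] by metis
    qed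
    then show ?thesis by (simp add: r_def)
  qed
  have r_inj: "r g = r g' \<Longrightarrow> g' * inverse g \<in> M" if "g \<in> L" "g' \<in> L" for g g'
    using sgrp_mult[OF M(1) r(2)[OF that(2)] sgrp_inv[OF M(1) r(2)[OF that(1)]]]
    by (simp add: grp_inv_mult mult.assoc)
  define R where "R = r ` L"
  have RL: "R \<subseteq> L" using r by (auto simp: R_def)
  have r_id: "r x = x" if x: "x \<in> R" for x
  proof -
    obtain g where g: "g \<in> L" "x = r g" using x by (auto simp: R_def)
    then have "r x = r g" using r(2)[OF g(1)] by (intro r_eq) auto
    then show ?thesis using g by simp
  qed
  have finR: "finite R"
  proof -
    obtain C where C: "finite C" "C \<subseteq> L" "\<And>g. g \<in> L \<Longrightarrow> \<exists>c\<in>C. g * inverse c \<in> M"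
      using fi_right_reps[OF M(3) L M(1)] by blast
    have "R \<subseteq> r ` C"
    proof
      fix x assume "x \<in> R"
      then obtain g where g: "g \<in> L" "x = r g" by (auto simp: R_def)
      then obtain c where "c \<in> C" "g * inverse c \<in> M" using C by blast
      then have "r c = r g" by (intro r_eq)
      then show "x \<in> r ` C" using \<open>c \<in> C\<close> g by (metis image_eqI)
    qed
    then show ?thesis using C(1) finite_subset by blast
  qed
  \<comment> \<open>Right multiplication by \<open>g\<close> permutes the transversal up to factors
    in \<open>M\<close>, and \<open>T\<close> sums the values of \<open>\<phi>\<close> at these
    factors.\<close>
  define T where "T g = (\<Sum>x\<in>R. \<phi> (x * g * inverse (r (x * g))))" for g
  have bij: "bij_betw (\<lambda>x. r (x * g)) R R" if g: "g \<in> L" for g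
  proof -
    have inj: "inj_on (\<lambda>x. r (x * g)) R"
    proof (rule inj_onI)
      fix x y assume xy: "x \<in> R" "y \<in> R" "r (x * g) = r (y * g)"
      then have "(y * g) * inverse (x * g) \<in> M"
        by (intro r_inj sgrp_mult L g) (use RL in auto)
      then have "r x = r y" by (intro r_eq) (simp add: grp_inv_mult mult.assoc)
      then show "x = y" using r_id xy by simp
    qed
    moreover have "(\<lambda>x. r (x * g)) ` R \<subseteq> R" using RL sgrp_mult[OF L _ g] by (auto simp: R_def)
    ultimately show ?thesis using finR by (simp add: bij_betw_def endo_inj_surj)
  qed
  have T_mult: "T (g * h) = T g + T h" if g: "g \<in> L" and h: "h \<in> L" for g h
  proof -
    have "\<phi> (x * (g * h) * inverse (r (x * (g * h)))) =
        \<phi> (x * g * inverse (r (x * g))) + \<phi> (r (x * g) * h * inverse (r (r (x * g) * h)))" if x: "x \<in> R" for x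
    proof -
      have xg: "x * g \<in> L" using x RL sgrp_mult[OF L _ g] by auto
      have eq: "r (x * (g * h)) = r (r (x * g) * h)"
        by (rule sym, rule r_eq) (use r(2)[OF xg] in \<open>simp add: grp_inv_mult mult.assoc\<close>)
      have "x * (g * h) * inverse (r (x * (g * h))) =
        (x * g * inverse (r (x * g))) * (r (x * g) * h * inverse (r (r (x * g) * h)))"
        by (simp add: eq mult.assoc)
      moreover have "x * g * inverse (r (x * g)) \<in> M" by (rule r(2)[OF xg])
      moreover have "r (x * g) * h * inverse (r (r (x * g) * h)) \<in> M"
        by (intro r(2) sgrp_mult[OF L _ h] r(1)[OF xg])
      ultimately show ?thesis using add_hom_mult[OF hom] by simp
    qed
    then have "T (g * h) = T g + (\<Sum>x\<in>R. \<phi> (r (x * g) * h * inverse (r (r (x * g) * h))))"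
      by (simp add: T_def sum.distrib)
    also have "(\<Sum>x\<in>R. \<phi> (r (x * g) * h * inverse (r (r (x * g) * h)))) = T h"
      unfolding T_def by (rule sum.reindex_bij_betw[OF bij[OF g]])
    finally show ?thesis .
  qed
  have T_hom: "add_hom L T" using T_mult by (simp add: add_hom_def)
  obtain e where e: "e \<ge> 1" "\<And>g. g \<in> L \<Longrightarrow> g ^ e \<in> M" using fi_exponent[OF M(3) L M(1)] by blast
  have "T g = real (card R) * \<phi> g" if g: "g \<in> L" for g
  proof -
    \<comment> \<open>The exponent \<open>e\<close> works for all of \<open>L\<close>, hence all
      conjugates of \<open>g ^ e\<close> lie in \<open>M\<close>. So \<open>g ^ e\<close> fixes
      every coset, and each factor is a conjugate of \<open>g ^ e\<close>, where
      \<open>\<phi>\<close> takes the value \<open>real e * \<phi> g\<close>.\<close>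
    have "\<phi> (x * g ^ e * inverse (r (x * g ^ e))) = real e * \<phi> g" if x: "x \<in> R" for x
    proof -
      have xL: "x \<in> L" using x RL by auto
      have "x * g * inverse x \<in> L" using xL g by (intro sgrp_mult sgrp_inv L)
      then have "x * g ^ e * inverse x \<in> M" unfolding grp_conj_power[symmetric] by (rule e(2))
      then have "r (x * g ^ e) = x" using r_eq[of "x * g ^ e" x] r_eq[of x "x * g ^ e"] r_id[OF x] by simp
      then show ?thesis using conj[OF sgrp_power[OF L g] xL] pow[OF g] by simp
    qed
    then have "T (g ^ e) = real (card R) * (real e * \<phi> g)" by (simp add: T_def)
    moreover have "T (g ^ e) = real e * T g" by (rule add_hom_power[OF T_hom L g])
    ultimately show ?thesis using e(1) by simp
  qed
  moreover have "R \<noteq> {}" using sgrp_one[OF L] by (auto simp: R_def)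
  then have "card R > 0" using finR by (simp add: card_gt_0_iff)
  ultimately have "\<phi> g = T g / real (card R)" if "g \<in> L" for g using that by simp
  then show ?thesis using T_mult sgrp_mult[OF L] by (simp add: add_hom_def add_divide_distrib)
qed

section \<open>The entropy of an invariant random walk\<close>

lemma exists_ultrafilter:
  fixes F :: "'a filter"
  assumes "F \<noteq> bot"
  obtains U where "U \<le> F" "U \<noteq> bot" "\<And>P. eventually P U \<or> eventually (\<lambda>x. \<not> P x) U"
proof -
  let ?A = "{G. G \<noteq> bot \<and> G \<le> F}"
  have "\<exists>U\<in>?A. \<forall>G\<in>?A. U \<ge> G \<longrightarrow> G = U"
  proof (rule predicate_Zorn)
    show "partial_order_on ?A (relation_of (\<ge>) ?A)"
      by (intro partial_order_on_relation_ofI) auto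
    fix C assume C: "C \<in> Chains (relation_of (\<ge>) ?A)"
    then have CA: "C \<subseteq> ?A" and tot: "\<And>G H. G \<in> C \<Longrightarrow> H \<in> C \<Longrightarrow> G \<le> H \<or> H \<le> G"
      by (auto simp: Chains_def relation_of_def)
    show "\<exists>U\<in>?A. \<forall>G\<in>C. G \<ge> U"
    proof (cases "C = {}")
      case True
      then show ?thesis using assms by auto
    next
      case False
      have "eventually P (Inf C) \<longleftrightarrow> (\<exists>G\<in>C. eventually P G)" for P
      proof (rule eventually_Inf_base[OF False])
        fix G H assume "G \<in> C" "H \<in> C"
        then show "\<exists>x\<in>C. x \<le> inf G H" using tot[of G H] by (meson inf_greatest order_refl)
      qed
      then have "Inf C \<noteq> bot"
        using CA by (auto simp: trivial_limit_def)
      moreover obtain G where "G \<in> C" using False by blast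
      then have "Inf C \<le> F" using CA by (intro Inf_lower2[of G C F]) auto
      ultimately show ?thesis by (auto intro: Inf_lower)
    qed
  qed
  then obtain U where U0: "U \<noteq> bot" "U \<le> F" "\<forall>G\<in>?A. U \<ge> G \<longrightarrow> G = U" by auto
  have U: "G = U" if "G \<noteq> bot" "G \<le> U" for G
    using U0(3) that order_trans[OF that(2) U0(2)] by simp
  show ?thesis
  proof
    fix P
    show "eventually P U \<or> eventually (\<lambda>x. \<not> P x) U"
    proof (cases "inf U (principal {x. P x}) = bot")
      case True
      then show ?thesis by (simp add: trivial_limit_def eventually_inf_principal)
    next
      case False
      then have "inf U (principal {x. P x}) = U" by (intro U) auto
      then have "eventually P (inf U (principal {x. P x})) \<longleftrightarrow> eventually P U" by simp
      then show ?thesis by (simp add: eventually_inf_principal)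
    qed
  qed (use U0 in auto)
qed

lemma ultrafilter_bounded_tendsto:
  fixes s :: "'a \<Rightarrow> real"
  assumes U: "U \<noteq> bot" "\<And>P. eventually P U \<or> eventually (\<lambda>x. \<not> P x) U" and s: "\<And>n. \<bar>s n\<bar> \<le> M"
  obtains l where "(s \<longlongrightarrow> l) U"
proof -
  have "compact {-M..M}" by simp
  moreover have "filtermap s U \<noteq> bot" using U by (simp add: filtermap_bot_iff)
  moreover have "eventually (\<lambda>x. x \<in> {-M..M}) (filtermap s U)"
    using s by (auto simp: eventually_filtermap abs_le_iff minus_le_iff)
  ultimately obtain l where l: "inf (nhds l) (filtermap s U) \<noteq> bot"
    using compact_filter[of "{-M..M}"] by blast
  have "(s \<longlongrightarrow> l) U"
  proof (rule topological_tendstoI)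
    fix S :: "real set" assume S: "open S" "l \<in> S"
    show "eventually (\<lambda>x. s x \<in> S) U"
    proof (rule ccontr)
      assume "\<not> ?thesis"
      then have "eventually (\<lambda>x. x \<notin> S) (filtermap s U)"
        using U(2)[of "\<lambda>x. s x \<in> S"] by (auto simp: eventually_filtermap)
      then have "eventually (\<lambda>x. x \<notin> S) (inf (nhds l) (filtermap s U))"
        by (rule filter_leD[rotated]) simp
      moreover have "eventually (\<lambda>x. x \<in> S) (inf (nhds l) (filtermap s U))"
        by (rule filter_leD[of _ "nhds l"]) (use S in \<open>auto simp: eventually_nhds\<close>)
      ultimately have "eventually (\<lambda>x. False) (inf (nhds l) (filtermap s U))"
        by eventually_elim simp
      then show False using l by (simp add: trivial_limit_def)
    qed
  qed
  then show ?thesis using that by blast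
qed

text \<open>The pointwise form of the bound of the squared Hellinger distance by the relative
  entropy, from \<open>ln x \<le> x - 1\<close> at \<open>x = sqrt (b / a)\<close>. The terms
  \<open>- a + b\<close> make each summand nonnegative and cancel when two probability vectors are
  summed.\<close>

lemma sqrt_diff_le_relative_entropy:
  fixes a b :: real
  assumes "a \<ge> 0" "b \<ge> 0" "b = 0 \<Longrightarrow> a = 0"
  shows "(sqrt a - sqrt b)\<^sup>2 \<le> a * ln a - a * ln b - a + b"
proof (cases "a = 0")
  case False
  then have a: "a > 0" and b: "b > 0" using assms by (auto simp: less_le)
  have "ln (sqrt (b / a)) \<le> sqrt (b / a) - 1"
    using a b by (intro ln_le_minus_one) auto
  then have "(ln b - ln a) / 2 \<le> sqrt (b / a) - 1"
    using a b by (simp add: ln_sqrt ln_div)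
  then have "a * ((ln b - ln a) / 2) \<le> a * (sqrt (b / a) - 1)"
    using a by (intro mult_left_mono) auto
  moreover have "a * sqrt (b / a) = sqrt a * sqrt b"
    using a b by (simp add: real_sqrt_divide field_simps)
  ultimately have "a * (ln b - ln a) \<le> 2 * (sqrt a * sqrt b) - 2 * a" by (simp add: field_simps)
  moreover have "(sqrt a - sqrt b)\<^sup>2 = a + b - 2 * (sqrt a * sqrt b)"
    using a b by (simp add: power2_eq_square algebra_simps)
  ultimately show ?thesis by (simp add: algebra_simps)
qed (use assms in auto)

section \<open>Invariant lazy random walks on an orbit\<close>

primrec kernel_ball :: "('x \<Rightarrow> 'x set) \<Rightarrow> nat \<Rightarrow> 'x \<Rightarrow> 'x set" where
  "kernel_ball N 0 x = {x}"
| "kernel_ball N (Suc n) x = (\<Union>z\<in>N x. kernel_ball N n z)"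

text \<open>A symmetric \<open>L\<close>-invariant walk of finite range on the orbit of
  \<open>b\<close>, with \<open>N x\<close> the points reachable in one step. Nonzero weights are
  bounded below by \<open>w0\<close>, so an average over neighbours controls each neighbour. A
  holding probability of at least 1/2 makes the Markov operator positive (\<open>P_positive\<close>)
  and the balls increasing.\<close>

locale walk =
  fixes act :: "'g::grp \<Rightarrow> 'x \<Rightarrow> 'x" (infixr "\<star>" 75)
    and L :: "'g set" and S :: "'x set" and b :: 'x
    and w :: "'x \<Rightarrow> 'x \<Rightarrow> real" and N :: "'x \<Rightarrow> 'x set" and w0 :: real and C :: real and e :: nat
  assumes act_one: "1 \<star> x = x"
    and act_mult: "(g * h) \<star> x = g \<star> h \<star> x"
    and L: "sgrp L"
    and S_eq: "S = (\<lambda>g. g \<star> b) ` L"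
    and N_eq: "x \<in> S \<Longrightarrow> N x = {y \<in> S. w x y \<noteq> 0}"
    and N_fin: "x \<in> S \<Longrightarrow> finite (N x)"
    and w_sym: "x \<in> S \<Longrightarrow> y \<in> S \<Longrightarrow> w x y = w y x"
    and w_inv: "g \<in> L \<Longrightarrow> x \<in> S \<Longrightarrow> y \<in> S \<Longrightarrow> w (g \<star> x) (g \<star> y) = w x y"
    and w_sum: "x \<in> S \<Longrightarrow> (\<Sum>y\<in>N x. w x y) = 1"
    and w_self: "x \<in> S \<Longrightarrow> w x x \<ge> 1 / 2"
    and w0: "w0 > 0" "x \<in> S \<Longrightarrow> y \<in> N x \<Longrightarrow> w x y \<ge> w0"
    and conn: "x \<in> S \<Longrightarrow> \<exists>n. x \<in> kernel_ball N n b"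
    and growth: "real (card (kernel_ball N n b)) \<le> C * (real n + 1) ^ e"
begin


abbreviation "B \<equiv> kernel_ball N"

definition P :: "('x \<Rightarrow> real) \<Rightarrow> 'x \<Rightarrow> real" where
  "P f x = (\<Sum>y\<in>N x. w x y * f y)"

definition p :: "nat \<Rightarrow> 'x \<Rightarrow> 'x \<Rightarrow> real" where
  "p n x y = (P ^^ n) (\<lambda>z. of_bool (z = y)) x"

lemma b_in: "b \<in> S"
  using S_eq act_one sgrp_one[OF L] by (metis imageI)

lemma act_S: "g \<in> L \<Longrightarrow> x \<in> S \<Longrightarrow> g \<star> x \<in> S"
  using sgrp_mult[OF L] by (auto simp: S_eq simp flip: act_mult)

lemma S_trans: "x \<in> S \<Longrightarrow> \<exists>g\<in>L. x = g \<star> b"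
  by (auto simp: S_eq)

lemma act_inv [simp]: "inverse g \<star> g \<star> x = x" "g \<star> inverse g \<star> x = x"
  by (simp_all flip: act_mult add: act_one)

lemma act_inj: "g \<star> x = g \<star> y \<longleftrightarrow> x = y"
  by (metis act_inv(1))

lemma w_nonneg: "x \<in> S \<Longrightarrow> y \<in> S \<Longrightarrow> w x y \<ge> 0"
  using w0 N_eq by (metis (mono_tags, lifting) less_eq_real_def mem_Collect_eq order_trans)

lemma N_S: "x \<in> S \<Longrightarrow> N x \<subseteq> S"
  using N_eq by auto

lemma N_in: "x \<in> S \<Longrightarrow> y \<in> N x \<Longrightarrow> y \<in> S"
  using N_S by blast

lemma N_self: "x \<in> S \<Longrightarrow> x \<in> N x"
  using N_eq w_self by fastforce

lemma N_sym: "x \<in> S \<Longrightarrow> y \<in> N x \<Longrightarrow> x \<in> N y"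
  using N_eq w_sym N_S by (metis (mono_tags, lifting) mem_Collect_eq)

lemma w_pos: "x \<in> S \<Longrightarrow> y \<in> N x \<Longrightarrow> w x y > 0"
  using w0 by (meson less_le_trans)

lemma N_act: "g \<in> L \<Longrightarrow> x \<in> S \<Longrightarrow> N (g \<star> x) = (\<lambda>y. g \<star> y) ` N x"
proof (intro equalityI subsetI)
  fix y assume g: "g \<in> L" "x \<in> S" "y \<in> N (g \<star> x)"
  then have y: "y \<in> S" "w (g \<star> x) y \<noteq> 0" using N_eq act_S by auto
  have "inverse g \<star> y \<in> S" using g y act_S sgrp_inv[OF L] by blast
  moreover have "w x (inverse g \<star> y) \<noteq> 0" using w_inv[of g x "inverse g \<star> y"] g y calculation by simp
  ultimately have "inverse g \<star> y \<in> N x" using N_eq g by auto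
  then show "y \<in> (\<lambda>y. g \<star> y) ` N x" by (metis act_inv(2) imageI)
next
  fix y assume g: "g \<in> L" "x \<in> S" "y \<in> (\<lambda>y. g \<star> y) ` N x"
  then obtain z where "z \<in> N x" "y = g \<star> z" by auto
  then show "y \<in> N (g \<star> x)" using N_eq g act_S w_inv by auto
qed

lemma P_act: "g \<in> L \<Longrightarrow> x \<in> S \<Longrightarrow> P f (g \<star> x) = P (\<lambda>y. f (g \<star> y)) x"
proof -
  assume g: "g \<in> L" "x \<in> S"
  have "P f (g \<star> x) = (\<Sum>y\<in>(\<lambda>y. g \<star> y) ` N x. w (g \<star> x) y * f y)"
    by (simp add: P_def N_act g)
  also have "\<dots> = (\<Sum>y\<in>N x. w (g \<star> x) (g \<star> y) * f (g \<star> y))"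
    by (subst sum.reindex) (auto simp: inj_on_def act_inj)
  also have "\<dots> = P (\<lambda>y. f (g \<star> y)) x"
    unfolding P_def by (intro sum.cong refl) (simp add: w_inv[OF g(1,2) N_in[OF g(2)]])
  finally show ?thesis .
qed

lemma P_cong: "x \<in> S \<Longrightarrow> (\<And>y. y \<in> S \<Longrightarrow> f y = f' y) \<Longrightarrow> P f x = P f' x"
  unfolding P_def using N_S by (intro sum.cong) auto

lemma Pn_cong: "x \<in> S \<Longrightarrow> (\<And>y. y \<in> S \<Longrightarrow> f y = f' y) \<Longrightarrow> (P ^^ n) f x = (P ^^ n) f' x"
  by (induction n arbitrary: x) (auto intro: P_cong)

lemma Pn_act: "g \<in> L \<Longrightarrow> x \<in> S \<Longrightarrow> (P ^^ n) f (g \<star> x) = (P ^^ n) (\<lambda>y. f (g \<star> y)) x"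
  by (induction n arbitrary: x) (auto simp: P_act intro: P_cong act_S)

lemma P_add: "P (\<lambda>x. f x + f' x) x = P f x + P f' x"
  by (simp add: P_def distrib_left sum.distrib)

lemma P_cmult: "P (\<lambda>x. c * f x) x = c * P f x"
  by (simp add: P_def sum_distrib_left mult.left_commute)

lemma P_diff: "P (\<lambda>x. f x - f' x) x = P f x - P f' x"
  by (simp add: P_def right_diff_distrib sum_subtractf)

lemma P_const: "x \<in> S \<Longrightarrow> P (\<lambda>_. c) x = c"
  using w_sum by (simp add: P_def flip: sum_distrib_right)

lemma P_mono: "x \<in> S \<Longrightarrow> (\<And>y. y \<in> S \<Longrightarrow> f y \<le> f' y) \<Longrightarrow> P f x \<le> P f' x"
  unfolding P_def by (intro sum_mono mult_left_mono) (auto intro: N_in w_nonneg)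

lemma P_sum: "P (\<lambda>x. \<Sum>i\<in>I. f i x) x = (\<Sum>i\<in>I. P (f i) x)"
  by (simp add: P_def sum_distrib_left sum.swap[of _ _ I])

lemma Pn_add: "(P ^^ n) (\<lambda>x. f x + f' x) x = (P ^^ n) f x + (P ^^ n) f' x"
proof (induction n arbitrary: x)
  case (Suc n)
  then have "(P ^^ n) (\<lambda>x. f x + f' x) = (\<lambda>x. (P ^^ n) f x + (P ^^ n) f' x)" by blast
  then show ?case by (simp add: P_add)
qed simp

lemma Pn_cmult: "(P ^^ n) (\<lambda>x. c * f x) x = c * (P ^^ n) f x"
proof (induction n arbitrary: x)
  case (Suc n)
  then have "(P ^^ n) (\<lambda>x. c * f x) = (\<lambda>x. c * (P ^^ n) f x)" by blast
  then show ?case by (simp add: P_cmult)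
qed simp

lemma Pn_sum: "(P ^^ n) (\<lambda>x. \<Sum>i\<in>I. f i x) x = (\<Sum>i\<in>I. (P ^^ n) (f i) x)"
proof (induction n arbitrary: x)
  case (Suc n)
  then have "(P ^^ n) (\<lambda>x. \<Sum>i\<in>I. f i x) = (\<lambda>x. \<Sum>i\<in>I. (P ^^ n) (f i) x)" by blast
  then show ?case by (simp add: P_sum)
qed simp

lemma Pn_mono: "x \<in> S \<Longrightarrow> (\<And>y. y \<in> S \<Longrightarrow> f y \<le> f' y) \<Longrightarrow> (P ^^ n) f x \<le> (P ^^ n) f' x"
  by (induction n arbitrary: x) (auto intro: P_mono)

lemma Pn_const: "x \<in> S \<Longrightarrow> (P ^^ n) (\<lambda>_. c) x = c"
proof (induction n arbitrary: x)
  case (Suc n)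
  then have "P ((P ^^ n) (\<lambda>_. c)) x = P (\<lambda>_. c) x" by (intro P_cong) auto
  then show ?case using P_const Suc.prems by simp
qed simp

lemma B_S: "x \<in> S \<Longrightarrow> B n x \<subseteq> S"
proof (induction n arbitrary: x)
  case (Suc n)
  then show ?case using N_in[OF Suc.prems] by fastforce
qed simp

lemma B_fin: "x \<in> S \<Longrightarrow> finite (B n x)"
  by (induction n arbitrary: x) (auto intro: N_fin N_in)

lemma B_Suc: "x \<in> S \<Longrightarrow> B n x \<subseteq> B (Suc n) x"
  using N_self by auto

lemma B_mono: "x \<in> S \<Longrightarrow> m \<le> n \<Longrightarrow> B m x \<subseteq> B n x"
  by (rule lift_Suc_mono_le[of "\<lambda>n. B n x"]) (use B_Suc in auto)

lemma B_self: "x \<in> S \<Longrightarrow> x \<in> B n x"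
  using B_mono[of x 0 n] by auto

lemma B_act: "g \<in> L \<Longrightarrow> x \<in> S \<Longrightarrow> B n (g \<star> x) = (\<lambda>y. g \<star> y) ` B n x"
proof (induction n arbitrary: x)
  case (Suc n)
  then have "B (Suc n) (g \<star> x) = (\<Union>z\<in>N x. B n (g \<star> z))" by (simp add: N_act)
  also have "\<dots> = (\<Union>z\<in>N x. (\<lambda>y. g \<star> y) ` B n z)" using Suc N_S by (intro SUP_cong) auto
  finally show ?case by auto
qed simp

lemma p_Suc: "p (Suc n) x y = (\<Sum>z\<in>N x. w x z * p n z y)"
  by (simp add: p_def P_def)

lemma p_0: "p 0 x y = of_bool (x = y)"
  by (simp add: p_def)

lemma p_nonneg: "x \<in> S \<Longrightarrow> p n x y \<ge> 0"
  unfolding p_def using Pn_mono[of x "\<lambda>_. 0" "\<lambda>z. of_bool (z = y)" n] Pn_const[of x n 0] by simp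

lemma p_supp: "x \<in> S \<Longrightarrow> y \<notin> B n x \<Longrightarrow> p n x y = 0"
proof (induction n arbitrary: x)
  case (Suc n)
  have "w x z * p n z y = 0" if z: "z \<in> N x" for z
    using Suc.IH[OF N_in[OF Suc.prems(1) z]] Suc.prems(2) z by auto
  then show ?case unfolding p_Suc by (rule sum.neutral[rule_format])
qed (simp add: p_0)

lemma Pn_p:
  assumes "x \<in> S" "finite D" "B n x \<subseteq> D"
  shows "(P ^^ n) f x = (\<Sum>y\<in>D. p n x y * f y)"
  using assms
proof (induction n arbitrary: x)
  case 0
  then show ?case by (simp add: p_0 sum.remove[of D x])
next
  case (Suc n)
  have "(P ^^ Suc n) f x = (\<Sum>z\<in>N x. w x z * (P ^^ n) f z)" by (simp add: P_def)
  also have "\<dots> = (\<Sum>z\<in>N x. w x z * (\<Sum>y\<in>D. p n z y * f y))"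
  proof (intro sum.cong refl arg_cong2[where f = "(*)"])
    fix z assume z: "z \<in> N x"
    then show "(P ^^ n) f z = (\<Sum>y\<in>D. p n z y * f y)"
      using Suc.prems by (intro Suc.IH N_in[OF Suc.prems(1) z]) auto
  qed
  also have "\<dots> = (\<Sum>y\<in>D. p (Suc n) x y * f y)"
    unfolding p_Suc by (simp add: sum_distrib_left sum_distrib_right mult.assoc sum.swap[of _ D])
  finally show ?case .
qed

lemma p_sum:
  assumes "x \<in> S" "finite D" "B n x \<subseteq> D"
  shows "(\<Sum>y\<in>D. p n x y) = 1"
  using Pn_p[OF assms, of "\<lambda>_. 1"] Pn_const[OF assms(1), of n 1] by simp

lemma p_add:
  assumes "x \<in> S" "finite D" "B m x \<subseteq> D"
  shows "p (m + n) x y = (\<Sum>z\<in>D. p m x z * p n z y)"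
  unfolding p_def[of "m + n"] funpow_add o_def Pn_p[OF assms] by (simp add: p_def)

lemma p_1: "x \<in> S \<Longrightarrow> y \<in> S \<Longrightarrow> p (Suc 0) x y = w x y"
proof -
  assume xy: "x \<in> S" "y \<in> S"
  have "p (Suc 0) x y = (\<Sum>z\<in>N x. if z = y then w x z else 0)"
    unfolding p_Suc p_0 by (intro sum.cong) auto
  also have "\<dots> = w x y" using xy N_fin N_eq by (auto simp: sum.delta)
  finally show ?thesis .
qed

lemma p_sym: "x \<in> S \<Longrightarrow> y \<in> S \<Longrightarrow> p n x y = p n y x"
proof (induction n arbitrary: x)
  case (Suc n)
  define D where "D = B n y \<union> N x"
  have D: "finite D" "D \<subseteq> S" "B n y \<subseteq> D" "N x \<subseteq> D"
    using B_fin N_fin B_S N_S Suc.prems by (auto simp: D_def)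
  have "p (Suc n) x y = (\<Sum>z\<in>N x. w x z * p n z y)" by (rule p_Suc)
  also have "\<dots> = (\<Sum>z\<in>D. w x z * p n z y)"
    by (rule sum.mono_neutral_left) (use D N_eq[OF Suc.prems(1)] in auto)
  also have "\<dots> = (\<Sum>z\<in>D. p n y z * p (Suc 0) z x)"
    using D Suc p_1 w_sym by (intro sum.cong) (auto simp: subset_iff mult.commute)
  also have "\<dots> = p (n + Suc 0) y x" using D Suc.prems by (intro p_add[symmetric])
  finally show ?case by simp
qed (auto simp: p_0)

lemma p_act: "g \<in> L \<Longrightarrow> x \<in> S \<Longrightarrow> p n (g \<star> x) (g \<star> y) = p n x y"
  unfolding p_def using Pn_act by (simp add: act_inj)

section \<open>Entropy of the n-step distribution\<close>

definition ent :: "nat \<Rightarrow> real" where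
  "ent n = - (\<Sum>y\<in>B n b. p n b y * ln (p n b y))"

text \<open>By invariance the entropy is the same from each starting point. Summation over an
  arbitrary finite superset \<open>D\<close> of the support lets distributions with different
  starting points be compared on a common set.\<close>

lemma ent_eq:
  assumes x: "x \<in> S" and D: "finite D" "B n x \<subseteq> D"
  shows "(\<Sum>y\<in>D. p n x y * ln (p n x y)) = - ent n"
proof -
  obtain g where g: "g \<in> L" "x = g \<star> b" using S_trans x by blast
  have "(\<Sum>y\<in>D. p n x y * ln (p n x y)) = (\<Sum>y\<in>B n x. p n x y * ln (p n x y))"
    by (rule sum.mono_neutral_right) (use D p_supp[OF x] in auto)
  also have "B n x = (\<lambda>y. g \<star> y) ` B n b" using B_act g b_in by simp
  also have "(\<Sum>y\<in>(\<lambda>y. g \<star> y) ` B n b. p n x y * ln (p n x y)) =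
      (\<Sum>y\<in>B n b. p n b y * ln (p n b y))"
    using g p_act[OF g(1) b_in] by (subst sum.reindex) (auto simp: inj_on_def act_inj)
  finally show ?thesis by (simp add: ent_def)
qed

text \<open>The distribution of n+1 steps from \<open>x\<close> is the mixture of the distributions
  of n steps from the neighbours. The gain in entropy of a mixture is the mean relative entropy of
  its parts with respect to it, and relative entropy dominates the squared Hellinger
  distance.\<close>

lemma ent_step:
  assumes x: "x \<in> S"
  shows "(\<Sum>s\<in>N x. w x s * (\<Sum>y\<in>B (Suc n) x. (sqrt (p n s y) - sqrt (p (Suc n) x y))\<^sup>2)) \<le> ent (Suc n) - ent n"
proof -
  define D where "D = B (Suc n) x"
  let ?D = D and ?q = "p (Suc n) x"
  have Ds: "B n s \<subseteq> ?D" if "s \<in> N x" for s using that by (auto simp: D_def)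
  have fD: "finite ?D" unfolding D_def by (rule B_fin[OF x])
  have xD: "B (Suc n) x \<subseteq> D" by (simp add: D_def)
  have "(\<Sum>s\<in>N x. w x s * (\<Sum>y\<in>?D. (sqrt (p n s y) - sqrt (?q y))\<^sup>2)) \<le>
      (\<Sum>s\<in>N x. w x s * (\<Sum>y\<in>?D. p n s y * ln (p n s y) - p n s y * ln (?q y) - p n s y + ?q y))"
  proof (intro sum_mono mult_left_mono)
    fix s y assume s: "s \<in> N x"
    have sS: "s \<in> S" using N_in x s by blast
    have "w x s * p n s y \<le> ?q y"
      unfolding p_Suc using N_fin[OF x] s w_nonneg[OF x] N_in[OF x] p_nonneg
      by (intro member_le_sum[where f = "\<lambda>z. w x z * p n z y"]) auto
    then have "?q y = 0 \<Longrightarrow> p n s y = 0"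
      using w_pos[OF x s] p_nonneg[OF sS, of n y] by (simp add: mult_le_0_iff)
    then show "(sqrt (p n s y) - sqrt (?q y))\<^sup>2 \<le> p n s y * ln (p n s y) - p n s y * ln (?q y) - p n s y + ?q y"
      using p_nonneg x sS by (intro sqrt_diff_le_relative_entropy) auto
  qed (use w_pos[OF x] in \<open>auto intro: less_imp_le\<close>)
  also have "\<dots> = (\<Sum>s\<in>N x. w x s * (- ent n - (\<Sum>y\<in>?D. p n s y * ln (?q y))))"
    by (intro sum.cong refl)
      (simp add: sum.distrib sum_subtractf ent_eq[OF N_in[OF x] fD Ds] p_sum[OF N_in[OF x] fD Ds] p_sum[OF x fD xD])
  also have "\<dots> = - ent n - (\<Sum>s\<in>N x. \<Sum>y\<in>?D. w x s * p n s y * ln (?q y))"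
    using w_sum[OF x] by (simp add: right_diff_distrib sum_subtractf sum_negf sum_distrib_left mult.assoc flip: sum_distrib_right)
  also have "(\<Sum>s\<in>N x. \<Sum>y\<in>?D. w x s * p n s y * ln (?q y)) = (\<Sum>y\<in>?D. ?q y * ln (?q y))"
    unfolding p_Suc by (subst sum.swap) (simp add: sum_distrib_right)
  also have "\<dots> = - ent (Suc n)" by (rule ent_eq[OF x fD xD])
  finally show ?thesis by (simp add: D_def)
qed

text \<open>Relative entropy with respect to the uniform distribution on the ball is
  nonnegative.\<close>

lemma ent_le: "ent n \<le> ln (real (card (B n b)))"
proof -
  let ?D = "B n b" and ?M = "real (card (B n b))"
  have D: "finite ?D" "?D \<noteq> {}" using B_fin[OF b_in] B_self[OF b_in] by auto
  then have M: "?M > 0" by (simp add: card_gt_0_iff)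
  have "0 \<le> (\<Sum>y\<in>?D. (sqrt (p n b y) - sqrt (1 / ?M))\<^sup>2)" by (intro sum_nonneg) auto
  also have "\<dots> \<le> (\<Sum>y\<in>?D. p n b y * ln (p n b y) - p n b y * ln (1 / ?M) - p n b y + 1 / ?M)"
    using p_nonneg[OF b_in] M by (intro sum_mono sqrt_diff_le_relative_entropy) auto
  also have "\<dots> = - ent n + ln ?M"
    using M D by (simp add: sum.distrib sum_subtractf ent_eq[OF b_in] p_sum[OF b_in] ln_div flip: sum_distrib_right)
  finally show ?thesis by simp
qed

end

section \<open>Gradient estimates for harmonic functions\<close>

context walk
begin

lemma wN_nonneg: "x \<in> S \<Longrightarrow> y \<in> N x \<Longrightarrow> w x y \<ge> 0"
  using w_pos by (meson less_imp_le)

lemma B_nbr: "s \<in> N x \<Longrightarrow> B n s \<subseteq> B (Suc n) x"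
  by auto

definition dent :: "nat \<Rightarrow> real" where
  "dent n = ent (Suc n) - ent n"

lemma sqrt_dist_le:
  assumes x: "x \<in> S" and s: "s \<in> N x"
  shows "(\<Sum>y\<in>B (Suc n) x. (sqrt (p n s y) - sqrt (p (Suc n) x y))\<^sup>2) \<le> dent n / w0"
proof -
  let ?f = "\<lambda>s. \<Sum>y\<in>B (Suc n) x. (sqrt (p n s y) - sqrt (p (Suc n) x y))\<^sup>2"
  have nn: "?f s \<ge> 0" for s by (intro sum_nonneg) auto
  have "w0 * ?f s \<le> w x s * ?f s" using w0(2)[OF x s] nn by (intro mult_right_mono) auto
  also have "\<dots> \<le> (\<Sum>s\<in>N x. w x s * ?f s)"
    using wN_nonneg[OF x] nn N_fin[OF x] s by (intro member_le_sum[where f = "\<lambda>s. w x s * ?f s"] mult_nonneg_nonneg) blast+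
  also have "\<dots> \<le> dent n" unfolding dent_def by (rule ent_step[OF x])
  finally show ?thesis using w0(1) by (simp add: field_simps)
qed

lemma dent_nonneg: "dent n \<ge> 0"
proof -
  have "0 \<le> (\<Sum>y\<in>B (Suc n) b. (sqrt (p n b y) - sqrt (p (Suc n) b y))\<^sup>2)" by (intro sum_nonneg) auto
  then have "0 \<le> dent n / w0" using sqrt_dist_le[OF b_in N_self[OF b_in], of n] by linarith
  then show ?thesis using w0(1) by (simp add: zero_le_divide_iff)
qed

lemma C_ge: "C \<ge> 1"
  using growth[of 0] by simp

text \<open>The entropy is at most logarithmic, so its increments are of order \<open>1 / n\<close> infinitely often.\<close>

lemma good_steps: "\<exists>n\<ge>m. dent n \<le> (real e + 1) / (real n + 1)"
proof (rule ccontr)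
  assume "\<not> ?thesis"
  \<comment> \<open>Increments this large would add up to \<open>(e + 1) * ln n\<close>, while the
    growth bound allows only \<open>e * ln n\<close> plus a constant; the extra 1 in the numerator
    gives the contradiction.\<close>
  then have big: "dent n \<ge> (real e + 1) / (real n + 1)" if "n \<ge> m" for n using that by force
  have low: "ent n \<ge> ent m + (real e + 1) * (ln (real n + 1) - ln (real m + 1))" if "n \<ge> m" for n
    using that
  proof (induction n rule: dec_induct)
    case (step n)
    have "ln (real (Suc n) + 1) - ln (real n + 1) = ln (1 + 1 / (real n + 1))"
      by (subst ln_divide_pos[symmetric]) (auto simp: field_simps)
    also have "\<dots> \<le> 1 / (real n + 1)" by (rule ln_add_one_self_le_self) auto
    finally have "(real e + 1) * (ln (real (Suc n) + 1) - ln (real n + 1)) \<le> (real e + 1) * (1 / (real n + 1))"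
      by (intro mult_left_mono) auto
    also have "\<dots> \<le> dent n" using big[of n] step by simp
    finally show ?case using step by (simp add: dent_def algebra_simps)
  qed simp
  have up: "ent n \<le> ln C + real e * ln (real n + 1)" for n
  proof -
    have "0 < card (B n b)" using B_fin[OF b_in] B_self[OF b_in] by (auto simp: card_gt_0_iff)
    then have "ln (real (card (B n b))) \<le> ln (C * (real n + 1) ^ e)"
      using growth[of n] C_ge by (subst ln_le_cancel_iff) auto
    also have "\<dots> = ln C + real e * ln (real n + 1)" using C_ge by (simp add: ln_mult ln_realpow)
    finally show ?thesis using ent_le[of n] by linarith
  qed
  define K where "K = ln C - ent m + (real e + 1) * ln (real m + 1)"
  have "ln (real n + 1) \<le> K" if "n \<ge> m" for n
    using low[OF that] up[of n] by (simp add: K_def algebra_simps)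
  moreover have "\<forall>\<^sub>F n in sequentially. ln (real n + 1) > K" by real_asymp
  then have "\<forall>\<^sub>F n in sequentially. n \<ge> m \<and> ln (real n + 1) > K"
    using eventually_ge_at_top by (intro eventually_conj)
  then obtain n where "n \<ge> m" "ln (real n + 1) > K" by (auto simp: eventually_at_top_linorder)
  ultimately show False by force
qed

lemma good_steps_small:
  assumes "\<epsilon> > 0"
  shows "\<exists>n\<ge>m. dent n \<le> \<epsilon>"
proof -
  obtain k :: nat where k: "(real e + 1) / \<epsilon> < real k" using reals_Archimedean2 by blast
  obtain n where n: "n \<ge> max m k" "dent n \<le> (real e + 1) / (real n + 1)" using good_steps by blast
  have "real e + 1 \<le> \<epsilon> * real k" using k assms by (simp add: field_simps)
  also have "\<dots> \<le> \<epsilon> * (real n + 1)" using n assms by (intro mult_left_mono) auto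
  finally have "(real e + 1) / (real n + 1) \<le> \<epsilon>" by (simp add: field_simps)
  then show ?thesis using n by force
qed

text \<open>Cauchy-Schwarz after factoring the difference of two distributions as
  \<open>(sqrt a - sqrt q) * (sqrt a + sqrt q)\<close>: the first factor is paid for by the entropy
  increment, the second leaves second moments of \<open>f\<close>.\<close>

lemma weighted_diff_le:
  assumes x: "x \<in> S" and s: "s \<in> N x"
  shows "(\<Sum>y\<in>B (Suc n) x. \<bar>p n s y - p (Suc n) x y\<bar> * f y)\<^sup>2 \<le>
    dent n / w0 * (2 * (\<Sum>y\<in>B (Suc n) x. (p n s y + p (Suc n) x y) * (f y)\<^sup>2))"
proof -
  define D where "D = B (Suc n) x"
  let ?a = "p n s" and ?q = "p (Suc n) x"
  have nn: "?a y \<ge> 0" "?q y \<ge> 0" for y using p_nonneg x N_in[OF x s] by auto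
  have "\<bar>?a y - ?q y\<bar> * f y = \<bar>sqrt (?a y) - sqrt (?q y)\<bar> * ((sqrt (?a y) + sqrt (?q y)) * f y)" for y
  proof -
    have "?a y - ?q y = (sqrt (?a y) - sqrt (?q y)) * (sqrt (?a y) + sqrt (?q y))"
      using nn[of y] by (simp add: algebra_simps)
    then show ?thesis using nn[of y] by (simp add: abs_mult)
  qed
  then have "(\<Sum>y\<in>D. \<bar>?a y - ?q y\<bar> * f y)\<^sup>2 \<le>
      (\<Sum>y\<in>D. \<bar>sqrt (?a y) - sqrt (?q y)\<bar>\<^sup>2) * (\<Sum>y\<in>D. ((sqrt (?a y) + sqrt (?q y)) * f y)\<^sup>2)"
    by (simp only: Cauchy_Schwarz_ineq_sum)
  also have "\<dots> \<le> dent n / w0 * (\<Sum>y\<in>D. 2 * ((?a y + ?q y) * (f y)\<^sup>2))"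
  proof (rule mult_mono)
    show "(\<Sum>y\<in>D. \<bar>sqrt (?a y) - sqrt (?q y)\<bar>\<^sup>2) \<le> dent n / w0"
      using sqrt_dist_le[OF x s] by (simp add: D_def)
    show "(\<Sum>y\<in>D. ((sqrt (?a y) + sqrt (?q y)) * f y)\<^sup>2) \<le> (\<Sum>y\<in>D. 2 * ((?a y + ?q y) * (f y)\<^sup>2))"
    proof (rule sum_mono)
      fix y
      have "(sqrt (?a y) + sqrt (?q y))\<^sup>2 \<le> 2 * (?a y + ?q y)"
        using nn[of y] sum_squares_bound[of "sqrt (?a y)" "sqrt (?q y)"] by (simp add: power2_sum)
      from mult_right_mono[OF this zero_le_power2[of "f y"]]
      show "((sqrt (?a y) + sqrt (?q y)) * f y)\<^sup>2 \<le> 2 * ((?a y + ?q y) * (f y)\<^sup>2)"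
        by (simp only: power_mult_distrib mult.assoc)
    qed
    show "0 \<le> dent n / w0" using dent_nonneg w0(1) by simp
  qed (intro sum_nonneg, simp)
  finally show ?thesis by (simp add: D_def sum_distrib_left)
qed

lemma heat_kernel_l1:
  assumes x: "x \<in> S" and s: "s \<in> N x"
  shows "(\<Sum>y\<in>B (Suc n) x. \<bar>p n s y - p (Suc n) x y\<bar>) \<le> 2 * sqrt (dent n / w0)"
proof -
  have Bs: "B n s \<subseteq> B (Suc n) x" using s by auto
  have "(\<Sum>y\<in>B (Suc n) x. \<bar>p n s y - p (Suc n) x y\<bar>)\<^sup>2 \<le> dent n / w0 * (2 * (1 + 1))"
    using weighted_diff_le[OF x s, of n "\<lambda>_. 1"]
    by (simp add: sum.distrib p_sum[OF N_in[OF x s] B_fin[OF x] Bs] p_sum[OF x B_fin[OF x]] del: kernel_ball.simps)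
  then have "(\<Sum>y\<in>B (Suc n) x. \<bar>p n s y - p (Suc n) x y\<bar>) \<le> sqrt (dent n / w0 * (2 * (1 + 1)))"
    by (rule real_le_rsqrt)
  also have "\<dots> = 2 * sqrt (dent n / w0)" using real_sqrt_mult[of 4 "dent n / w0"] by (simp add: mult.commute)
  finally show ?thesis .
qed

section \<open>Harmonic functions and their energy\<close>

definition harm :: "('x \<Rightarrow> real) \<Rightarrow> bool" where
  "harm f \<longleftrightarrow> (\<forall>x\<in>S. P f x = f x)"

text \<open>Twice the carre du champ of the walk: the energy density in polarized form.\<close>

definition \<Gamma> :: "('x \<Rightarrow> real) \<Rightarrow> ('x \<Rightarrow> real) \<Rightarrow> 'x \<Rightarrow> real" where
  "\<Gamma> f f' x = (\<Sum>y\<in>N x. w x y * ((f y - f x) * (f' y - f' x)))"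

lemma harm_Pn: "harm f \<Longrightarrow> x \<in> S \<Longrightarrow> (P ^^ n) f x = f x"
proof (induction n arbitrary: x)
  case (Suc n)
  then have "P ((P ^^ n) f) x = P f x" by (intro P_cong) auto
  then show ?case using Suc.prems by (simp add: harm_def)
qed simp

lemma P_square: "harm f \<Longrightarrow> x \<in> S \<Longrightarrow> P (\<lambda>y. (f y)\<^sup>2) x = (f x)\<^sup>2 + \<Gamma> f f x"
proof -
  assume f: "harm f" and x: "x \<in> S"
  have "\<Gamma> f f x = (\<Sum>y\<in>N x. w x y * (f y)\<^sup>2 - 2 * f x * (w x y * f y) + (f x)\<^sup>2 * w x y)"
    unfolding \<Gamma>_def by (intro sum.cong refl) (simp add: power2_eq_square algebra_simps)
  also have "\<dots> = P (\<lambda>y. (f y)\<^sup>2) x - 2 * f x * P f x + (f x)\<^sup>2"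
    using w_sum[OF x] by (simp add: sum.distrib sum_subtractf P_def flip: sum_distrib_left)
  also have "P f x = f x" using f x by (simp add: harm_def)
  finally show ?thesis by (simp add: power2_eq_square)
qed

text \<open>The square of a harmonic function minus its accumulated energy is a martingale, so the
  second moment after \<open>m\<close> steps is governed by the energies met at the times
  \<open>k < m\<close>.\<close>

lemma Pn_square:
  assumes f: "harm f" and x: "x \<in> S"
  shows "(P ^^ m) (\<lambda>y. (f y)\<^sup>2) x = (f x)\<^sup>2 + (\<Sum>k<m. (P ^^ k) (\<Gamma> f f) x)"
proof (induction m)
  case (Suc m)
  have "(P ^^ Suc m) (\<lambda>y. (f y)\<^sup>2) x = (P ^^ m) (P (\<lambda>y. (f y)\<^sup>2)) x" by (simp add: funpow_swap1)
  also have "\<dots> = (P ^^ m) (\<lambda>y. (f y)\<^sup>2 + \<Gamma> f f y) x" by (intro Pn_cong x P_square f)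
  finally show ?case using Suc by (simp add: Pn_add)
qed simp

lemma \<Gamma>_nonneg: "x \<in> S \<Longrightarrow> \<Gamma> f f x \<ge> 0"
  unfolding \<Gamma>_def by (rule sum_nonneg) (simp add: wN_nonneg)

lemma \<Gamma>_shift: "\<Gamma> (\<lambda>y. f y - c) (\<lambda>y. f y - c) x = \<Gamma> f f x"
  by (simp add: \<Gamma>_def)

lemma harm_shift: "harm f \<Longrightarrow> harm (\<lambda>y. f y - c)"
  by (simp add: harm_def P_diff P_const)

text \<open>Harmonicity writes \<open>f s - f x\<close> as the integral of \<open>f - f x\<close>
  against the difference of the distributions after n steps from \<open>s\<close> and n+1 steps from
  \<open>x\<close>; \<open>weighted_diff_le\<close> then separates the entropy increment from second
  moments. The moment from \<open>s\<close> is absorbed by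
  \<open>w0 * p n s y \<le> p (Suc n) x y\<close>, whence the factor \<open>1 / w0 + 1\<close>, and
  the moment from \<open>x\<close> is accumulated energy. An increment of order 1/n turns the sum
  into a mean.\<close>

lemma gradient_estimate:
  assumes f: "harm f" and x: "x \<in> S" and s: "s \<in> N x"
  shows "(f s - f x)\<^sup>2 \<le> 2 * (1 / w0 + 1) / w0 * dent n * (\<Sum>k<Suc n. (P ^^ k) (\<Gamma> f f) x)"
proof -
  define f0 where "f0 y = f y - f x" for y
  have f0: "harm f0" unfolding f0_def by (rule harm_shift[OF f])
  define D where "D = B (Suc n) x"
  have fD: "finite D" "B n s \<subseteq> D" "B (Suc n) x \<subseteq> D" using B_fin[OF x] B_nbr[OF s] by (simp_all add: D_def del: kernel_ball.simps)
  have sS: "s \<in> S" by (rule N_in[OF x s])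
  let ?a = "p n s" and ?q = "p (Suc n) x"
  have nn: "?a y \<ge> 0" "?q y \<ge> 0" for y using p_nonneg x sS by auto
  have "f0 s = (\<Sum>y\<in>D. ?a y * f0 y)" "f0 x = (\<Sum>y\<in>D. ?q y * f0 y)"
    using harm_Pn[OF f0] Pn_p[OF sS fD(1,2)] Pn_p[OF x fD(1,3)] x sS by metis+
  then have "f s - f x = (\<Sum>y\<in>D. (?a y - ?q y) * f0 y)"
    by (simp add: f0_def sum_subtractf left_diff_distrib)
  then have "\<bar>f s - f x\<bar> \<le> (\<Sum>y\<in>D. \<bar>?a y - ?q y\<bar> * \<bar>f0 y\<bar>)"
    by (simp add: sum_abs flip: abs_mult)
  then have "(f s - f x)\<^sup>2 \<le> (\<Sum>y\<in>D. \<bar>?a y - ?q y\<bar> * \<bar>f0 y\<bar>)\<^sup>2"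
    by (metis abs_ge_zero power2_abs power_mono)
  also have "\<dots> \<le> dent n / w0 * (2 * (\<Sum>y\<in>D. (?a y + ?q y) * (\<bar>f0 y\<bar>)\<^sup>2))"
    unfolding D_def by (rule weighted_diff_le[OF x s])
  also have "\<dots> \<le> dent n / w0 * (2 * (\<Sum>y\<in>D. (1 / w0 + 1) * (?q y * (f0 y)\<^sup>2)))"
  proof (intro mult_left_mono sum_mono)
    fix y
    have "w0 * ?a y \<le> w x s * ?a y" using w0(2)[OF x s] nn by (intro mult_right_mono) auto
    also have "\<dots> \<le> ?q y"
      unfolding p_Suc using N_fin[OF x] s wN_nonneg[OF x] N_in[OF x] p_nonneg
      by (intro member_le_sum[where f = "\<lambda>z. w x z * p n z y"]) auto
    finally have "?a y + ?q y \<le> (1 / w0 + 1) * ?q y" using w0(1) by (simp add: field_simps)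
    from mult_right_mono[OF this, of "(f0 y)\<^sup>2"]
    show "(?a y + ?q y) * (\<bar>f0 y\<bar>)\<^sup>2 \<le> (1 / w0 + 1) * (?q y * (f0 y)\<^sup>2)" by (simp add: mult.assoc)
  qed (use dent_nonneg w0(1) in auto)
  also have "(\<Sum>y\<in>D. (1 / w0 + 1) * (?q y * (f0 y)\<^sup>2)) = (1 / w0 + 1) * (P ^^ Suc n) (\<lambda>y. (f0 y)\<^sup>2) x"
    unfolding Pn_p[OF x fD(1,3)] by (rule sum_distrib_left[symmetric])
  also have "(P ^^ Suc n) (\<lambda>y. (f0 y)\<^sup>2) x = (\<Sum>k<Suc n. (P ^^ k) (\<Gamma> f f) x)"
    unfolding Pn_square[OF f0 x] by (simp add: f0_def[abs_def] \<Gamma>_shift[abs_def])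
  finally show ?thesis by (simp only: divide_inverse mult_ac)
qed

text \<open>The Liouville property: along the times with small entropy increment, the distributions
  started at neighbours become close in the l1 norm, so a bounded harmonic function has equal values
  there.\<close>

lemma harm_bounded_const:
  assumes f: "harm f" and M: "\<And>y. y \<in> S \<Longrightarrow> \<bar>f y\<bar> \<le> M" and x: "x \<in> S"
  shows "f x = f b"
proof -
  have step: "f s = f x" if x: "x \<in> S" and s: "s \<in> N x" for x s
  proof -
    have bound: "\<bar>f s - f x\<bar> \<le> M * (2 * sqrt (dent n / w0))" for n
    proof -
      define D where "D = B (Suc n) x"
      have fD: "finite D" "B n s \<subseteq> D" "B (Suc n) x \<subseteq> D" using B_fin[OF x] B_nbr[OF s] by (simp_all add: D_def del: kernel_ball.simps)
      have sS: "s \<in> S" by (rule N_in[OF x s])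
      have "f s = (\<Sum>y\<in>D. p n s y * f y)" "f x = (\<Sum>y\<in>D. p (Suc n) x y * f y)"
        using harm_Pn[OF f] Pn_p[OF sS fD(1,2)] Pn_p[OF x fD(1,3)] x sS by metis+
      then have "\<bar>f s - f x\<bar> = \<bar>\<Sum>y\<in>D. (p n s y - p (Suc n) x y) * f y\<bar>"
        by (simp add: sum_subtractf left_diff_distrib)
      also have "\<dots> \<le> (\<Sum>y\<in>D. \<bar>p n s y - p (Suc n) x y\<bar> * M)"
      proof (rule order_trans[OF sum_abs], rule sum_mono)
        fix y assume "y \<in> D"
        then have "y \<in> S" using B_S[OF x] by (auto simp: D_def simp del: kernel_ball.simps)
        then show "\<bar>(p n s y - p (Suc n) x y) * f y\<bar> \<le> \<bar>p n s y - p (Suc n) x y\<bar> * M"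
          using M by (simp add: abs_mult mult_left_mono)
      qed
      also have "\<dots> \<le> M * (2 * sqrt (dent n / w0))"
        using heat_kernel_l1[OF x s, of n] M[OF x] unfolding D_def[symmetric]
        by (subst sum_distrib_right[symmetric], subst mult.commute) (intro mult_left_mono, auto)
      finally show ?thesis .
    qed
    have "\<bar>f s - f x\<bar> \<le> \<epsilon>" if \<epsilon>: "\<epsilon> > 0" for \<epsilon>
    proof -
      \<comment> \<open>Chosen so that
        \<open>2 * sqrt (\<delta> / w0) = \<epsilon> / (\<bar>M\<bar> + 1)\<close>.\<close>
      define \<delta> where "\<delta> = (\<epsilon> / (2 * (\<bar>M\<bar> + 1)))\<^sup>2 * w0"
      have "\<delta> > 0" unfolding \<delta>_def using \<epsilon> w0(1) by (intro mult_pos_pos) auto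
      then obtain n where n: "dent n \<le> \<delta>" using good_steps_small by blast
      have "sqrt (dent n / w0) \<le> sqrt ((\<epsilon> / (2 * (\<bar>M\<bar> + 1)))\<^sup>2)"
        using n w0(1) by (intro real_sqrt_le_mono) (simp add: \<delta>_def field_simps)
      also have "\<dots> = \<epsilon> / (2 * (\<bar>M\<bar> + 1))" using \<epsilon> by simp
      finally have "2 * sqrt (dent n / w0) \<le> \<epsilon> / (\<bar>M\<bar> + 1)" by (simp add: field_simps)
      then have "M * (2 * sqrt (dent n / w0)) \<le> M * (\<epsilon> / (\<bar>M\<bar> + 1))"
        using M[OF x] by (intro mult_left_mono) auto
      also have "\<dots> \<le> \<epsilon>" using \<epsilon> M[OF x] by (simp add: field_simps)
      finally show ?thesis using bound[of n] by linarith
    qed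
    then show ?thesis by (metis abs_le_zero_iff field_le_epsilon add_0 eq_iff_diff_eq_0)
  qed
  have "f x = f y" if "y \<in> S" "x \<in> B n y" for n x y
    using that
  proof (induction n arbitrary: y)
    case (Suc n)
    then show ?case using step N_in by fastforce
  qed simp
  then show ?thesis using conn[OF x] b_in by blast
qed

end

section \<open>A nonconstant Lipschitz harmonic function\<close>

context walk
begin

lemma p_diag: "x \<in> S \<Longrightarrow> p n x x = p n b b"
  using S_trans p_act b_in by metis

text \<open>By symmetry the l2 inner product of two heat kernels is again a heat kernel value, so
  the norms and energies below become combinations of transition probabilities.\<close>

lemma p_inner:
  assumes "x \<in> S" "y \<in> S" "finite D" "D \<subseteq> S" "B k x \<subseteq> D"
  shows "(\<Sum>z\<in>D. p k x z * p l y z) = p (k + l) x y"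
  unfolding p_add[OF assms(1,3,5)] using assms p_sym by (intro sum.cong refl) (metis subsetD)

lemma dist_sq:
  assumes "x \<in> S" "y \<in> S" "finite D" "D \<subseteq> S" "B k x \<subseteq> D" "B k y \<subseteq> D"
  shows "(\<Sum>z\<in>D. (p k x z - p k y z)\<^sup>2) = 2 * p (2 * k) b b - 2 * p (2 * k) x y"
proof -
  have "(\<Sum>z\<in>D. (p k x z - p k y z)\<^sup>2) =
    (\<Sum>z\<in>D. p k x z * p k x z) + (\<Sum>z\<in>D. p k y z * p k y z) - 2 * (\<Sum>z\<in>D. p k x z * p k y z)"
    by (simp add: power2_eq_square algebra_simps sum.distrib sum_subtractf sum_distrib_left)
  also have "\<dots> = p (k + k) x x + p (k + k) y y - 2 * p (k + k) x y"
    unfolding p_inner[OF assms(1,1,3,4,5)] p_inner[OF assms(2,2,3,4,6)] p_inner[OF assms(1,2,3,4,5)] ..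
  finally show ?thesis unfolding p_diag[OF assms(1)] p_diag[OF assms(2)] by (simp add: mult_2[of k])
qed

text \<open>The weighted squares \<open>(v x + v y)\<^sup>2 / 2\<close> sum to the quadratic form
  plus at most the squared norm of \<open>v\<close>, because row sums are at most 1. The diagonal
  alone, with weights at least 1/2, already contributes the squared norm.\<close>

lemma P_positive:
  assumes A: "finite A" "A \<subseteq> S" and v: "\<And>z. z \<in> S \<Longrightarrow> z \<notin> A \<Longrightarrow> v z = 0"
  shows "0 \<le> (\<Sum>x\<in>A. v x * P v x)"
proof -
  have eq: "P v x = (\<Sum>y\<in>A. w x y * v y)" if x: "x \<in> A" for x
  proof -
    have xS: "x \<in> S" using x A by auto
    have "P v x = (\<Sum>y\<in>N x \<inter> A. w x y * v y)" unfolding P_def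
      by (rule sum.mono_neutral_right) (use N_fin[OF xS] v N_in[OF xS] in auto)
    also have "\<dots> = (\<Sum>y\<in>A. w x y * v y)"
      by (rule sum.mono_neutral_left) (use A N_eq[OF xS] in auto)
    finally show ?thesis .
  qed
  have row: "(\<Sum>y\<in>A. w x y) \<le> 1" if x: "x \<in> A" for x
  proof -
    have xS: "x \<in> S" using x A by auto
    have "(\<Sum>y\<in>A. w x y) = (\<Sum>y\<in>A \<inter> N x. w x y)"
      by (rule sum.mono_neutral_right) (use A N_eq[OF xS] in auto)
    also have "\<dots> \<le> (\<Sum>y\<in>N x. w x y)"
      by (rule sum_mono2) (use N_fin[OF xS] wN_nonneg[OF xS] in auto)
    finally show ?thesis using w_sum[OF xS] by simp
  qed
  have "(\<Sum>x\<in>A. (v x)\<^sup>2) \<le> (\<Sum>x\<in>A. w x x * (v x + v x)\<^sup>2 / 2)"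
  proof (rule sum_mono)
    fix x assume "x \<in> A"
    then have "w x x \<ge> 1 / 2" using A w_self by auto
    from mult_right_mono[OF this, of "(v x + v x)\<^sup>2 / 2"]
    show "(v x)\<^sup>2 \<le> w x x * (v x + v x)\<^sup>2 / 2" by (simp add: power2_eq_square algebra_simps)
  qed
  also have "\<dots> \<le> (\<Sum>x\<in>A. \<Sum>y\<in>A. w x y * (v x + v y)\<^sup>2 / 2)"
  proof (rule sum_mono)
    fix x assume x: "x \<in> A"
    have "w x y \<ge> 0" if "y \<in> A" for y using w_nonneg x that A(2) by blast
    then show "w x x * (v x + v x)\<^sup>2 / 2 \<le> (\<Sum>y\<in>A. w x y * (v x + v y)\<^sup>2 / 2)"
      using x A(1) by (intro member_le_sum[where f = "\<lambda>y. w x y * (v x + v y)\<^sup>2 / 2"]) auto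
  qed
  also have "\<dots> = (\<Sum>x\<in>A. \<Sum>y\<in>A. v x * (w x y * v y) + (v x)\<^sup>2 / 2 * w x y + (v y)\<^sup>2 / 2 * w x y)"
    by (intro sum.cong refl) (simp add: power2_eq_square field_simps)
  also have "\<dots> = (\<Sum>x\<in>A. v x * P v x) + (\<Sum>x\<in>A. \<Sum>y\<in>A. (v x)\<^sup>2 / 2 * w x y) + (\<Sum>x\<in>A. \<Sum>y\<in>A. (v y)\<^sup>2 / 2 * w x y)"
    by (simp add: sum.distrib eq sum_distrib_left)
  also have "(\<Sum>x\<in>A. \<Sum>y\<in>A. (v y)\<^sup>2 / 2 * w x y) = (\<Sum>x\<in>A. \<Sum>y\<in>A. (v x)\<^sup>2 / 2 * w x y)"
  proof (subst sum.swap, intro sum.cong refl)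
    fix x y assume "x \<in> A" "y \<in> A"
    then have "w x y = w y x" using w_sym A(2) by blast
    then show "(v x)\<^sup>2 / 2 * w y x = (v x)\<^sup>2 / 2 * w x y" by simp
  qed
  also have "(\<Sum>x\<in>A. \<Sum>y\<in>A. (v x)\<^sup>2 / 2 * w x y) \<le> (\<Sum>x\<in>A. (v x)\<^sup>2 / 2)"
  proof (rule sum_mono)
    fix x assume "x \<in> A"
    from mult_left_mono[OF row[OF this], of "(v x)\<^sup>2 / 2"]
    show "(\<Sum>y\<in>A. (v x)\<^sup>2 / 2 * w x y) \<le> (v x)\<^sup>2 / 2" by (simp add: sum_distrib_left)
  qed
  finally show ?thesis by (simp add: sum_divide_distrib[symmetric])
qed

definition q :: "nat \<Rightarrow> real" where "q n = p n b b"

text \<open>With \<open>u = p k b\<close> as an l2 vector, \<open>a (2 * k)\<close> is the Dirichlet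
  energy of \<open>u\<close> (the inner product of \<open>u - P u\<close> with \<open>u\<close>),
  \<open>a (2 * k) - a (2 * k + 1)\<close> is the squared norm of \<open>u - P u\<close>
  (\<open>step_sq\<close>), and \<open>a (2 * k + 1) - a (2 * k + 2)\<close> is the quadratic form
  of \<open>P\<close> at \<open>u - P u\<close> (\<open>a_odd\<close>).\<close>

definition a :: "nat \<Rightarrow> real" where "a n = q n - q (Suc n)"

text \<open>By \<open>dist_sq\<close>, the summands are the weighted squared l2 distances between
  the heat kernels at \<open>x\<close> and at its neighbours.\<close>

lemma a_even:
  assumes x: "x \<in> S"
  shows "(\<Sum>y\<in>N x. w x y * (2 * q (2 * k) - 2 * p (2 * k) x y)) = 2 * a (2 * k)"
proof -
  have "(\<Sum>y\<in>N x. w x y * p (2 * k) x y) = p (Suc (2 * k)) x x"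
    unfolding p_Suc using p_sym[OF x N_in[OF x]] by (intro sum.cong) auto
  then have "(\<Sum>y\<in>N x. w x y * p (2 * k) x y) = q (Suc (2 * k))" using p_diag[OF x, of "Suc (2 * k)"] by (simp only: q_def)
  moreover have "(\<Sum>y\<in>N x. w x y * (2 * q (2 * k) - 2 * p (2 * k) x y)) =
      (\<Sum>y\<in>N x. 2 * q (2 * k) * w x y - 2 * (w x y * p (2 * k) x y))"
    by (intro sum.cong refl) (simp add: algebra_simps)
  then have "(\<Sum>y\<in>N x. w x y * (2 * q (2 * k) - 2 * p (2 * k) x y)) =
      2 * q (2 * k) * (\<Sum>y\<in>N x. w x y) - 2 * (\<Sum>y\<in>N x. w x y * p (2 * k) x y)"
    unfolding sum_subtractf sum_distrib_left[symmetric] .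
  ultimately show ?thesis using w_sum[OF x] by (simp add: a_def)
qed

lemma dist_nonneg:
  assumes "x \<in> S" "y \<in> S"
  shows "2 * q (2 * k) - 2 * p (2 * k) x y \<ge> 0"
proof -
  have "0 \<le> (\<Sum>z\<in>B k x \<union> B k y. (p k x z - p k y z)\<^sup>2)" by (intro sum_nonneg) auto
  then show ?thesis using dist_sq[OF assms, of "B k x \<union> B k y" k] B_fin B_S assms by (simp add: q_def)
qed

lemma dist_le:
  assumes x: "x \<in> S" and y: "y \<in> N x"
  shows "2 * q (2 * k) - 2 * p (2 * k) x y \<le> 2 * a (2 * k) / w0"
proof -
  define d where "d z = 2 * q (2 * k) - 2 * p (2 * k) x z" for z
  have d: "d z \<ge> 0" if "z \<in> N x" for z
    unfolding d_def by (rule dist_nonneg[OF x N_in[OF x that]])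
  have "w0 * d y \<le> w x y * d y" by (rule mult_right_mono[OF w0(2)[OF x y] d[OF y]])
  also have "\<dots> \<le> (\<Sum>y\<in>N x. w x y * d y)"
    using y N_fin[OF x] wN_nonneg[OF x] d by (intro member_le_sum[where f = "\<lambda>y. w x y * d y"] mult_nonneg_nonneg) blast+
  also have "\<dots> = 2 * a (2 * k)" unfolding d_def by (rule a_even[OF x])
  finally have "w0 * d y \<le> 2 * a (2 * k)" .
  then show ?thesis using w0(1) by (simp add: d_def field_simps)
qed

lemma a_even_nonneg: "a (2 * k) \<ge> 0"
proof -
  have "0 \<le> 2 * a (2 * k) / w0"
    using dist_nonneg[OF b_in b_in, of k] dist_le[OF b_in N_self[OF b_in], of k] by linarith
  then show ?thesis using w0(1) by (simp add: zero_le_divide_iff)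
qed

lemma P_p: 
  assumes "z \<in> S" "x \<in> S" shows "P (p n x) z = p (Suc n) x z"
proof -
  have "P (p n x) z = (\<Sum>y\<in>N z. w z y * p n y x)"
    unfolding P_def
  proof (intro sum.cong refl)
    fix y assume "y \<in> N z"
    then show "w z y * p n x y = w z y * p n y x" using p_sym[OF assms(2) N_in[OF assms(1)], of y n] by simp
  qed
  then show ?thesis using p_sym[OF assms(2,1), of "Suc n"] by (simp add: p_Suc)
qed

lemma a_odd: "a (2 * k + 2) \<le> a (2 * k + 1)"
proof -
  define D where "D = B (Suc (Suc k)) b"
  have D: "finite D" "D \<subseteq> S" "B k b \<subseteq> D" "B (Suc k) b \<subseteq> D"
    unfolding D_def using B_fin[OF b_in, of "Suc (Suc k)"] B_S[OF b_in, of "Suc (Suc k)"]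
      B_mono[OF b_in, of k "Suc (Suc k)"] B_mono[OF b_in, of "Suc k" "Suc (Suc k)"] by (simp_all del: kernel_ball.simps)
  define v where "v z = p k b z - p (Suc k) b z" for z
  have Pv: "P v z = p (Suc k) b z - p (Suc (Suc k)) b z" if "z \<in> S" for z
    using P_diff[of "p k b" "p (Suc k) b" z] P_p[OF that b_in] by (simp add: v_def[abs_def])
  have "0 \<le> (\<Sum>z\<in>D. v z * P v z)"
  proof (rule P_positive[OF D(1,2)])
    fix z assume "z \<notin> D"
    then have "z \<notin> B k b" "z \<notin> B (Suc k) b" using D(3,4) by blast+
    then show "v z = 0" using p_supp[OF b_in, of z k] p_supp[OF b_in, of z "Suc k"] by (simp add: v_def)
  qed
  also have "\<dots> = (\<Sum>z\<in>D. v z * (p (Suc k) b z - p (Suc (Suc k)) b z))"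
    using Pv D(2) by (intro sum.cong) auto
  also have "\<dots> = (\<Sum>z\<in>D. p k b z * p (Suc k) b z) - (\<Sum>z\<in>D. p k b z * p (Suc (Suc k)) b z)
      - (\<Sum>z\<in>D. p (Suc k) b z * p (Suc k) b z) + (\<Sum>z\<in>D. p (Suc k) b z * p (Suc (Suc k)) b z)"
    by (simp add: v_def algebra_simps sum.distrib sum_subtractf)
  also have "\<dots> = q (2 * k + 1) - q (2 * k + 2) - q (2 * k + 2) + q (2 * k + 3)"
    using p_inner[OF b_in b_in D(1,2,3), of "Suc k"] p_inner[OF b_in b_in D(1,2,3), of "Suc (Suc k)"]
      p_inner[OF b_in b_in D(1,2,4), of "Suc k"] p_inner[OF b_in b_in D(1,2,4), of "Suc (Suc k)"]
    by (simp add: q_def mult_2[of k] numeral_3_eq_3)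
  finally show ?thesis by (simp add: a_def numeral_3_eq_3)
qed

lemma a_nonneg: "a n \<ge> 0"
proof (cases "even n")
  case True
  then show ?thesis using a_even_nonneg by auto
next
  case False
  then obtain k where "n = 2 * k + 1" by (auto elim: oddE)
  moreover have "a (2 * k + 2) \<ge> 0" using a_even_nonneg[of "Suc k"] by simp
  ultimately show ?thesis using a_odd[of k] by simp
qed

lemma q_antimono: "m \<le> n \<Longrightarrow> q n \<le> q m"
  by (rule lift_Suc_antimono_le[of q]) (use a_nonneg in \<open>auto simp: a_def\<close>)

lemma step_sq:
  assumes "x \<in> S" "finite D" "D \<subseteq> S" "B (Suc k) x \<subseteq> D"
  shows "(\<Sum>z\<in>D. (p (Suc k) x z - p k x z)\<^sup>2) = a (2 * k) - a (2 * k + 1)"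
proof -
  have Bk: "B k x \<subseteq> D" using B_Suc[OF assms(1)] assms(4) by blast
  have "(\<Sum>z\<in>D. (p (Suc k) x z - p k x z)\<^sup>2) = (\<Sum>z\<in>D. p (Suc k) x z * p (Suc k) x z)
    + (\<Sum>z\<in>D. p k x z * p k x z) - 2 * (\<Sum>z\<in>D. p k x z * p (Suc k) x z)"
    by (simp add: power2_eq_square algebra_simps sum.distrib sum_subtractf sum_distrib_left)
  also have "\<dots> = p (Suc k + Suc k) x x + p (k + k) x x - 2 * p (k + Suc k) x x"
    unfolding p_inner[OF assms(1,1,2,3,4)] p_inner[OF assms(1,1,2,3) Bk] ..
  also have "\<dots> = q (2 * k + 2) + q (2 * k) - 2 * q (2 * k + 1)"
    unfolding p_diag[OF assms(1)] q_def by (simp add: mult_2[of k])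
  finally show ?thesis by (simp add: a_def)
qed

text \<open>One edge costs two comparisons with the common distribution \<open>p (Suc n) x\<close>,
  from \<open>s\<close> and from \<open>x\<close> itself, which is one of its own neighbours; each
  costs \<open>2 * sqrt (dent n / w0)\<close>.\<close>

lemma heat_kernel_close:
  assumes "x \<in> S" "z \<in> B r x"
  shows "\<bar>p n z y - p n x y\<bar> \<le> real r * (4 * sqrt (dent n / w0))"
  using assms
proof (induction r arbitrary: x)
  case (Suc r)
  then obtain s where s: "s \<in> N x" "z \<in> B r s" by auto
  have sS: "s \<in> S" using N_in Suc s by blast
  have nb: "\<bar>p n s y - p (Suc n) x y\<bar> \<le> 2 * sqrt (dent n / w0)" if s: "s \<in> N x" for s
  proof (cases "y \<in> B (Suc n) x")
    case True
    then have "\<bar>p n s y - p (Suc n) x y\<bar> \<le> (\<Sum>y\<in>B (Suc n) x. \<bar>p n s y - p (Suc n) x y\<bar>)"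
      using B_fin[OF Suc.prems(1)] by (intro member_le_sum) (auto simp del: kernel_ball.simps)
    then show ?thesis using heat_kernel_l1[OF Suc.prems(1) s, of n] by linarith
  next
    case False
    then have "p n s y = 0" "p (Suc n) x y = 0"
      using p_supp[OF N_in[OF Suc.prems(1) s], of y n] p_supp[OF Suc.prems(1), of y "Suc n"] B_nbr[OF s] by auto
    then show ?thesis using dent_nonneg w0(1) by simp
  qed
  have "\<bar>p n s y - p n x y\<bar> \<le> 4 * sqrt (dent n / w0)"
    using nb[OF s(1)] nb[OF N_self[OF Suc.prems(1)]] by linarith
  moreover have "\<bar>p n z y - p n s y\<bar> \<le> real r * (4 * sqrt (dent n / w0))" using Suc.IH[OF sS s(2)] .
  ultimately show ?case by (simp add: algebra_simps)
qed simp

text \<open>At a time of small entropy increment, many points within a bounded distance of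
  \<open>b\<close> carry almost the return probability, and their total mass is at most 1.\<close>

lemma q_small:
  assumes inf: "infinite S" and \<epsilon>: "\<epsilon> > 0"
  shows "\<exists>n. q n \<le> \<epsilon>"
proof -
  obtain M :: nat where M: "2 / \<epsilon> < real M" using reals_Archimedean2 by blast
  obtain A where A: "finite A" "card A = M" "A \<subseteq> S" using infinite_arbitrarily_large[OF inf] by metis
  obtain r where r: "A \<subseteq> B r b"
  proof -
    obtain f where f: "\<And>x. x \<in> A \<Longrightarrow> x \<in> B (f x) b" using conn A(3) by (metis subsetD)
    have "A \<subseteq> B (Max (f ` A)) b"
    proof
      fix x assume "x \<in> A"
      then have "f x \<le> Max (f ` A)" using A by auto
      then show "x \<in> B (Max (f ` A)) b" using f[OF \<open>x \<in> A\<close>] B_mono[OF b_in] by blast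
    qed
    then show ?thesis using that by blast
  qed
  define \<delta> where "\<delta> = (\<epsilon> / (8 * (real r + 1)))\<^sup>2 * w0"
  have "\<delta> > 0" unfolding \<delta>_def using \<epsilon> w0(1) by (intro mult_pos_pos) auto
  then obtain n where n: "dent n \<le> \<delta>" using good_steps_small by blast
  have "sqrt (dent n / w0) \<le> sqrt ((\<epsilon> / (8 * (real r + 1)))\<^sup>2)"
    using n w0(1) by (intro real_sqrt_le_mono) (simp add: \<delta>_def field_simps)
  also have "\<dots> = \<epsilon> / (8 * (real r + 1))" using \<epsilon> by simp
  finally have "real r * (4 * sqrt (dent n / w0)) \<le> real r * (4 * (\<epsilon> / (8 * (real r + 1))))"
    by (intro mult_left_mono) auto
  also have "\<dots> \<le> \<epsilon> / 2" using \<epsilon> by (simp add: field_simps)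
  finally have small: "real r * (4 * sqrt (dent n / w0)) \<le> \<epsilon> / 2" .
  have "real M * (q n - \<epsilon> / 2) = (\<Sum>z\<in>A. q n - \<epsilon> / 2)" using A by simp
  also have "\<dots> \<le> (\<Sum>z\<in>A. p n b z)"
  proof (rule sum_mono)
    fix z assume z: "z \<in> A"
    then have "\<bar>p n z b - p n b b\<bar> \<le> \<epsilon> / 2"
      using heat_kernel_close[OF b_in, of z r n b] r small by auto
    moreover have "p n z b = p n b z" using p_sym b_in A z by auto
    ultimately show "q n - \<epsilon> / 2 \<le> p n b z" unfolding q_def by linarith
  qed
  also have "\<dots> \<le> (\<Sum>z\<in>A \<union> B n b. p n b z)"
    using A B_fin[OF b_in] p_nonneg[OF b_in] by (intro sum_mono2) auto
  also have "\<dots> = 1" using A B_fin[OF b_in] by (intro p_sum b_in) auto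
  finally have "real M * (q n - \<epsilon> / 2) \<le> 1" .
  moreover have "real M * (\<epsilon> / 2) > 1" using M \<epsilon> by (simp add: field_simps)
  ultimately have "real M * (q n - \<epsilon> / 2) < real M * (\<epsilon> / 2)" by linarith
  then have "q n - \<epsilon> / 2 < \<epsilon> / 2" by (rule mult_left_less_imp_less) simp
  then show ?thesis by (intro exI[of _ n]) simp
qed

text \<open>Cauchy-Schwarz for a probability vector supported on the ball of radius
  \<open>k\<close>, whose squared norm is \<open>q (2 * k)\<close>.\<close>

lemma q_lower: "1 \<le> C * (real k + 1) ^ e * q (2 * k)"
proof -
  have "1 = (\<Sum>z\<in>B k b. p k b z * 1)\<^sup>2" using p_sum[OF b_in B_fin[OF b_in]] by simp
  also have "\<dots> \<le> (\<Sum>z\<in>B k b. (p k b z)\<^sup>2) * (\<Sum>z\<in>B k b. 1\<^sup>2)" by (rule Cauchy_Schwarz_ineq_sum)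
  also have "(\<Sum>z\<in>B k b. (p k b z)\<^sup>2) = q (2 * k)"
    using p_inner[OF b_in b_in B_fin[OF b_in] B_S[OF b_in], of k k k]
    by (simp add: q_def power2_eq_square mult_2[of k])
  also have "q (2 * k) * (\<Sum>z\<in>B k b. 1\<^sup>2) \<le> q (2 * k) * (C * (real k + 1) ^ e)"
    using growth[of k] p_nonneg[OF b_in] by (intro mult_left_mono) (auto simp: q_def)
  finally show ?thesis by (simp add: mult_ac)
qed

text \<open>Otherwise \<open>a\<close> would decay exponentially, and with it the return probabilities \<open>q\<close>, against \<open>q_lower\<close>.\<close>

lemma slow_energy:
  assumes inf: "infinite S" and \<epsilon>: "\<epsilon> > 0"
  shows "\<exists>k. a (2 * k) - a (2 * k + 1) < \<epsilon> * a (2 * k)"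
proof (rule ccontr)
  assume "\<not> ?thesis"
  then have *: "a (2 * k + 1) \<le> (1 - \<epsilon>) * a (2 * k)" for k by (auto simp: not_less algebra_simps)
  have exp: "a (2 * k) \<le> a 0 * exp (- \<epsilon> * real k)" for k
  proof (induction k)
    case (Suc k)
    have "a (2 * Suc k) \<le> (1 - \<epsilon>) * a (2 * k)" using *[of k] a_odd[of k] by simp
    also have "\<dots> \<le> exp (- \<epsilon>) * a (2 * k)" using exp_ge_add_one_self[of "- \<epsilon>"] a_nonneg by (intro mult_right_mono) auto
    also have "\<dots> \<le> exp (- \<epsilon>) * (a 0 * exp (- \<epsilon> * real k))" using Suc by (intro mult_left_mono) auto
    finally show ?case by (simp add: algebra_simps exp_diff exp_minus field_simps)
  qed simp
  \<comment> \<open>The geometric decay of \<open>a\<close> bounds the telescoping sum for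
    \<open>q\<close> by a multiple of its first term.\<close>
  have tel: "\<epsilon> * (q (2 * k) - q (2 * m)) \<le> 2 * a (2 * k)" if "k \<le> m" for k m
    using that
  proof (induction rule: inc_induct)
    case base
    then show ?case using a_nonneg by simp
  next
    case (step k)
    have "\<epsilon> * (q (2 * k) - q (2 * m)) = \<epsilon> * (a (2 * k) + a (2 * k + 1)) + \<epsilon> * (q (2 * Suc k) - q (2 * m))"
      by (simp add: a_def algebra_simps)
    also have "\<dots> \<le> \<epsilon> * (2 * a (2 * k)) + 2 * a (2 * k + 2)"
    proof (rule add_mono)
      have "\<epsilon> * a (2 * k) \<ge> 0" using a_nonneg \<epsilon> by simp
      then have "a (2 * k + 1) \<le> a (2 * k)" using *[of k] by (simp add: algebra_simps)
      then show "\<epsilon> * (a (2 * k) + a (2 * k + 1)) \<le> \<epsilon> * (2 * a (2 * k))" using \<epsilon> by (intro mult_left_mono) auto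
    qed (use step in simp)
    also have "\<dots> \<le> 2 * a (2 * k)" using *[of k] a_odd[of k] by (simp add: algebra_simps)
    finally show ?case .
  qed
  \<comment> \<open>Since \<open>q\<close> becomes arbitrarily small by \<open>q_small\<close>, the
    bound passes from differences to \<open>q (2 * k)\<close> itself.\<close>
  have qk: "\<epsilon> * q (2 * k) \<le> 2 * a 0 * exp (- \<epsilon> * real k)" for k
  proof (rule field_le_epsilon)
    fix \<delta> :: real assume \<delta>: "\<delta> > 0"
    obtain n where n: "q n \<le> \<delta> / \<epsilon>" using q_small[OF inf, of "\<delta> / \<epsilon>"] \<delta> \<epsilon> by auto
    have "q (2 * max k n) \<le> \<delta> / \<epsilon>" using q_antimono[of n "2 * max k n"] n by linarith
    then have "\<epsilon> * q (2 * max k n) \<le> \<delta>" using \<epsilon> by (simp add: field_simps)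
    moreover have "\<epsilon> * (q (2 * k) - q (2 * max k n)) \<le> 2 * a (2 * k)" by (rule tel) simp
    ultimately show "\<epsilon> * q (2 * k) \<le> 2 * a 0 * exp (- \<epsilon> * real k) + \<delta>" using exp[of k] by (simp add: algebra_simps)
  qed
  define K where "K = C * (2 * a 0) * exp \<epsilon> / \<epsilon> ^ Suc e"
  have "1 \<le> K * ((\<epsilon> * (real k + 1)) ^ e / exp (\<epsilon> * (real k + 1)))" for k
  proof -
    have "1 \<le> C * (real k + 1) ^ e * q (2 * k)" by (rule q_lower)
    also have "\<dots> \<le> C * (real k + 1) ^ e * (2 * a 0 * exp (- \<epsilon> * real k) / \<epsilon>)"
      using qk[of k] \<epsilon> C_ge by (intro mult_left_mono) (auto simp: field_simps)
    also have "\<dots> = K * ((\<epsilon> * (real k + 1)) ^ e / exp (\<epsilon> * (real k + 1)))"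
    proof -
      have "exp (\<epsilon> * (real k + 1)) = exp (\<epsilon> * real k) * exp \<epsilon>" by (simp add: distrib_left exp_add)
      moreover have "(\<epsilon> * (real k + 1)) ^ e = \<epsilon> ^ e * (real k + 1) ^ e" by (rule power_mult_distrib)
      ultimately show ?thesis using \<epsilon> by (simp add: K_def exp_minus divide_inverse) (simp add: field_simps)
    qed
    finally show ?thesis .
  qed
  moreover have "filterlim (\<lambda>k. \<epsilon> * (real k + 1)) at_top sequentially" using \<epsilon> by real_asymp
  then have "(\<lambda>k. K * ((\<epsilon> * (real k + 1)) ^ e / exp (\<epsilon> * (real k + 1)))) \<longlonglongrightarrow> K * 0"
    by (intro tendsto_intros filterlim_compose[OF tendsto_power_div_exp_0])
  ultimately have "1 \<le> K * 0" by (intro LIMSEQ_le_const) auto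
  then show False by simp
qed

end

lemma abs_le_of_square_le: "x\<^sup>2 \<le> c\<^sup>2 \<Longrightarrow> 0 \<le> c \<Longrightarrow> \<bar>x\<bar> \<le> c" for x c :: real
  by (metis abs_le_square_iff abs_of_nonneg)

section \<open>Limits of normalized differences of heat kernels\<close>

context walk
begin

definition lip :: "real \<Rightarrow> ('x \<Rightarrow> real) \<Rightarrow> bool" where
  "lip M f \<longleftrightarrow> (\<forall>x\<in>S. \<forall>y\<in>N x. \<bar>f y - f x\<bar> \<le> M)"

lemma lip_ball: "lip M f \<Longrightarrow> x \<in> S \<Longrightarrow> z \<in> B n x \<Longrightarrow> \<bar>f z - f x\<bar> \<le> real n * M"
proof (induction n arbitrary: x)
  case (Suc n)
  then obtain s where s: "s \<in> N x" "z \<in> B n s" by auto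
  have "\<bar>f z - f s\<bar> \<le> real n * M" using Suc s N_in by blast
  moreover have "\<bar>f s - f x\<bar> \<le> M" using Suc.prems s by (auto simp: lip_def)
  ultimately show ?case by (simp add: distrib_right)
qed simp

text \<open>The witnesses are the inner products of the heat kernel differences at \<open>x, b\<close> and at \<open>s, b\<close>,
  divided by \<open>a (2 * k)\<close>; they are almost harmonic for the \<open>k\<close> of \<open>slow_energy\<close>.\<close>

lemma approx_harmonic:
  assumes inf: "infinite S" and \<epsilon>: "\<epsilon> > 0"
  obtains F where "\<And>s. s \<in> N b \<Longrightarrow> lip (2 / w0) (F s)" "\<And>s. s \<in> N b \<Longrightarrow> F s b = 0"
    "\<And>s x. s \<in> N b \<Longrightarrow> x \<in> S \<Longrightarrow> \<bar>P (F s) x - F s x\<bar> \<le> \<epsilon>" "(\<Sum>s\<in>N b. w b s * F s s) = 2"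
proof -
  \<comment> \<open>Makes the product of the squared norms \<open>\<delta> * \<alpha>\<close> and
    \<open>2 * \<alpha> / w0\<close> equal to
    \<open>(\<epsilon> * \<alpha>)\<^sup>2\<close>.\<close>
  define \<delta> where "\<delta> = \<epsilon>\<^sup>2 * w0 / 2"
  have "\<delta> > 0" using \<epsilon> w0(1) by (simp add: \<delta>_def)
  then obtain k where k: "a (2 * k) - a (2 * k + 1) < \<delta> * a (2 * k)" using slow_energy[OF inf] by blast
  define \<alpha> where "\<alpha> = a (2 * k)"
  have en: "0 \<le> a (2 * k) - a (2 * k + 1)"
  proof -
    have "0 \<le> (\<Sum>z\<in>B (Suc k) b. (p (Suc k) b z - p k b z)\<^sup>2)" by (intro sum_nonneg) auto
    also have "\<dots> = a (2 * k) - a (2 * k + 1)" by (rule step_sq[OF b_in B_fin[OF b_in] B_S[OF b_in]]) simp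
    finally show ?thesis .
  qed
  then have "0 < \<delta> * \<alpha>" using k by (simp add: \<alpha>_def)
  then have \<alpha>: "\<alpha> > 0" using \<open>\<delta> > 0\<close> by (simp add: zero_less_mult_iff)
  define F where "F s x = (p (2 * k) x s - p (2 * k) x b - p (2 * k) b s + q (2 * k)) / \<alpha>" for s x
  have F\<alpha>: "F s x * \<alpha> = p (2 * k) x s - p (2 * k) x b - p (2 * k) b s + q (2 * k)" for s x
    using \<alpha> by (simp add: F_def)
  have inner: "(\<Sum>z\<in>D. (p i y z - p j x z) * (p k s z - p k b z)) =
      p (i + k) y s - p (i + k) y b - p (j + k) x s + p (j + k) x b"
    if "x \<in> S" "y \<in> S" "s \<in> S" "finite D" "D \<subseteq> S" "B i y \<subseteq> D" "B j x \<subseteq> D" for D x y s i j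
  proof -
    have "(\<Sum>z\<in>D. (p i y z - p j x z) * (p k s z - p k b z)) =
      (\<Sum>z\<in>D. p i y z * p k s z) - (\<Sum>z\<in>D. p i y z * p k b z) - (\<Sum>z\<in>D. p j x z * p k s z) + (\<Sum>z\<in>D. p j x z * p k b z)"
      by (simp add: algebra_simps sum.distrib sum_subtractf)
    also have "\<dots> = p (i + k) y s - p (i + k) y b - p (j + k) x s + p (j + k) x b"
      unfolding p_inner[OF that(2,3,4,5,6)] p_inner[OF that(2) b_in that(4,5,6)]
        p_inner[OF that(1,3,4,5,7)] p_inner[OF that(1) b_in that(4,5,7)] ..
    finally show ?thesis .
  qed
  have sb: "(\<Sum>z\<in>D. (p k s z - p k b z)\<^sup>2) \<le> 2 * \<alpha> / w0"
    if "s \<in> N b" "finite D" "D \<subseteq> S" "B k s \<subseteq> D" "B k b \<subseteq> D" for s D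
  proof -
    have "(\<Sum>z\<in>D. (p k s z - p k b z)\<^sup>2) = (\<Sum>z\<in>D. (p k b z - p k s z)\<^sup>2)" by (simp add: power2_commute)
    then show ?thesis using dist_sq[OF b_in N_in[OF b_in that(1)] that(2,3,5,4)] dist_le[OF b_in that(1), of k]
      by (simp add: q_def \<alpha>_def)
  qed
  show ?thesis
  proof
    fix s assume s: "s \<in> N b"
    have sS: "s \<in> S" by (rule N_in[OF b_in s])
    show "F s b = 0" using \<alpha> by (simp add: F_def q_def)
    show "lip (2 / w0) (F s)" unfolding lip_def
    proof (intro ballI)
      fix x y assume x: "x \<in> S" and y: "y \<in> N x"
      have yS: "y \<in> S" by (rule N_in[OF x y])
      define D where "D = B k x \<union> B k y \<union> B k s \<union> B k b"
      have D: "finite D" "D \<subseteq> S" "B k x \<subseteq> D" "B k y \<subseteq> D" "B k s \<subseteq> D" "B k b \<subseteq> D"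
        using B_fin B_S x yS sS b_in by (auto simp: D_def)
      \<comment> \<open>An increment of \<open>F s\<close> over an edge is an inner product of two
        differences of heat kernels over edges, each of squared norm at most
        \<open>2 * \<alpha> / w0\<close>; after division by \<open>\<alpha>\<close> the Lipschitz
        constant \<open>2 / w0\<close> is independent of \<open>\<epsilon>\<close>.\<close>
      have "(F s y - F s x) * \<alpha> = (\<Sum>z\<in>D. (p k y z - p k x z) * (p k s z - p k b z))"
        unfolding inner[OF x yS sS D(1,2,4,3)] by (simp add: left_diff_distrib F\<alpha> mult_2[of k])
      then have "((F s y - F s x) * \<alpha>)\<^sup>2 \<le> (\<Sum>z\<in>D. (p k y z - p k x z)\<^sup>2) * (\<Sum>z\<in>D. (p k s z - p k b z)\<^sup>2)"
        by (simp only: Cauchy_Schwarz_ineq_sum)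
      also have "\<dots> \<le> (2 * \<alpha> / w0) * (2 * \<alpha> / w0)"
      proof (rule mult_mono)
        have "(\<Sum>z\<in>D. (p k y z - p k x z)\<^sup>2) = (\<Sum>z\<in>D. (p k x z - p k y z)\<^sup>2)" by (simp add: power2_commute)
        then show "(\<Sum>z\<in>D. (p k y z - p k x z)\<^sup>2) \<le> 2 * \<alpha> / w0"
          using dist_sq[OF x yS D(1,2,3,4)] dist_le[OF x y, of k] by (simp add: q_def \<alpha>_def)
        show "(\<Sum>z\<in>D. (p k s z - p k b z)\<^sup>2) \<le> 2 * \<alpha> / w0" using sb[OF s] D by simp
      qed (use \<alpha> w0(1) in \<open>auto intro: sum_nonneg\<close>)
      also have "\<dots> = (2 * \<alpha> / w0)\<^sup>2" by (rule power2_eq_square[symmetric])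
      finally have "\<bar>(F s y - F s x) * \<alpha>\<bar> \<le> 2 * \<alpha> / w0"
        by (rule abs_le_of_square_le) (use \<alpha> w0(1) in simp)
      then have "\<alpha> * \<bar>F s y - F s x\<bar> \<le> \<alpha> * (2 / w0)" using \<alpha> by (simp add: abs_mult mult.commute)
      then show "\<bar>F s y - F s x\<bar> \<le> 2 / w0" using \<alpha> by (simp only: mult_le_cancel_left_pos)
    qed
    fix x assume x: "x \<in> S"
    define D where "D = B (Suc k) x \<union> B k s \<union> B k b"
    have D: "finite D" "D \<subseteq> S" "B k x \<subseteq> D" "B (Suc k) x \<subseteq> D" "B k s \<subseteq> D" "B k b \<subseteq> D"
      using B_fin[OF x, of "Suc k"] B_fin[OF sS] B_fin[OF b_in] B_S[OF x, of "Suc k"] B_S[OF sS] B_S[OF b_in] B_Suc[OF x, of k]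
      unfolding D_def by blast+
    have pP: "P (\<lambda>x. p n x y) x = p (Suc n) x y" for n y by (simp add: P_def p_Suc)
    have "P (\<lambda>x. \<alpha> * F s x) x = P (\<lambda>x. p (2 * k) x s - p (2 * k) x b - (p (2 * k) b s - q (2 * k))) x"
      using \<alpha> by (intro P_cong x) (simp add: F_def)
    also have "\<dots> = p (Suc (2 * k)) x s - p (Suc (2 * k)) x b - (p (2 * k) b s - q (2 * k))"
      unfolding P_diff pP P_const[OF x] ..
    finally have "(P (F s) x - F s x) * \<alpha> = p (Suc (2 * k)) x s - p (Suc (2 * k)) x b - p (2 * k) x s + p (2 * k) x b"
      unfolding P_cmult left_diff_distrib F\<alpha> by (simp add: mult.commute)
    also have "\<dots> = (\<Sum>z\<in>D. (p (Suc k) x z - p k x z) * (p k s z - p k b z))"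
      unfolding inner[OF x x sS D(1,2,4,3)] by (simp add: mult_2[of k])
    finally have "((P (F s) x - F s x) * \<alpha>)\<^sup>2 \<le> (\<Sum>z\<in>D. (p (Suc k) x z - p k x z)\<^sup>2) * (\<Sum>z\<in>D. (p k s z - p k b z)\<^sup>2)"
      by (simp only: Cauchy_Schwarz_ineq_sum)
    also have "\<dots> \<le> (\<delta> * \<alpha>) * (2 * \<alpha> / w0)"
    proof (rule mult_mono)
      show "(\<Sum>z\<in>D. (p (Suc k) x z - p k x z)\<^sup>2) \<le> \<delta> * \<alpha>"
        unfolding step_sq[OF x D(1,2,4)] using k by (simp add: \<alpha>_def)
      show "(\<Sum>z\<in>D. (p k s z - p k b z)\<^sup>2) \<le> 2 * \<alpha> / w0" using sb[OF s] D by simp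
    qed (use \<alpha> \<open>\<delta> > 0\<close> in \<open>auto intro: sum_nonneg\<close>)
    also have "\<dots> = (\<epsilon> * \<alpha>)\<^sup>2" using w0(1) by (simp add: \<delta>_def power2_eq_square)
    finally have "\<bar>(P (F s) x - F s x) * \<alpha>\<bar> \<le> \<epsilon> * \<alpha>"
      by (rule abs_le_of_square_le) (use \<alpha> \<epsilon> in simp)
    then show "\<bar>P (F s) x - F s x\<bar> \<le> \<epsilon>" using \<alpha> by (simp add: abs_mult)
  next
    \<comment> \<open>\<open>F s s\<close> is the squared distance of the heat kernels at
      \<open>s\<close> and \<open>b\<close> divided by \<open>\<alpha>\<close>, and by
      \<open>a_even\<close> its mean is exactly 2. This normalization keeps the limit from being
      zero.\<close>
    have "(\<Sum>s\<in>N b. w b s * F s s) = (\<Sum>s\<in>N b. w b s * (2 * q (2 * k) - 2 * p (2 * k) b s)) / \<alpha>"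
      unfolding sum_divide_distrib
    proof (intro sum.cong refl)
      fix s assume "s \<in> N b"
      then have "s \<in> S" using N_in b_in by blast
      then have "p (2 * k) s b = p (2 * k) b s" "p (2 * k) s s = q (2 * k)" 
        using p_sym[OF _ b_in, of s "2 * k"] p_diag[of s "2 * k"] by (simp_all only: q_def)
      then show "w b s * F s s = w b s * (2 * q (2 * k) - 2 * p (2 * k) b s) / \<alpha>" by (simp add: F_def)
    qed
    also have "\<dots> = 2" using \<alpha> unfolding a_even[OF b_in] by (simp add: \<alpha>_def)
    finally show "(\<Sum>s\<in>N b. w b s * F s s) = 2" .
  qed
qed

text \<open>Functions that vanish at \<open>b\<close> with a common Lipschitz constant are pointwise
  bounded, so ultrafilter limits exist, and they are harmonic as the errors tend to 0. The mean of
  the \<open>f s s\<close> is still 2, hence some \<open>f s\<close> differs at \<open>s\<close>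
  from its value 0 at \<open>b\<close>.\<close>

lemma exists_lipschitz_harmonic:
  assumes inf: "infinite S"
  obtains f x where "harm f" "lip (2 / w0) f" "x \<in> S" "f x \<noteq> f b"
proof -
  define Q where "Q n F \<longleftrightarrow> (\<forall>s\<in>N b. lip (2 / w0) (F s) \<and> F s b = 0 \<and> (\<forall>x\<in>S. \<bar>P (F s) x - F s x\<bar> \<le> 1 / real (Suc n)))
      \<and> (\<Sum>s\<in>N b. w b s * F s s) = 2" for n F
  have "\<exists>F. Q n F" for n
  proof -
    have "1 / real (Suc n) > 0" by simp
    from approx_harmonic[OF inf this] obtain F where "\<And>s. s \<in> N b \<Longrightarrow> lip (2 / w0) (F s)"
      "\<And>s. s \<in> N b \<Longrightarrow> F s b = 0" "\<And>s x. s \<in> N b \<Longrightarrow> x \<in> S \<Longrightarrow> \<bar>P (F s) x - F s x\<bar> \<le> 1 / real (Suc n)"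
      "(\<Sum>s\<in>N b. w b s * F s s) = 2" by blast
    then show ?thesis unfolding Q_def by (intro exI[of _ F]) blast
  qed
  then obtain F where QF: "\<And>n. Q n (F n)" by metis
  have F: "\<And>n s. s \<in> N b \<Longrightarrow> lip (2 / w0) (F n s)" "\<And>n s. s \<in> N b \<Longrightarrow> F n s b = 0"
    "\<And>n s x. s \<in> N b \<Longrightarrow> x \<in> S \<Longrightarrow> \<bar>P (F n s) x - F n s x\<bar> \<le> 1 / real (Suc n)"
    "\<And>n. (\<Sum>s\<in>N b. w b s * F n s s) = 2"
    using QF unfolding Q_def by blast+
  obtain U :: "nat filter" where U: "U \<le> sequentially" "U \<noteq> bot" "\<And>P. eventually P U \<or> eventually (\<lambda>x. \<not> P x) U"
    using exists_ultrafilter[OF sequentially_bot] by blast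
  have "\<exists>l. ((\<lambda>n. F n s x) \<longlongrightarrow> l) U" if s: "s \<in> N b" and x: "x \<in> S" for s x
  proof -
    obtain r where r: "x \<in> B r b" using conn x by blast
    have "\<bar>F n s x\<bar> \<le> real r * (2 / w0)" for n
      using lip_ball[OF F(1)[OF s] b_in r, of n] F(2)[OF s, of n] by simp
    then show ?thesis using ultrafilter_bounded_tendsto[OF U(2,3)] by metis
  qed
  then obtain f where f: "\<And>s x. s \<in> N b \<Longrightarrow> x \<in> S \<Longrightarrow> ((\<lambda>n. F n s x) \<longlongrightarrow> f s x) U" by metis
  have harm: "harm (f s)" if s: "s \<in> N b" for s
    unfolding harm_def
  proof
    fix x assume x: "x \<in> S"
    have "((\<lambda>n. P (F n s) x - F n s x) \<longlongrightarrow> P (f s) x - f s x) U"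
      unfolding P_def using f s x N_in by (intro tendsto_intros) auto
    moreover have "((\<lambda>n. P (F n s) x - F n s x) \<longlongrightarrow> 0) U"
    proof (rule tendsto_mono[OF U(1)], rule Lim_null_comparison)
      show "\<forall>\<^sub>F n in sequentially. norm (P (F n s) x - F n s x) \<le> 1 / real (Suc n)"
        using F(3)[OF s x] by simp
      show "(\<lambda>n. 1 / real (Suc n)) \<longlonglongrightarrow> 0" by (rule LIMSEQ_Suc[OF lim_1_over_n])
    qed
    ultimately show "P (f s) x = f s x" using tendsto_unique[OF U(2)] by fastforce
  qed
  have lip: "lip (2 / w0) (f s)" if s: "s \<in> N b" for s
    unfolding lip_def
  proof (intro ballI)
    fix x y assume x: "x \<in> S" and y: "y \<in> N x"
    have "((\<lambda>n. \<bar>F n s y - F n s x\<bar>) \<longlongrightarrow> \<bar>f s y - f s x\<bar>) U"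
      using f[OF s x] f[OF s N_in[OF x y]] by (intro tendsto_intros)
    then show "\<bar>f s y - f s x\<bar> \<le> 2 / w0"
      by (rule tendsto_upperbound) (use F(1)[OF s] x y U(2) in \<open>auto simp: lip_def\<close>)
  qed
  have zero: "f s b = 0" if s: "s \<in> N b" for s
    using tendsto_unique[OF U(2) f[OF s b_in]] F(2)[OF s] by simp
  have "((\<lambda>n. \<Sum>s\<in>N b. w b s * F n s s) \<longlongrightarrow> (\<Sum>s\<in>N b. w b s * f s s)) U"
    by (intro tendsto_sum tendsto_mult tendsto_const f N_in[OF b_in])
  then have "((\<lambda>n. 2) \<longlongrightarrow> (\<Sum>s\<in>N b. w b s * f s s)) U" unfolding F(4) .
  then have sum2: "(\<Sum>s\<in>N b. w b s * f s s) = 2" by (rule tendsto_unique[OF U(2) _ tendsto_const])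
  have "\<exists>s\<in>N b. f s s \<noteq> 0"
  proof (rule ccontr)
    assume "\<not> ?thesis"
    then have "(\<Sum>s\<in>N b. w b s * f s s) = 0" by (intro sum.neutral) auto
    then show False using sum2 by simp
  qed
  then obtain s where s: "s \<in> N b" "f s s \<noteq> 0" by blast
  then have "f s s \<noteq> f s b" using zero by simp
  then show ?thesis by (rule that[OF harm[OF s(1)] lip[OF s(1)] N_in[OF b_in s(1)]])
qed

end

section \<open>The space of Lipschitz harmonic functions\<close>

context walk
begin

text \<open>A single choice fixed for all functions: the ultrafilter refines
  \<open>sequentially\<close>, so bounded averages converge along it, and it lives on the times of
  \<open>good_steps\<close>.\<close>

definition ult :: "nat filter" where
  "ult = (SOME U. U \<le> inf sequentially (principal {n. dent n \<le> (real e + 1) / (real n + 1)}) \<and> U \<noteq> bot \<and>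
     (\<forall>P. eventually P U \<or> eventually (\<lambda>x. \<not> P x) U))"

lemma ult:
  shows ult_le: "ult \<le> sequentially" 
    and ult_good: "eventually (\<lambda>n. dent n \<le> (real e + 1) / (real n + 1)) ult"
    and ult_bot: "ult \<noteq> bot"
    and ult_ultra: "eventually Q ult \<or> eventually (\<lambda>x. \<not> Q x) ult"
proof -
  let ?F = "inf sequentially (principal {n. dent n \<le> (real e + 1) / (real n + 1)})"
  have "\<not> eventually (\<lambda>n. n \<in> {n. dent n \<le> (real e + 1) / (real n + 1)} \<longrightarrow> False) sequentially"
    using good_steps by (auto simp: eventually_sequentially)
  then have F: "?F \<noteq> bot" unfolding trivial_limit_def eventually_inf_principal .
  obtain U where "U \<le> ?F" "U \<noteq> bot" "\<And>P. eventually P U \<or> eventually (\<lambda>x. \<not> P x) U"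
    using exists_ultrafilter[OF F] by blast
  then have "ult \<le> ?F \<and> ult \<noteq> bot \<and> (\<forall>P. eventually P ult \<or> eventually (\<lambda>x. \<not> P x) ult)"
    unfolding ult_def by (intro someI[of "\<lambda>U. U \<le> ?F \<and> U \<noteq> bot \<and> (\<forall>P. eventually P U \<or> eventually (\<lambda>x. \<not> P x) U)" U]) blast
  then have u: "ult \<le> ?F" "ult \<noteq> bot" "\<forall>P. eventually P ult \<or> eventually (\<lambda>x. \<not> P x) ult" by blast+
  show "ult \<le> sequentially" using u(1) by simp
  have "eventually (\<lambda>n. dent n \<le> (real e + 1) / (real n + 1)) ?F" by (simp add: eventually_inf_principal)
  then show "eventually (\<lambda>n. dent n \<le> (real e + 1) / (real n + 1)) ult" by (rule filter_leD[OF u(1)])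
  show "ult \<noteq> bot" by (rule u(2))
  show "eventually Q ult \<or> eventually (\<lambda>x. \<not> Q x) ult" using u(3) by blast
qed

definition Av :: "nat \<Rightarrow> ('x \<Rightarrow> real) \<Rightarrow> 'x \<Rightarrow> real" where
  "Av n u x = (\<Sum>k<Suc n. (P ^^ k) u x) / (real n + 1)"

lemma Av_add: "Av n (\<lambda>x. u x + v x) x = Av n u x + Av n v x"
  by (simp only: Av_def Pn_add sum.distrib add_divide_distrib)

lemma Av_cmult: "Av n (\<lambda>x. c * u x) x = c * Av n u x"
  by (simp only: Av_def Pn_cmult sum_distrib_left[symmetric] times_divide_eq_right)

lemma Av_sum: "Av n (\<lambda>x. \<Sum>i\<in>I. u i x) x = (\<Sum>i\<in>I. Av n (u i) x)"
  by (simp only: Av_def Pn_sum sum_divide_distrib sum.swap[of _ I])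

lemma Av_mono: 
  assumes "x \<in> S" "\<And>y. y \<in> S \<Longrightarrow> u y \<le> v y" shows "Av n u x \<le> Av n v x"
  unfolding Av_def by (intro divide_right_mono sum_mono Pn_mono assms) auto

lemma Av_const: "x \<in> S \<Longrightarrow> Av n (\<lambda>_. c) x = c"
  unfolding Av_def by (simp add: Pn_const field_simps)

lemma Av_bound:
  assumes x: "x \<in> S" and u: "\<And>y. y \<in> S \<Longrightarrow> \<bar>u y\<bar> \<le> M"
  shows "\<bar>Av n u x\<bar> \<le> M"
proof -
  have "Av n u x \<le> Av n (\<lambda>_. M) x" "Av n (\<lambda>_. - M) x \<le> Av n u x"
    using u by (intro Av_mono x; fastforce simp: abs_le_iff)+
  then show ?thesis by (simp add: Av_const[OF x])
qed

text \<open>As a function of the starting point, the Cesaro average is harmonic up to an error of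
  order 1/n. Its limit is a bounded harmonic function, hence constant.\<close>

lemma Av_lim:
  assumes u: "\<And>y. y \<in> S \<Longrightarrow> \<bar>u y\<bar> \<le> M"
  obtains l where "\<And>x. x \<in> S \<Longrightarrow> ((\<lambda>n. Av n u x) \<longlongrightarrow> l) ult"
proof -
  have "\<exists>l. ((\<lambda>n. Av n u x) \<longlongrightarrow> l) ult" if "x \<in> S" for x
    by (rule ultrafilter_bounded_tendsto[OF ult_bot ult_ultra, of "\<lambda>n. Av n u x" M])
      (use Av_bound[OF that, of u M, OF u] in blast)+
  then obtain l where l: "\<And>x. x \<in> S \<Longrightarrow> ((\<lambda>n. Av n u x) \<longlongrightarrow> l x) ult" by metis
  have "harm l" unfolding harm_def
  proof
    fix x assume x: "x \<in> S"
    have "P (Av n u) x - Av n u x = ((P ^^ Suc n) u x - u x) / (real n + 1)" for n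
    proof -
      have "P (Av n u) x = (\<Sum>k<Suc n. (P ^^ Suc k) u x) / (real n + 1)"
        by (simp only: Av_def[abs_def] divide_inverse mult.commute[of _ "inverse _"] P_cmult P_sum funpow.simps o_apply)
      then have "P (Av n u) x - Av n u x = (\<Sum>k<Suc n. (P ^^ Suc k) u x - (P ^^ k) u x) / (real n + 1)"
        by (simp only: Av_def sum_subtractf diff_divide_distrib)
      also have "(\<Sum>k<Suc n. (P ^^ Suc k) u x - (P ^^ k) u x) = (P ^^ Suc n) u x - (P ^^ 0) u x"
        by (rule sum_lessThan_telescope)
      finally show ?thesis by simp
    qed
    moreover have "\<bar>(P ^^ Suc n) u x - u x\<bar> \<le> 2 * M" for n
    proof -
      have "(P ^^ Suc n) u x \<le> (P ^^ Suc n) (\<lambda>_. M) x" "(P ^^ Suc n) (\<lambda>_. - M) x \<le> (P ^^ Suc n) u x"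
        using u by (intro Pn_mono x; fastforce simp: abs_le_iff)+
      then show ?thesis using u[OF x] unfolding Pn_const[OF x] by linarith
    qed
    ultimately have d: "norm (P (Av n u) x - Av n u x) \<le> 2 * M / (real n + 1)" for n
      by (simp only: abs_divide real_norm_def) (simp add: divide_right_mono)
    have "(\<lambda>n. 2 * M / (real n + 1)) \<longlonglongrightarrow> 0" by real_asymp
    then have "(\<lambda>n. P (Av n u) x - Av n u x) \<longlonglongrightarrow> 0"
      by (rule Lim_null_comparison[OF always_eventually[OF allI[OF d]]])
    then have "((\<lambda>n. P (Av n u) x - Av n u x) \<longlongrightarrow> 0) ult" by (rule tendsto_mono[OF ult_le])
    moreover have "((\<lambda>n. P (Av n u) x - Av n u x) \<longlongrightarrow> P l x - l x) ult"
      unfolding P_def by (intro tendsto_diff tendsto_sum tendsto_mult tendsto_const l x N_in[OF x])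
    ultimately have "P l x - l x = 0" using tendsto_unique[OF ult_bot] by blast
    then show "P l x = l x" by simp
  qed
  moreover have "\<bar>l y\<bar> \<le> M" if y: "y \<in> S" for y
    by (rule tendsto_upperbound[OF tendsto_rabs[OF l[OF y]] _ ult_bot]) (simp add: Av_bound[OF y, of u M, OF u])
  ultimately have "l x = l b" if "x \<in> S" for x using harm_bounded_const that by blast
  then show ?thesis using that[of "l b"] l by metis
qed

definition LH :: "('x \<Rightarrow> real) set" where
  "LH = {f. harm f \<and> (\<exists>M. lip M f)}"

lemma harm_lin: "harm f \<Longrightarrow> harm g \<Longrightarrow> harm (\<lambda>x. c * f x + g x)"
  by (simp add: harm_def P_add P_cmult)

lemma LH_lin: "f \<in> LH \<Longrightarrow> g \<in> LH \<Longrightarrow> (\<lambda>x. c * f x + g x) \<in> LH"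
proof -
  assume f: "f \<in> LH" and g: "g \<in> LH"
  obtain M M' where M: "lip M f" "lip M' g" using f g by (auto simp: LH_def)
  have "lip (\<bar>c\<bar> * M + M') (\<lambda>x. c * f x + g x)" unfolding lip_def
  proof (intro ballI)
    fix x y assume xy: "x \<in> S" "y \<in> N x"
    have "\<bar>c * f y + g y - (c * f x + g x)\<bar> \<le> \<bar>c * (f y - f x)\<bar> + \<bar>g y - g x\<bar>" by (simp add: algebra_simps)
    also have "\<dots> \<le> \<bar>c\<bar> * M + M'"
      unfolding abs_mult using M xy by (intro add_mono mult_left_mono) (auto simp: lip_def)
    finally show "\<bar>c * f y + g y - (c * f x + g x)\<bar> \<le> \<bar>c\<bar> * M + M'" .
  qed
  then show ?thesis using f g harm_lin by (auto simp: LH_def)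
qed

lemma LH_zero: "(\<lambda>_. c) \<in> LH"
  by (auto simp: LH_def harm_def P_const lip_def intro!: exI[of _ 0])

lemma LH_sum: "finite I \<Longrightarrow> (\<And>i. i \<in> I \<Longrightarrow> f i \<in> LH) \<Longrightarrow> (\<lambda>x. \<Sum>i\<in>I. c i * f i x) \<in> LH"
proof (induction I rule: finite_induct)
  case empty
  then show ?case using LH_zero[of 0] by simp
next
  case (insert i I)
  then show ?case using LH_lin[of "f i" "\<lambda>x. \<Sum>i\<in>I. c i * f i x" "c i"] by simp
qed

lemma LH_diff: "f \<in> LH \<Longrightarrow> g \<in> LH \<Longrightarrow> (\<lambda>x. f x - g x) \<in> LH"
  using LH_lin[of g f "- 1"] by simp

text \<open>The mean energy along the walk. Since the limit does not depend on the starting point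
  (\<open>G_lim\<close>), the form is invariant under translations by \<open>L\<close>
  (\<open>G_tr\<close>). Its null space on \<open>LH\<close> consists of the functions that are
  constant on \<open>S\<close> (\<open>G_zero_const\<close>).\<close>

definition G :: "('x \<Rightarrow> real) \<Rightarrow> ('x \<Rightarrow> real) \<Rightarrow> real" where
  "G f g = Lim ult (\<lambda>n. Av n (\<Gamma> f g) b)"

lemma \<Gamma>_abs:
  assumes "lip M f" "lip M' g" "x \<in> S"
  shows "\<bar>\<Gamma> f g x\<bar> \<le> M * M'"
proof -
  have "\<bar>\<Gamma> f g x\<bar> \<le> (\<Sum>y\<in>N x. w x y * (M * M'))" unfolding \<Gamma>_def
  proof (rule order_trans[OF sum_abs], rule sum_mono)
    fix y assume y: "y \<in> N x"
    have "\<bar>f y - f x\<bar> * \<bar>g y - g x\<bar> \<le> M * M'"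
      using assms y by (intro mult_mono) (auto simp: lip_def intro: order_trans[OF abs_ge_zero])
    then show "\<bar>w x y * ((f y - f x) * (g y - g x))\<bar> \<le> w x y * (M * M')"
      using wN_nonneg[OF assms(3) y] by (simp add: abs_mult mult_left_mono)
  qed
  then show ?thesis using w_sum[OF assms(3)] by (simp flip: sum_distrib_right)
qed

lemma G_lim: 
  assumes "f \<in> LH" "g \<in> LH" "x \<in> S"
  shows "((\<lambda>n. Av n (\<Gamma> f g) x) \<longlongrightarrow> G f g) ult"
proof -
  obtain M M' where M: "lip M f" "lip M' g" using assms by (auto simp: LH_def)
  obtain l where l: "\<And>x. x \<in> S \<Longrightarrow> ((\<lambda>n. Av n (\<Gamma> f g) x) \<longlongrightarrow> l) ult"
    using Av_lim[of "\<Gamma> f g" "M * M'"] \<Gamma>_abs[OF M] by blast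
  have "G f g = l" unfolding G_def by (rule tendsto_Lim[OF ult_bot l[OF b_in]])
  then show ?thesis using l[OF assms(3)] by simp
qed

lemma G_unique:
  assumes "f \<in> LH" "g \<in> LH" "((\<lambda>n. Av n (\<Gamma> f g) b) \<longlongrightarrow> l) ult"
  shows "G f g = l"
  by (rule tendsto_unique[OF ult_bot G_lim[OF assms(1,2) b_in] assms(3)])

lemma \<Gamma>_sym: "\<Gamma> f g = \<Gamma> g f"
  by (simp add: \<Gamma>_def[abs_def] mult.commute)

lemma G_sym: "G f g = G g f"
  by (simp add: G_def \<Gamma>_sym)

lemma G_lin:
  assumes "f \<in> LH" "g \<in> LH" "h \<in> LH"
  shows "G (\<lambda>x. c * f x + g x) h = c * G f h + G g h"
proof (rule G_unique[OF LH_lin[OF assms(1,2)] assms(3)])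
  have "\<Gamma> (\<lambda>x. c * f x + g x) h = (\<lambda>x. c * \<Gamma> f h x + \<Gamma> g h x)"
    by (simp add: \<Gamma>_def fun_eq_iff sum_distrib_left sum.distrib[symmetric] algebra_simps)
  then show "((\<lambda>n. Av n (\<Gamma> (\<lambda>x. c * f x + g x) h) b) \<longlongrightarrow> c * G f h + G g h) ult"
    unfolding Av_add[of _ "\<lambda>x. c * \<Gamma> f h x", THEN eq_reflection] Av_cmult
    by (simp only: Av_add Av_cmult) (intro tendsto_intros G_lim assms b_in)
qed

lemma G_zero: "G (\<lambda>_. c) h = 0"
proof -
  have "\<Gamma> (\<lambda>_. c) h = (\<lambda>_. 0)" by (simp add: \<Gamma>_def fun_eq_iff)
  then show ?thesis unfolding G_def using Av_const[OF b_in, of _ 0] tendsto_Lim[OF ult_bot tendsto_const] by simp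
qed

lemma G_sum:
  assumes "finite I" "\<And>i. i \<in> I \<Longrightarrow> f i \<in> LH" "h \<in> LH"
  shows "G (\<lambda>x. \<Sum>i\<in>I. c i * f i x) h = (\<Sum>i\<in>I. c i * G (f i) h)"
  using assms
proof (induction I rule: finite_induct)
  case empty
  then show ?case using G_zero[of 0] by simp
next
  case (insert i I)
  then show ?case using G_lin[of "f i" "\<lambda>x. \<Sum>i\<in>I. c i * f i x" h "c i"] LH_sum[of I f c] by simp
qed

lemma G_diff: "f \<in> LH \<Longrightarrow> g \<in> LH \<Longrightarrow> h \<in> LH \<Longrightarrow> G (\<lambda>x. f x - g x) h = G f h - G g h"
  using G_lin[of g f h "- 1"] by simp

text \<open>The constant of \<open>gradient_estimate\<close> times the bound
  \<open>real e + 1\<close> for \<open>(real n + 1) * dent n\<close> along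
  \<open>ult\<close>.\<close>

definition Kc :: real where "Kc = 2 * (1 / w0 + 1) / w0 * (real e + 1)"

lemma Kc_pos: "Kc > 0"
proof -
  have "2 * (1 / w0 + 1) / w0 > 0" using w0(1) by (intro mult_pos_pos divide_pos_pos add_pos_pos) auto
  then show ?thesis unfolding Kc_def by (intro mult_pos_pos) auto
qed

lemma gradient_le_G:
  assumes f: "f \<in> LH" and x: "x \<in> S" and s: "s \<in> N x"
  shows "(f s - f x)\<^sup>2 \<le> Kc * G f f"
proof (rule tendsto_lowerbound[OF tendsto_mult_left[OF G_lim[OF f f x]] _ ult_bot])
  show "eventually (\<lambda>n. (f s - f x)\<^sup>2 \<le> Kc * Av n (\<Gamma> f f) x) ult"
    using ult_good
  proof (eventually_elim)
    fix n assume n: "dent n \<le> (real e + 1) / (real n + 1)"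
    have "(f s - f x)\<^sup>2 \<le> 2 * (1 / w0 + 1) / w0 * dent n * (\<Sum>k<Suc n. (P ^^ k) (\<Gamma> f f) x)"
      by (rule gradient_estimate[OF _ x s]) (use f in \<open>simp add: LH_def\<close>)
    also have "\<dots> \<le> 2 * (1 / w0 + 1) / w0 * ((real e + 1) / (real n + 1)) * (\<Sum>k<Suc n. (P ^^ k) (\<Gamma> f f) x)"
    proof (intro mult_right_mono mult_left_mono n sum_nonneg)
      fix k
      show "0 \<le> (P ^^ k) (\<Gamma> f f) x"
        using Pn_mono[OF x, of "\<lambda>_. 0" "\<Gamma> f f" k] \<Gamma>_nonneg Pn_const[OF x, of k 0] by simp
    qed (use w0(1) in simp)
    also have "\<dots> = Kc * Av n (\<Gamma> f f) x" by (simp only: Kc_def Av_def divide_inverse mult_ac)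
    finally show "(f s - f x)\<^sup>2 \<le> Kc * Av n (\<Gamma> f f) x" .
  qed
qed

lemma G_nonneg: "f \<in> LH \<Longrightarrow> G f f \<ge> 0"
  using gradient_le_G[OF _ b_in N_self[OF b_in], of f] Kc_pos by (simp add: zero_le_mult_iff)

lemma const_nbr:
  assumes "\<And>x s. x \<in> S \<Longrightarrow> s \<in> N x \<Longrightarrow> f s = f x" "x \<in> S"
  shows "f x = f b"
proof -
  have "f x = f y" if "y \<in> S" "x \<in> B n y" for n x y
    using that
  proof (induction n arbitrary: y)
    case (Suc n)
    then obtain s where s: "s \<in> N y" "x \<in> B n s" by auto
    then show ?case using Suc.IH[OF N_in[OF Suc.prems(1) s(1)] s(2)] assms(1)[OF Suc.prems(1) s(1)] by simp
  qed simp
  then show ?thesis using conn[OF assms(2)] b_in by blast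
qed

lemma G_zero_const:
  assumes "f \<in> LH" "G f f = 0" "x \<in> S" shows "f x = f b"
proof (rule const_nbr[OF _ assms(3)])
  fix x s assume "x \<in> S" "s \<in> N x"
  then show "f s = f x" using gradient_le_G[OF assms(1), of x s] assms(2) by simp
qed

lemma G_const_left:
  assumes "\<And>x. x \<in> S \<Longrightarrow> f x = f b" "h \<in> LH" "f \<in> LH"
  shows "G f h = 0"
proof (rule G_unique[OF assms(3,2)])
  have "\<Gamma> f h x = 0" if "x \<in> S" for x
    unfolding \<Gamma>_def using assms(1) N_in[OF that] that by (intro sum.neutral) auto
  then have "\<bar>Av n (\<Gamma> f h) b\<bar> \<le> 0" for n by (intro Av_bound b_in) auto
  then show "((\<lambda>n. Av n (\<Gamma> f h) b) \<longlongrightarrow> 0) ult" by simp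
qed

end

section \<open>The energy seminorm and finite dimension\<close>

context walk
begin

definition nm :: "('x \<Rightarrow> real) \<Rightarrow> real" where
  "nm f = sqrt (G f f)"

lemma nm_sq: "f \<in> LH \<Longrightarrow> (nm f)\<^sup>2 = G f f"
  by (simp add: nm_def G_nonneg)

lemma nm_nonneg: "f \<in> LH \<Longrightarrow> nm f \<ge> 0"
  by (simp add: nm_def G_nonneg)

lemma G_lin_right: "f \<in> LH \<Longrightarrow> g \<in> LH \<Longrightarrow> h \<in> LH \<Longrightarrow> G h (\<lambda>x. c * f x + g x) = c * G h f + G h g"
  unfolding G_sym[of h "\<lambda>x. c * f x + g x"] G_sym[of h f] G_sym[of h g] by (rule G_lin)

lemma G_expand:
  assumes "f \<in> LH" "g \<in> LH"
  shows "G (\<lambda>x. c * f x + g x) (\<lambda>x. c * f x + g x) = c\<^sup>2 * G f f + 2 * c * G f g + G g g"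
proof -
  let ?h = "\<lambda>x. c * f x + g x"
  have "G ?h ?h = c * G f ?h + G g ?h" by (rule G_lin[OF assms LH_lin[OF assms]])
  also have "G f ?h = c * G f f + G f g" by (rule G_lin_right[OF assms assms(1)])
  also have "G g ?h = c * G f g + G g g" using G_lin_right[OF assms assms(2)] G_sym[of g f] by simp
  finally show ?thesis by (simp add: power2_eq_square distrib_left)
qed

lemma G_Cauchy_Schwarz:
  assumes f: "f \<in> LH" and g: "g \<in> LH"
  shows "\<bar>G f g\<bar> \<le> nm f * nm g"
proof (cases "G f f = 0")
  case True
  then have "G f g = 0" using G_const_left[OF G_zero_const[OF f True] g f] by simp
  then show ?thesis using nm_nonneg f g by simp
next
  case False
  then have ff: "G f f > 0" using G_nonneg[OF f] by simp
  define c where "c = - G f g / G f f"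
  have "0 \<le> c\<^sup>2 * G f f + 2 * c * G f g + G g g"
    using G_nonneg[OF LH_lin[OF f g, of c]] G_expand[OF f g, of c] by simp
  also have "\<dots> = G g g - (G f g)\<^sup>2 / G f f"
    using ff by (simp add: c_def power2_eq_square field_simps)
  finally have "(G f g)\<^sup>2 \<le> G f f * G g g" using ff by (simp add: field_simps)
  then have "(G f g)\<^sup>2 \<le> (nm f * nm g)\<^sup>2" using nm_sq[OF f] nm_sq[OF g] by (simp add: power_mult_distrib)
  then show ?thesis using nm_nonneg f g by (intro abs_le_of_square_le) auto
qed

lemma nm_triangle:
  assumes f: "f \<in> LH" and g: "g \<in> LH"
  shows "nm (\<lambda>x. f x + g x) \<le> nm f + nm g"
proof (rule power2_le_imp_le)
  have fg: "(\<lambda>x. f x + g x) \<in> LH" using LH_lin[OF f g, of 1] by simp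
  have "(nm (\<lambda>x. f x + g x))\<^sup>2 = G f f + 2 * G f g + G g g"
    using nm_sq[OF fg] G_expand[OF f g, of 1] by simp
  also have "\<dots> \<le> (nm f)\<^sup>2 + 2 * (nm f * nm g) + (nm g)\<^sup>2"
    using G_Cauchy_Schwarz[OF f g] nm_sq[OF f] nm_sq[OF g] by simp
  also have "\<dots> = (nm f + nm g)\<^sup>2" by (simp add: power2_sum)
  finally show "(nm (\<lambda>x. f x + g x))\<^sup>2 \<le> (nm f + nm g)\<^sup>2" .
qed (use nm_nonneg f g in auto)

lemma nm_cmult: "f \<in> LH \<Longrightarrow> nm (\<lambda>x. c * f x) = \<bar>c\<bar> * nm f"
  using G_expand[OF _ LH_zero[of 0], of f c] G_zero[of 0] G_sym[of f "\<lambda>_. 0"]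
  by (simp add: nm_def real_sqrt_mult)

lemma nm_diff: "f \<in> LH \<Longrightarrow> g \<in> LH \<Longrightarrow> nm (\<lambda>x. f x - g x) \<le> nm f + nm g"
  using nm_triangle[of f "\<lambda>x. - 1 * g x"] nm_cmult[of g "- 1"] LH_lin[of g "\<lambda>_. 0" "- 1"] LH_zero[of 0] by simp

text \<open>Functions are total on the type, but \<open>nm\<close> sees only their values on
  \<open>S\<close>, and these only modulo constants.\<close>

lemma nm_eq_const:
  assumes "f \<in> LH" "g \<in> LH" "\<And>x. x \<in> S \<Longrightarrow> f x - g x = c"
  shows "nm f = nm g"
proof -
  have eq: "\<Gamma> f f x = \<Gamma> g g x" if x: "x \<in> S" for x
    unfolding \<Gamma>_def
  proof (intro sum.cong refl)
    fix y assume "y \<in> N x"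
    then have "f y - f x = g y - g x" using assms(3)[OF N_in[OF x]] assms(3)[OF x] by fastforce
    then show "w x y * ((f y - f x) * (f y - f x)) = w x y * ((g y - g x) * (g y - g x))" by simp
  qed
  have "(P ^^ n) (\<Gamma> f f) b = (P ^^ n) (\<Gamma> g g) b" for n by (rule Pn_cong[OF b_in eq])
  then have "Av n (\<Gamma> f f) b = Av n (\<Gamma> g g) b" for n by (simp add: Av_def)
  then show ?thesis by (simp add: nm_def G_def)
qed

lemma nm_sum:
  "finite I \<Longrightarrow> (\<And>i. i \<in> I \<Longrightarrow> f i \<in> LH) \<Longrightarrow> nm (\<lambda>x. \<Sum>i\<in>I. c i * f i x) \<le> (\<Sum>i\<in>I. \<bar>c i\<bar> * nm (f i))"
proof (induction I rule: finite_induct)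
  case empty
  then show ?case using G_zero[of 0] by (simp add: nm_def)
next
  case (insert i I)
  have "nm (\<lambda>x. c i * f i x + (\<Sum>i\<in>I. c i * f i x)) \<le> nm (\<lambda>x. c i * f i x) + nm (\<lambda>x. \<Sum>i\<in>I. c i * f i x)"
    using insert LH_lin[OF _ LH_zero[of 0], of "f i" "c i"] LH_sum[of I f c] by (intro nm_triangle) auto
  also have "\<dots> \<le> \<bar>c i\<bar> * nm (f i) + (\<Sum>i\<in>I. \<bar>c i\<bar> * nm (f i))"
    using insert nm_cmult[of "f i" "c i"] by simp
  finally show ?case using insert by simp
qed

definition orthonormal :: "nat \<Rightarrow> (nat \<Rightarrow> 'x \<Rightarrow> real) \<Rightarrow> bool" where
  "orthonormal k f \<longleftrightarrow> (\<forall>i<k. f i \<in> LH) \<and> (\<forall>i<k. \<forall>j<k. G (f i) (f j) = of_bool (i = j))"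

lemma orthonormal_G_sum:
  assumes o: "orthonormal k f"
  shows "G (\<lambda>x. \<Sum>i<k. c i * f i x) (\<lambda>x. \<Sum>i<k. c i * f i x) = (\<Sum>i<k. (c i)\<^sup>2)"
    and "j < k \<Longrightarrow> G (\<lambda>x. \<Sum>i<k. c i * f i x) (f j) = c j"
proof -
  have LH: "\<And>i. i \<in> {..<k} \<Longrightarrow> f i \<in> LH" using o by (auto simp: orthonormal_def)
  have *: "G (\<lambda>x. \<Sum>i<k. c i * f i x) (f j) = c j" if j: "j < k" for j
  proof -
    have "G (\<lambda>x. \<Sum>i<k. c i * f i x) (f j) = (\<Sum>i<k. c i * G (f i) (f j))"
      using j by (intro G_sum LH) auto
    also have "\<dots> = (\<Sum>i<k. if i = j then c i else 0)"
      using o j by (intro sum.cong) (auto simp: orthonormal_def)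
    finally show ?thesis using j by simp
  qed
  then show "j < k \<Longrightarrow> G (\<lambda>x. \<Sum>i<k. c i * f i x) (f j) = c j" .
  have "G (\<lambda>x. \<Sum>i<k. c i * f i x) (\<lambda>x. \<Sum>i<k. c i * f i x) = (\<Sum>i<k. c i * G (f i) (\<lambda>x. \<Sum>i<k. c i * f i x))"
    by (intro G_sum LH_sum LH) auto
  also have "\<dots> = (\<Sum>i<k. (c i)\<^sup>2)"
    using * by (intro sum.cong) (auto simp: G_sym[of _ "\<lambda>x. \<Sum>i<k. c i * f i x"] power2_eq_square)
  finally show "G (\<lambda>x. \<Sum>i<k. c i * f i x) (\<lambda>x. \<Sum>i<k. c i * f i x) = (\<Sum>i<k. (c i)\<^sup>2)" .
qed

text \<open>The pointwise bound \<open>gradient_le_G\<close>, applied to the combination of the \<open>f\<^sub>i\<close> that maximises the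
  gradient, bounds the trace of the Gram density; averaging it turns this into a bound on the dimension.\<close>

lemma orthonormal_card:
  assumes o: "orthonormal k f"
  shows "real k \<le> Kc"
proof -
  have LH: "f i \<in> LH" if "i < k" for i using o that by (auto simp: orthonormal_def)
  have edge: "(\<Sum>i<k. (f i y - f i x)\<^sup>2) \<le> Kc" if x: "x \<in> S" and y: "y \<in> N x" for x y
  proof -
    define s where "s = (\<Sum>i<k. (f i y - f i x)\<^sup>2)"
    define g where "g z = (\<Sum>i<k. (f i y - f i x) * f i z)" for z
    have g: "g \<in> LH" unfolding g_def[abs_def] by (intro LH_sum) (auto intro: LH)
    have "g y - g x = s"
      by (simp add: g_def s_def sum_subtractf[symmetric] power2_eq_square right_diff_distrib[symmetric])
    moreover have "G g g = s" unfolding g_def[abs_def] s_def by (rule orthonormal_G_sum[OF o])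
    ultimately have "s * s \<le> Kc * s" using gradient_le_G[OF g x y] by (simp add: power2_eq_square)
    moreover have "s \<ge> 0" unfolding s_def by (intro sum_nonneg) auto
    ultimately have "s \<le> Kc" using Kc_pos by (cases "s = 0") auto
    then show ?thesis by (simp add: s_def)
  qed
  have tr: "(\<Sum>i<k. \<Gamma> (f i) (f i) x) \<le> Kc" if x: "x \<in> S" for x
  proof -
    have "(\<Sum>i<k. \<Gamma> (f i) (f i) x) = (\<Sum>y\<in>N x. w x y * (\<Sum>i<k. (f i y - f i x)\<^sup>2))"
      unfolding \<Gamma>_def by (subst sum.swap) (simp add: sum_distrib_left power2_eq_square)
    also have "\<dots> \<le> (\<Sum>y\<in>N x. w x y * Kc)"
      by (intro sum_mono mult_left_mono edge[OF x] wN_nonneg[OF x])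
    finally show ?thesis using w_sum[OF x] by (simp flip: sum_distrib_right)
  qed
  have "((\<lambda>n. \<Sum>i<k. Av n (\<Gamma> (f i) (f i)) b) \<longlongrightarrow> (\<Sum>i<k. G (f i) (f i))) ult"
    by (intro tendsto_sum G_lim b_in) (auto intro: LH)
  moreover have "(\<Sum>i<k. G (f i) (f i)) = real k" using o by (simp add: orthonormal_def)
  ultimately have lim: "((\<lambda>n. \<Sum>i<k. Av n (\<Gamma> (f i) (f i)) b) \<longlongrightarrow> real k) ult" by simp
  show ?thesis
  proof (rule tendsto_upperbound[OF lim always_eventually ult_bot], rule allI)
    fix n
    have "(\<Sum>i<k. Av n (\<Gamma> (f i) (f i)) b) = Av n (\<lambda>x. \<Sum>i<k. \<Gamma> (f i) (f i) x) b" by (rule Av_sum[symmetric])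
    also have "\<dots> \<le> Av n (\<lambda>_. Kc) b" by (intro Av_mono b_in tr)
    finally show "(\<Sum>i<k. Av n (\<Gamma> (f i) (f i)) b) \<le> Kc" by (simp add: Av_const[OF b_in])
  qed
qed

text \<open>A system of maximal length exists by \<open>orthonormal_card\<close>. The residue of
  \<open>g\<close> has norm 0 by maximality, so it is constant on \<open>S\<close>; this is the
  origin of \<open>c\<close>.\<close>

lemma orthonormal_basis:
  obtains k f where "orthonormal k f"
    "\<And>g. g \<in> LH \<Longrightarrow> \<exists>c. \<forall>x\<in>S. g x = (\<Sum>i<k. G g (f i) * f i x) + c"
proof -
  define Q where "Q k \<longleftrightarrow> (\<exists>f. orthonormal k f)" for k
  have Q0: "Q 0" by (auto simp: Q_def orthonormal_def)
  have bd: "k \<le> nat \<lceil>Kc\<rceil>" if "Q k" for k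
  proof -
    have "real k \<le> Kc" using that orthonormal_card by (auto simp: Q_def)
    then show ?thesis using real_nat_ceiling_ge[of Kc] by linarith
  qed
  define k where "k = Greatest Q"
  have k: "Q k" "\<And>m. Q m \<Longrightarrow> m \<le> k"
    unfolding k_def using GreatestI_nat[of Q, OF Q0 bd] Greatest_le_nat[of Q, OF _ bd] by blast+
  from k(1) obtain f where f: "orthonormal k f" by (auto simp: Q_def)
  have LH: "f i \<in> LH" if "i < k" for i using f that by (auto simp: orthonormal_def)
  show ?thesis
  proof
    fix g assume g: "g \<in> LH"
    define h where "h x = g x - (\<Sum>i<k. G g (f i) * f i x)" for x
    have s: "(\<lambda>x. \<Sum>i<k. G g (f i) * f i x) \<in> LH" by (intro LH_sum) (auto intro: LH)
    have h: "h \<in> LH" unfolding h_def[abs_def] by (rule LH_diff[OF g s])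
    have orth: "G h (f j) = 0" if "j < k" for j
      using G_diff[OF g s LH[OF that]] orthonormal_G_sum(2)[OF f that] by (simp add: h_def[abs_def])
    have "G h h = 0"
    proof (rule ccontr)
      assume "G h h \<noteq> 0"
      then have pos: "G h h > 0" using G_nonneg[OF h] by simp
      define u where "u x = (1 / nm h) * h x" for x
      have u: "u \<in> LH" using LH_lin[OF h LH_zero[of 0], of "1 / nm h"] by (simp add: u_def[abs_def])
      have uG: "G u r = (1 / nm h) * G h r" if "r \<in> LH" for r
        using G_lin[OF h LH_zero[of 0] that, of "1 / nm h"] G_zero[of 0 r] by (simp add: u_def[abs_def])
      have "G u u = 1"
        using uG[OF u] uG[OF h] G_sym[of u h] pos nm_sq[OF h] by (simp add: power2_eq_square field_simps)
      moreover have "G u (f j) = 0" if "j < k" for j using uG[OF LH[OF that]] orth[OF that] by simp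
      moreover have "G (f j) u = 0" if "j < k" for j using calculation(2)[OF that] G_sym[of u "f j"] by simp
      ultimately have "orthonormal (Suc k) (\<lambda>i. if i < k then f i else u)"
        using f u by (auto simp: orthonormal_def less_Suc_eq)
      then show False using k(2)[of "Suc k"] by (auto simp: Q_def)
    qed
    have "g x = (\<Sum>i<k. G g (f i) * f i x) + h b" if "x \<in> S" for x
      using G_zero_const[OF h \<open>G h h = 0\<close> that] h_def[of x] by linarith
    then show "\<exists>c. \<forall>x\<in>S. g x = (\<Sum>i<k. G g (f i) * f i x) + c" by blast
  qed (rule f)
qed

section \<open>Translations as isometries of the space\<close>

definition tr :: "'g \<Rightarrow> ('x \<Rightarrow> real) \<Rightarrow> 'x \<Rightarrow> real" where
  "tr g f x = f (inverse g \<star> x)"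

lemma tr_mult: "tr (g * h) f = tr g (tr h f)"
  by (simp add: tr_def fun_eq_iff grp_inv_mult act_mult)

lemma tr_one: "tr 1 f = f"
  by (simp add: tr_def fun_eq_iff act_one)

lemma \<Gamma>_tr:
  assumes g: "g \<in> L" and x: "x \<in> S"
  shows "\<Gamma> (tr g f) (tr g h) x = \<Gamma> f h (inverse g \<star> x)"
proof -
  have gi: "inverse g \<in> L" by (rule sgrp_inv[OF L g])
  have "\<Gamma> f h (inverse g \<star> x) = (\<Sum>y\<in>(\<lambda>y. inverse g \<star> y) ` N x. w (inverse g \<star> x) y *
      ((f y - f (inverse g \<star> x)) * (h y - h (inverse g \<star> x))))"
    by (simp add: \<Gamma>_def N_act[OF gi x])
  also have "\<dots> = (\<Sum>y\<in>N x. w (inverse g \<star> x) (inverse g \<star> y) *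
      ((f (inverse g \<star> y) - f (inverse g \<star> x)) * (h (inverse g \<star> y) - h (inverse g \<star> x))))"
    by (subst sum.reindex) (auto simp: inj_on_def act_inj)
  also have "\<dots> = \<Gamma> (tr g f) (tr g h) x"
    unfolding \<Gamma>_def tr_def by (intro sum.cong refl) (simp add: w_inv[OF gi x N_in[OF x]])
  finally show ?thesis ..
qed

lemma tr_LH: 
  assumes g: "g \<in> L" and f: "f \<in> LH" shows "tr g f \<in> LH"
proof -
  have gi: "inverse g \<in> L" by (rule sgrp_inv[OF L g])
  obtain M where M: "lip M f" using f by (auto simp: LH_def)
  have "harm (tr g f)" unfolding harm_def
  proof
    fix x assume x: "x \<in> S"
    have "P (tr g f) x = P f (inverse g \<star> x)" using P_act[OF gi x, of f] by (simp add: tr_def[abs_def])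
    then show "P (tr g f) x = tr g f x" using f act_S[OF gi x] by (simp add: LH_def harm_def tr_def)
  qed
  moreover have "lip M (tr g f)" unfolding lip_def
  proof (intro ballI)
    fix x y assume xy: "x \<in> S" "y \<in> N x"
    then have "inverse g \<star> y \<in> N (inverse g \<star> x)" using N_act[OF gi xy(1)] by blast
    then show "\<bar>tr g f y - tr g f x\<bar> \<le> M" using M act_S[OF gi xy(1)] by (auto simp: lip_def tr_def)
  qed
  ultimately show ?thesis by (auto simp: LH_def)
qed

lemma G_tr:
  assumes g: "g \<in> L" and f: "f \<in> LH" and h: "h \<in> LH"
  shows "G (tr g f) (tr g h) = G f h"
proof (rule G_unique[OF tr_LH[OF g f] tr_LH[OF g h]])
  have gi: "inverse g \<in> L" by (rule sgrp_inv[OF L g])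
  have "Av n (\<Gamma> (tr g f) (tr g h)) b = Av n (\<Gamma> f h) (inverse g \<star> b)" for n
    unfolding Av_def Pn_act[OF gi b_in]
    using Pn_cong[OF b_in, of "\<Gamma> (tr g f) (tr g h)" "\<lambda>y. \<Gamma> f h (inverse g \<star> y)"] \<Gamma>_tr[OF g] by simp
  then show "((\<lambda>n. Av n (\<Gamma> (tr g f) (tr g h)) b) \<longlongrightarrow> G f h) ult"
    using G_lim[OF f h act_S[OF gi b_in]] by simp
qed

lemma nm_tr: "g \<in> L \<Longrightarrow> f \<in> LH \<Longrightarrow> nm (tr g f) = nm f"
  by (simp add: nm_def G_tr)

text \<open>Precompactness of the image of \<open>L\<close> in the isometries of a finite
  dimensional space: \<open>\<phi> g\<close> rounds the matrix of \<open>tr g\<close> in an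
  orthonormal basis to a grid of mesh \<open>\<eta>\<close>, and the entries lie in [-1, 1].\<close>

lemma totally_bounded:
  assumes \<epsilon>: "\<epsilon> > 0"
  obtains \<phi> :: "'g \<Rightarrow> nat \<Rightarrow> nat \<Rightarrow> int" where "finite (\<phi> ` L)"
    "\<And>g h f. g \<in> L \<Longrightarrow> h \<in> L \<Longrightarrow> \<phi> g = \<phi> h \<Longrightarrow> f \<in> LH \<Longrightarrow> nm (\<lambda>x. tr g f x - tr h f x) \<le> \<epsilon> * nm f"
proof -
  obtain k u where o: "orthonormal k u"
    and basis: "\<And>g. g \<in> LH \<Longrightarrow> \<exists>c. \<forall>x\<in>S. g x = (\<Sum>i<k. G g (u i) * u i x) + c"
    using orthonormal_basis by blast
  have LH: "u i \<in> LH" if "i < k" for i using o that by (auto simp: orthonormal_def)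
  have nm1: "nm (u i) = 1" if "i < k" for i using o that by (auto simp: orthonormal_def nm_def)
  \<comment> \<open>The \<open>k\<close> coordinates of the images of each of \<open>k\<close> basis
    vectors are off by at most \<open>\<eta>\<close>, which adds up to
    \<open>k\<^sup>2 * \<eta>\<close>.\<close>
  define \<eta> where "\<eta> = \<epsilon> / (real k ^ 2 + 1)"
  have "real k ^ 2 + 1 > 0" by (rule add_nonneg_pos) auto
  then have \<eta>: "\<eta> > 0" "real k ^ 2 * \<eta> \<le> \<epsilon>" using \<epsilon> by (auto simp: \<eta>_def field_simps)
  define \<phi> where "\<phi> g i j = (if i < k \<and> j < k then \<lfloor>G (tr g (u i)) (u j) / \<eta>\<rfloor> else 0)" for g i j
  show ?thesis
  proof
    define A where "A = {- \<lceil>1 / \<eta>\<rceil> - 1..\<lceil>1 / \<eta>\<rceil>}"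
    have bd: "\<phi> g i j \<in> A" if g: "g \<in> L" and ij: "i < k" "j < k" for g i j
    proof -
      have "\<bar>G (tr g (u i)) (u j)\<bar> \<le> 1"
        using G_Cauchy_Schwarz[OF tr_LH[OF g LH[OF ij(1)]] LH[OF ij(2)]] nm_tr[OF g LH[OF ij(1)]] nm1 ij by simp
      then have "\<bar>G (tr g (u i)) (u j) / \<eta>\<bar> \<le> 1 / \<eta>" using \<eta> by (simp add: abs_divide divide_right_mono)
      then have "G (tr g (u i)) (u j) / \<eta> \<le> 1 / \<eta>" "- (1 / \<eta>) \<le> G (tr g (u i)) (u j) / \<eta>"
        by linarith+
      then show ?thesis unfolding \<phi>_def A_def using ij
        by (simp only: if_True simp_thms atLeastAtMost_iff) linarith
    qed
    have "\<phi> ` L \<subseteq> {F. \<forall>i. (i \<in> {..<k} \<longrightarrow> F i \<in> {f. \<forall>j. (j \<in> {..<k} \<longrightarrow> f j \<in> A) \<and> (j \<notin> {..<k} \<longrightarrow> f j = 0)}) \<and>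
       (i \<notin> {..<k} \<longrightarrow> F i = (\<lambda>_. 0))}"
      using bd by (auto simp: \<phi>_def fun_eq_iff)
    moreover have "finite A" by (simp add: A_def)
    ultimately show "finite (\<phi> ` L)"
      using finite_set_of_finite_funs[of "{..<k}" "{f. \<forall>j. (j \<in> {..<k} \<longrightarrow> f j \<in> A) \<and> (j \<notin> {..<k} \<longrightarrow> f j = 0)}" "\<lambda>_. 0"]
        finite_set_of_finite_funs[of "{..<k}" A 0] by (meson finite_lessThan finite_subset)
    fix g h f assume g: "g \<in> L" and h: "h \<in> L" and eq: "\<phi> g = \<phi> h" and f: "f \<in> LH"
    have close: "nm (\<lambda>x. tr g (u i) x - tr h (u i) x) \<le> real k * \<eta>" if i: "i < k" for i
    proof -
      define v where "v x = tr g (u i) x - tr h (u i) x" for x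
      have gh: "tr g (u i) \<in> LH" "tr h (u i) \<in> LH" using tr_LH g h LH[OF i] by auto
      have v: "v \<in> LH" unfolding v_def[abs_def] by (rule LH_diff[OF gh])
      obtain c where c: "\<And>x. x \<in> S \<Longrightarrow> v x = (\<Sum>j<k. G v (u j) * u j x) + c" using basis[OF v] by blast
      have s: "(\<lambda>x. \<Sum>j<k. G v (u j) * u j x) \<in> LH" by (intro LH_sum) (auto intro: LH)
      have "nm v = nm (\<lambda>x. \<Sum>j<k. G v (u j) * u j x)" by (rule nm_eq_const[OF v s, of c]) (simp add: c)
      also have "\<dots> \<le> (\<Sum>j<k. \<bar>G v (u j)\<bar> * nm (u j))" by (intro nm_sum) (auto intro: LH)
      also have "\<dots> \<le> (\<Sum>j<k. \<eta>)"
      proof (rule sum_mono)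
        fix j assume "j \<in> {..<k}"
        then have j: "j < k" by simp
        have "\<phi> g i j = \<phi> h i j" using eq by simp
        then have "\<lfloor>G (tr g (u i)) (u j) / \<eta>\<rfloor> = \<lfloor>G (tr h (u i)) (u j) / \<eta>\<rfloor>" using i j by (simp add: \<phi>_def)
        then have "\<bar>G (tr g (u i)) (u j) / \<eta> - G (tr h (u i)) (u j) / \<eta>\<bar> \<le> 1" by linarith
        then have "\<bar>G (tr g (u i)) (u j) - G (tr h (u i)) (u j)\<bar> \<le> \<eta>"
          using \<eta>(1) by (simp add: diff_divide_distrib[symmetric] abs_divide)
        then show "\<bar>G v (u j)\<bar> * nm (u j) \<le> \<eta>"
          using nm1[OF j] G_diff[OF gh LH[OF j]] by (simp add: v_def[abs_def])
      qed
      finally show ?thesis by (simp add: v_def[abs_def])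
    qed
    obtain c where c: "\<And>x. x \<in> S \<Longrightarrow> f x = (\<Sum>i<k. G f (u i) * u i x) + c" using basis[OF f] by blast
    have eqs: "tr g f x - tr h f x = (\<Sum>i<k. G f (u i) * (tr g (u i) x - tr h (u i) x))" if "x \<in> S" for x
      using c[OF act_S[OF sgrp_inv[OF L g] that]] c[OF act_S[OF sgrp_inv[OF L h] that]]
      by (simp add: tr_def sum_subtractf right_diff_distrib)
    have d: "(\<lambda>x. tr g (u i) x - tr h (u i) x) \<in> LH" if "i < k" for i
      using LH_diff tr_LH g h LH[OF that] by blast
    have "nm (\<lambda>x. tr g f x - tr h f x) = nm (\<lambda>x. \<Sum>i<k. G f (u i) * (tr g (u i) x - tr h (u i) x))"
      by (rule nm_eq_const[of _ _ 0]) (use LH_diff tr_LH g h f d eqs in \<open>auto intro!: LH_sum\<close>)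
    also have "\<dots> \<le> (\<Sum>i<k. \<bar>G f (u i)\<bar> * nm (\<lambda>x. tr g (u i) x - tr h (u i) x))"
      by (intro nm_sum) (auto intro: d)
    also have "\<dots> \<le> (\<Sum>i<k. nm f * (real k * \<eta>))"
    proof (intro sum_mono mult_mono)
      fix i assume "i \<in> {..<k}"
      then have i: "i < k" by simp
      show "\<bar>G f (u i)\<bar> \<le> nm f" using G_Cauchy_Schwarz[OF f LH[OF i]] nm1[OF i] by simp
      show "nm (\<lambda>x. tr g (u i) x - tr h (u i) x) \<le> real k * \<eta>" by (rule close[OF i])
      show "0 \<le> nm f" by (rule nm_nonneg[OF f])
      show "0 \<le> nm (\<lambda>x. tr g (u i) x - tr h (u i) x)" by (rule nm_nonneg[OF d[OF i]])
    qed
    also have "\<dots> = (real k ^ 2 * \<eta>) * nm f" by (simp add: power2_eq_square)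
    also have "\<dots> \<le> \<epsilon> * nm f" using \<eta>(2) nm_nonneg[OF f] by (rule mult_right_mono)
    finally show "nm (\<lambda>x. tr g f x - tr h f x) \<le> \<epsilon> * nm f" .
  qed
qed

text \<open>At a suitable time \<open>n\<close> the Gram matrix of the energies averaged from
  \<open>b\<close> is within \<open>\<eta>\<close> of the identity, with
  \<open>k\<^sup>2 * \<eta> < 1\<close>, so the averaged energy at this single time is already
  positive definite on the span of the basis. It vanishes for a function that is constant near
  \<open>b\<close>.\<close>

lemma determined_by_ball:
  obtains R where "\<And>f. f \<in> LH \<Longrightarrow> (\<And>x. x \<in> B R b \<Longrightarrow> f x = f b) \<Longrightarrow> nm f = 0"
proof -
  obtain k u where o: "orthonormal k u"
    and basis: "\<And>g. g \<in> LH \<Longrightarrow> \<exists>c. \<forall>x\<in>S. g x = (\<Sum>i<k. G g (u i) * u i x) + c"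
    using orthonormal_basis by blast
  have LH: "u i \<in> LH" if "i < k" for i using o that by (auto simp: orthonormal_def)
  define \<eta> where "\<eta> = 1 / (real k ^ 2 + 1)"
  have "real k ^ 2 + 1 > 0" by (rule add_nonneg_pos) auto
  then have \<eta>: "\<eta> > 0" "real k ^ 2 * \<eta> < 1" by (auto simp: \<eta>_def field_simps)
  have "eventually (\<lambda>n. \<forall>i\<in>{..<k}. \<forall>j\<in>{..<k}. dist (Av n (\<Gamma> (u i) (u j)) b) (G (u i) (u j)) < \<eta>) ult"
    by (intro eventually_ball_finite ballI tendstoD[OF G_lim[OF _ _ b_in] \<eta>(1)]) (auto intro: LH)
  then obtain n where n: "\<And>i j. i < k \<Longrightarrow> j < k \<Longrightarrow> \<bar>Av n (\<Gamma> (u i) (u j)) b - of_bool (i = j)\<bar> < \<eta>"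
    using eventually_happens[of _ ult] ult_bot o by (auto simp: dist_real_def orthonormal_def) blast
  show ?thesis
  proof
    \<comment> \<open>Up to \<open>n\<close> steps are averaged and the energy density looks one
      edge further, hence the radius \<open>Suc n\<close>.\<close>
    fix f assume f: "f \<in> LH" and const: "\<And>x. x \<in> B (Suc n) b \<Longrightarrow> f x = f b"
    obtain c where c: "\<And>x. x \<in> S \<Longrightarrow> f x = (\<Sum>i<k. G f (u i) * u i x) + c" using basis[OF f] by blast
    have "\<Gamma> f f x = 0" if x: "x \<in> B m b" and m: "m \<le> n" for x m
    proof -
      have xS: "x \<in> S" using x B_S[OF b_in] by blast
      have ball: "y \<in> B (Suc r) z" if "y \<in> N x" "x \<in> B r z" "z \<in> S" for r y z
        using that
      proof (induction r arbitrary: z)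
        case (Suc r)
        then obtain t where t: "t \<in> N z" "x \<in> B r t" by auto
        then have "y \<in> B (Suc r) t" using Suc N_in by blast
        then show ?case using t by (auto simp del: kernel_ball.simps(2) simp: kernel_ball.simps(2)[of N "Suc r"])
      qed auto
      have "y \<in> B (Suc n) b" if "y \<in> N x" for y
        using ball[OF that x b_in] B_mono[OF b_in, of "Suc m" "Suc n"] m by blast
      then show ?thesis unfolding \<Gamma>_def using const N_self[OF xS] by (intro sum.neutral) auto
    qed
    then have "(P ^^ m) (\<Gamma> f f) b = 0" if "m \<le> n" for m
      using that unfolding Pn_p[OF b_in B_fin[OF b_in] subset_refl] by (intro sum.neutral) auto
    then have Av0: "Av n (\<Gamma> f f) b = 0" unfolding Av_def by simp
    define a where "a i = G f (u i)" for i
    have "\<Gamma> f f x = (\<Sum>i<k. \<Sum>j<k. a i * a j * \<Gamma> (u i) (u j) x)" if x: "x \<in> S" for x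
    proof -
      have "\<Gamma> f f x = (\<Sum>y\<in>N x. w x y * ((\<Sum>i<k. a i * (u i y - u i x)) * (\<Sum>j<k. a j * (u j y - u j x))))"
        unfolding \<Gamma>_def
        by (intro sum.cong refl) (simp add: c[OF x] c[OF N_in[OF x]] a_def right_diff_distrib sum_subtractf)
      also have "\<dots> = (\<Sum>y\<in>N x. \<Sum>i<k. \<Sum>j<k. a i * a j * (w x y * ((u i y - u i x) * (u j y - u j x))))"
        by (intro sum.cong refl, subst sum_product) (simp add: sum_distrib_left mult_ac)
      also have "\<dots> = (\<Sum>i<k. \<Sum>y\<in>N x. \<Sum>j<k. a i * a j * (w x y * ((u i y - u i x) * (u j y - u j x))))"
        by (rule sum.swap)
      also have "\<dots> = (\<Sum>i<k. \<Sum>j<k. \<Sum>y\<in>N x. a i * a j * (w x y * ((u i y - u i x) * (u j y - u j x))))"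
        by (intro sum.cong refl sum.swap)
      finally show ?thesis by (simp add: \<Gamma>_def sum_distrib_left)
    qed
    then have "Av n (\<Gamma> f f) b = Av n (\<lambda>x. \<Sum>i<k. \<Sum>j<k. a i * a j * \<Gamma> (u i) (u j) x) b"
      unfolding Av_def using Pn_cong[OF b_in, of "\<Gamma> f f"] by simp
    also have "\<dots> = (\<Sum>i<k. \<Sum>j<k. a i * a j * Av n (\<Gamma> (u i) (u j)) b)"
      by (simp only: Av_sum Av_cmult)
    finally have "0 = (\<Sum>i<k. \<Sum>j<k. a i * a j * Av n (\<Gamma> (u i) (u j)) b)" using Av0 by simp
    define s where "s = (\<Sum>i<k. (a i)\<^sup>2)"
    have s: "nm f = sqrt s"
    proof -
      have "(\<lambda>x. \<Sum>i<k. a i * u i x) \<in> LH" by (intro LH_sum) (auto intro: LH)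
      then have "nm f = nm (\<lambda>x. \<Sum>i<k. a i * u i x)" using c by (intro nm_eq_const[of _ _ c] f) (auto simp: a_def)
      then show ?thesis using orthonormal_G_sum(1)[OF o, of a] by (simp add: nm_def s_def)
    qed
    have "s = (\<Sum>i<k. \<Sum>j<k. a i * a j * of_bool (i = j))"
      by (simp add: s_def power2_eq_square of_bool_def if_distrib[of "(*) _"] cong: if_cong)
    also have "\<dots> = (\<Sum>i<k. \<Sum>j<k. a i * a j * (of_bool (i = j) - Av n (\<Gamma> (u i) (u j)) b))"
      using \<open>0 = _\<close> by (simp add: right_diff_distrib sum_subtractf)
    also have "\<dots> \<le> (\<Sum>i<k. \<Sum>j<k. s * \<eta>)"
    proof (intro sum_mono)
      fix i j assume "i \<in> {..<k}" "j \<in> {..<k}"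
      then have ij: "i < k" "j < k" by auto
      have le: "(a l)\<^sup>2 \<le> s" if "l < k" for l
        unfolding s_def using that by (intro member_le_sum[where f = "\<lambda>i. (a i)\<^sup>2"]) auto
      have "\<bar>a i * a j\<bar> \<le> ((a i)\<^sup>2 + (a j)\<^sup>2) / 2"
        using sum_squares_bound[of "\<bar>a i\<bar>" "\<bar>a j\<bar>"] by (simp add: abs_mult)
      also have "\<dots> \<le> s" using le[OF ij(1)] le[OF ij(2)] by simp
      finally have 1: "\<bar>a i * a j\<bar> \<le> s" .
      have 2: "\<bar>of_bool (i = j) - Av n (\<Gamma> (u i) (u j)) b\<bar> \<le> \<eta>"
        using n[OF ij] by linarith
      have "0 \<le> s" using 1 by linarith
      from mult_mono[OF 1 2 this abs_ge_zero]
      show "a i * a j * (of_bool (i = j) - Av n (\<Gamma> (u i) (u j)) b) \<le> s * \<eta>"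
        unfolding abs_mult[symmetric] by (rule order_trans[OF abs_ge_self])
    qed
    also have "\<dots> = (real k ^ 2 * \<eta>) * s" by (simp add: power2_eq_square)
    finally have "s \<le> (real k ^ 2 * \<eta>) * s" .
    then have "(1 - real k ^ 2 * \<eta>) * s \<le> 0" by (simp add: left_diff_distrib)
    then have "s \<le> 0" using \<eta>(2) by (simp add: mult_le_0_iff)
    moreover have "s \<ge> 0" unfolding s_def by (intro sum_nonneg) auto
    ultimately show "nm f = 0" using s by simp
  qed
qed

end

section \<open>Commutators of elements close to the identity\<close>

text \<open>\<open>\<delta> g\<close> is to be thought of as the distance of \<open>g\<close> from
  the identity in a group of isometries of a normed space: commutators are quadratically small, and
  by \<open>\<delta>_pow\<close> the powers of a small element drift away linearly.
  \<open>count\<close> bounds the number of elements of length at most \<open>n\<close> that are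
  distinct modulo the kernel of \<open>\<delta>\<close>.\<close>

locale contracting =
  fixes L :: "'g::grp set" and \<delta> :: "'g \<Rightarrow> real" and len :: "'g \<Rightarrow> nat" and K :: real and D :: nat
  assumes L: "sgrp L"
    and \<delta>_nonneg: "g \<in> L \<Longrightarrow> \<delta> g \<ge> 0"
    and \<delta>_one: "\<delta> 1 = 0"
    and \<delta>_mult: "g \<in> L \<Longrightarrow> h \<in> L \<Longrightarrow> \<delta> (g * h) \<le> \<delta> g + \<delta> h"
    and \<delta>_inv: "g \<in> L \<Longrightarrow> \<delta> (inverse g) = \<delta> g"
    and \<delta>_conj: "g \<in> L \<Longrightarrow> h \<in> L \<Longrightarrow> \<delta> (h * g * inverse h) = \<delta> g"
    and \<delta>_comm: "g \<in> L \<Longrightarrow> h \<in> L \<Longrightarrow> \<delta> (g * h * inverse g * inverse h) \<le> 2 * \<delta> g * \<delta> h"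
    and \<delta>_pow: "g \<in> L \<Longrightarrow> real n * \<delta> g \<le> 1 / 2 \<Longrightarrow> real n * \<delta> g \<le> 2 * \<delta> (g ^ n)"
    and len_one: "len 1 = 0"
    and len_mult: "g \<in> L \<Longrightarrow> h \<in> L \<Longrightarrow> len (g * h) \<le> len g + len h"
    and len_inv: "g \<in> L \<Longrightarrow> len (inverse g) \<le> len g"
    and count: "finite I \<Longrightarrow> I \<subseteq> L \<Longrightarrow> (\<And>g. g \<in> I \<Longrightarrow> len g \<le> n) \<Longrightarrow>
      (\<And>g h. g \<in> I \<Longrightarrow> h \<in> I \<Longrightarrow> g \<noteq> h \<Longrightarrow> \<delta> (inverse g * h) > 0) \<Longrightarrow> real (card I) \<le> K * (real n + 1) ^ D"
begin

definition Ker :: "'g set" where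
  "Ker = {g \<in> L. \<delta> g = 0}"

lemma sgrp_Ker: "sgrp Ker"
proof (rule sgrpI)
  show "1 \<in> Ker" using sgrp_one[OF L] \<delta>_one by (simp add: Ker_def)
  show "g * h \<in> Ker" if "g \<in> Ker" "h \<in> Ker" for g h
    using that \<delta>_mult[of g h] \<delta>_nonneg[of "g * h"] sgrp_mult[OF L, of g h] by (auto simp: Ker_def)
  show "inverse g \<in> Ker" if "g \<in> Ker" for g
    using that \<delta>_inv[of g] sgrp_inv[OF L, of g] by (auto simp: Ker_def)
qed

lemma Ker_conj: "g \<in> Ker \<Longrightarrow> h \<in> L \<Longrightarrow> h * g * inverse h \<in> Ker"
  using \<delta>_conj[of g h] sgrp_conj[OF L, of h g] by (auto simp: Ker_def)

lemma Ker_L: "Ker \<subseteq> L"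
  by (auto simp: Ker_def)

lemma Ker_\<delta>:
  assumes "g \<in> L" "h \<in> L" "inverse g * h \<in> Ker"
  shows "\<delta> g = \<delta> h"
proof -
  have "\<delta> h \<le> \<delta> g + \<delta> (inverse g * h)" using \<delta>_mult[of g "inverse g * h"] assms Ker_L by auto
  moreover have "inverse h * g \<in> Ker" using sgrp_inv[OF sgrp_Ker assms(3)] by (simp add: grp_inv_mult)
  moreover have "\<delta> g \<le> \<delta> h + \<delta> (inverse h * g)" using \<delta>_mult[of h "inverse h * g"] assms calculation(2) Ker_L by auto
  ultimately show ?thesis using assms by (simp add: Ker_def)
qed

lemma \<delta>_power: "g \<in> L \<Longrightarrow> \<delta> (g ^ n) \<le> real n * \<delta> g"
proof (induction n)
  case (Suc n)
  then show ?case using \<delta>_mult[of g "g ^ n"] sgrp_power[OF L, of g n] by (simp add: distrib_right)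
qed (simp add: \<delta>_one)

lemma len_power: "g \<in> L \<Longrightarrow> len (g ^ n) \<le> n * len g"
proof (induction n)
  case (Suc n)
  then show ?case using len_mult[of g "g ^ n"] sgrp_power[OF L, of g n] by simp
qed (simp add: len_one)

text \<open>For the largest \<open>n\<close> with \<open>n * \<delta> z \<le> 1 / 2\<close>, the
  linear drift of powers would push \<open>\<delta> (z ^ n)\<close> above 1/16.\<close>

lemma no_small_subgroups:
  assumes z: "z \<in> L" and small: "\<And>n. \<delta> (z ^ n) \<le> 1 / 16"
  shows "\<delta> z = 0"
proof (rule ccontr)
  assume "\<delta> z \<noteq> 0"
  then have pos: "\<delta> z > 0" using \<delta>_nonneg[OF z] by simp
  define n where "n = nat \<lfloor>1 / (2 * \<delta> z)\<rfloor>"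
  have "real n \<le> 1 / (2 * \<delta> z)" "1 / (2 * \<delta> z) < real n + 1" using pos by (simp_all add: n_def)
  then have n: "real n * \<delta> z \<le> 1 / 2" "1 / 2 < (real n + 1) * \<delta> z" using pos by (simp_all add: field_simps)
  have "\<delta> z \<le> 1 / 16" using small[of 1] by simp
  then show False using \<delta>_pow[OF z n(1)] small[of n] n(2) by (simp add: distrib_right)
qed

primrec ladder_word :: "'g list \<Rightarrow> nat list \<Rightarrow> 'g" where
  "ladder_word [] as = 1"
| "ladder_word (y # ys) as = y ^ hd as * ladder_word ys (tl as)"

lemma ladder_word_L: "set ys \<subseteq> L \<Longrightarrow> ladder_word ys as \<in> L"
  by (induction ys arbitrary: as) (auto intro: sgrp_one sgrp_mult sgrp_power L)

definition admissible :: "nat \<Rightarrow> nat \<Rightarrow> nat list set" where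
  "admissible A n = {as. set as \<subseteq> {..A} \<and> length as = n}"

text \<open>Along a list whose members approach the identity geometrically fast, the ordered products of
  small powers are pairwise distinct modulo the kernel, like digit expansions.\<close>

lemma ladder_separated:
  fixes A :: nat
  assumes \<epsilon>: "\<epsilon> > 0" "32 * real A * \<epsilon> \<le> 1" "A \<ge> 1"
    and ys: "set ys \<subseteq> L" "\<And>y. y \<in> set ys \<Longrightarrow> 0 < \<delta> y" "\<And>y. y \<in> set ys \<Longrightarrow> \<delta> y \<le> \<epsilon>"
      "\<And>i. Suc i < length ys \<Longrightarrow> \<delta> (ys ! Suc i) \<le> 2 * \<epsilon> * \<delta> (ys ! i)"
  shows "as \<in> admissible A (length ys) \<Longrightarrow> ys \<noteq> [] \<Longrightarrow> \<delta> (ladder_word ys as) \<le> 2 * real A * \<delta> (hd ys)"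
    and "as \<in> admissible A (length ys) \<Longrightarrow> as' \<in> admissible A (length ys) \<Longrightarrow> as \<noteq> as' \<Longrightarrow>
      \<delta> (inverse (ladder_word ys as) * ladder_word ys as') > 0"
  using ys
proof (induction ys arbitrary: as as')
  case Nil
  { case 1 then show ?case by simp
  next case 2 then show ?case by (simp add: admissible_def) }
next
  case (Cons y ys)
  have "1 * (32 * \<epsilon>) \<le> real A * (32 * \<epsilon>)" using \<epsilon> by (intro mult_right_mono) auto
  then have \<epsilon>4: "4 * \<epsilon> \<le> 1" using \<epsilon>(2) by simp
  have y: "y \<in> L" "\<delta> y > 0" "\<delta> y \<le> \<epsilon>" if "set (y # ys) \<subseteq> L" "\<And>z. z \<in> set (y # ys) \<Longrightarrow> 0 < \<delta> z"
      "\<And>z. z \<in> set (y # ys) \<Longrightarrow> \<delta> z \<le> \<epsilon>" using that by auto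
  \<comment> \<open>The members after \<open>y\<close> are smaller by the factor
    \<open>2 * \<epsilon>\<close>, so a whole tail moves only a fraction of
    \<open>\<delta> y\<close>; with \<open>32 * A * \<epsilon> \<le> 1\<close> this fraction is at
    most 1/8.\<close>
  have tailbd: "\<delta> (ladder_word ys bs) \<le> 4 * real A * \<epsilon> * \<delta> y"
    if prems: "set (y # ys) \<subseteq> L" "\<And>z. z \<in> set (y # ys) \<Longrightarrow> 0 < \<delta> z" "\<And>z. z \<in> set (y # ys) \<Longrightarrow> \<delta> z \<le> \<epsilon>"
      "\<And>i. Suc i < length (y # ys) \<Longrightarrow> \<delta> ((y # ys) ! Suc i) \<le> 2 * \<epsilon> * \<delta> ((y # ys) ! i)"
      and bs: "bs \<in> admissible A (length ys)" for bs
  proof (cases "ys = []")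
    case True
    then show ?thesis using \<delta>_one \<epsilon> y(2)[OF prems(1-3)] by simp
  next
    case False
    have "\<delta> (ladder_word ys bs) \<le> 2 * real A * \<delta> (hd ys)"
    proof (rule Cons.IH(1)[OF bs False])
      show "\<delta> (ys ! Suc i) \<le> 2 * \<epsilon> * \<delta> (ys ! i)" if "Suc i < length ys" for i
        using prems(4)[of "Suc i"] that by simp
    qed (use prems in auto)
    also have "\<dots> \<le> 2 * real A * (2 * \<epsilon> * \<delta> y)"
      using prems(4)[of 0] False by (intro mult_left_mono) (auto simp: hd_conv_nth)
    finally show ?thesis by simp
  qed
  { case 1
    note P = 1(3-6)
    have a: "hd as \<le> A" and tl: "tl as \<in> admissible A (length ys)"
      using 1(1) by (cases as; auto simp: admissible_def)+
    have tL: "ladder_word ys (tl as) \<in> L" using 1(3) by (intro ladder_word_L) auto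
    have "\<delta> (ladder_word (y # ys) as) \<le> \<delta> (y ^ hd as) + \<delta> (ladder_word ys (tl as))"
      using \<delta>_mult[OF sgrp_power[OF L y(1)[OF P(1-3)]] tL] by simp
    also have "\<delta> (y ^ hd as) \<le> real (hd as) * \<delta> y" by (rule \<delta>_power[OF y(1)[OF P(1-3)]])
    also have "\<dots> \<le> real A * \<delta> y" using a y(2)[OF P(1-3)] by (intro mult_right_mono) auto
    also have "\<delta> (ladder_word ys (tl as)) \<le> 4 * real A * \<epsilon> * \<delta> y" by (rule tailbd[OF P tl])
    also have "4 * real A * \<epsilon> * \<delta> y \<le> real A * \<delta> y"
      using mult_left_mono[OF \<epsilon>4, of "real A"] y(2)[OF P(1-3)] by (intro mult_right_mono) (auto simp: mult_ac)
    finally show ?case by simp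
  next
    case 2
    note P = 2(4-7)
    have a: "hd as \<le> A" "hd as' \<le> A" and tl: "tl as \<in> admissible A (length ys)" "tl as' \<in> admissible A (length ys)"
      and ne: "hd as \<noteq> hd as' \<or> tl as \<noteq> tl as'"
      using 2(1,2,3) by (cases as; cases as'; auto simp: admissible_def)+
    have tL: "ladder_word ys cs \<in> L" for cs using 2(4) by (intro ladder_word_L) auto
    \<comment> \<open>When the leading exponents differ, \<open>y ^ n\<close> with
      \<open>n \<ge> 1\<close> has \<open>\<delta>\<close> at least \<open>\<delta> y / 2\<close>,
      more than two tails of at most \<open>\<delta> y / 8\<close> can compensate.\<close>
    have sep: "\<delta> (inverse (ladder_word (y # ys) bs) * ladder_word (y # ys) bs') > 0"
      if lt: "hd bs < hd bs'" "hd bs' \<le> A" and tls: "tl bs \<in> admissible A (length ys)" "tl bs' \<in> admissible A (length ys)" for bs bs'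
    proof -
      define n where "n = hd bs' - hd bs"
      define u u' where "u = ladder_word ys (tl bs)" and "u' = ladder_word ys (tl bs')"
      have uL: "u \<in> L" "u' \<in> L" using tL by (auto simp: u_def u'_def)
      have yn: "y ^ n \<in> L" using y(1)[OF P(1-3)] by (rule sgrp_power[OF L])
      have "y ^ hd bs' = y ^ hd bs * y ^ n" using lt by (simp add: n_def flip: power_add)
      then have eq: "inverse (ladder_word (y # ys) bs) * ladder_word (y # ys) bs' = inverse u * (y ^ n * u')"
        by (simp add: u_def u'_def grp_inv_mult mult.assoc)
      define v where "v = inverse u * (y ^ n * u')"
      have vL: "v \<in> L" unfolding v_def by (intro sgrp_mult sgrp_inv L uL yn)
      have "y ^ n = u * (v * inverse u')" by (simp add: v_def mult.assoc)
      then have "\<delta> (y ^ n) \<le> \<delta> u + (\<delta> v + \<delta> u')"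
        using \<delta>_mult[OF uL(1) sgrp_mult[OF L vL sgrp_inv[OF L uL(2)]]] \<delta>_mult[OF vL sgrp_inv[OF L uL(2)]] \<delta>_inv[OF uL(2)] by simp
      moreover have "real n * \<delta> y \<le> 2 * \<delta> (y ^ n)"
      proof (rule \<delta>_pow[OF y(1)[OF P(1-3)]])
        have "real n * \<delta> y \<le> real A * \<epsilon>" using lt y[OF P(1-3)] by (intro mult_mono) (auto simp: n_def)
        then show "real n * \<delta> y \<le> 1 / 2" using \<epsilon> by linarith
      qed
      moreover have "1 * \<delta> y \<le> real n * \<delta> y" using lt y(2)[OF P(1-3)] by (intro mult_right_mono) (auto simp: n_def)
      moreover have "\<delta> u \<le> 4 * real A * \<epsilon> * \<delta> y" "\<delta> u' \<le> 4 * real A * \<epsilon> * \<delta> y"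
        using tailbd[OF P tls(1)] tailbd[OF P tls(2)] by (auto simp: u_def u'_def)
      moreover have "4 * real A * \<epsilon> * \<delta> y \<le> 1 / 8 * \<delta> y"
        using \<epsilon> y(2)[OF P(1-3)] by (intro mult_right_mono) auto
      ultimately have "\<delta> v > 0" using y(2)[OF P(1-3)] by linarith
      then show ?thesis by (simp only: eq v_def)
    qed
    consider "hd as < hd as'" | "hd as' < hd as" | "hd as = hd as'" "tl as \<noteq> tl as'" using ne by linarith
    then show ?case
    proof cases
      case 1
      then show ?thesis using sep a tl by blast
    next
      case 2
      define v where "v = inverse (ladder_word (y # ys) as') * ladder_word (y # ys) as"
      have "v \<in> L" unfolding v_def
        by (intro sgrp_mult sgrp_inv L ladder_word_L) (use P(1) in auto)
      moreover have "\<delta> v > 0" unfolding v_def using sep[OF 2 a(1) tl(2,1)] .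
      ultimately have "\<delta> (inverse v) > 0" using \<delta>_inv by simp
      then show ?thesis by (simp add: v_def grp_inv_mult)
    next
      case 3
      have "\<delta> (inverse (ladder_word ys (tl as)) * ladder_word ys (tl as')) > 0"
      proof (rule Cons.IH(2)[OF tl 3(2)])
        show "\<delta> (ys ! Suc i) \<le> 2 * \<epsilon> * \<delta> (ys ! i)" if "Suc i < length ys" for i
          using P(4)[of "Suc i"] that by simp
      qed (use P in auto)
      then show ?thesis using 3(1) by (simp add: grp_inv_mult mult.assoc)
    qed }
qed

lemma len_ladder_word:
  "set ys \<subseteq> L \<Longrightarrow> as \<in> admissible A (length ys) \<Longrightarrow> len (ladder_word ys as) \<le> A * sum_list (map len ys)"
proof (induction ys arbitrary: as)
  case (Cons y ys)
  have a: "hd as \<le> A" and tl: "tl as \<in> admissible A (length ys)"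
    using Cons.prems(2) by (cases as; auto simp: admissible_def)+
  have y: "y \<in> L" "ladder_word ys (tl as) \<in> L" using Cons.prems(1) by (auto intro: ladder_word_L)
  have "len (ladder_word (y # ys) as) \<le> len (y ^ hd as) + len (ladder_word ys (tl as))"
    using len_mult[OF sgrp_power[OF L y(1)] y(2)] by simp
  also have "\<dots> \<le> hd as * len y + A * sum_list (map len ys)"
    using len_power[OF y(1)] Cons.IH[OF _ tl] Cons.prems(1) by (intro add_mono) auto
  also have "\<dots> \<le> A * len y + A * sum_list (map len ys)" using a by simp
  finally show ?case by (simp add: algebra_simps)
qed (simp add: len_one)

text \<open>Simple commutators of weight \<open>j + 1\<close> with entries in \<open>T\<close>,
  nested on the right.\<close>

primrec Ch :: "'g set \<Rightarrow> nat \<Rightarrow> 'g set" where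
  "Ch T 0 = T"
| "Ch T (Suc j) = {x * y * inverse x * inverse y | x y. x \<in> T \<and> y \<in> Ch T j}"

lemma Ch_L: "T \<subseteq> L \<Longrightarrow> Ch T j \<subseteq> L"
  by (induction j) (auto intro!: sgrp_mult sgrp_inv L)

lemma Ch_\<delta>:
  assumes T: "T \<subseteq> L" "\<And>t. t \<in> T \<Longrightarrow> \<delta> t \<le> \<epsilon>" and \<epsilon>: "0 < \<epsilon>" "2 * \<epsilon> \<le> 1"
  shows "y \<in> Ch T j \<Longrightarrow> \<delta> y \<le> \<epsilon>"
proof (induction j arbitrary: y)
  case (Suc j)
  then obtain x z where xz: "x \<in> T" "z \<in> Ch T j" "y = x * z * inverse x * inverse z" by auto
  then have "\<delta> y \<le> 2 * \<delta> x * \<delta> z" using \<delta>_comm[of x z] T Ch_L[OF T(1), of j] by auto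
  also have "\<dots> \<le> 1 * \<delta> z"
    using T(2)[OF xz(1)] \<epsilon> \<delta>_nonneg[of z] xz Ch_L[OF T(1), of j] by (intro mult_right_mono) auto
  finally show ?case using Suc.IH[OF xz(2)] by simp
qed (use T in auto)

text \<open>The inner commutators of a nonvanishing one are its rungs. Lengths obey
  \<open>len y \<le> 2 * l + 2 * len z\<close>, so \<open>len + 2 * l\<close> at most doubles with
  each nesting; this explains the summand \<open>2 * l\<close> in the bound.\<close>

lemma Ch_ladder:
  assumes T: "T \<subseteq> L" "\<And>t. t \<in> T \<Longrightarrow> \<delta> t \<le> \<epsilon>" "\<And>t. t \<in> T \<Longrightarrow> len t \<le> l" and \<epsilon>: "0 < \<epsilon>" "2 * \<epsilon> \<le> 1"
  shows "y \<in> Ch T m \<Longrightarrow> \<delta> y > 0 \<Longrightarrow> \<exists>ys. length ys = Suc m \<and> ys ! m = y \<and> set ys \<subseteq> L \<and>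
    (\<forall>z\<in>set ys. 0 < \<delta> z \<and> \<delta> z \<le> \<epsilon>) \<and> (\<forall>i. Suc i < length ys \<longrightarrow> \<delta> (ys ! Suc i) \<le> 2 * \<epsilon> * \<delta> (ys ! i)) \<and>
    (\<forall>i<length ys. len (ys ! i) + 2 * l \<le> 4 * l * 2 ^ i)"
proof (induction m arbitrary: y)
  case 0
  then show ?case using T by (intro exI[of _ "[y]"]) fastforce
next
  case (Suc m)
  then obtain x z where xz: "x \<in> T" "z \<in> Ch T m" "y = x * z * inverse x * inverse z" by auto
  have xL: "x \<in> L" "z \<in> L" using xz T Ch_L[OF T(1), of m] by auto
  have yL: "y \<in> L" unfolding xz(3) by (intro sgrp_mult sgrp_inv L xL)
  have \<delta>y: "\<delta> y \<le> 2 * \<delta> x * \<delta> z" using \<delta>_comm[OF xL] xz by simp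
  then have zpos: "\<delta> z > 0"
    using Suc.prems(2) \<delta>_nonneg[OF xL(2)] by (cases "\<delta> z = 0") auto
  have ratio: "\<delta> y \<le> 2 * \<epsilon> * \<delta> z"
    by (rule order_trans[OF \<delta>y]) (use T(2)[OF xz(1)] zpos in \<open>intro mult_right_mono; simp\<close>)
  obtain ys where ys: "length ys = Suc m" "ys ! m = z" "set ys \<subseteq> L" "\<forall>z\<in>set ys. 0 < \<delta> z \<and> \<delta> z \<le> \<epsilon>"
    "\<forall>i. Suc i < length ys \<longrightarrow> \<delta> (ys ! Suc i) \<le> 2 * \<epsilon> * \<delta> (ys ! i)"
    "\<forall>i<length ys. len (ys ! i) + 2 * l \<le> 4 * l * 2 ^ i"
    using Suc.IH[OF xz(2) zpos] by blast
  have "len y \<le> len (x * z) + len (inverse x * inverse z)"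
    using len_mult[OF sgrp_mult[OF L xL] sgrp_mult[OF L sgrp_inv[OF L xL(1)] sgrp_inv[OF L xL(2)]]]
    by (simp add: xz(3) mult.assoc)
  also have "\<dots> \<le> (l + len z) + (l + len z)"
    using len_mult[OF xL] len_mult[OF sgrp_inv[OF L xL(1)] sgrp_inv[OF L xL(2)]]
      len_inv[OF xL(1)] len_inv[OF xL(2)] T(3)[OF xz(1)] by linarith
  finally have ly: "len y + 2 * l \<le> 4 * l * 2 ^ Suc m" using ys(1,2,6) by force
  show ?case
  proof (intro exI[of _ "ys @ [y]"] conjI allI impI ballI)
    show "(ys @ [y]) ! Suc m = y" using ys(1) by (simp add: nth_append)
    show "\<delta> ((ys @ [y]) ! Suc i) \<le> 2 * \<epsilon> * \<delta> ((ys @ [y]) ! i)" if "Suc i < length (ys @ [y])" for i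
    proof (cases "Suc i < length ys")
      case True
      then show ?thesis using ys(5) by (simp add: nth_append)
    next
      case False
      then have "i = m" using that ys(1) by simp
      then show ?thesis using ys(1,2) ratio by (simp add: nth_append)
    qed
    show "len ((ys @ [y]) ! i) + 2 * l \<le> 4 * l * 2 ^ i" if "i < length (ys @ [y])" for i
    proof (cases "i < length ys")
      case True
      then show ?thesis using ys(6) by (simp add: nth_append)
    next
      case False
      then have "i = Suc m" using that ys(1) by simp
      then show ?thesis using ys(1) ly by (simp add: nth_append)
    qed
    show "0 < \<delta> u" "\<delta> u \<le> \<epsilon>" if "u \<in> set (ys @ [y])" for u
      using that ys(4) Suc.prems Ch_\<delta>[OF T(1,2) \<epsilon> Suc.prems(1)] by auto
  qed (use ys yL in auto)
qed

text \<open>Iterated commutators shrink geometrically, so nonvanishing ones would form ladders, whose words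
  are too many for the polynomial bound \<open>count\<close>.\<close>

lemma Ch_vanishes:
  assumes T: "finite T" "T \<subseteq> L" "\<And>t. t \<in> T \<Longrightarrow> \<delta> t \<le> \<epsilon>" and \<epsilon>: "0 < \<epsilon>" "32 * 2 ^ Suc D * \<epsilon> \<le> 1"
  shows "\<exists>m. \<forall>y\<in>Ch T m. \<delta> y = 0"
proof (rule ccontr)
  assume neg: "\<not> ?thesis"
  \<comment> \<open>Words with exponents up to \<open>A\<close> along \<open>m + 1\<close> rungs
    number at least \<open>2 ^ (m * (D + 1))\<close>, while their length is of order
    \<open>2 ^ m\<close>, for which the count allows only order \<open>2 ^ (m * D)\<close>. The
    surplus \<open>2 ^ m\<close> gives the contradiction.\<close>
  define A :: nat where "A = 2 ^ Suc D"
  have A: "A \<ge> 1" "32 * real A * \<epsilon> \<le> 1" using \<epsilon> by (simp_all add: A_def)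
  have "1 * (32 * \<epsilon>) \<le> real A * (32 * \<epsilon>)" using \<epsilon> A by (intro mult_right_mono) auto
  then have \<epsilon>2: "2 * \<epsilon> \<le> 1" using A(2) by simp
  define l where "l = Max (len ` T)"
  have l: "len t \<le> l" if "t \<in> T" for t using T(1) that by (simp add: l_def)
  have bound: "2 ^ m \<le> K * (8 * real A * real l + 1) ^ D" for m
  proof -
    obtain y where y: "y \<in> Ch T m" "\<delta> y \<noteq> 0" using neg by blast
    then have "\<delta> y > 0" using \<delta>_nonneg[of y] Ch_L[OF T(2), of m] by force
    then obtain ys where ys: "length ys = Suc m" "set ys \<subseteq> L" "\<forall>z\<in>set ys. 0 < \<delta> z \<and> \<delta> z \<le> \<epsilon>"
      "\<forall>i. Suc i < length ys \<longrightarrow> \<delta> (ys ! Suc i) \<le> 2 * \<epsilon> * \<delta> (ys ! i)"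
      "\<forall>i<length ys. len (ys ! i) + 2 * l \<le> 4 * l * 2 ^ i"
      using Ch_ladder[OF T(2,3) l \<epsilon>(1) \<epsilon>2 y(1)] by blast
    have sep: "\<delta> (inverse (ladder_word ys as) * ladder_word ys as') > 0"
      if "as \<in> admissible A (Suc m)" "as' \<in> admissible A (Suc m)" "as \<noteq> as'" for as as'
      by (rule ladder_separated(2)[OF \<epsilon>(1) A(2,1) ys(2)]) (use ys that in auto)
    have fin: "finite (admissible A (Suc m))" and card: "card (admissible A (Suc m)) = (A + 1) ^ Suc m"
      using finite_lists_length_eq[of "{..A}" "Suc m"] card_lists_length_eq[of "{..A}" "Suc m"] by (auto simp: admissible_def)
    have inj: "inj_on (ladder_word ys) (admissible A (Suc m))"
    proof (rule inj_onI, rule ccontr)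
      fix as as' assume "as \<in> admissible A (Suc m)" "as' \<in> admissible A (Suc m)"
        "ladder_word ys as = ladder_word ys as'" "as \<noteq> as'"
      then show False using sep[of as as'] \<delta>_one by simp
    qed
    define n where "n = A * (4 * l * 2 ^ Suc m)"
    have "sum_list (map len ys) = (\<Sum>i<Suc m. len (ys ! i))"
      using ys(1) by (simp add: sum_list_sum_nth atLeast0LessThan)
    also have "\<dots> \<le> (\<Sum>i<Suc m. 4 * l * 2 ^ i)" using ys(1,5) by (intro sum_mono) force
    also have "\<dots> = 4 * l * (\<Sum>i<Suc m. 2 ^ i)" by (rule sum_distrib_left[symmetric])
    also have "(\<Sum>i<Suc m. (2::nat) ^ i) \<le> 2 ^ Suc m" using sum_power2[of "Suc m"] by (simp add: atLeast0LessThan)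
    finally have sl: "sum_list (map len ys) \<le> 4 * l * 2 ^ Suc m" by simp
    have len: "len (ladder_word ys as) \<le> n" if "as \<in> admissible A (Suc m)" for as
    proof -
      have "len (ladder_word ys as) \<le> A * sum_list (map len ys)" using len_ladder_word[OF ys(2)] that ys(1) by simp
      also have "\<dots> \<le> n" unfolding n_def using sl by (rule mult_le_mono2)
      finally show ?thesis .
    qed
    have "real (card (ladder_word ys ` admissible A (Suc m))) \<le> K * (real n + 1) ^ D"
    proof (rule count)
      show "0 < \<delta> (inverse g * h)" if gh: "g \<in> ladder_word ys ` admissible A (Suc m)"
        "h \<in> ladder_word ys ` admissible A (Suc m)" "g \<noteq> h" for g h
      proof -
        obtain as as' where "as \<in> admissible A (Suc m)" "g = ladder_word ys as"
          "as' \<in> admissible A (Suc m)" "h = ladder_word ys as'" using gh by blast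
        then show ?thesis using sep[of as as'] gh(3) by metis
      qed
    qed (use fin len ladder_word_L[OF ys(2)] in auto)
    then have c: "real ((A + 1) ^ Suc m) \<le> K * (real n + 1) ^ D" using card_image[OF inj] card by simp
    have K0: "K \<ge> 0"
    proof -
      have "0 < (A + 1) ^ Suc m" by (rule zero_less_power) simp
      then have "0 < real ((A + 1) ^ Suc m)" by (simp only: of_nat_0_less_iff)
      then have "0 < K * (real n + 1) ^ D" using c by linarith
      then show ?thesis by (simp add: zero_less_mult_iff)
    qed
    have "real n + 1 \<le> (8 * real A * real l + 1) * 2 ^ m"
      by (simp add: n_def algebra_simps)
    then have "(real n + 1) ^ D \<le> ((8 * real A * real l + 1) * 2 ^ m) ^ D" by (intro power_mono) auto
    then have "K * (real n + 1) ^ D \<le> K * ((8 * real A * real l + 1) * 2 ^ m) ^ D" using K0 by (rule mult_left_mono)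
    with c have "real ((A + 1) ^ Suc m) \<le> K * (8 * real A * real l + 1) ^ D * (2 ^ m) ^ D"
      by (simp add: power_mult_distrib mult.assoc)
    moreover have "2 ^ m * (2 ^ m) ^ D \<le> real ((A + 1) ^ Suc m)"
    proof -
      have "(2 ^ m * (2 ^ m) ^ D :: nat) = (2 ^ Suc D) ^ m"
        by (simp add: power_mult[symmetric] power_add[symmetric] mult.commute)
      also have "\<dots> \<le> (A + 1) ^ m" by (intro power_mono) (auto simp: A_def)
      also have "\<dots> \<le> (A + 1) ^ Suc m" by (intro power_increasing) auto
      finally have "real (2 ^ m * (2 ^ m) ^ D) \<le> real ((A + 1) ^ Suc m)" by (rule of_nat_mono)
      then show ?thesis by simp
    qed
    ultimately have "2 ^ m * (2 ^ m) ^ D \<le> K * (8 * real A * real l + 1) ^ D * (2 ^ m) ^ D" by (rule order_trans[rotated])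
    then show ?thesis by (rule mult_right_le_imp_le) simp
  qed
  obtain m where "K * (8 * real A * real l + 1) ^ D < 2 ^ m" using real_arch_pow[of 2] by auto
  then show False using bound[of m] by linarith
qed

text \<open>Descends from vanishing commutators of high weight to those of weight 2. If all
  commutators of the next weight lie in \<open>Ker\<close>, then \<open>y = [x, u]\<close> commutes
  with \<open>x\<close> modulo \<open>Ker\<close>, so \<open>y ^ n\<close> agrees with
  \<open>[x ^ n, u]\<close>, which stays within \<open>2 * \<delta> u\<close> of the identity for
  all \<open>n\<close>; thus \<open>y \<in> Ker\<close> by \<open>no_small_subgroups\<close>. The
  radius solves \<open>32 * 2 ^ Suc D * \<epsilon> = 1\<close>.\<close>

lemma near_identity_commute:
  assumes g: "g \<in> L" "\<delta> g \<le> 1 / (64 * 2 ^ D)" and h: "h \<in> L" "\<delta> h \<le> 1 / (64 * 2 ^ D)"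
  shows "g * h * inverse g * inverse h \<in> Ker"
proof -
  define \<epsilon> :: real where "\<epsilon> = 1 / (64 * 2 ^ D)"
  have \<epsilon>: "0 < \<epsilon>" "32 * 2 ^ Suc D * \<epsilon> \<le> 1" by (simp_all add: \<epsilon>_def)
  have "(1::real) \<le> 2 ^ D" by simp
  then have \<epsilon>': "64 * \<epsilon> \<le> 1" by (simp add: \<epsilon>_def field_simps)
  define T where "T = {g, h}"
  have T: "finite T" "T \<subseteq> L" "\<And>t. t \<in> T \<Longrightarrow> \<delta> t \<le> \<epsilon>" using g h by (auto simp: T_def \<epsilon>_def)
  obtain m where "\<forall>y\<in>Ch T m. \<delta> y = 0" using Ch_vanishes[OF T \<epsilon>] by blast
  then have Km: "Ch T m \<subseteq> Ker" using Ch_L[OF T(2), of m] by (auto simp: Ker_def)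
  have down: "Ch T (Suc j) \<subseteq> Ker" if "Ch T (Suc (Suc j)) \<subseteq> Ker" for j
  proof
    fix y assume y: "y \<in> Ch T (Suc j)"
    then obtain x u where xu: "x \<in> T" "u \<in> Ch T j" "y = x * u * inverse x * inverse u" by auto
    have L': "x \<in> L" "u \<in> L" "y \<in> L"
      using xu(1,2) T(2) y Ch_L[OF T(2), of j] Ch_L[OF T(2), of "Suc j"] by blast+
    have "x * y * inverse x * inverse y \<in> Ch T (Suc (Suc j))"
      unfolding Ch.simps(2)[of T "Suc j"] using xu(1) y by blast
    then have xy: "x * y * inverse x * inverse y \<in> Ker" using that by blast
    have xyn: "x * y ^ n * inverse x * inverse (y ^ n) \<in> Ker" for n
    proof (induction n)
      case 0
      then show ?case using sgrp_one[OF sgrp_Ker] by simp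
    next
      case (Suc n)
      define k where "k = x * y ^ n * inverse x * inverse (y ^ n)"
      have "x * y ^ Suc n * inverse x * inverse (y ^ Suc n) =
        (x * y * inverse x * inverse y) * (y * k * inverse y)"
        by (simp add: k_def grp_inv_mult mult.assoc)
      also have "\<dots> \<in> Ker" using Suc unfolding k_def[symmetric]
        by (intro sgrp_mult[OF sgrp_Ker xy] Ker_conj L')
      finally show ?case .
    qed
    have pow: "inverse (y ^ n) * (x ^ n * u * inverse (x ^ n) * inverse u) \<in> Ker" for n
    proof (induction n)
      case 0
      then show ?case using sgrp_one[OF sgrp_Ker] by simp
    next
      case (Suc n)
      define k where "k = inverse (y ^ n) * (x ^ n * u * inverse (x ^ n) * inverse u)"
      define c where "c = x * y ^ n * inverse x * inverse (y ^ n)"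
      define v where "v = x * u * inverse x * inverse u"
      have "x ^ Suc n * u * inverse (x ^ Suc n) * inverse u = x * (y ^ n * k) * (inverse x * v)"
        by (simp add: k_def v_def grp_inv_mult mult.assoc)
      also have "\<dots> = c * y ^ n * (x * k * inverse x) * y"
        by (simp add: c_def v_def flip: xu(3)) (simp add: xu(3) mult.assoc)
      finally have "inverse (y ^ Suc n) * (x ^ Suc n * u * inverse (x ^ Suc n) * inverse u) =
        inverse (y ^ Suc n) * c * y ^ Suc n * (inverse y * (x * k * inverse x) * y)"
        by (simp add: power_Suc2 mult.assoc del: power_Suc)
      also have "\<dots> \<in> Ker"
      proof (rule sgrp_mult[OF sgrp_Ker])
        have "inverse (y ^ Suc n) * c * inverse (inverse (y ^ Suc n)) \<in> Ker"
          unfolding c_def by (intro Ker_conj xyn sgrp_inv[OF L] sgrp_power[OF L] L')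
        then show "inverse (y ^ Suc n) * c * y ^ Suc n \<in> Ker" by simp
        have "inverse y * (x * k * inverse x) * inverse (inverse y) \<in> Ker"
          using Suc unfolding k_def[symmetric] by (intro Ker_conj sgrp_inv[OF L] L')
        then show "inverse y * (x * k * inverse x) * y \<in> Ker" by simp
      qed
      finally show ?case .
    qed
    have "\<delta> (y ^ n) \<le> 1 / 16" for n
    proof -
      have "\<delta> (y ^ n) = \<delta> (x ^ n * u * inverse (x ^ n) * inverse u)"
        by (rule Ker_\<delta>[OF _ _ pow]) (intro sgrp_mult sgrp_power sgrp_inv L L')+
      also have "\<dots> \<le> \<delta> (x ^ n * u * inverse (x ^ n)) + \<delta> (inverse u)"
        by (intro \<delta>_mult sgrp_mult sgrp_power sgrp_inv L L')
      also have "\<dots> = 2 * \<delta> u" using \<delta>_conj[OF L'(2) sgrp_power[OF L L'(1)]] \<delta>_inv[OF L'(2)] by simp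
      also have "\<delta> u \<le> \<epsilon>" by (rule Ch_\<delta>[OF T(2,3) \<epsilon>(1) _ xu(2)]) (use \<epsilon>' \<epsilon>(1) in auto)
      finally show ?thesis using \<epsilon>' by simp
    qed
    then show "y \<in> Ker" using no_small_subgroups[OF L'(3)] L'(3) by (simp add: Ker_def)
  qed
  have "Ch T (Suc m) \<subseteq> Ker"
  proof
    fix y assume "y \<in> Ch T (Suc m)"
    then obtain x u where xu: "x \<in> T" "u \<in> Ch T m" "y = x * u * inverse x * inverse u" by auto
    then have "x * u * inverse x \<in> Ker" "inverse u \<in> Ker"
      using Km T(2) sgrp_inv[OF sgrp_Ker, of u] Ker_conj[of u x] by blast+
    then show "y \<in> Ker" unfolding xu(3) by (rule sgrp_mult[OF sgrp_Ker])
  qed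
  then have "Ch T (Suc 0) \<subseteq> Ker"
    by (induction m) (use down in auto)
  then show ?thesis by (auto simp: T_def)
qed

end

section \<open>The action on Lipschitz harmonic functions\<close>

text \<open>The elements commuting with a given one modulo the normal subgroup \<open>N\<close> form
  a subgroup; this is used once in each variable.\<close>

lemma abel_mod_gen:
  assumes L: "sgrp L" and S: "S \<subseteq> L" and N: "sgrp N" "N \<subseteq> L"
    and normal: "\<And>g h. g \<in> N \<Longrightarrow> h \<in> L \<Longrightarrow> h * g * inverse h \<in> N"
    and comm: "\<And>s t. s \<in> S \<Longrightarrow> t \<in> S \<Longrightarrow> s * t * inverse s * inverse t \<in> N"
  shows "abel_mod (gen S) (N \<inter> gen S)"
proof -
  have cent: "sgrp {h \<in> L. a * h * inverse a * inverse h \<in> N}" if a: "a \<in> L" for a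
  proof (rule sgrpI)
    show "1 \<in> {h \<in> L. a * h * inverse a * inverse h \<in> N}" using sgrp_one[OF L] sgrp_one[OF N(1)] by simp
    fix h assume h: "h \<in> {h \<in> L. a * h * inverse a * inverse h \<in> N}"
    have "inverse h * inverse (a * h * inverse a * inverse h) * inverse (inverse h) \<in> N"
      using h by (intro normal sgrp_inv[OF N(1)] sgrp_inv[OF L]) auto
    then show "inverse h \<in> {h \<in> L. a * h * inverse a * inverse h \<in> N}"
      using h sgrp_inv[OF L] by (simp add: grp_inv_mult mult.assoc)
    fix k assume k: "k \<in> {h \<in> L. a * h * inverse a * inverse h \<in> N}"
    have "h * (a * k * inverse a * inverse k) * inverse h \<in> N" using h k by (intro normal) auto
    then have "(a * h * inverse a * inverse h) * (h * (a * k * inverse a * inverse k) * inverse h) \<in> N"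
      using h sgrp_mult[OF N(1)] by blast
    then show "h * k \<in> {h \<in> L. a * h * inverse a * inverse h \<in> N}"
      using h k sgrp_mult[OF L] by (simp add: grp_inv_mult mult.assoc)
  qed
  have sym: "h * a * inverse h * inverse a \<in> N" if "a * h * inverse a * inverse h \<in> N" for a h
    using sgrp_inv[OF N(1) that] by (simp add: grp_inv_mult mult.assoc)
  have gL: "gen S \<subseteq> L" by (rule gen_least[OF L S])
  have 1: "gen S \<subseteq> {h \<in> L. s * h * inverse s * inverse h \<in> N}" if "s \<in> S" for s
    by (rule gen_least[OF cent]) (use that S comm in auto)
  have 2: "gen S \<subseteq> {h \<in> L. g * h * inverse g * inverse h \<in> N}" if "g \<in> gen S" for g
  proof (rule gen_least[OF cent])
    show "S \<subseteq> {h \<in> L. g * h * inverse g * inverse h \<in> N}" using 1 that S sym by blast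
  qed (use that gL in blast)
  have "g * h * inverse g * inverse h \<in> gen S" if "g \<in> gen S" "h \<in> gen S" for g h
    by (intro sgrp_mult[OF sgrp_gen] sgrp_inv[OF sgrp_gen] that)
  then show ?thesis using 2 sgrp_Int[OF N(1) sgrp_gen] sgrp_gen unfolding abel_mod_def by blast
qed

section \<open>Contraction for the action on Lipschitz harmonic functions\<close>

context walk
begin

lemma B_trans: "y \<in> B m x \<Longrightarrow> z \<in> B n y \<Longrightarrow> z \<in> B (m + n) x"
  by (induction m arbitrary: x) auto

lemma B_sym: "x \<in> S \<Longrightarrow> y \<in> B n x \<Longrightarrow> x \<in> B n y"
proof (induction n arbitrary: x)
  case (Suc n)
  then obtain s where s: "s \<in> N x" "y \<in> B n s" by auto
  then have "s \<in> B n y" using Suc N_in by blast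
  moreover have "x \<in> B 1 s" using N_sym[OF Suc.prems(1) s(1)] by auto
  ultimately show ?case using B_trans[of s n y x 1] by simp
qed simp

definition dtr :: "'g \<Rightarrow> ('x \<Rightarrow> real) \<Rightarrow> 'x \<Rightarrow> real" where
  "dtr g f x = tr g f x - f x"

text \<open>The operator norm of \<open>tr g - 1\<close> on the quotient of \<open>LH\<close> by the
  functions of norm 0.\<close>

definition \<delta> :: "'g \<Rightarrow> real" where
  "\<delta> g = Sup {nm (dtr g f) | f. f \<in> LH \<and> nm f \<le> 1}"

definition len :: "'g \<Rightarrow> nat" where
  "len g = (LEAST n. g \<star> b \<in> B n b)"

lemma dtr_LH: "g \<in> L \<Longrightarrow> f \<in> LH \<Longrightarrow> dtr g f \<in> LH"
  unfolding dtr_def[abs_def] by (intro LH_diff tr_LH)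

lemma nm_zero: "nm (\<lambda>_. c) = 0"
  by (simp add: nm_def G_zero)

lemma nm_minus: "f \<in> LH \<Longrightarrow> nm (\<lambda>x. - f x) = nm f"
  using nm_cmult[of f "- 1"] by simp

lemma LH_cmult: "f \<in> LH \<Longrightarrow> (\<lambda>x. c * f x) \<in> LH"
  using LH_lin[of f "\<lambda>_. 0" c] LH_zero[of 0] by simp

lemma nm_dtr_le: "g \<in> L \<Longrightarrow> f \<in> LH \<Longrightarrow> nm (dtr g f) \<le> 2 * nm f"
  unfolding dtr_def[abs_def] using nm_diff[OF tr_LH, of g f f] nm_tr[of g f] by simp

lemma \<delta>_bdd: "g \<in> L \<Longrightarrow> bdd_above {nm (dtr g f) | f. f \<in> LH \<and> nm f \<le> 1}"
  by (rule bdd_aboveI[of _ 2]) (use nm_dtr_le in fastforce)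

lemma \<delta>_upper:
  assumes g: "g \<in> L" and f: "f \<in> LH"
  shows "nm (dtr g f) \<le> \<delta> g * nm f"
proof (cases "nm f = 0")
  case True
  then show ?thesis using nm_dtr_le[OF g f] by simp
next
  case False
  then have pos: "nm f > 0" using nm_nonneg[OF f] by simp
  define h where "h x = (1 / nm f) * f x" for x
  have h: "h \<in> LH" unfolding h_def[abs_def] by (rule LH_cmult[OF f])
  have "nm h = 1" using nm_cmult[OF f, of "1 / nm f"] pos by (simp add: h_def[abs_def])
  then have "nm (dtr g h) \<le> \<delta> g"
    unfolding \<delta>_def using h by (intro cSup_upper \<delta>_bdd[OF g]) auto
  moreover have "dtr g h = (\<lambda>x. (1 / nm f) * dtr g f x)"
    by (simp add: dtr_def tr_def h_def fun_eq_iff diff_divide_distrib)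
  then have "nm (dtr g h) = (1 / nm f) * nm (dtr g f)"
    using nm_cmult[OF dtr_LH[OF g f], of "1 / nm f"] pos by simp
  ultimately show ?thesis using pos by (simp add: field_simps)
qed

lemma \<delta>_least:
  assumes "c \<ge> 0" "\<And>f. f \<in> LH \<Longrightarrow> nm (dtr g f) \<le> c * nm f"
  shows "\<delta> g \<le> c"
  unfolding \<delta>_def
proof (rule cSup_least)
  show "{nm (dtr g f) | f. f \<in> LH \<and> nm f \<le> 1} \<noteq> {}"
    using LH_zero[of 0] nm_zero[of 0] by (auto intro!: exI[of _ "\<lambda>_. 0"])
  fix r assume "r \<in> {nm (dtr g f) | f. f \<in> LH \<and> nm f \<le> 1}"
  then obtain f where f: "f \<in> LH" "nm f \<le> 1" "r = nm (dtr g f)" by blast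
  then have "r \<le> c * nm f" using assms by simp
  also have "\<dots> \<le> c" using mult_left_mono[OF f(2) assms(1)] by simp
  finally show "r \<le> c" .
qed

lemma \<delta>_nonneg:
  assumes g: "g \<in> L" shows "\<delta> g \<ge> 0"
proof -
  have "dtr g (\<lambda>_. 0) = (\<lambda>_. 0)" by (simp add: dtr_def tr_def fun_eq_iff)
  then have "0 \<in> {nm (dtr g f) | f. f \<in> LH \<and> nm f \<le> 1}"
    using LH_zero[of 0] nm_zero[of 0] by (auto intro!: exI[of _ "\<lambda>_. 0"])
  then show ?thesis unfolding \<delta>_def by (rule cSup_upper[OF _ \<delta>_bdd[OF g]])
qed

lemma \<delta>_mult:
  assumes g: "g \<in> L" and h: "h \<in> L"
  shows "\<delta> (g * h) \<le> \<delta> g + \<delta> h"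
proof (rule \<delta>_least)
  show "0 \<le> \<delta> g + \<delta> h" using \<delta>_nonneg g h by simp
  fix f assume f: "f \<in> LH"
  have "dtr (g * h) f = (\<lambda>x. tr g (dtr h f) x + dtr g f x)"
    by (simp add: dtr_def tr_mult fun_eq_iff) (simp add: tr_def dtr_def)
  then have "nm (dtr (g * h) f) \<le> nm (tr g (dtr h f)) + nm (dtr g f)"
    using nm_triangle[OF tr_LH[OF g dtr_LH[OF h f]] dtr_LH[OF g f]] by simp
  also have "\<dots> \<le> \<delta> h * nm f + \<delta> g * nm f"
    using nm_tr[OF g dtr_LH[OF h f]] \<delta>_upper[OF h f] \<delta>_upper[OF g f] by simp
  finally show "nm (dtr (g * h) f) \<le> (\<delta> g + \<delta> h) * nm f" by (simp add: algebra_simps)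
qed

lemma \<delta>_eqI:
  assumes g: "g \<in> L" and h: "h \<in> L" 
    and "\<And>f. f \<in> LH \<Longrightarrow> \<exists>f'\<in>LH. nm f' = nm f \<and> nm (dtr h f) = nm (dtr g f')"
  shows "\<delta> h \<le> \<delta> g"
proof (rule \<delta>_least[OF \<delta>_nonneg[OF g]])
  fix f assume "f \<in> LH"
  then obtain f' where "f' \<in> LH" "nm f' = nm f" "nm (dtr h f) = nm (dtr g f')" using assms by blast
  then show "nm (dtr h f) \<le> \<delta> g * nm f" using \<delta>_upper[OF g, of f'] by simp
qed

lemma nm_dtr_inv: 
  assumes g: "g \<in> L" and f: "f \<in> LH" shows "nm (dtr (inverse g) f) = nm (dtr g f)"
proof -
  have gi: "inverse g \<in> L" by (rule sgrp_inv[OF L g])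
  have "dtr (inverse g) f = tr (inverse g) (\<lambda>x. - dtr g f x)"
    by (simp add: dtr_def tr_def fun_eq_iff)
  moreover have "(\<lambda>x. - dtr g f x) \<in> LH" using LH_cmult[OF dtr_LH[OF g f], of "- 1"] by simp
  ultimately show ?thesis using nm_tr[OF gi] nm_minus[OF dtr_LH[OF g f]] by simp
qed

lemma \<delta>_inv: 
  assumes g: "g \<in> L" shows "\<delta> (inverse g) = \<delta> g"
proof (rule antisym)
  have gi: "inverse g \<in> L" by (rule sgrp_inv[OF L g])
  show "\<delta> (inverse g) \<le> \<delta> g" by (rule \<delta>_eqI[OF g gi]) (use nm_dtr_inv[OF g] in auto)
  show "\<delta> g \<le> \<delta> (inverse g)" by (rule \<delta>_eqI[OF gi g]) (use nm_dtr_inv[OF g] in auto)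
qed

lemma \<delta>_conj_le:
  assumes g: "g \<in> L" and h: "h \<in> L"
  shows "\<delta> (h * g * inverse h) \<le> \<delta> g"
proof (rule \<delta>_eqI[OF g sgrp_conj[OF L h g]])
  fix f assume f: "f \<in> LH"
  have hi: "inverse h \<in> L" by (rule sgrp_inv[OF L h])
  have "dtr (h * g * inverse h) f = tr h (dtr g (tr (inverse h) f))"
    by (simp add: dtr_def tr_mult fun_eq_iff) (simp add: tr_def dtr_def)
  then have "nm (dtr (h * g * inverse h) f) = nm (dtr g (tr (inverse h) f))"
    using nm_tr[OF h dtr_LH[OF g tr_LH[OF hi f]]] by simp
  then show "\<exists>f'\<in>LH. nm f' = nm f \<and> nm (dtr (h * g * inverse h) f) = nm (dtr g f')"
    using tr_LH[OF hi f] nm_tr[OF hi f] by blast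
qed

lemma \<delta>_conj:
  assumes g: "g \<in> L" and h: "h \<in> L"
  shows "\<delta> (h * g * inverse h) = \<delta> g"
proof (rule antisym[OF \<delta>_conj_le[OF assms]])
  have "\<delta> (inverse h * (h * g * inverse h) * inverse (inverse h)) \<le> \<delta> (h * g * inverse h)"
    by (intro \<delta>_conj_le sgrp_conj[OF L h g] sgrp_inv[OF L h])
  then show "\<delta> g \<le> \<delta> (h * g * inverse h)" by (simp add: mult.assoc)
qed

text \<open>With \<open>k = inverse g * inverse h\<close>, the operator of the commutator minus 1 is
  \<open>(g - 1) (h - 1) - (h - 1) (g - 1)\<close> applied after the isometry
  \<open>tr k\<close>.\<close>

lemma \<delta>_comm:
  assumes g: "g \<in> L" and h: "h \<in> L"
  shows "\<delta> (g * h * inverse g * inverse h) \<le> 2 * \<delta> g * \<delta> h"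
proof (rule \<delta>_least)
  show "0 \<le> 2 * \<delta> g * \<delta> h" using \<delta>_nonneg g h by simp
  fix f assume f: "f \<in> LH"
  define k where "k = inverse g * inverse h"
  have kL: "k \<in> L" unfolding k_def by (intro sgrp_mult sgrp_inv L g h)
  define f' where "f' = tr k f"
  have f': "f' \<in> LH" "nm f' = nm f" using tr_LH[OF kL f] nm_tr[OF kL f] by (auto simp: f'_def)
  have ff': "f = tr (h * g) f'" by (simp add: f'_def k_def mult.assoc tr_one flip: tr_mult)
  have "dtr (g * h * inverse g * inverse h) f = (\<lambda>x. tr (g * h) f' x - tr (h * g) f' x)"
    unfolding dtr_def ff'[symmetric] by (simp add: f'_def k_def mult.assoc flip: tr_mult)
  also have "\<dots> = (\<lambda>x. dtr g (dtr h f') x - dtr h (dtr g f') x)"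
    by (simp add: dtr_def tr_mult fun_eq_iff) (simp add: tr_def dtr_def)
  finally have "nm (dtr (g * h * inverse g * inverse h) f) \<le> nm (dtr g (dtr h f')) + nm (dtr h (dtr g f'))"
    using nm_diff[OF dtr_LH[OF g dtr_LH[OF h f'(1)]] dtr_LH[OF h dtr_LH[OF g f'(1)]]] by simp
  also have "\<dots> \<le> \<delta> g * (\<delta> h * nm f') + \<delta> h * (\<delta> g * nm f')"
    using \<delta>_upper g h f'(1) dtr_LH \<delta>_nonneg
    by (intro add_mono order_trans[OF \<delta>_upper] mult_left_mono) auto
  finally show "nm (dtr (g * h * inverse g * inverse h) f) \<le> 2 * \<delta> g * \<delta> h * nm f" by (simp add: f'(2) mult_ac)
qed

lemma \<delta>_one: "\<delta> 1 = 0"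
proof (rule antisym[OF \<delta>_least \<delta>_nonneg[OF sgrp_one[OF L]]])
  show "nm (dtr 1 f) \<le> 0 * nm f" for f
    using nm_zero[of 0] by (simp add: dtr_def[abs_def] tr_one)
qed simp

text \<open>First order expansion: \<open>g ^ n - 1\<close> differs from \<open>n * (g - 1)\<close>
  at \<open>f\<close> by at most \<open>n\<^sup>2 * \<delta> g\<close> times the norm of
  \<open>(g - 1) f\<close>; as long as \<open>n * \<delta> g \<le> 1 / 2\<close>, this is at most
  half of the main term.\<close>

lemma \<delta>_pow:
  assumes g: "g \<in> L" and small: "real n * \<delta> g \<le> 1 / 2"
  shows "real n * \<delta> g \<le> 2 * \<delta> (g ^ n)"
proof (cases "n = 0")
  case True
  then show ?thesis by (simp add: \<delta>_one)
next
  case False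
  have pow: "\<delta> (g ^ n) \<le> real n * \<delta> g" for n
  proof (induction n)
    case (Suc n)
    then show ?case using \<delta>_mult[OF g sgrp_power[OF L g], of n] by (simp add: distrib_right)
  qed (simp add: \<delta>_one)
  have gn: "g ^ n \<in> L" for n by (rule sgrp_power[OF L g])
  have "\<delta> g \<le> 2 * \<delta> (g ^ n) / real n"
  proof (rule \<delta>_least)
    show "0 \<le> 2 * \<delta> (g ^ n) / real n" using \<delta>_nonneg[OF gn] by simp
    fix f assume f: "f \<in> LH"
    define v where "v = dtr g f"
    have v: "v \<in> LH" unfolding v_def by (rule dtr_LH[OF g f])
    have lin: "(\<lambda>x. dtr (g ^ m) f x - real m * v x) \<in> LH" for m
      by (intro LH_diff LH_cmult dtr_LH gn f v)
    have "nm (\<lambda>x. dtr (g ^ m) f x - real m * v x) \<le> (real m)\<^sup>2 * \<delta> g * nm v" for m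
    proof (induction m)
      case 0
      then show ?case using nm_zero[of 0] by (simp add: dtr_def[abs_def] tr_one)
    next
      case (Suc m)
      have "(\<lambda>x. dtr (g ^ Suc m) f x - real (Suc m) * v x) =
          (\<lambda>x. (dtr (g ^ m) f x - real m * v x) + dtr (g ^ m) v x)"
        by (simp add: dtr_def v_def tr_mult power_Suc2 fun_eq_iff algebra_simps del: power_Suc) (simp add: tr_def dtr_def)
      then have "nm (\<lambda>x. dtr (g ^ Suc m) f x - real (Suc m) * v x) \<le>
          nm (\<lambda>x. dtr (g ^ m) f x - real m * v x) + nm (dtr (g ^ m) v)"
        using nm_triangle[OF lin dtr_LH[OF gn v]] by simp
      also have "\<dots> \<le> (real m)\<^sup>2 * \<delta> g * nm v + real m * \<delta> g * nm v"
        using Suc \<delta>_upper[OF gn v, of m] mult_right_mono[OF pow[of m] nm_nonneg[OF v]] by linarith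
      also have "\<dots> = ((real m)\<^sup>2 + real m) * (\<delta> g * nm v)" by (simp add: algebra_simps)
      also have "\<dots> \<le> (real (Suc m))\<^sup>2 * (\<delta> g * nm v)"
        using \<delta>_nonneg[OF g] nm_nonneg[OF v] by (intro mult_right_mono) (auto simp: power2_eq_square algebra_simps)
      finally show ?case by (simp add: mult.assoc)
    qed
    note this[of n]
    also have "(real n)\<^sup>2 * \<delta> g * nm v = real n * (real n * \<delta> g) * nm v" by (simp add: power2_eq_square)
    also have "\<dots> \<le> real n * (1 / 2) * nm v"
      using small nm_nonneg[OF v] by (intro mult_right_mono mult_left_mono) auto
    finally have 1: "nm (\<lambda>x. dtr (g ^ n) f x - real n * v x) \<le> real n * (1 / 2) * nm v" .
    have "(\<lambda>x. real n * v x) = (\<lambda>x. dtr (g ^ n) f x - (dtr (g ^ n) f x - real n * v x))" by simp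
    then have "nm (\<lambda>x. real n * v x) \<le> nm (dtr (g ^ n) f) + nm (\<lambda>x. dtr (g ^ n) f x - real n * v x)"
      using nm_diff[OF dtr_LH[OF gn f] lin, of n n] by simp
    then have "real n * nm v \<le> \<delta> (g ^ n) * nm f + real n * (1 / 2) * nm v"
      using 1 \<delta>_upper[OF gn f, of n] nm_cmult[OF v, of "real n"] by simp
    then show "nm (dtr g f) \<le> 2 * \<delta> (g ^ n) / real n * nm f" using False by (simp add: v_def field_simps)
  qed
  then show ?thesis using False by (simp add: field_simps)
qed

lemma len_B:
  assumes g: "g \<in> L" shows "g \<star> b \<in> B (len g) b"
  unfolding len_def using conn[OF act_S[OF g b_in]] by (rule LeastI_ex)

lemma len_le: "g \<star> b \<in> B n b \<Longrightarrow> len g \<le> n"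
  unfolding len_def by (rule Least_le)

lemma len_one: "len 1 = 0"
  using len_le[of 1 0] by (simp add: act_one)

lemma len_mult:
  assumes g: "g \<in> L" and h: "h \<in> L" shows "len (g * h) \<le> len g + len h"
proof (rule len_le)
  have "g \<star> h \<star> b \<in> B (len h) (g \<star> b)" using len_B[OF h] B_act[OF g b_in] by auto
  then show "(g * h) \<star> b \<in> B (len g + len h) b" using B_trans[OF len_B[OF g]] by (simp add: act_mult)
qed

lemma len_inv:
  assumes g: "g \<in> L" shows "len (inverse g) \<le> len g"
proof (rule len_le)
  have gi: "inverse g \<in> L" by (rule sgrp_inv[OF L g])
  have "inverse g \<star> g \<star> b \<in> B (len g) (inverse g \<star> b)"
    unfolding B_act[OF gi b_in] by (rule imageI[OF len_B[OF g]])
  then show "inverse g \<star> b \<in> B (len g) b" using B_sym[OF act_S[OF gi b_in]] by simp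
qed

lemma \<delta>_zero_of_agree:
  assumes g: "g \<in> L" and h: "h \<in> L" and R: "\<And>f. f \<in> LH \<Longrightarrow> (\<And>x. x \<in> B R b \<Longrightarrow> f x = f b) \<Longrightarrow> nm f = 0"
    and agree: "\<And>x. x \<in> B R b \<Longrightarrow> inverse g \<star> x = inverse h \<star> x"
  shows "\<delta> (inverse g * h) = 0"
proof -
  have gi: "inverse g \<in> L" by (rule sgrp_inv[OF L g])
  have "\<delta> (inverse g * h) \<le> 0"
  proof (rule \<delta>_least)
    fix f assume f: "f \<in> LH"
    have "dtr (inverse g * h) f = tr (inverse g) (\<lambda>x. tr h f x - tr g f x)"
      by (simp add: dtr_def tr_mult fun_eq_iff) (simp add: tr_def dtr_def)
    moreover have d: "(\<lambda>x. tr h f x - tr g f x) \<in> LH" by (intro LH_diff tr_LH g h f)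
    moreover have "nm (\<lambda>x. tr h f x - tr g f x) = 0"
      by (rule R[OF d]) (simp add: tr_def agree B_self[OF b_in])
    ultimately show "nm (dtr (inverse g * h) f) \<le> 0 * nm f" using nm_tr[OF gi] by simp
  qed simp
  then show ?thesis using \<delta>_nonneg[OF sgrp_mult[OF L gi h]] by simp
qed

text \<open>Modulo the elements with \<open>\<delta> = 0\<close>, a group element is determined by
  the restriction of its inverse to the ball of radius \<open>R\<close> that detects harmonic
  functions. For length at most \<open>n\<close> this restriction maps into the ball of radius
  \<open>n + R\<close>, so the number of restrictions is bounded by a polynomial of degree
  \<open>e * M\<close>.\<close>

lemma contracting: "\<exists>K D. contracting L \<delta> len K D"
proof -
  obtain R where R: "\<And>f. f \<in> LH \<Longrightarrow> (\<And>x. x \<in> B R b \<Longrightarrow> f x = f b) \<Longrightarrow> nm f = 0"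
    using determined_by_ball by blast
  define M where "M = card (B R b)"
  have "contracting L \<delta> len ((C * (real R + 1) ^ e) ^ M) (e * M)"
  proof
    fix I n assume I: "finite I" "I \<subseteq> L" "\<And>g. g \<in> I \<Longrightarrow> len g \<le> n"
      "\<And>g h. g \<in> I \<Longrightarrow> h \<in> I \<Longrightarrow> g \<noteq> h \<Longrightarrow> \<delta> (inverse g * h) > 0"
    define Phi where "Phi g = restrict (\<lambda>x. inverse g \<star> x) (B R b)" for g
    have inj: "inj_on Phi I"
    proof (rule inj_onI, rule ccontr)
      fix g h assume gh: "g \<in> I" "h \<in> I" "Phi g = Phi h" "g \<noteq> h"
      then have "inverse g \<star> x = inverse h \<star> x" if "x \<in> B R b" for x
        using that by (metis Phi_def restrict_apply')
      then have "\<delta> (inverse g * h) = 0" using \<delta>_zero_of_agree[OF _ _ R] gh I(2) by blast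
      then show False using I(4)[OF gh(1,2,4)] by simp
    qed
    have im: "Phi ` I \<subseteq> PiE (B R b) (\<lambda>_. B (n + R) b)"
    proof (intro image_subsetI PiE_I)
      fix g x assume g: "g \<in> I" and x: "x \<in> B R b"
      have gL: "inverse g \<in> L" using g I(2) sgrp_inv[OF L] by blast
      have "len (inverse g) \<le> n" using len_inv[of g] I(2,3) g by fastforce
      then have "inverse g \<star> b \<in> B n b" using len_B[OF gL] B_mono[OF b_in] by blast
      moreover have "inverse g \<star> x \<in> B R (inverse g \<star> b)" using x B_act[OF gL b_in] by auto
      ultimately show "Phi g x \<in> B (n + R) b" using B_trans x by (auto simp: Phi_def)
    qed (simp add: Phi_def)
    have fin: "finite (PiE (B R b) (\<lambda>_. B (n + R) b))" by (intro finite_PiE B_fin b_in)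
    have "card I \<le> card (PiE (B R b) (\<lambda>_. B (n + R) b))" by (rule card_inj_on_le[OF inj im fin])
    also have "\<dots> = card (B (n + R) b) ^ M" by (simp add: card_PiE B_fin b_in M_def)
    finally have "real (card I) \<le> real (card (B (n + R) b)) ^ M" by (metis of_nat_le_iff of_nat_power)
    also have "\<dots> \<le> (C * (real (n + R) + 1) ^ e) ^ M" by (intro power_mono growth) auto
    also have "\<dots> \<le> (C * ((real R + 1) * (real n + 1)) ^ e) ^ M"
      using C_ge by (intro power_mono mult_left_mono) (auto simp: algebra_simps)
    also have "\<dots> = (C * (real R + 1) ^ e) ^ M * (real n + 1) ^ (e * M)"
      by (simp add: power_mult_distrib power_mult)
    finally show "real (card I) \<le> (C * (real R + 1) ^ e) ^ M * (real n + 1) ^ (e * M)" .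
  qed (use L \<delta>_nonneg \<delta>_one \<delta>_mult \<delta>_inv \<delta>_conj \<delta>_comm \<delta>_pow len_one len_mult len_inv in auto)
  then show ?thesis by blast
qed

text \<open>\<open>M\<close> is generated by the elements within \<open>\<epsilon>\<close> of the
  identity; these commute modulo the kernel, and \<open>totally_bounded\<close> makes the index
  finite. An element fixing \<open>b\<close> permutes the finite ball that detects harmonic
  functions, so the stabilizer acts through a finite group, which is the last claim.\<close>

lemma virtually_abelian_action:
  obtains M Z where "sgrp M" "M \<subseteq> L" "fi M L" "abel_mod M Z"
    "\<And>g f. g \<in> Z \<Longrightarrow> f \<in> LH \<Longrightarrow> nm (dtr g f) = 0" "fi (Z \<inter> {g \<in> M. g \<star> b = b}) {g \<in> M. g \<star> b = b}"
proof -
  obtain K D where "contracting L \<delta> len K D" using contracting by blast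
  then interpret c: contracting L \<delta> len K D .
  define \<epsilon> :: real where "\<epsilon> = 1 / (64 * 2 ^ D)"
  have \<epsilon>: "\<epsilon> > 0" by (simp add: \<epsilon>_def)
  define A where "A = {g \<in> L. \<delta> g \<le> \<epsilon>}"
  define M where "M = gen A"
  have MsubL: "M \<subseteq> L" unfolding M_def by (rule gen_least[OF L]) (auto simp: A_def)
  have ab: "abel_mod M (c.Ker \<inter> M)" unfolding M_def
    by (rule abel_mod_gen[OF L _ c.sgrp_Ker c.Ker_L]) (use c.Ker_conj c.near_identity_commute in \<open>auto simp: A_def \<epsilon>_def\<close>)
  obtain \<phi> :: "'g \<Rightarrow> nat \<Rightarrow> nat \<Rightarrow> int" where \<phi>: "finite (\<phi> ` L)"
    "\<And>g h f. g \<in> L \<Longrightarrow> h \<in> L \<Longrightarrow> \<phi> g = \<phi> h \<Longrightarrow> f \<in> LH \<Longrightarrow> nm (\<lambda>x. tr g f x - tr h f x) \<le> \<epsilon> * nm f"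
    using totally_bounded[OF \<epsilon>] by blast
  have "fi M L"
  proof (rule fiI[OF \<phi>(1)])
    fix g h assume gh: "g \<in> L" "h \<in> L" "\<phi> g = \<phi> h"
    have gi: "inverse g \<in> L" by (rule sgrp_inv[OF L gh(1)])
    have "\<delta> (inverse g * h) \<le> \<epsilon>"
    proof (rule \<delta>_least)
      fix f assume f: "f \<in> LH"
      have "dtr (inverse g * h) f = tr (inverse g) (\<lambda>x. tr h f x - tr g f x)"
        by (simp add: dtr_def tr_mult fun_eq_iff) (simp add: tr_def dtr_def)
      moreover have d: "(\<lambda>x. tr h f x - tr g f x) \<in> LH" by (intro LH_diff tr_LH gh f)
      ultimately show "nm (dtr (inverse g * h) f) \<le> \<epsilon> * nm f" using nm_tr[OF gi d] \<phi>(2)[OF gh(2,1) gh(3)[symmetric] f] by simp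
    qed (use \<epsilon> in simp)
    then show "inverse g * h \<in> M" unfolding M_def by (intro gen_incl) (use sgrp_mult[OF L gi gh(2)] in \<open>simp add: A_def\<close>)
  qed
  moreover have "nm (dtr g f) = 0" if "g \<in> c.Ker \<inter> M" "f \<in> LH" for g f
    using that \<delta>_upper[of g f] nm_nonneg[OF dtr_LH, of g f] by (auto simp: c.Ker_def)
  moreover have "fi ((c.Ker \<inter> M) \<inter> {g \<in> M. g \<star> b = b}) {g \<in> M. g \<star> b = b}"
  proof -
    obtain R where R: "\<And>f. f \<in> LH \<Longrightarrow> (\<And>x. x \<in> B R b \<Longrightarrow> f x = f b) \<Longrightarrow> nm f = 0"
      using determined_by_ball by blast
    define Phi where "Phi g = restrict (\<lambda>x. inverse g \<star> x) (B R b)" for g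
    show ?thesis
    proof (rule fiI[of Phi])
      have "Phi ` {g \<in> M. g \<star> b = b} \<subseteq> PiE (B R b) (\<lambda>_. B R b)"
      proof (intro image_subsetI PiE_I)
        fix g x assume g: "g \<in> {g \<in> M. g \<star> b = b}" and x: "x \<in> B R b"
        have gL: "inverse g \<in> L" using g MsubL sgrp_inv[OF L] by blast
        have "inverse g \<star> b = b" using g by (metis (mono_tags, lifting) act_inv(1) mem_Collect_eq)
        then show "Phi g x \<in> B R b" using x B_act[OF gL b_in, of R] by (auto simp: Phi_def)
      qed (simp add: Phi_def)
      then show "finite (Phi ` {g \<in> M. g \<star> b = b})"
        by (rule finite_subset) (intro finite_PiE B_fin b_in)
      fix g h assume g: "g \<in> {g \<in> M. g \<star> b = b}" and h: "h \<in> {g \<in> M. g \<star> b = b}" and eq: "Phi g = Phi h"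
      have "inverse g \<star> x = inverse h \<star> x" if "x \<in> B R b" for x
        using eq that by (metis Phi_def restrict_apply')
      then have "\<delta> (inverse g * h) = 0" using \<delta>_zero_of_agree[OF _ _ R] g h MsubL by blast
      moreover have "inverse g * h \<in> M" using g h by (auto simp: M_def intro!: sgrp_mult sgrp_inv sgrp_gen)
      moreover have "(inverse g * h) \<star> b = b" using g h by (metis (mono_tags, lifting) act_inv(1) act_mult mem_Collect_eq)
      ultimately show "inverse g * h \<in> (c.Ker \<inter> M) \<inter> {g \<in> M. g \<star> b = b}" using MsubL by (auto simp: c.Ker_def)
    qed
  qed
  ultimately show ?thesis using that[of M "c.Ker \<inter> M"] ab MsubL sgrp_gen[of A] M_def by blast
qed

text \<open>If \<open>M\<close> acts trivially modulo constants, it changes a harmonic function by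
  additive constants, and these form a homomorphism. Were it zero, \<open>f\<close> would be
  \<open>M\<close>-invariant, take finitely many values because the index is finite, and be constant
  by the Liouville property.\<close>

lemma translation_hom:
  assumes inf: "infinite S" and M: "sgrp M" "M \<subseteq> L" "fi M L"
    and triv: "\<And>g f. g \<in> M \<Longrightarrow> f \<in> LH \<Longrightarrow> nm (dtr g f) = 0"
  obtains \<theta> :: "'g \<Rightarrow> real" where "add_hom M \<theta>" "\<And>g. g \<in> M \<Longrightarrow> g \<star> b = b \<Longrightarrow> \<theta> g = 0" "\<exists>g\<in>M. \<theta> g \<noteq> 0"
proof -
  obtain f x where f: "harm f" "lip (2 / w0) f" and x: "x \<in> S" "f x \<noteq> f b"
    using exists_lipschitz_harmonic[OF inf] by blast
  then have fL: "f \<in> LH" by (auto simp: LH_def)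
  define \<theta> where "\<theta> g = dtr g f b" for g
  have const: "dtr g f y = \<theta> g" if g: "g \<in> M" and y: "y \<in> S" for g y
  proof -
    have gL: "g \<in> L" using g M by auto
    have "G (dtr g f) (dtr g f) = 0" using triv[OF g fL] nm_sq[OF dtr_LH[OF gL fL]] by simp
    then show ?thesis unfolding \<theta>_def by (rule G_zero_const[OF dtr_LH[OF gL fL] _ y])
  qed
  have "add_hom M \<theta>" unfolding add_hom_def
  proof (intro ballI)
    fix g h assume g: "g \<in> M" and h: "h \<in> M"
    have "inverse g \<star> b \<in> S" using g M sgrp_inv[OF L] act_S b_in by blast
    then have "dtr h f (inverse g \<star> b) = \<theta> h" using const[OF h] by simp
    moreover have "\<theta> (g * h) = dtr h f (inverse g \<star> b) + dtr g f b"
      by (simp add: \<theta>_def dtr_def tr_def grp_inv_mult act_mult)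
    ultimately show "\<theta> (g * h) = \<theta> g + \<theta> h" by (simp add: \<theta>_def)
  qed
  moreover have "\<theta> g = 0" if "g \<star> b = b" for g
  proof -
    have "inverse g \<star> b = b" using that by (metis act_inv(1))
    then show ?thesis by (simp add: \<theta>_def dtr_def tr_def)
  qed
  moreover have "\<exists>g\<in>M. \<theta> g \<noteq> 0"
  proof (rule ccontr)
    assume "\<not> ?thesis"
    then have zero: "\<theta> g = 0" if "g \<in> M" for g using that by blast
    obtain Cs where Cs: "finite Cs" "Cs \<subseteq> L" "\<And>g. g \<in> L \<Longrightarrow> \<exists>c\<in>Cs. g * inverse c \<in> M"
      using fi_right_reps[OF M(3) L M(1)] by blast
    have "f y \<in> (\<lambda>c. f (c \<star> b)) ` Cs" if y: "y \<in> S" for y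
    proof -
      obtain g where g: "g \<in> L" "y = g \<star> b" using S_trans[OF y] by blast
      obtain c where c: "c \<in> Cs" "g * inverse c \<in> M" using Cs(3)[OF g(1)] by blast
      have "dtr (g * inverse c) f y = 0" using const[OF c(2) y] zero[OF c(2)] by simp
      moreover have "inverse (g * inverse c) \<star> y = c \<star> b"
        by (simp add: g(2) grp_inv_mult flip: act_mult) (simp add: mult.assoc)
      ultimately have "f y = f (c \<star> b)" by (simp add: dtr_def tr_def)
      then show ?thesis using c by blast
    qed
    then have "\<bar>f y\<bar> \<le> Max (abs ` (\<lambda>c. f (c \<star> b)) ` Cs)" if "y \<in> S" for y
      using Cs(1) that by (intro Max_ge) auto
    then have "f x = f b" by (rule harm_bounded_const[OF f(1) _ x(1)])
    then show False using x(2) by simp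
  qed
  ultimately show ?thesis using that by blast
qed

end

section \<open>Actions with polynomial growth\<close>

primrec pw :: "'g::grp set \<Rightarrow> nat \<Rightarrow> 'g set" where
  "pw A 0 = {1}"
| "pw A (Suc n) = {g * h | g h. g \<in> A \<and> h \<in> pw A n}"

lemma pw_add: "g \<in> pw A m \<Longrightarrow> h \<in> pw A n \<Longrightarrow> g * h \<in> pw A (m + n)"
proof (induction m arbitrary: g)
  case (Suc m)
  then obtain a g' where "a \<in> A" "g' \<in> pw A m" "g = a * g'" by auto
  then have "g * h = a * (g' * h)" "g' * h \<in> pw A (m + n)" using Suc by (simp_all add: mult.assoc)
  then show ?case using \<open>a \<in> A\<close> by auto
qed simp

lemma pw_1: "a \<in> A \<Longrightarrow> a \<in> pw A 1"
  by auto

lemma pw_mono: "1 \<in> A \<Longrightarrow> m \<le> n \<Longrightarrow> pw A m \<subseteq> pw A n"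
proof -
  assume one: "1 \<in> A" and le: "m \<le> n"
  have "pw A k \<subseteq> pw A (Suc k)" for k
  proof
    fix g assume "g \<in> pw A k"
    then have "\<exists>a h. g = a * h \<and> a \<in> A \<and> h \<in> pw A k" using one by (intro exI[of _ 1] exI[of _ g]) auto
    then show "g \<in> pw A (Suc k)" by simp
  qed
  then show ?thesis by (rule lift_Suc_mono_le[OF _ le])
qed

lemma pw_gen: "pw A n \<subseteq> gen A"
proof (induction n)
  case (Suc n)
  then show ?case using gen_mult[OF _ gen_incl] by auto
qed (simp add: gen_one)

lemma gen_pw:
  assumes inv: "\<And>a. a \<in> A \<Longrightarrow> inverse a \<in> A" and g: "g \<in> gen A"
  shows "\<exists>n. g \<in> pw A n"
  using g
proof (induction rule: gen.induct)
  case gen_one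
  show ?case by (auto intro: exI[of _ 0])
next
  case (gen_step g s)
  then show ?case using pw_add pw_1 by blast
next
  case (gen_step_inv g s)
  then show ?case using pw_add pw_1 inv by blast
qed

lemma pw_mult_pw: "(\<And>a. a \<in> A \<Longrightarrow> a \<in> pw A' m) \<Longrightarrow> pw A n \<subseteq> pw A' (m * n)"
proof (induction n)
  case (Suc n)
  show ?case
  proof
    fix g assume "g \<in> pw A (Suc n)"
    then obtain a h where "a \<in> A" "h \<in> pw A n" "g = a * h" by auto
    then show "g \<in> pw A' (m * Suc n)" using Suc pw_add[of a A' m h "m * n"] by auto
  qed
qed simp

text \<open>\<open>ell g\<close> plays the distance from \<open>b\<close> to
  \<open>g \<star> b\<close>. All counting is of orbit points; the group elements above one point
  form a coset of a possibly infinite stabilizer.\<close>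

locale growth_action =
  fixes act :: "'g::grp \<Rightarrow> 'x \<Rightarrow> 'x" (infixr "\<star>" 75)
    and H :: "'g set" and b :: 'x and ell :: "'g \<Rightarrow> real" and C :: real and D :: nat
  assumes act_one: "1 \<star> x = x"
    and act_mult: "(g * h) \<star> x = g \<star> h \<star> x"
    and H: "sgrp H"
    and ell_mult: "g \<in> H \<Longrightarrow> h \<in> H \<Longrightarrow> ell (g * h) \<le> ell g + ell h"
    and ell_inv: "g \<in> H \<Longrightarrow> ell (inverse g) = ell g"
    and ell_stab: "g \<in> H \<Longrightarrow> g \<star> b = b \<Longrightarrow> ell g = 0"
    and ball_fin: "finite {g \<star> b | g. g \<in> H \<and> ell g \<le> r}"
    and ball_card: "r \<ge> 0 \<Longrightarrow> real (card {g \<star> b | g. g \<in> H \<and> ell g \<le> r}) \<le> C * (1 + r) ^ D"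
begin

definition stab :: "'g set \<Rightarrow> 'g set" where "stab L = {g \<in> L. g \<star> b = b}"

definition orb :: "'g set \<Rightarrow> 'x set" where "orb A = (\<lambda>g. g \<star> b) ` A"

definition sph :: "'g set \<Rightarrow> real \<Rightarrow> 'g set" where "sph L r = {g \<in> L. ell g \<le> r}"

text \<open>Coarse connectedness of the orbit in algebraic form: steps between orbit points become
  generators of bounded displacement.\<close>

definition conn :: "'g set \<Rightarrow> real \<Rightarrow> bool" where "conn L r \<longleftrightarrow> r \<ge> 0 \<and> L \<subseteq> gen (sph L r)"

text \<open>Growth with respect to the word metric of \<open>L\<close>, not to \<open>ell\<close>.
  The word metric of a kernel can be much larger than \<open>ell\<close>, and it is this intrinsic
  degree that drops in \<open>growing_kernel_degree\<close>.\<close>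

definition growing :: "'g set \<Rightarrow> nat \<Rightarrow> bool" where
  "growing L e \<longleftrightarrow> (\<exists>r C'. conn L r \<and> (\<forall>n. real (card (orb (pw (sph L r) n))) \<le> C' * (real n + 1) ^ e))"

lemma act_inv [simp]: "inverse g \<star> g \<star> x = x" "g \<star> inverse g \<star> x = x"
  by (simp_all flip: act_mult add: act_one)

lemma act_inj: "g \<star> x = g \<star> y \<longleftrightarrow> x = y"
  by (metis act_inv(1))

lemma same_point: "g \<star> b = h \<star> b \<longleftrightarrow> (inverse g * h) \<star> b = b"
  by (metis act_inv act_mult)

lemma stab_L: "stab L \<subseteq> L"
  by (auto simp: stab_def)

lemma sgrp_stab: "sgrp L \<Longrightarrow> sgrp (stab L)"
proof (rule sgrpI)
  assume L: "sgrp L"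
  show "1 \<in> stab L" using sgrp_one[OF L] by (simp add: stab_def act_one)
  show "g * h \<in> stab L" if "g \<in> stab L" "h \<in> stab L" for g h
    using that sgrp_mult[OF L] by (simp add: stab_def act_mult)
  show "inverse g \<in> stab L" if "g \<in> stab L" for g
    using that sgrp_inv[OF L, of g] act_inv(1)[of g b] by (simp add: stab_def)
qed

lemma ell_one: "ell 1 = 0"
  using ell_stab[OF sgrp_one[OF H]] by (simp add: act_one)

lemma ell_nonneg: "g \<in> H \<Longrightarrow> ell g \<ge> 0"
  using ell_mult[of "inverse g" g] ell_inv[of g] sgrp_inv[OF H, of g] by (simp add: ell_one)

lemma ell_power: "g \<in> H \<Longrightarrow> ell (g ^ n) \<le> real n * ell g"
proof (induction n)
  case (Suc n)
  then show ?case using ell_mult[of g "g ^ n"] sgrp_power[OF H, of g n] by (simp add: distrib_right)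
qed (simp add: ell_one)

lemma ell_conj: "g \<in> H \<Longrightarrow> h \<in> H \<Longrightarrow> ell (h * g * inverse h) \<le> ell g + 2 * ell h"
  using ell_mult[of "h * g" "inverse h"] ell_mult[of h g] ell_inv[of h] sgrp_mult[OF H, of h g] sgrp_inv[OF H, of h]
  by linarith

lemma sph_one: "sgrp L \<Longrightarrow> r \<ge> 0 \<Longrightarrow> 1 \<in> sph L r"
  by (simp add: sph_def sgrp_one ell_one)

lemma sph_inv: "sgrp L \<Longrightarrow> L \<subseteq> H \<Longrightarrow> g \<in> sph L r \<Longrightarrow> inverse g \<in> sph L r"
  using sgrp_inv[of L g] ell_inv[of g] by (auto simp: sph_def)

lemma stab_sph: "L \<subseteq> H \<Longrightarrow> r \<ge> 0 \<Longrightarrow> stab L \<subseteq> sph L r"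
  using ell_stab by (auto simp: sph_def stab_def)

lemma pw_sph_L: "sgrp L \<Longrightarrow> pw (sph L r) n \<subseteq> L"
  using pw_gen[of "sph L r" n] gen_least[of L "sph L r"] by (auto simp: sph_def)

lemma pw_sph_ell: "sgrp L \<Longrightarrow> L \<subseteq> H \<Longrightarrow> g \<in> pw (sph L r) n \<Longrightarrow> ell g \<le> real n * r"
proof (induction n arbitrary: g)
  case (Suc n)
  then obtain a h where "a \<in> sph L r" "h \<in> pw (sph L r) n" "g = a * h" by auto
  moreover from this have "a \<in> H" "h \<in> H" using pw_sph_L[OF Suc.prems(1), of r n] Suc.prems(2) by (auto simp: sph_def)
  ultimately show ?case using ell_mult[of a h] Suc.IH[OF Suc.prems(1,2), of h] by (auto simp: sph_def distrib_right)
qed (simp add: ell_one)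

lemma orb_fin:
  assumes "A \<subseteq> H" "\<And>g. g \<in> A \<Longrightarrow> ell g \<le> r" shows "finite (orb A)"
  by (rule finite_subset[OF _ ball_fin[of r]]) (use assms in \<open>auto simp: orb_def\<close>)

lemma orb_card:
  assumes "A \<subseteq> H" "\<And>g. g \<in> A \<Longrightarrow> ell g \<le> r" "r \<ge> 0" shows "real (card (orb A)) \<le> C * (1 + r) ^ D"
proof -
  have "card (orb A) \<le> card {g \<star> b | g. g \<in> H \<and> ell g \<le> r}"
    by (rule card_mono[OF ball_fin]) (use assms in \<open>auto simp: orb_def\<close>)
  then show ?thesis using ball_card[OF assms(3)] by linarith
qed

lemma orb_pw_fin: "sgrp L \<Longrightarrow> L \<subseteq> H \<Longrightarrow> finite (orb (pw (sph L r) n))"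
  by (rule orb_fin[of _ "real n * r"]) (use pw_sph_L pw_sph_ell in blast)+

lemma finite_reps:
  assumes "finite (orb A)"
  obtains T where "finite T" "T \<subseteq> A" "\<And>g. g \<in> A \<Longrightarrow> \<exists>t\<in>T. g \<star> b = t \<star> b"
proof -
  obtain T where "T \<subseteq> A" "finite T" "orb A = orb T"
    using finite_subset_image[OF assms[unfolded orb_def] subset_refl] unfolding orb_def by metis
  then show ?thesis using that[of T] by (auto simp: orb_def)
qed

text \<open>Up to the stabilizer there are finitely many generators of \<open>L'\<close>, each a
  word in the generators of \<open>L\<close>. Stabilizing elements are single letters of
  \<open>L\<close>, which accounts for the \<open>Suc\<close> in \<open>m\<close>.\<close>

lemma pw_sub:
  assumes L: "sgrp L" "L \<subseteq> H" and L': "sgrp L'" "L' \<subseteq> L" and r: "conn L r"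
  obtains m where "m \<ge> 1" "\<And>n. pw (sph L' r') n \<subseteq> pw (sph L r) (m * n)"
proof -
  have r0: "r \<ge> 0" using r by (simp add: conn_def)
  have one: "1 \<in> sph L r" by (rule sph_one[OF L(1) r0])
  have "finite (orb (sph L' r'))" by (rule orb_fin[of _ r']) (use L L' in \<open>auto simp: sph_def\<close>)
  then obtain T where T: "finite T" "T \<subseteq> sph L' r'" "\<And>g. g \<in> sph L' r' \<Longrightarrow> \<exists>t\<in>T. g \<star> b = t \<star> b"
    using finite_reps by metis
  have "\<exists>n. t \<in> pw (sph L r) n" if "t \<in> T" for t
  proof (rule gen_pw)
    show "t \<in> gen (sph L r)" using that T(2) L'(2) r by (auto simp: conn_def sph_def)
  qed (rule sph_inv[OF L])
  then obtain f where f: "\<And>t. t \<in> T \<Longrightarrow> t \<in> pw (sph L r) (f t)" by metis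
  define m where "m = Suc (Max (insert 0 (f ` T)))"
  have "g \<in> pw (sph L r) m" if g: "g \<in> sph L' r'" for g
  proof -
    obtain t where t: "t \<in> T" "g \<star> b = t \<star> b" using T(3)[OF g] by blast
    have tL: "t \<in> L" "g \<in> L" using t T(2) g L'(2) by (auto simp: sph_def)
    have "inverse t * g \<in> stab L" using t(2) sgrp_mult[OF L(1) sgrp_inv[OF L(1) tL(1)] tL(2)] same_point[of t g]
      by (simp add: stab_def)
    then have "inverse t * g \<in> sph L r" using stab_sph[OF L(2) r0] by blast
    then have "t * (inverse t * g) \<in> pw (sph L r) (f t + 1)" by (intro pw_add f t pw_1)
    moreover have "f t + 1 \<le> m" using T(1) t by (simp add: m_def)
    ultimately show ?thesis using pw_mono[OF one, of "f t + 1" m] by auto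
  qed
  then have "pw (sph L' r') n \<subseteq> pw (sph L r) (m * n)" for n by (rule pw_mult_pw)
  then show ?thesis using that[of m] by (simp add: m_def)
qed

lemma growing_sub:
  assumes L: "sgrp L" "L \<subseteq> H" and L': "sgrp L'" "L' \<subseteq> L" and g: "growing L e" and r': "conn L' r'"
  shows "\<exists>C'. \<forall>n. real (card (orb (pw (sph L' r') n))) \<le> C' * (real n + 1) ^ e"
proof -
  obtain r C' where r: "conn L r" "\<And>n. real (card (orb (pw (sph L r) n))) \<le> C' * (real n + 1) ^ e"
    using g by (auto simp: growing_def)
  obtain m where m: "m \<ge> 1" "\<And>n. pw (sph L' r') n \<subseteq> pw (sph L r) (m * n)" using pw_sub[OF L L' r(1)] by blast
  have "real (card (orb (pw (sph L' r') n))) \<le> (\<bar>C'\<bar> * real m ^ e) * (real n + 1) ^ e" for n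
  proof -
    have "card (orb (pw (sph L' r') n)) \<le> card (orb (pw (sph L r) (m * n)))"
      using m(2)[of n] by (intro card_mono orb_pw_fin L) (auto simp: orb_def)
    then have "real (card (orb (pw (sph L' r') n))) \<le> C' * (real (m * n) + 1) ^ e" using r(2)[of "m * n"] by linarith
    also have "\<dots> \<le> \<bar>C'\<bar> * (real m * (real n + 1)) ^ e"
      using m(1) by (intro mult_mono power_mono) (auto simp: algebra_simps)
    finally show ?thesis by (simp add: power_mult_distrib mult.assoc)
  qed
  then show ?thesis by blast
qed

lemma conn_gen:
  assumes L: "sgrp L" "L \<subseteq> H" and U: "U \<subseteq> L" "L \<subseteq> gen U" and r: "\<And>u. u \<in> U \<Longrightarrow> ell u \<le> r" "r \<ge> 0"
  shows "conn L r"
proof -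
  have "gen U \<subseteq> gen (sph L r)" using U(1) r by (intro gen_mono) (auto simp: sph_def)
  then show ?thesis using U(2) r(2) by (auto simp: conn_def)
qed

text \<open>Schreier generators \<open>c * s * inverse c'\<close> with coset representatives
  \<open>c\<close> and \<open>c'\<close>; their displacement is at most \<open>r\<close> plus twice
  the largest displacement of a representative.\<close>

lemma conn_fi:
  assumes L: "sgrp L" "L \<subseteq> H" and M: "sgrp M" "M \<subseteq> L" "fi M L" and r: "conn L r"
  shows "\<exists>r'. conn M r'"
proof -
  have r0: "r \<ge> 0" using r by (simp add: conn_def)
  obtain C0 where C0: "finite C0" "C0 \<subseteq> L" "\<And>g. g \<in> L \<Longrightarrow> \<exists>c\<in>C0. g * inverse c \<in> M"
    using fi_right_reps[OF M(3) L(1) M(1)] by blast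
  define Cs where "Cs = insert 1 C0"
  have Cs: "finite Cs" "Cs \<subseteq> L" using C0 sgrp_one[OF L(1)] by (auto simp: Cs_def)
  define r' where "r' = r + 2 * Max (ell ` Cs)"
  have Max: "ell c \<le> Max (ell ` Cs)" if "c \<in> Cs" for c using Cs that by simp
  have "0 \<le> Max (ell ` Cs)" using Max[of 1] by (simp add: Cs_def ell_one)
  then have r'0: "r' \<ge> 0" using r0 by (simp add: r'_def)
  have step: "\<exists>c\<in>Cs. \<exists>l\<in>gen (sph M r'). g = l * c" if "g \<in> gen (sph L r)" for g
    using that
  proof (induction rule: gen.induct)
    case gen_one
    show ?case by (auto simp: Cs_def intro!: gen.gen_one bexI[of _ 1])
  next
    case (gen_step g s)
    then obtain c l where cl: "c \<in> Cs" "l \<in> gen (sph M r')" "g = l * c" by blast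
    have sL: "s \<in> L" "ell s \<le> r" "c \<in> L" using gen_step cl Cs by (auto simp: sph_def)
    obtain c' where c': "c' \<in> Cs" "c * s * inverse c' \<in> M"
      using C0(3)[OF sgrp_mult[OF L(1) sL(3,1)]] by (auto simp: Cs_def)
    have "ell (c * s * inverse c') \<le> r'"
      using ell_mult[of "c * s" "inverse c'"] ell_mult[of c s] ell_inv[of c'] Max[OF cl(1)] Max[OF c'(1)] sL c'(1) Cs(2)
        L(2) sgrp_mult[OF H, of c s] sgrp_inv[OF H, of c'] by (fastforce simp: r'_def)
    then have "l * (c * s * inverse c') \<in> gen (sph M r')"
      using c'(2) by (intro gen_mult[OF gen_incl cl(2)]) (simp add: sph_def)
    moreover have "g * s = l * (c * s * inverse c') * c'" using cl(3) by (simp add: mult.assoc)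
    ultimately show ?case using c'(1) by blast
  next
    case (gen_step_inv g s)
    then obtain c l where cl: "c \<in> Cs" "l \<in> gen (sph M r')" "g = l * c" by blast
    have sL: "inverse s \<in> L" "ell (inverse s) \<le> r" "c \<in> L"
      using gen_step_inv sph_inv[OF L gen_step_inv(2)] cl Cs by (auto simp: sph_def)
    obtain c' where c': "c' \<in> Cs" "c * inverse s * inverse c' \<in> M"
      using C0(3)[OF sgrp_mult[OF L(1) sL(3,1)]] by (auto simp: Cs_def)
    have "ell (c * inverse s * inverse c') \<le> r'"
      using ell_mult[of "c * inverse s" "inverse c'"] ell_mult[of c "inverse s"] ell_inv[of c'] Max[OF cl(1)] Max[OF c'(1)] sL c'(1) Cs(2)
        L(2) sgrp_mult[OF H, of c "inverse s"] sgrp_inv[OF H, of c'] by (fastforce simp: r'_def)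
    then have "l * (c * inverse s * inverse c') \<in> gen (sph M r')"
      using c'(2) by (intro gen_mult[OF gen_incl cl(2)]) (simp add: sph_def)
    moreover have "g * inverse s = l * (c * inverse s * inverse c') * c'" using cl(3) by (simp add: mult.assoc)
    ultimately show ?case using c'(1) by blast
  qed
  have "M \<subseteq> gen (insert 1 (sph M r') \<union> (Cs \<inter> M))"
  proof
    fix g assume g: "g \<in> M"
    then obtain c l where cl: "c \<in> Cs" "l \<in> gen (sph M r')" "g = l * c" using step[of g] r M(2) unfolding conn_def by blast
    have "l \<in> M" using cl(2) gen_least[OF M(1), of "sph M r'"] by (auto simp: sph_def)
    then have "c \<in> M" using g cl(3) sgrp_mult_left_iff[OF M(1)] by simp
    then show "g \<in> gen (insert 1 (sph M r') \<union> (Cs \<inter> M))"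
      using cl gen_mono[of "sph M r'" "insert 1 (sph M r') \<union> (Cs \<inter> M)"]
        gen_mult[OF gen_incl[of c "insert 1 (sph M r') \<union> (Cs \<inter> M)"], of l] by auto
  qed
  then have "conn M r'"
  proof (rule conn_gen[OF M(1) order_trans[OF M(2) L(2)] _ _ _ r'0, rotated])
    show "insert 1 (sph M r') \<union> Cs \<inter> M \<subseteq> M" using sgrp_one[OF M(1)] by (auto simp: sph_def)
    fix u assume "u \<in> insert 1 (sph M r') \<union> Cs \<inter> M"
    then show "ell u \<le> r'" using Max[of u] \<open>0 \<le> Max (ell ` Cs)\<close> r0 r'0 by (auto simp: sph_def ell_one r'_def)
  qed
  then show ?thesis by blast
qed

lemma growing_fi:
  assumes "sgrp L" "L \<subseteq> H" "sgrp M" "M \<subseteq> L" "fi M L" "growing L e"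
  shows "growing M e"
proof -
  obtain r where "conn L r" using assms(6) by (auto simp: growing_def)
  then obtain r' where "conn M r'" using conn_fi[OF assms(1-5)] by blast
  then show ?thesis using growing_sub[OF assms(1-4,6)] by (auto simp: growing_def)
qed

text \<open>The substitute for finite generation: finitely many orbit points within distance
  \<open>r\<close> leave finitely many generators modulo the stabilizer.\<close>

lemma finite_gen:
  assumes L: "sgrp L" "L \<subseteq> H" and r: "conn L r"
  obtains T where "finite T" "T \<subseteq> L" "L \<subseteq> gen (T \<union> stab L)"
proof -
  have "finite (orb (sph L r))" by (rule orb_fin[of _ r]) (use L in \<open>auto simp: sph_def\<close>)
  then obtain T where T: "finite T" "T \<subseteq> sph L r" "\<And>g. g \<in> sph L r \<Longrightarrow> \<exists>t\<in>T. g \<star> b = t \<star> b"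
    using finite_reps by metis
  have "sph L r \<subseteq> gen (T \<union> stab L)"
  proof
    fix g assume g: "g \<in> sph L r"
    then obtain t where t: "t \<in> T" "g \<star> b = t \<star> b" using T(3) by blast
    have "t \<in> L" "g \<in> L" using t(1) T(2) g by (auto simp: sph_def)
    then have "inverse t * g \<in> stab L" using same_point[of t g] t(2) sgrp_mult[OF L(1) sgrp_inv[OF L(1)]] by (simp add: stab_def)
    then have "t * (inverse t * g) \<in> gen (T \<union> stab L)" using t(1) by (intro gen_mult[OF gen_incl gen_incl]) auto
    then show "g \<in> gen (T \<union> stab L)" by simp
  qed
  then have "L \<subseteq> gen (T \<union> stab L)" using r gen_least[OF sgrp_gen, of "sph L r" "T \<union> stab L"] by (auto simp: conn_def)
  moreover have "T \<subseteq> L" using T(2) by (auto simp: sph_def)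
  ultimately show ?thesis using that T(1) by blast
qed

end

section \<open>Existence of a virtual homomorphism to the integers\<close>

context growth_action
begin

text \<open>The quantifier over \<open>g\<close> is harmless, because \<open>sph L r\<close> absorbs
  the stabilizer of \<open>b\<close> from the left and so every way of writing \<open>x\<close>
  gives the same neighbours (\<open>nbr_eq\<close>).\<close>

definition nbr :: "'g set \<Rightarrow> real \<Rightarrow> 'x \<Rightarrow> 'x set" where
  "nbr L r x = {y. \<exists>g\<in>L. \<exists>s\<in>sph L r. x = g \<star> b \<and> y = (g * s) \<star> b}"

text \<open>Half of the mass stays, the other half is uniform on \<open>nbr L r x\<close>. All these
  sets have the cardinality of \<open>orb (sph L r)\<close>, so the total mass is 1.\<close>

definition wt :: "'g set \<Rightarrow> real \<Rightarrow> 'x \<Rightarrow> 'x \<Rightarrow> real" where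
  "wt L r x y = (if x = y then 1 / 2 else 0) + (if y \<in> nbr L r x then 1 / (2 * real (card (orb (sph L r)))) else 0)"

lemma nbr_eq:
  assumes L: "sgrp L" "L \<subseteq> H" and g: "g \<in> L"
  shows "nbr L r (g \<star> b) = (\<star>) g ` orb (sph L r)"
proof
  show "(\<star>) g ` orb (sph L r) \<subseteq> nbr L r (g \<star> b)"
    using g by (auto simp: nbr_def orb_def act_mult)
  show "nbr L r (g \<star> b) \<subseteq> (\<star>) g ` orb (sph L r)"
  proof
    fix y assume "y \<in> nbr L r (g \<star> b)"
    then obtain h s where h: "h \<in> L" "s \<in> sph L r" "g \<star> b = h \<star> b" "y = (h * s) \<star> b" by (auto simp: nbr_def)
    define k where "k = inverse g * h"
    have k: "k \<in> stab L" unfolding stab_def k_def using same_point[of g h] h(3) sgrp_mult[OF L(1) sgrp_inv[OF L(1) g] h(1)] by simp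
    then have kH: "k \<in> H" "k \<star> b = b" "k \<in> L" using L by (auto simp: stab_def)
    have s: "s \<in> L" "ell s \<le> r" "s \<in> H" using h L by (auto simp: sph_def)
    have "k * s \<in> sph L r" using ell_mult[OF kH(1) s(3)] ell_stab[OF kH(1,2)] s sgrp_mult[OF L(1) kH(3) s(1)] by (simp add: sph_def)
    moreover have "h * s = g * (k * s)" by (simp add: k_def mult.assoc)
    then have "y = g \<star> (k * s) \<star> b" using h(4) by (simp add: act_mult)
    ultimately show "y \<in> (\<star>) g ` orb (sph L r)" by (auto simp: orb_def)
  qed
qed

lemma nbr_ball:
  assumes L: "sgrp L" "L \<subseteq> H" and g: "g \<in> L"
  shows "kernel_ball (nbr L r) n (g \<star> b) = (\<star>) g ` orb (pw (sph L r) n)"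
  using g
proof (induction n arbitrary: g)
  case 0
  then show ?case by (simp add: orb_def act_one)
next
  case (Suc n)
  have "kernel_ball (nbr L r) (Suc n) (g \<star> b) = (\<Union>s\<in>sph L r. kernel_ball (nbr L r) n (g \<star> s \<star> b))"
    by (simp add: nbr_eq[OF L Suc.prems] orb_def)
  also have "\<dots> = (\<Union>s\<in>sph L r. (\<star>) (g * s) ` orb (pw (sph L r) n))"
  proof (rule SUP_cong)
    fix s assume "s \<in> sph L r"
    then have "g * s \<in> L" using sgrp_mult[OF L(1) Suc.prems] by (simp add: sph_def)
    then show "kernel_ball (nbr L r) n (g \<star> s \<star> b) = (\<star>) (g * s) ` orb (pw (sph L r) n)"
      using Suc.IH[of "g * s"] by (simp add: act_mult)
  qed simp
  also have "\<dots> = (\<star>) g ` orb (pw (sph L r) (Suc n))"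
  proof -
    have "pw (sph L r) (Suc n) = (\<Union>s\<in>sph L r. (*) s ` pw (sph L r) n)" by auto
    then show ?thesis by (simp only: orb_def image_UN image_image act_mult)
  qed
  finally show ?case .
qed

lemma walk_orb:
  assumes L: "sgrp L" "L \<subseteq> H" and r: "conn L r"
    and gr: "\<And>n. real (card (orb (pw (sph L r) n))) \<le> C' * (real n + 1) ^ e"
  shows "walk (\<star>) L (orb L) b (wt L r) (nbr L r) (1 / (2 * real (card (orb (sph L r))))) C' e"
proof -
  let ?B = "orb (sph L r)"
  have r0: "r \<ge> 0" using r by (simp add: conn_def)
  have one: "1 \<in> sph L r" by (rule sph_one[OF L(1) r0])
  have fin: "finite ?B" by (rule orb_fin[of _ r]) (use L in \<open>auto simp: sph_def\<close>)
  have "b \<in> ?B" using one by (auto simp: orb_def act_one intro!: image_eqI[of _ _ 1])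
  then have pos: "card ?B > 0" using fin by (auto simp: card_gt_0_iff)
  then have "0 < 1 / (2 * real (card ?B))" by simp
  then have pos': "1 / 2 + 1 / (2 * real (card ?B)) \<noteq> 0" by linarith
  have sphL: "sph L r \<subseteq> L" by (auto simp: sph_def)
  have self: "x \<in> nbr L r x" if "x \<in> orb L" for x
  proof -
    obtain h where "h \<in> L" "x = h \<star> b" "x = (h * 1) \<star> b" using \<open>x \<in> orb L\<close> by (auto simp: orb_def)
    then show ?thesis using one unfolding nbr_def by blast
  qed
  have nbr_orb: "y \<in> orb L" if "y \<in> nbr L r x" for x y
    using that sphL sgrp_mult[OF L(1)] by (auto simp: nbr_def orb_def)
  have bL: "b = 1 \<star> b" by (simp add: act_one)
  have nbr_sym: "x \<in> nbr L r y" if "y \<in> nbr L r x" for x y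
  proof -
    obtain g s where g: "g \<in> L" "s \<in> sph L r" "x = g \<star> b" "y = (g * s) \<star> b" using \<open>y \<in> nbr L r x\<close> unfolding nbr_def by blast
    have "inverse s \<in> sph L r" by (rule sph_inv[OF L g(2)])
    moreover have "x = ((g * s) * inverse s) \<star> b" using g by (simp add: mult.assoc)
    moreover have "g * s \<in> L" using g sphL sgrp_mult[OF L(1)] by blast
    ultimately show ?thesis using g(4) unfolding nbr_def by blast
  qed
  have nbr_act: "g \<star> y \<in> nbr L r (g \<star> x) \<longleftrightarrow> y \<in> nbr L r x" if g: "g \<in> L" and x: "x \<in> orb L" for g x y
  proof -
    obtain h where h: "h \<in> L" "x = h \<star> b" using x by (auto simp: orb_def)
    have "nbr L r (g \<star> x) = (\<star>) (g * h) ` ?B"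
      using nbr_eq[OF L sgrp_mult[OF L(1) g h(1)], of r] h by (simp add: act_mult)
    also have "\<dots> = (\<star>) g ` nbr L r x" using nbr_eq[OF L h(1), of r] h by (simp add: image_image act_mult)
    finally show ?thesis using act_inj by auto
  qed
  have cardN: "finite (nbr L r x)" "card (nbr L r x) = card ?B" if "x \<in> orb L" for x
  proof -
    obtain h where h: "h \<in> L" "x = h \<star> b" using \<open>x \<in> orb L\<close> by (auto simp: orb_def)
    have "inj_on ((\<star>) h) ?B" by (rule inj_onI) (simp add: act_inj)
    then show "finite (nbr L r x)" "card (nbr L r x) = card ?B" using fin nbr_eq[OF L h(1), of r] h by (simp_all add: card_image)
  qed
  show ?thesis
  proof unfold_locales
    show "orb L = (\<lambda>g. g \<star> b) ` L" by (simp add: orb_def)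
    show "nbr L r x = {y \<in> orb L. wt L r x y \<noteq> 0}" if "x \<in> orb L" for x
      using that self[OF that] nbr_orb[of _ x] pos pos' by (auto simp: wt_def split: if_splits)
    show "wt L r x y = wt L r y x" for x y using nbr_sym[of x y] nbr_sym[of y x] by (auto simp: wt_def)
    show "wt L r (g \<star> x) (g \<star> y) = wt L r x y" if "g \<in> L" "x \<in> orb L" for g x y
      using nbr_act[OF that, of y] by (simp add: wt_def act_inj)
    show "(\<Sum>y\<in>nbr L r x. wt L r x y) = 1" if "x \<in> orb L" for x
      using self[OF that] cardN[OF that] pos by (simp add: wt_def sum.distrib)
    show "1 / 2 \<le> wt L r x x" for x by (simp add: wt_def)
    show "0 < 1 / (2 * real (card ?B))" using pos by simp
    show "1 / (2 * real (card ?B)) \<le> wt L r x y" if "y \<in> nbr L r x" for x y using that by (simp add: wt_def)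
    show "\<exists>n. x \<in> kernel_ball (nbr L r) n b" if "x \<in> orb L" for x
    proof -
      obtain h where h: "h \<in> L" "x = h \<star> b" using \<open>x \<in> orb L\<close> by (auto simp: orb_def)
      obtain n where "h \<in> pw (sph L r) n" using gen_pw[OF sph_inv[OF L], of r h] h(1) r by (auto simp: conn_def)
      then have "x \<in> kernel_ball (nbr L r) n (1 \<star> b)"
        unfolding nbr_ball[OF L sgrp_one[OF L(1)]] using h by (auto simp: orb_def act_one)
      then show ?thesis by (auto simp: act_one)
    qed
    show "real (card (kernel_ball (nbr L r) n b)) \<le> C' * (real n + 1) ^ e" for n
      using gr[of n] nbr_ball[OF L sgrp_one[OF L(1)], of r n] by (simp add: act_one)
  qed (use act_one act_mult L cardN in auto)
qed

lemma not_fi_kernel: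
  fixes \<phi> :: "'g \<Rightarrow> real"
  assumes "add_hom L \<phi>" "sgrp L" "g \<in> L" "\<phi> g \<noteq> 0" shows "\<not> fi {g \<in> L. \<phi> g = 0} L"
proof
  assume "fi {g \<in> L. \<phi> g = 0} L"
  then obtain e where "e \<ge> 1" "\<And>g. g \<in> L \<Longrightarrow> g ^ e \<in> {g \<in> L. \<phi> g = 0}"
    using fi_exponent[OF _ assms(2) sgrp_kernel[OF assms(1,2)]] by blast
  then show False using add_hom_power[OF assms(1-3), of e] assms(3,4) by auto
qed

lemma abel_mod_kernel:
  fixes \<phi> :: "'g \<Rightarrow> real"
  assumes \<phi>: "add_hom L \<phi>" and L: "sgrp L" shows "abel_mod L {g \<in> L. \<phi> g = 0}"
proof -
  have "\<phi> (g * h * inverse g * inverse h) = 0" if "g \<in> L" "h \<in> L" for g h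
    using that by (simp add: add_hom_mult[OF \<phi>] add_hom_inv[OF \<phi> L] sgrp_mult[OF L] sgrp_inv[OF L])
  then show ?thesis using sgrp_kernel[OF \<phi> L] L by (auto simp: abel_mod_def intro!: sgrp_mult[OF L] sgrp_inv[OF L])
qed

text \<open>The image of \<open>\<phi>\<close> is a nontrivial finitely generated subgroup of the
  reals, hence an infinite finitely generated abelian group; \<open>\<phi>\<close> itself need not
  be a multiple of an integer homomorphism.\<close>

lemma real_hom_int_hom:
  fixes \<phi> :: "'g \<Rightarrow> real"
  assumes L: "sgrp L" "L \<subseteq> H" and r: "conn L r" and \<phi>: "add_hom L \<phi>" "\<And>g. g \<in> stab L \<Longrightarrow> \<phi> g = 0" and nz: "\<exists>g\<in>L. \<phi> g \<noteq> 0"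
  obtains \<theta> :: "'g \<Rightarrow> int" where "add_hom L \<theta>" "\<And>g. g \<in> L \<Longrightarrow> \<phi> g = 0 \<Longrightarrow> \<theta> g = 0" "\<exists>g\<in>L. \<theta> g \<noteq> 0"
proof -
  obtain T where T: "finite T" "T \<subseteq> L" "L \<subseteq> gen (T \<union> stab L)" using finite_gen[OF L r] by blast
  let ?K = "{g \<in> L. \<phi> g = 0}"
  have "stab L \<subseteq> ?K" using \<phi>(2) by (auto simp: stab_def)
  then have "L \<subseteq> gen (T \<union> ?K)" using T(3) gen_mono[of "T \<union> stab L" "T \<union> ?K"] by blast
  then show ?thesis
    using exists_int_hom[OF T(1) abel_mod_kernel[OF \<phi>(1) L(1)] T(2), of thesis] that not_fi_kernel[OF \<phi>(1) L(1)] nz by blast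
qed

text \<open>If \<open>Z\<close> has infinite index in \<open>M\<close>, the infinite abelian
  quotient has a nonzero homomorphism to the integers; it kills the stabilizer, whose image modulo
  \<open>Z\<close> is finite. If the index is finite, \<open>Z\<close> itself acts trivially modulo
  constants and \<open>translation_hom\<close> applies.\<close>

theorem exists_virtual_int_hom:
  assumes L: "sgrp L" "L \<subseteq> H" and gr: "growing L e" and inf: "infinite (orb L)"
  obtains M and \<theta> :: "'g \<Rightarrow> int" where "sgrp M" "M \<subseteq> L" "fi M L" "add_hom M \<theta>"
    "\<And>g. g \<in> stab M \<Longrightarrow> \<theta> g = 0" "\<exists>g\<in>M. \<theta> g \<noteq> 0"
proof -
  obtain r C' where r: "conn L r" and C': "\<And>n. real (card (orb (pw (sph L r) n))) \<le> C' * (real n + 1) ^ e"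
    using gr unfolding growing_def by blast
  interpret W: walk "(\<star>)" L "orb L" b "wt L r" "nbr L r" "1 / (2 * real (card (orb (sph L r))))" C' e
    by (rule walk_orb[OF L r C'])
  obtain M Z where M: "sgrp M" "M \<subseteq> L" "fi M L" and MZ: "abel_mod M Z"
    and triv: "\<And>g f. g \<in> Z \<Longrightarrow> f \<in> W.LH \<Longrightarrow> W.nm (W.dtr g f) = 0"
    and fiZ: "fi (Z \<inter> {g \<in> M. g \<star> b = b}) {g \<in> M. g \<star> b = b}"
    using W.virtually_abelian_action by blast
  have Z: "sgrp Z" "Z \<subseteq> M" using MZ by (auto simp: abel_mod_def)
  have MH: "M \<subseteq> H" using M(2) L(2) by blast
  obtain rM where rM: "conn M rM" using conn_fi[OF L M r] by blast
  have fiZ': "fi (Z \<inter> stab M) (stab M)" using fiZ by (simp add: stab_def)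
  have sZ: "sgrp (Z \<inter> stab M)" by (rule sgrp_Int[OF Z(1) sgrp_stab[OF M(1)]])
  show ?thesis
  proof (cases "fi Z M")
    case False
    obtain T where T: "finite T" "T \<subseteq> M" "M \<subseteq> gen (T \<union> stab M)" using finite_gen[OF M(1) MH rM] by blast
    \<comment> \<open>Representatives of the stabilizer modulo \<open>Z\<close> complete
      \<open>T\<close> to finitely many generators of \<open>M\<close> modulo
      \<open>Z\<close>.\<close>
    obtain D where D: "finite D" "D \<subseteq> stab M" "\<And>g. g \<in> stab M \<Longrightarrow> \<exists>d\<in>D. inverse d * g \<in> Z \<inter> stab M"
      using fiZ' unfolding fi_def by blast
    have "stab M \<subseteq> gen (T \<union> D \<union> Z)"
    proof
      fix g assume "g \<in> stab M"
      then obtain d where d: "d \<in> D" "inverse d * g \<in> Z" using D(3) by blast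
      have "d * (inverse d * g) \<in> gen (T \<union> D \<union> Z)"
        using d by (intro gen_mult[OF gen_incl gen_incl]) auto
      then show "g \<in> gen (T \<union> D \<union> Z)" by simp
    qed
    then have "T \<union> stab M \<subseteq> gen (T \<union> D \<union> Z)" using gen_incl[of _ "T \<union> D \<union> Z"] by blast
    then have "M \<subseteq> gen (T \<union> D \<union> Z)" using T(3) gen_least[OF sgrp_gen, of "T \<union> stab M" "T \<union> D \<union> Z"] by blast
    moreover have "T \<union> D \<subseteq> M" using T(2) D(2) stab_L[of M] by blast
    moreover have "finite (T \<union> D)" using T D by simp
    ultimately obtain \<theta> :: "'g \<Rightarrow> int" where \<theta>: "add_hom M \<theta>" "\<And>g. g \<in> Z \<Longrightarrow> \<theta> g = 0" "\<exists>g\<in>M. \<theta> g \<noteq> 0"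
      using exists_int_hom[OF _ MZ, of "T \<union> D"] False by blast
    have "\<theta> g = 0" if g: "g \<in> stab M" for g
    proof -
      obtain k where k: "k \<ge> 1" "\<And>g. g \<in> stab M \<Longrightarrow> g ^ k \<in> Z \<inter> stab M"
        using fi_exponent[OF fiZ' sgrp_stab[OF M(1)] sZ] by blast
      then have "\<theta> (g ^ k) = 0" using \<theta>(2) g by blast
      moreover have "g \<in> M" using g by (simp add: stab_def)
      ultimately show ?thesis using add_hom_power[OF \<theta>(1) M(1), of g k] k(1) by simp
    qed
    then show ?thesis using that[OF M \<theta>(1)] \<theta>(3) by blast
  next
    case True
    have ZL: "Z \<subseteq> L" using Z M by blast
    have fiL: "fi Z L" by (rule fi_trans[OF True M(3) Z(2) M(2) L(1)])
    obtain \<phi> :: "'g \<Rightarrow> real" where \<phi>: "add_hom Z \<phi>" "\<And>g. g \<in> Z \<Longrightarrow> g \<star> b = b \<Longrightarrow> \<phi> g = 0" "\<exists>g\<in>Z. \<phi> g \<noteq> 0"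
      using W.translation_hom[OF inf Z(1) ZL fiL triv] by blast
    obtain rZ where rZ: "conn Z rZ" using conn_fi[OF L Z(1) ZL fiL r] by blast
    have \<phi>0: "\<phi> g = 0" if "g \<in> stab Z" for g using that \<phi>(2) by (simp add: stab_def)
    obtain \<theta> :: "'g \<Rightarrow> int" where \<theta>: "add_hom Z \<theta>" "\<And>g. g \<in> Z \<Longrightarrow> \<phi> g = 0 \<Longrightarrow> \<theta> g = 0" "\<exists>g\<in>Z. \<theta> g \<noteq> 0"
      using real_hom_int_hom[OF Z(1) order_trans[OF ZL L(2)] rZ \<phi>(1) \<phi>0 \<phi>(3)] by blast
    have "\<theta> g = 0" if "g \<in> stab Z" for g using \<theta>(2) \<phi>0[OF that] that by (simp add: stab_def)
    then show ?thesis using that[OF Z(1) ZL fiL \<theta>(1)] \<theta>(3) by blast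
  qed
qed

end

section \<open>Kernels of homomorphisms to the integers\<close>

text \<open>The product of the conjugates \<open>t ^ i * f * inverse (t ^ i)\<close> over the
  \<open>i\<close> in \<open>E \<inter> {1..n}\<close>, with the largest \<open>i\<close>
  leftmost.\<close>

primrec aw :: "'g::grp \<Rightarrow> 'g \<Rightarrow> nat \<Rightarrow> nat set \<Rightarrow> 'g" where
  "aw t f 0 E = 1"
| "aw t f (Suc n) E = (if Suc n \<in> E then t ^ Suc n * f * inverse (t ^ Suc n) else 1) * aw t f n E"

lemma aw_gen:
  assumes "\<And>i. 1 \<le> i \<Longrightarrow> i \<le> n \<Longrightarrow> t ^ i * f * inverse (t ^ i) \<in> gen A"
  shows "aw t f n E \<in> gen A"
  using assms
proof (induction n)
  case (Suc n)
  have "aw t f n E \<in> gen A" using Suc by simp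
  moreover have "t ^ Suc n * f * inverse (t ^ Suc n) \<in> gen A" by (rule Suc.prems) auto
  ultimately show ?case using gen_mult[of "aw t f n E" A] by (simp del: power_Suc)
qed (simp add: gen_one)

lemma exp_beats_poly:
  fixes a c :: real
  shows "\<exists>n::nat. (a * (1 + real n * c) ^ q) ^ p < 2 ^ n"
proof -
  define k where "k = (\<bar>a\<bar> * (1 + \<bar>c\<bar>) ^ q) ^ p"
  have "(\<lambda>n. (real n + 1) ^ (q * p) / 2 ^ n) \<longlonglongrightarrow> 0" by real_asymp
  then have "(\<lambda>n. k * ((real n + 1) ^ (q * p) / 2 ^ n)) \<longlonglongrightarrow> 0" by (rule tendsto_mult_right_zero)
  then have "\<forall>\<^sub>F n in sequentially. k * ((real n + 1) ^ (q * p) / 2 ^ n) < 1"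
    by (rule order_tendstoD(2)) simp
  then obtain n where n: "k * (real n + 1) ^ (q * p) < 2 ^ n"
    by (auto simp: eventually_sequentially divide_simps)
  have "\<bar>1 + real n * c\<bar> \<le> (1 + \<bar>c\<bar>) * (real n + 1)"
    by (rule order_trans[OF abs_triangle_ineq]) (simp add: algebra_simps abs_mult)
  then have "\<bar>1 + real n * c\<bar> ^ q \<le> ((1 + \<bar>c\<bar>) * (real n + 1)) ^ q" by (rule power_mono[OF _ abs_ge_zero])
  then have "(\<bar>a\<bar> * \<bar>1 + real n * c\<bar> ^ q) ^ p \<le> (\<bar>a\<bar> * ((1 + \<bar>c\<bar>) * (real n + 1)) ^ q) ^ p"
    by (rule power_mono[OF mult_left_mono]) auto
  also have "\<dots> = k * (real n + 1) ^ (q * p)" by (simp add: k_def power_mult_distrib power_mult)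
  finally have "\<bar>(a * (1 + real n * c) ^ q) ^ p\<bar> < 2 ^ n" using n by (simp add: abs_mult power_abs)
  then show ?thesis by (intro exI[of _ n]) simp
qed

context growth_action
begin

text \<open>Cancelling adjacent powers of \<open>t\<close> turns the product into
  \<open>t ^ n\<close> followed by at most \<open>n\<close> letters \<open>f\<close> and
  \<open>n\<close> letters \<open>inverse t\<close>, so the length is linear in \<open>n\<close>
  although the conjugators grow.\<close>

lemma aw_ell:
  assumes t: "t \<in> H" and f: "f \<in> H"
  shows "aw t f n E \<in> H" "ell (aw t f n E) \<le> real n * (2 * ell t + ell f)"
proof -
  have H1: "t ^ i * f * inverse (t ^ i) \<in> H" for i by (rule sgrp_conj[OF H sgrp_power[OF H t] f])
  have awH: "aw t f n E \<in> H" for n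
  proof (induction n)
    case (Suc n)
    then show ?case using sgrp_mult[OF H H1[of "Suc n"]] by (simp del: power_Suc)
  qed (simp add: sgrp_one[OF H])
  then show "aw t f n E \<in> H" .
  have v: "ell (inverse (t ^ n) * aw t f n E) \<le> real n * (ell t + ell f)"
  proof (induction n)
    case (Suc n)
    define v where "v = inverse (t ^ n) * aw t f n E"
    have vH: "v \<in> H" unfolding v_def using sgrp_mult[OF H sgrp_inv[OF H sgrp_power[OF H t]] awH] .
    have tv: "inverse t * v \<in> H" by (rule sgrp_mult[OF H sgrp_inv[OF H t] vH])
    have e: "ell (inverse t * v) \<le> ell t + ell v" using ell_mult[OF sgrp_inv[OF H t] vH] ell_inv[OF t] by simp
    have p: "inverse (t ^ Suc n) = inverse t * inverse (t ^ n)" by (simp add: power_Suc2 grp_inv_mult del: power_Suc)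
    have "inverse (t ^ Suc n) * aw t f (Suc n) E = (if Suc n \<in> E then f * (inverse t * v) else inverse t * v)"
      by (simp add: v_def mult.assoc del: power_Suc) (simp add: p mult.assoc del: power_Suc)
    moreover have "ell (f * (inverse t * v)) \<le> ell f + ell (inverse t * v)" by (rule ell_mult[OF f tv])
    ultimately have "ell (inverse (t ^ Suc n) * aw t f (Suc n) E) \<le> ell f + (ell t + ell v)"
      using e ell_nonneg[OF f] by auto
    then show ?case using Suc by (simp add: v_def algebra_simps)
  qed (simp add: ell_one)
  have "ell (t ^ n * (inverse (t ^ n) * aw t f n E)) \<le> ell (t ^ n) + ell (inverse (t ^ n) * aw t f n E)"
    by (rule ell_mult) (intro sgrp_power sgrp_mult sgrp_inv H t awH)+
  then show "ell (aw t f n E) \<le> real n * (2 * ell t + ell f)"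
    using v ell_power[OF t, of n] by (simp add: algebra_simps)
qed

text \<open>The argument of Milnor: there are \<open>2 ^ n\<close> sets \<open>E\<close>, but only
  polynomially many orbit points in reach. The collision is found for all \<open>f \<in> F\<close>
  simultaneously, at the price of the exponent \<open>card F\<close>; \<open>vh_relation\<close>
  relies on one pair of sets for all generators.\<close>

lemma words_collide:
  assumes t: "t \<in> H" and F: "finite F" "F \<subseteq> H"
  obtains n E E' where "E \<subseteq> {1..n}" "E' \<subseteq> {1..n}" "E \<noteq> E'" "\<And>f. f \<in> F \<Longrightarrow> aw t f n E \<star> b = aw t f n E' \<star> b"
proof -
  define c where "c = 2 * ell t + Max (insert 0 (ell ` F))"
  have c: "2 * ell t + ell f \<le> c" if "f \<in> F" for f using F(1) that by (simp add: c_def)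
  have c0: "c \<ge> 0" using ell_nonneg[OF t] F(1) by (simp add: c_def Max_ge_iff)
  obtain n where n: "(C * (1 + real n * c) ^ D) ^ card F < 2 ^ n" using exp_beats_poly by blast
  let ?B = "{g \<star> b | g. g \<in> H \<and> ell g \<le> real n * c}"
  let ?w = "\<lambda>E. \<lambda>f\<in>F. aw t f n E \<star> b"
  have "\<not> inj_on ?w (Pow {1..n})"
  proof
    assume inj: "inj_on ?w (Pow {1..n})"
    have "?w ` Pow {1..n} \<subseteq> (\<Pi>\<^sub>E f\<in>F. ?B)"
    proof (rule image_subsetI)
      fix E
      have "aw t f n E \<star> b \<in> ?B" if f: "f \<in> F" for f
      proof -
        have fH: "f \<in> H" using f F by auto
        have "ell (aw t f n E) \<le> real n * c"
          using aw_ell(2)[OF t fH, of n E] mult_left_mono[OF c[OF f], of "real n"] by linarith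
        then show ?thesis using aw_ell(1)[OF t fH] by blast
      qed
      then show "?w E \<in> (\<Pi>\<^sub>E f\<in>F. ?B)" by (intro restrict_PiE_iff[THEN iffD2] ballI)
    qed
    then have "card (Pow {1..n}) \<le> card (\<Pi>\<^sub>E f\<in>F. ?B)"
      using inj F(1) ball_fin by (intro card_inj_on_le[OF inj] finite_PiE) auto
    then have "2 ^ n \<le> card ?B ^ card F" by (simp add: card_Pow card_PiE[OF F(1)])
    then have "real (2 ^ n) \<le> real (card ?B ^ card F)" by (rule of_nat_mono)
    also have "\<dots> = real (card ?B) ^ card F" by simp
    also have "\<dots> \<le> (C * (1 + real n * c) ^ D) ^ card F"
      using c0 ball_card[of "real n * c"] by (intro power_mono) auto
    finally show False using n by simp
  qed
  then obtain E E' where E: "E \<subseteq> {1..n}" "E' \<subseteq> {1..n}" "E \<noteq> E'" and eq: "?w E = ?w E'" unfolding inj_on_def by blast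
  have "aw t f n E \<star> b = aw t f n E' \<star> b" if "f \<in> F" for f using fun_cong[OF eq, of f] that by simp
  then show ?thesis using that[OF E] by blast
qed

text \<open>Solve for the last factor in which the two words differ.\<close>

lemma aw_collision:
  assumes L: "sgrp L" and t: "t \<in> L" and f: "f \<in> L"
    and ne: "E \<inter> {1..n} \<noteq> E' \<inter> {1..n}" and eq: "aw t f n E \<star> b = aw t f n E' \<star> b"
  shows "\<exists>m\<ge>1. t ^ m * f * inverse (t ^ m) \<in> gen (stab L \<union> {t ^ i * f * inverse (t ^ i) | i. 1 \<le> i \<and> i < m})"
  using ne eq
proof (induction n)
  case (Suc n)
  let ?c = "t ^ Suc n * f * inverse (t ^ Suc n)"
  let ?A = "stab L \<union> {t ^ i * f * inverse (t ^ i) | i. 1 \<le> i \<and> i < Suc n}"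
  have AL: "?A \<subseteq> L" using sgrp_conj[OF L sgrp_power[OF L t] f] stab_L by auto
  have awA: "aw t f n P \<in> gen ?A" for P by (rule aw_gen, rule gen_incl) auto
  have cL: "?c \<in> L" by (rule sgrp_conj[OF L sgrp_power[OF L t] f])
  have awL: "aw t f n P \<in> L" for P using awA gen_least[OF L AL] by blast
  have key: "?c \<in> gen ?A" if "(?c * aw t f n P) \<star> b = aw t f n Q \<star> b" for P Q
  proof -
    have "aw t f n Q \<star> b = (?c * aw t f n P) \<star> b" using that by simp
    then have "inverse (aw t f n Q) * (?c * aw t f n P) \<in> stab L"
      using same_point[of "aw t f n Q" "?c * aw t f n P"] sgrp_mult[OF L sgrp_inv[OF L awL] sgrp_mult[OF L cL awL]]
      unfolding stab_def by blast
    then have k: "inverse (aw t f n Q) * (?c * aw t f n P) \<in> gen ?A" by (intro gen_incl) blast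
    have "aw t f n Q * (inverse (aw t f n Q) * (?c * aw t f n P)) * inverse (aw t f n P) \<in> gen ?A"
      by (rule sgrp_mult[OF sgrp_gen sgrp_mult[OF sgrp_gen awA[of Q] k] sgrp_inv[OF sgrp_gen awA[of P]]])
    then show ?thesis by (simp add: mult.assoc del: power_Suc)
  qed
  show ?case
  proof (cases "Suc n \<in> E \<longleftrightarrow> Suc n \<in> E'")
    case True
    have "aw t f n E \<star> b = aw t f n E' \<star> b"
      using Suc.prems(2) True by (cases "Suc n \<in> E") (simp_all add: act_mult act_inj del: power_Suc)
    moreover have "{1..Suc n} = insert (Suc n) {1..n}" by auto
    then have "E \<inter> {1..n} \<noteq> E' \<inter> {1..n}" using Suc.prems(1) True by (auto split: if_splits)
    ultimately show ?thesis using Suc.IH by blast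
  next
    case False
    then have "?c \<in> gen ?A"
      using Suc.prems(2) key[of E E'] key[of E' E] by (cases "Suc n \<in> E") (simp_all del: power_Suc)
    then show ?thesis by (intro exI[of _ "Suc n"]) simp
  qed
qed simp

lemma collision:
  assumes L: "sgrp L" "L \<subseteq> H" and t: "t \<in> L" and f: "f \<in> L"
  shows "\<exists>m\<ge>1. t ^ m * f * inverse (t ^ m) \<in> gen (stab L \<union> {t ^ i * f * inverse (t ^ i) | i. 1 \<le> i \<and> i < m})"
proof (rule words_collide[of t "{f}"])
  show "t \<in> H" "finite {f}" "{f} \<subseteq> H" using t f L(2) by auto
  fix n E E' assume E: "E \<subseteq> {1..n}" "E' \<subseteq> {1..n}" "E \<noteq> E'" "\<And>f'. f' \<in> {f} \<Longrightarrow> aw t f' n E \<star> b = aw t f' n E' \<star> b"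
  then have "E \<inter> {1..n} \<noteq> E' \<inter> {1..n}" by auto
  then show ?thesis using aw_collision[OF L(1) t f _ E(4)] by blast
qed

text \<open>The translates by \<open>t ^ j\<close>, \<open>j \<le> n\<close>, of the \<open>n\<close>-ball of the kernel are disjoint.\<close>

lemma growing_kernel_degree:
  fixes \<theta> :: "'g \<Rightarrow> int"
  assumes L: "sgrp L" "L \<subseteq> H" and gr: "growing L e" and \<theta>: "add_hom L \<theta>" and st: "\<And>g. g \<in> stab L \<Longrightarrow> \<theta> g = 0"
    and t: "t \<in> L" "\<theta> t = 1" and r': "conn {g \<in> L. \<theta> g = 0} r'"
  shows "\<exists>e'. e = Suc e' \<and> growing {g \<in> L. \<theta> g = 0} e'"
proof -
  let ?M = "{g \<in> L. \<theta> g = 0}"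
  have M: "sgrp ?M" "?M \<subseteq> L" using sgrp_kernel[OF \<theta> L(1)] by auto
  have MH: "?M \<subseteq> H" using M(2) L(2) by blast
  obtain r C' where r: "conn L r" and C': "\<And>n. real (card (orb (pw (sph L r) n))) \<le> C' * (real n + 1) ^ e"
    using gr unfolding growing_def by blast
  have r0: "r \<ge> 0" using r by (simp add: conn_def)
  have one: "1 \<in> sph L r" by (rule sph_one[OF L(1) r0])
  obtain m where m: "m \<ge> 1" "\<And>n. pw (sph ?M r') n \<subseteq> pw (sph L r) (m * n)" using pw_sub[OF L M r] by blast
  obtain k where k: "t \<in> pw (sph L r) k" using gen_pw[OF sph_inv[OF L], of r t] t(1) r by (auto simp: conn_def)
  have tj: "t ^ j \<in> pw (sph L r) (k * j)" for j
  proof (induction j)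
    case (Suc j)
    then show ?case using pw_add[OF k Suc] by simp
  qed simp
  define q where "q = k + m"
  have key: "(real n + 1) * real (card (orb (pw (sph ?M r') n))) \<le> (\<bar>C'\<bar> * real q ^ e) * (real n + 1) ^ e" for n
  proof -
    let ?O = "orb (pw (sph ?M r') n)"
    let ?f = "\<lambda>(j, x). t ^ j \<star> x"
    have inj: "inj_on ?f ({..n} \<times> ?O)"
    proof (rule inj_onI, clarify)
      fix i x j y assume x: "x \<in> ?O" and y: "y \<in> ?O" and eq: "t ^ i \<star> x = t ^ j \<star> y"
      obtain u v where u: "u \<in> pw (sph ?M r') n" "x = u \<star> b" and v: "v \<in> pw (sph ?M r') n" "y = v \<star> b"
        using x y unfolding orb_def by blast
      have uM: "u \<in> ?M" and vM: "v \<in> ?M" using u v pw_sph_L[OF M(1)] by blast+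
      have "(t ^ i * u) \<star> b = (t ^ j * v) \<star> b" using eq u v by (simp add: act_mult)
      then have "inverse (t ^ i * u) * (t ^ j * v) \<in> stab L"
        using same_point[of "t ^ i * u" "t ^ j * v"] uM vM t(1) unfolding stab_def
        by (auto intro!: sgrp_mult[OF L(1)] sgrp_inv[OF L(1)] sgrp_power[OF L(1)])
      \<comment> \<open>Two translates with a common point differ by an element of the stabilizer,
        on which \<open>\<theta>\<close> vanishes; here its value is computed to be
        \<open>j - i\<close>.\<close>
      moreover have "\<theta> (inverse (t ^ i * u) * (t ^ j * v)) = int j - int i"
        using uM vM t by (simp add: add_hom_mult[OF \<theta>] add_hom_inv[OF \<theta> L(1)] add_hom_power[OF \<theta> L(1)] sgrp_mult[OF L(1)]
            sgrp_inv[OF L(1)] sgrp_power[OF L(1)])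
      ultimately have "i = j" using st by fastforce
      then show "i = j \<and> x = y" using eq by (simp add: act_inj)
    qed
    have sub: "?f ` ({..n} \<times> ?O) \<subseteq> orb (pw (sph L r) (q * n))"
    proof
      fix z assume "z \<in> ?f ` ({..n} \<times> ?O)"
      then obtain j x where j: "j \<in> {..n}" and "x \<in> ?O" and z: "z = t ^ j \<star> x" by auto
      from \<open>x \<in> ?O\<close> obtain u where u: "u \<in> pw (sph ?M r') n" "x = u \<star> b" unfolding orb_def by blast
      have "t ^ j * u \<in> pw (sph L r) (k * j + m * n)" using pw_add[OF tj] m(2) u(1) by blast
      moreover have "k * j + m * n \<le> q * n" using j by (simp add: q_def algebra_simps)
      ultimately have "t ^ j * u \<in> pw (sph L r) (q * n)" using pw_mono[OF one] by blast
      then have "(t ^ j * u) \<star> b \<in> orb (pw (sph L r) (q * n))" unfolding orb_def by (rule imageI)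
      then show "z \<in> orb (pw (sph L r) (q * n))" using u(2) z by (simp add: act_mult)
    qed
    have "(n + 1) * card ?O = card ({..n} \<times> ?O)" by (simp add: card_cartesian_product)
    also have "\<dots> \<le> card (orb (pw (sph L r) (q * n)))" by (rule card_inj_on_le[OF inj sub orb_pw_fin[OF L]])
    finally have "real ((n + 1) * card ?O) \<le> real (card (orb (pw (sph L r) (q * n))))" by (rule of_nat_mono)
    also have "\<dots> \<le> C' * (real (q * n) + 1) ^ e" by (rule C')
    also have "\<dots> \<le> \<bar>C'\<bar> * (real q * (real n + 1)) ^ e"
      using m(1) by (intro mult_mono power_mono) (auto simp: q_def algebra_simps)
    also have "real ((n + 1) * card ?O) = (real n + 1) * real (card ?O)" by (simp only: of_nat_mult of_nat_add of_nat_1)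
    finally show ?thesis by (simp only: power_mult_distrib mult.assoc)
  qed
  have card1: "real (card (orb (pw (sph ?M r') n))) \<ge> 1" for n
  proof -
    have r'0: "r' \<ge> 0" using r' by (simp add: conn_def)
    have "1 \<in> pw (sph ?M r') n" using pw_mono[OF sph_one[OF M(1) r'0], of 0 n] by auto
    then have "orb (pw (sph ?M r') n) \<noteq> {}" by (auto simp: orb_def)
    then show ?thesis using orb_pw_fin[OF M(1) MH, of r' n] by (simp add: Suc_le_eq card_gt_0_iff)
  qed
  \<comment> \<open>The \<open>n + 1\<close> disjoint translates of a nonempty set rule out bounded
    growth, so \<open>e\<close> is a successor.\<close>
  have "e \<noteq> 0"
  proof
    assume "e = 0"
    obtain n :: nat where n: "real n > \<bar>C'\<bar>" using reals_Archimedean2 by blast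
    have "(real n + 1) * 1 \<le> (real n + 1) * real (card (orb (pw (sph ?M r') n)))"
      by (rule mult_left_mono[OF card1[of n]]) simp
    also have "\<dots> \<le> \<bar>C'\<bar>" using key[of n] \<open>e = 0\<close> by simp
    finally show False using n by simp
  qed
  then obtain e' where e': "e = Suc e'" by (cases e) auto
  have "real (card (orb (pw (sph ?M r') n))) \<le> (\<bar>C'\<bar> * real q ^ e) * (real n + 1) ^ e'" for n
  proof -
    have "(real n + 1) * real (card (orb (pw (sph ?M r') n))) \<le> (real n + 1) * ((\<bar>C'\<bar> * real q ^ e) * (real n + 1) ^ e')"
      using key[of n] by (simp add: e' algebra_simps)
    then show ?thesis by (rule mult_left_le_imp_le) simp
  qed
  then show ?thesis using e' r' unfolding growing_def by blast
qed

text \<open>By \<open>collision\<close>, the stabilizer and finitely many conjugates by powers of \<open>t\<close> generate a subgroup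
  that \<open>t\<close> normalizes.\<close>

lemma kernel_conn:
  fixes \<theta> :: "'g \<Rightarrow> int"
  assumes L: "sgrp L" "L \<subseteq> H" and r: "conn L r" and \<theta>: "add_hom L \<theta>" and st: "\<And>g. g \<in> stab L \<Longrightarrow> \<theta> g = 0"
    and t: "t \<in> L" "\<theta> t = 1"
  shows "\<exists>r'. conn {g \<in> L. \<theta> g = 0} r'"
proof -
  let ?M = "{g \<in> L. \<theta> g = 0}"
  let ?K = "stab L"
  have M: "sgrp ?M" "?M \<subseteq> L" using sgrp_kernel[OF \<theta> L(1)] by auto
  have MH: "?M \<subseteq> H" using M(2) L(2) by blast
  have KM: "?K \<subseteq> ?M" using st stab_L by blast
  have tM: "s * g * inverse s \<in> ?M" if "g \<in> ?M" "s \<in> L" for s g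
    using that by (simp add: add_hom_mult[OF \<theta>] add_hom_inv[OF \<theta> L(1)] sgrp_mult[OF L(1)] sgrp_inv[OF L(1)])
  define c where "c f j = power_int t j * f * inverse (power_int t j)" for f j
  have cM: "c f j \<in> ?M" if "f \<in> ?M" for f j unfolding c_def by (rule tM[OF that sgrp_powi[OF L(1) t(1)]])
  have c_add: "power_int t i * c f j * inverse (power_int t i) = c f (i + j)" for f i j
    by (simp add: c_def grp_powi_add grp_inv_mult mult.assoc)
  \<comment> \<open>\<open>t\<close> need not normalize the stabilizer \<open>?K\<close>, but the
    conjugates of its elements by \<open>power_int t j\<close> have bounded displacement and so meet
    finitely many cosets of \<open>?K\<close>. The cases \<open>j = 1\<close> and
    \<open>j = - 1\<close> suffice, as conjugation proceeds one step at a time.\<close>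
  have reps: "\<exists>F. finite F \<and> F \<subseteq> ?K \<and> (\<forall>g\<in>?K. \<exists>f\<in>F. inverse (c f j) * c g j \<in> ?K)" for j
  proof -
    have "finite (orb ((\<lambda>g. c g j) ` ?K))"
    proof (rule orb_fin)
      show "(\<lambda>g. c g j) ` ?K \<subseteq> H" using cM KM MH by blast
      fix g assume "g \<in> (\<lambda>g. c g j) ` ?K"
      then obtain g' where g': "g' \<in> ?K" "g = c g' j" by blast
      have "g' \<in> H" "ell g' = 0" using g'(1) ell_stab[of g'] L(2) by (auto simp: stab_def)
      then show "ell g \<le> 2 * ell (power_int t j)"
        using ell_conj[of g' "power_int t j"] sgrp_powi[OF L(1) t(1)] L(2) g'(2) by (auto simp: c_def)
    qed
    then obtain T where T: "finite T" "T \<subseteq> (\<lambda>g. c g j) ` ?K" "\<And>g. g \<in> (\<lambda>g. c g j) ` ?K \<Longrightarrow> \<exists>t\<in>T. g \<star> b = t \<star> b"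
      using finite_reps by metis
    obtain F where F: "F \<subseteq> ?K" "finite F" "T = (\<lambda>g. c g j) ` F" using finite_subset_image[OF T(1,2)] by blast
    have "\<exists>f\<in>F. inverse (c f j) * c g j \<in> ?K" if g: "g \<in> ?K" for g
    proof -
      obtain f where f: "f \<in> F" "c g j \<star> b = c f j \<star> b" using T(3)[of "c g j"] g F(3) by blast
      have "c f j \<in> L" "c g j \<in> L" using cM KM F(1) f(1) g M(2) by blast+
      then have "inverse (c f j) * c g j \<in> ?K"
        using same_point[of "c f j" "c g j"] f(2) sgrp_mult[OF L(1) sgrp_inv[OF L(1)]] unfolding stab_def by auto
      then show ?thesis using f(1) by blast
    qed
    then show ?thesis using F by blast
  qed
  obtain T where T: "finite T" "T \<subseteq> L" "L \<subseteq> gen (T \<union> ?K)" using finite_gen[OF L r] by blast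
  obtain F1 where F1: "finite F1" "F1 \<subseteq> ?K" "\<And>g. g \<in> ?K \<Longrightarrow> \<exists>f\<in>F1. inverse (c f 1) * c g 1 \<in> ?K" using reps[of 1] by blast
  obtain F2 where F2: "finite F2" "F2 \<subseteq> ?K" "\<And>g. g \<in> ?K \<Longrightarrow> \<exists>f\<in>F2. inverse (c f (- 1)) * c g (- 1) \<in> ?K" using reps[of "- 1"] by blast
  \<comment> \<open>The kernel components of the generators, together with enough of the stabilizer
    to control its conjugates by \<open>t\<close> and \<open>inverse t\<close>.\<close>
  define F where "F = (\<lambda>s. s * inverse (power_int t (\<theta> s))) ` T \<union> F1 \<union> F2"
  have F: "finite F" "F \<subseteq> ?M"
  proof -
    show "finite F" using T F1 F2 by (simp add: F_def)
    have "s * inverse (power_int t (\<theta> s)) \<in> ?M" if "s \<in> T" for s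
      using that T(2) t by (auto simp: add_hom_mult[OF \<theta>] add_hom_inv[OF \<theta> L(1)] add_hom_powi[OF \<theta> L(1)] sgrp_mult[OF L(1)]
          sgrp_inv[OF L(1)] sgrp_powi[OF L(1)])
    then show "F \<subseteq> ?M" using F1(2) F2(2) KM by (auto simp: F_def)
  qed
  have ti: "inverse t \<in> L" by (rule sgrp_inv[OF L(1) t(1)])
  have cp: "t ^ i * f * inverse (t ^ i) = c f (int i)" for i f by (simp add: c_def)
  have cn: "inverse t ^ i * f * inverse (inverse t ^ i) = c f (- int i)" for i f
    by (simp add: c_def grp_powi_minus grp_inv_power)
  define Pmp where "Pmp f m \<longleftrightarrow> m \<ge> 1 \<and> c f (int m) \<in> gen (?K \<union> {c f (int i) | i. 1 \<le> i \<and> i < m})" for f m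
  have "\<exists>m. Pmp f m" if "f \<in> F" for f
    using collision[OF L t(1), of f] F(2) that unfolding cp Pmp_def by blast
  then obtain mp where "\<And>f. f \<in> F \<Longrightarrow> Pmp f (mp f)" by metis
  then have mp: "\<And>f. f \<in> F \<Longrightarrow> mp f \<ge> 1 \<and> c f (int (mp f)) \<in> gen (?K \<union> {c f (int i) | i. 1 \<le> i \<and> i < mp f})" unfolding Pmp_def by blast
  define Pmn where "Pmn f m \<longleftrightarrow> m \<ge> 1 \<and> c f (- int m) \<in> gen (?K \<union> {c f (- int i) | i. 1 \<le> i \<and> i < m})" for f m
  have "\<exists>m. Pmn f m" if "f \<in> F" for f
    using collision[OF L ti, of f] F(2) that unfolding cn Pmn_def by blast
  then obtain mn where "\<And>f. f \<in> F \<Longrightarrow> Pmn f (mn f)" by metis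
  then have mn: "\<And>f. f \<in> F \<Longrightarrow> mn f \<ge> 1 \<and> c f (- int (mn f)) \<in> gen (?K \<union> {c f (- int i) | i. 1 \<le> i \<and> i < mn f})" unfolding Pmn_def by blast
  \<comment> \<open>The exponents strictly between the negative and the positive collision of
    \<open>f\<close>. The conjugates at both ends lie in \<open>W\<close> too (\<open>YW\<close>),
    so a shift by one stays in \<open>W\<close>.\<close>
  define Y where "Y = (\<Union>f\<in>F. c f ` {- int (mn f)<..<int (mp f)})"
  define W where "W = gen (?K \<union> Y)"
  have W: "sgrp W" by (simp add: W_def sgrp_gen)
  have YM: "Y \<subseteq> ?M" using cM F(2) unfolding Y_def by blast
  have WM: "W \<subseteq> ?M" unfolding W_def using YM KM by (intro gen_least M(1)) blast
  have YW: "c f j \<in> W" if "f \<in> F" "- int (mn f) \<le> j" "j \<le> int (mp f)" for f j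
  proof -
    have sub: "?K \<union> {c f (int i) | i. 1 \<le> i \<and> i < mp f} \<subseteq> ?K \<union> Y" "?K \<union> {c f (- int i) | i. 1 \<le> i \<and> i < mn f} \<subseteq> ?K \<union> Y"
      using mp[OF that(1)] mn[OF that(1)] that(1) by (force simp: Y_def)+
    have "c f (int (mp f)) \<in> W" "c f (- int (mn f)) \<in> W"
      using mp[OF that(1)] mn[OF that(1)] gen_mono[OF sub(1)] gen_mono[OF sub(2)] unfolding W_def by blast+
    moreover have "c f j \<in> W" if "j \<noteq> int (mp f)" "j \<noteq> - int (mn f)"
      unfolding W_def Y_def using that \<open>f \<in> F\<close> \<open>- int (mn f) \<le> j\<close> \<open>j \<le> int (mp f)\<close>
      by (intro gen_incl UnI2 UN_I[of f] imageI) auto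
    ultimately show ?thesis by metis
  qed
  have KW: "?K \<subseteq> W" unfolding W_def using gen_incl by blast
  have conjW: "power_int t i * g * inverse (power_int t i) \<in> W" if i: "i = 1 \<or> i = - 1" and g: "g \<in> W" for i g
  proof -
    have "sgrp {g. power_int t i * g * inverse (power_int t i) \<in> W}"
    proof (rule sgrpI)
      show "1 \<in> {g. power_int t i * g * inverse (power_int t i) \<in> W}" using sgrp_one[OF W] by simp
      fix g assume "g \<in> {g. power_int t i * g * inverse (power_int t i) \<in> W}"
      then have *: "power_int t i * g * inverse (power_int t i) \<in> W" by simp
      show "inverse g \<in> {g. power_int t i * g * inverse (power_int t i) \<in> W}"
        using sgrp_inv[OF W *] by (simp add: grp_inv_mult mult.assoc)
      fix h assume "h \<in> {g. power_int t i * g * inverse (power_int t i) \<in> W}"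
      then have "power_int t i * h * inverse (power_int t i) \<in> W" by simp
      note sgrp_mult[OF W * this]
      then show "g * h \<in> {g. power_int t i * g * inverse (power_int t i) \<in> W}"
        by (simp add: mult.assoc)
    qed
    moreover have "?K \<union> Y \<subseteq> {g. power_int t i * g * inverse (power_int t i) \<in> W}"
    proof
      fix g assume "g \<in> ?K \<union> Y"
      then show "g \<in> {g. power_int t i * g * inverse (power_int t i) \<in> W}"
      proof
        assume "g \<in> Y"
        then obtain f j where f: "f \<in> F" "- int (mn f) < j" "j < int (mp f)" "g = c f j" by (auto simp: Y_def)
        then have "c f (i + j) \<in> W" using i by (intro YW) auto
        then show ?thesis using f(4) c_add[of i f j] by simp
      next
        assume g: "g \<in> ?K"
        obtain f where f: "f \<in> F" "inverse (c f i) * c g i \<in> ?K"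
          using F1(3)[OF g] F2(3)[OF g] i unfolding F_def by blast
        have "c f i \<in> W" using YW[OF f(1), of i] mp[OF f(1)] mn[OF f(1)] i by auto
        then have "c f i * (inverse (c f i) * c g i) \<in> W" using sgrp_mult[OF W] f(2) KW by blast
        then show ?thesis by (simp add: c_def)
      qed
    qed
    ultimately show ?thesis using g gen_least[of "{g. power_int t i * g * inverse (power_int t i) \<in> W}" "?K \<union> Y"]
      unfolding W_def by blast
  qed
  have conjW': "power_int t i * g * inverse (power_int t i) \<in> W" if g: "g \<in> W" for i g
  proof (induction i rule: int_induct[of _ 0])
    case base
    then show ?case using g by simp
  next
    case (step1 i)
    then show ?case using conjW[of 1, OF _ step1(2)] by (simp add: grp_powi_add grp_inv_mult mult.assoc flip: add.commute[of 1])
  next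
    case (step2 i)
    have "power_int t (i - 1) = power_int t (- 1) * power_int t i" using grp_powi_add[of t "- 1" i] by simp
    then show ?case using conjW[of "- 1", OF _ step2(2)] by (simp add: grp_inv_mult mult.assoc)
  qed
  have seedW: "s * inverse (power_int t (\<theta> s)) \<in> W \<and> s \<in> L" if "s \<in> T \<union> ?K" for s
  proof (cases "s \<in> T")
    case True
    then have "s * inverse (power_int t (\<theta> s)) \<in> F" by (simp add: F_def)
    then have "c (s * inverse (power_int t (\<theta> s))) 0 \<in> W" by (intro YW) auto
    then show ?thesis using True T(2) by (auto simp: c_def)
  next
    case False
    then have "s \<in> ?K" using that by blast
    then show ?thesis using KW stab_L[of L] by (auto simp: st)
  qed
  have gW: "g * inverse (power_int t (\<theta> g)) \<in> W \<and> g \<in> L" if "g \<in> gen (T \<union> ?K)" for g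
    using that
  proof (induction rule: gen.induct)
    case gen_one
    then show ?case using sgrp_one[OF W] sgrp_one[OF L(1)] add_hom_one[OF \<theta> L(1)] by simp
  next
    case (gen_step g s)
    have s: "s * inverse (power_int t (\<theta> s)) \<in> W" "s \<in> L" using seedW[OF gen_step(2)] by auto
    have "g * s * inverse (power_int t (\<theta> (g * s))) =
      (g * inverse (power_int t (\<theta> g))) * (power_int t (\<theta> g) * (s * inverse (power_int t (\<theta> s))) * inverse (power_int t (\<theta> g)))"
      using gen_step s by (simp add: add_hom_mult[OF \<theta>] grp_powi_add grp_inv_mult mult.assoc)
    also have "\<dots> \<in> W" using gen_step.IH sgrp_mult[OF W _ conjW'[OF s(1)]] by blast
    finally show ?case using sgrp_mult[OF L(1)] gen_step s by blast
  next
    case (gen_step_inv g s)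
    have s: "s * inverse (power_int t (\<theta> s)) \<in> W" "s \<in> L" using seedW[OF gen_step_inv(2)] by auto
    define k where "k = \<theta> g - \<theta> s"
    have k: "\<theta> (g * inverse s) = k" using gen_step_inv s by (simp add: k_def add_hom_mult[OF \<theta>] add_hom_inv[OF \<theta> L(1)] sgrp_inv[OF L(1)])
    have tg: "power_int t (\<theta> g) = power_int t k * power_int t (\<theta> s)" by (simp add: k_def flip: grp_powi_add)
    have "g * inverse s * inverse (power_int t (\<theta> (g * inverse s))) =
      (g * inverse (power_int t (\<theta> g))) * (power_int t k * inverse (s * inverse (power_int t (\<theta> s))) * inverse (power_int t k))"
      unfolding k tg by (simp add: grp_inv_mult mult.assoc)
    also have "\<dots> \<in> W" using gen_step_inv.IH sgrp_mult[OF W _ conjW'[OF sgrp_inv[OF W s(1)]]] by blast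
    finally show ?case using sgrp_mult[OF L(1) _ sgrp_inv[OF L(1)]] gen_step_inv s by blast
  qed
  define R where "R = Max (insert 0 (ell ` Y))"
  have finY: "finite Y" using F(1) by (simp add: Y_def)
  have "conn ?M R"
  proof (rule conn_gen[OF M(1) MH])
    show "?K \<union> Y \<subseteq> ?M" using KM YM by blast
    show "?M \<subseteq> gen (?K \<union> Y)"
    proof
      fix g assume g: "g \<in> ?M"
      then have "g * inverse (power_int t (\<theta> g)) \<in> W" using gW T(3) by blast
      then show "g \<in> gen (?K \<union> Y)" using g by (simp add: W_def)
    qed
    fix u assume "u \<in> ?K \<union> Y"
    then show "ell u \<le> R"
    proof
      assume "u \<in> ?K"
      then have "ell u = 0" using ell_stab L(2) by (auto simp: stab_def)
      then show ?thesis using finY by (simp add: R_def)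
    qed (use finY in \<open>simp add: R_def\<close>)
  qed (use finY in \<open>simp add: R_def\<close>)
  then show ?thesis by blast
qed

text \<open>Division by the generator of the image keeps the kernel and makes the homomorphism
  surjective, so that some \<open>t\<close> has value 1.\<close>

theorem growing_kernel:
  fixes \<theta> :: "'g \<Rightarrow> int"
  assumes L: "sgrp L" "L \<subseteq> H" and gr: "growing L e" and \<theta>: "add_hom L \<theta>" and st: "\<And>g. g \<in> stab L \<Longrightarrow> \<theta> g = 0"
    and nz: "\<exists>g\<in>L. \<theta> g \<noteq> 0"
  shows "\<exists>e'. e = Suc e' \<and> growing {g \<in> L. \<theta> g = 0} e'"
proof -
  obtain t where t: "t \<in> L" "\<theta> t > 0" "\<And>g. g \<in> L \<Longrightarrow> \<theta> t dvd \<theta> g" using int_hom_generator[OF \<theta> L(1)] nz by blast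
  define \<theta>' where "\<theta>' g = \<theta> g div \<theta> t" for g
  have \<theta>': "add_hom L \<theta>'" using add_hom_mult[OF \<theta>] t(3) by (simp add: add_hom_def \<theta>'_def div_plus_div_distrib_dvd_left)
  have eq: "{g \<in> L. \<theta> g = 0} = {g \<in> L. \<theta>' g = 0}" using t(2,3) by (auto simp: \<theta>'_def dvd_div_eq_0_iff)
  have st': "\<theta>' g = 0" if "g \<in> stab L" for g using st[OF that] by (simp add: \<theta>'_def)
  have t1: "\<theta>' t = 1" using t(2) by (simp add: \<theta>'_def)
  obtain r where "conn L r" using gr unfolding growing_def by blast
  then obtain r' where r': "conn {g \<in> L. \<theta>' g = 0} r'" using kernel_conn[OF L _ \<theta>' st' t(1) t1] by blast
  show ?thesis unfolding eq by (rule growing_kernel_degree[OF L gr \<theta>' st' t(1) t1 r'])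
qed

end

section \<open>Periodic functions from polynomial relations\<close>

text \<open>Makes functions a module over the rational polynomials, with the indeterminate acting by
  composition with \<open>c\<close>; \<open>pact_mult\<close> is the module law.\<close>

definition pact :: "('x \<Rightarrow> 'x) \<Rightarrow> rat poly \<Rightarrow> ('x \<Rightarrow> real) \<Rightarrow> 'x \<Rightarrow> real" where
  "pact c p u x = (\<Sum>i\<le>Polynomial.degree p. of_rat (Polynomial.coeff p i) * u ((c ^^ i) x))"

lemma pact_bound:
  assumes "Polynomial.degree p \<le> n" shows "pact c p u x = (\<Sum>i\<le>n. of_rat (Polynomial.coeff p i) * u ((c ^^ i) x))"
  unfolding pact_def by (rule sum.mono_neutral_left) (use assms in \<open>auto simp: coeff_eq_0\<close>)

lemma pact_0 [simp]: "pact c 0 u x = 0"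
  by (simp add: pact_def)

lemma pact_pCons [simp]: "pact c (pCons a p) u x = of_rat a * u x + pact c p u (c x)"
proof -
  have "pact c (pCons a p) u x = (\<Sum>i\<le>Suc (Polynomial.degree p). of_rat (Polynomial.coeff (pCons a p) i) * u ((c ^^ i) x))"
    by (rule pact_bound) (rule degree_pCons_le)
  also have "\<dots> = of_rat a * u x + (\<Sum>i\<le>Polynomial.degree p. of_rat (Polynomial.coeff p i) * u ((c ^^ i) (c x)))"
    by (simp add: sum.atMost_Suc_shift funpow_swap1 del: sum.atMost_Suc)
  finally show ?thesis by (simp add: pact_def)
qed

lemma pact_add [simp]: "pact c (p + q) u x = pact c p u x + pact c q u x"
proof -
  define n where "n = max (Polynomial.degree p) (Polynomial.degree q)"
  have "Polynomial.degree p \<le> n" "Polynomial.degree q \<le> n" "Polynomial.degree (p + q) \<le> n" by (auto simp: n_def degree_add_le_max)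
  then show ?thesis
    by (simp add: pact_bound[of _ n] of_rat_add distrib_right sum.distrib)
qed

lemma pact_smult [simp]: "pact c (Polynomial.smult a p) u x = of_rat a * pact c p u x"
proof -
  have "Polynomial.degree (Polynomial.smult a p) \<le> Polynomial.degree p" by (rule degree_smult_le)
  then show ?thesis by (simp add: pact_bound[of _ "Polynomial.degree p"] of_rat_mult sum_distrib_left mult.assoc)
qed

lemma pact_diff [simp]: "pact c (p - q) u x = pact c p u x - pact c q u x"
  using pact_add[of c "p - q" q u x] by simp

lemma pact_mult: "pact c (p * q) u = pact c p (pact c q u)"
proof (induction p)
  case (pCons a p)
  show ?case by (rule ext) (simp add: pCons mult_pCons_left)
qed (simp add: fun_eq_iff)

lemma pact_zero_fun [simp]: "pact c p (\<lambda>_. 0) x = 0"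
  by (simp add: pact_def)

lemma pact_monom [simp]: "pact c (Polynomial.monom 1 n) u x = u ((c ^^ n) x)"
  by (induction n arbitrary: x) (simp_all add: monom_0 monom_Suc funpow_swap1)

lemma pact_sum_monom: "finite E \<Longrightarrow> pact c (\<Sum>i\<in>E. Polynomial.monom 1 (f i)) u x = (\<Sum>i\<in>E. u ((c ^^ f i) x))"
  by (induction E rule: finite_induct) auto

section \<open>Complex roots of rational polynomials\<close>

abbreviation cpoly :: "rat poly \<Rightarrow> complex poly" where "cpoly \<equiv> map_poly of_rat"

lemma complex_of_rat: "(of_rat q :: complex) = of_real (of_rat q)"
  by (cases q) (simp add: of_rat_rat)

lemma cpoly_add: "cpoly (p + q) = cpoly p + cpoly q"
  by (rule poly_eqI) (simp add: coeff_map_poly of_rat_add)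

lemma cpoly_diff: "cpoly (p - q) = cpoly p - cpoly q"
  by (rule poly_eqI) (simp add: coeff_map_poly of_rat_diff)

lemma cpoly_smult: "cpoly (Polynomial.smult a p) = Polynomial.smult (of_rat a) (cpoly p)"
  by (rule poly_eqI) (simp add: coeff_map_poly of_rat_mult)

lemma cpoly_mult: "cpoly (p * q) = cpoly p * cpoly q"
proof (induction p)
  case (pCons a p)
  then show ?case by (simp add: mult_pCons_left cpoly_add cpoly_smult map_poly_pCons)
qed simp

lemma cpoly_monom: "cpoly (Polynomial.monom 1 n) = Polynomial.monom 1 n"
  by (rule poly_eqI) (simp add: coeff_map_poly)

lemma cpoly_sum_monom: "finite E \<Longrightarrow> poly (cpoly (\<Sum>i\<in>E. Polynomial.monom 1 (f i))) z = (\<Sum>i\<in>E. z ^ f i)"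
  by (induction E rule: finite_induct) (auto simp: cpoly_add cpoly_monom poly_monom)

lemma cpoly_pderiv: "cpoly (pderiv p) = pderiv (cpoly p)"
  by (rule poly_eqI) (simp add: coeff_map_poly coeff_pderiv of_rat_mult of_rat_add)

lemma cpoly_eq_0 [simp]: "cpoly p = 0 \<longleftrightarrow> p = 0"
  by (auto simp: poly_eq_iff coeff_map_poly)

lemma degree_cpoly [simp]: "Polynomial.degree (cpoly p) = Polynomial.degree p"
  by (rule degree_map_poly) simp

text \<open>\<open>z\<close> is a root of a nonzero polynomial with coefficients 0, 1 and -1; beyond
  modulus 2 its leading term outweighs the geometric sum of the others.\<close>

lemma equal_power_sums_bound:
  fixes z :: complex
  assumes E: "finite E" "finite E'" "E \<noteq> E'" and eq: "(\<Sum>i\<in>E. z ^ i) = (\<Sum>i\<in>E'. z ^ i)"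
  shows "norm z \<le> 2"
proof (rule ccontr)
  assume "\<not> norm z \<le> 2"
  then have z: "norm z > 2" by simp
  define D where "D = (E - E') \<union> (E' - E)"
  have D: "finite D" "D \<noteq> {}" using E by (auto simp: D_def)
  define m where "m = Max D"
  define e where "e i = (if i \<in> E - E' then 1 else - 1 :: complex)" for i
  have "(\<Sum>i\<in>D. e i * z ^ i) = (\<Sum>i\<in>E - E'. e i * z ^ i) + (\<Sum>i\<in>E' - E. e i * z ^ i)"
    unfolding D_def using E by (intro sum.union_disjoint) auto
  also have "\<dots> = (\<Sum>i\<in>E - E'. z ^ i) - (\<Sum>i\<in>E' - E. z ^ i)"
    by (simp add: e_def sum_negf)
  also have "\<dots> = 0"
    using eq sum.Int_Diff[OF E(1), of "\<lambda>i. z ^ i" E'] sum.Int_Diff[OF E(2), of "\<lambda>i. z ^ i" E] by (simp add: Int_commute)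
  finally have s: "(\<Sum>i\<in>D. e i * z ^ i) = 0" .
  have mD: "m \<in> D" unfolding m_def by (rule Max_in[OF D])
  have "D - {m} \<subseteq> {..<m}" using Max_ge[OF D(1)] unfolding m_def by (auto simp: order_less_le)
  have "norm (e m * z ^ m) = norm (\<Sum>i\<in>D - {m}. e i * z ^ i)"
    using s sum.remove[OF D(1) mD, of "\<lambda>i. e i * z ^ i"] by (simp add: eq_neg_iff_add_eq_0[symmetric])
  also have "\<dots> \<le> (\<Sum>i\<in>D - {m}. norm z ^ i)"
    by (rule order_trans[OF norm_sum], rule sum_mono) (simp add: norm_mult norm_power e_def)
  also have "\<dots> \<le> (\<Sum>i<m. norm z ^ i)"
    by (rule sum_mono2) (use \<open>D - {m} \<subseteq> {..<m}\<close> in auto)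
  also have "\<dots> = (norm z ^ m - 1) / (norm z - 1)" using z by (intro geometric_sum) auto
  also have "\<dots> \<le> (norm z ^ m - 1) / 1"
    using z by (intro divide_left_mono) auto
  also have "\<dots> < norm z ^ m" by simp
  finally show False by (simp add: e_def norm_mult norm_power split: if_splits)
qed

lemma norm_le_1_from_powers:
  assumes "\<And>k. k \<ge> 1 \<Longrightarrow> (x::real) ^ k \<le> 2" shows "x \<le> 1"
proof (rule ccontr)
  assume "\<not> x \<le> 1"
  then obtain n where "2 < x ^ n" using real_arch_pow[of x 2] by auto
  moreover have "x ^ n \<le> x ^ Suc n" using \<open>\<not> x \<le> 1\<close> by (intro power_increasing) auto
  ultimately have "2 < x ^ Suc n" by linarith
  then show False using assms[of "Suc n"] by simp
qed

text \<open>Lagrange interpolation: the coefficients are linear combinations of the values on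
  \<open>A\<close>, with weights that depend on \<open>A\<close> alone.\<close>

lemma interpolation_bound:
  fixes A :: "complex set"
  assumes A: "finite A"
  shows "\<exists>K. \<forall>p l. Polynomial.degree p < card A \<longrightarrow> (\<forall>z\<in>A. norm (poly p z) \<le> 1) \<longrightarrow> norm (Polynomial.coeff p l) \<le> K"
proof -
  define q where "q z = (\<Prod>w\<in>A - {z}. [:- w, 1:])" for z
  define b where "b z = Polynomial.smult (inverse (poly (q z) z)) (q z)" for z
  have q0: "poly (q z) z \<noteq> 0" for z using A by (auto simp: q_def poly_prod)
  have bz: "poly (b z) z = 1" for z using q0[of z] by (simp add: b_def)
  have bw: "poly (b z) w = 0" if "w \<in> A" "w \<noteq> z" for z w
    using A that by (auto simp: b_def q_def poly_prod)
  have degq: "Polynomial.degree (b z) < card A" if "z \<in> A" for z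
  proof -
    have "Polynomial.degree (q z) \<le> (\<Sum>w\<in>A - {z}. 1)" unfolding q_def by (rule order_trans[OF degree_prod_sum_le]) (use A in auto)
    also have "\<dots> < card A" using card_Diff1_less[OF A that] by simp
    finally show ?thesis unfolding b_def using degree_smult_le le_less_trans by blast
  qed
  define K where "K = (\<Sum>l\<le>card A. \<Sum>z\<in>A. norm (Polynomial.coeff (b z) l))"
  have "norm (Polynomial.coeff p l) \<le> K" if p: "Polynomial.degree p < card A" "\<forall>z\<in>A. norm (poly p z) \<le> 1" for p l
  proof (cases "l \<le> card A")
    case True
    have "p = (\<Sum>z\<in>A. Polynomial.smult (poly p z) (b z))"
    proof (rule poly_eqI_degree[of A])
      show "poly p x = poly (\<Sum>z\<in>A. Polynomial.smult (poly p z) (b z)) x" if x: "x \<in> A" for x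
      proof -
        have "(\<Sum>z\<in>A. poly p z * poly (b z) x) = (\<Sum>z\<in>A. if z = x then poly p x else 0)"
          by (rule sum.cong) (use x bz bw in auto)
        then show ?thesis using A x by (simp add: poly_sum)
      qed
      have "Polynomial.degree (\<Sum>z\<in>A. Polynomial.smult (poly p z) (b z)) \<le> card A - 1"
        by (rule degree_sum_le[OF A]) (use degq degree_smult_le[of _ "b _"] in \<open>fastforce intro: order_trans[OF degree_smult_le]\<close>)
      then show "Polynomial.degree (\<Sum>z\<in>A. Polynomial.smult (poly p z) (b z)) < card A" using p(1) by linarith
    qed (use p in auto)
    then have "Polynomial.coeff p l = (\<Sum>z\<in>A. poly p z * Polynomial.coeff (b z) l)"
      by (metis (no_types, lifting) coeff_smult coeff_sum sum.cong)
    also have "norm \<dots> \<le> (\<Sum>z\<in>A. norm (Polynomial.coeff (b z) l))"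
    proof (rule order_trans[OF norm_sum], rule sum_mono)
      fix z assume "z \<in> A"
      then show "norm (poly p z * Polynomial.coeff (b z) l) \<le> norm (Polynomial.coeff (b z) l)"
        using p(2) mult_right_mono[of "norm (poly p z)" 1 "norm (Polynomial.coeff (b z) l)"] by (simp add: norm_mult)
    qed
    also have "\<dots> \<le> K" unfolding K_def
      by (rule member_le_sum[of l "{..card A}" "\<lambda>l. \<Sum>z\<in>A. norm (Polynomial.coeff (b z) l)"]) (use True in \<open>auto intro: sum_nonneg\<close>)
    finally show ?thesis .
  next
    case False
    then have "Polynomial.coeff p l = 0" using p(1) by (intro coeff_eq_0) auto
    then show ?thesis by (auto simp: K_def intro!: sum_nonneg)
  qed
  then show ?thesis by blast
qed

lemma common_denominator:
  fixes F :: "rat set"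
  assumes "finite F" shows "\<exists>N::nat. N \<ge> 1 \<and> (\<forall>x\<in>F. of_nat N * x \<in> \<int>)"
  using assms
proof (induction F rule: finite_induct)
  case empty
  show ?case by (auto intro: exI[of _ 1])
next
  case (insert x F)
  then obtain N where N: "N \<ge> 1" "\<forall>x\<in>F. of_nat N * x \<in> \<int>" by blast
  obtain a d where x: "quotient_of x = (a, d)" by fastforce
  have d: "d > 0" "x = of_int a / of_int d" using quotient_of_denom_pos[OF x] quotient_of_div[OF x] by auto
  have "of_nat (nat d * N) * x = of_int (a * int N)" using d by (simp add: field_simps)
  moreover have "of_nat (nat d * N) * y \<in> \<int>" if "y \<in> F" for y
  proof -
    have "of_nat (nat d) * (of_nat N * y) \<in> \<int>" by (rule Ints_mult[OF Ints_of_nat]) (use N that in auto)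
    then show ?thesis by (simp add: mult.assoc)
  qed
  moreover have "nat d * N \<ge> 1" using d N by simp
  ultimately show ?case by (metis Ints_of_int insert_iff)
qed

text \<open>A common denominator of the first \<open>deg P\<close> remainders of powers modulo \<open>Q\<close> serves for all of them,
  because \<open>P\<close> is a multiple of \<open>Q\<close> with integer coefficients and leading coefficient \<open>\<plusminus>1\<close>. This replaces
  the Gauss lemma.\<close>

lemma powers_mod_eq:
  fixes P Q :: "rat poly"
  assumes P: "Q dvd P" "Polynomial.lead_coeff P = 1 \<or> Polynomial.lead_coeff P = - 1" "\<And>i. Polynomial.coeff P i \<in> \<int>"
    and Q: "Polynomial.degree Q \<ge> 1"
    and sf: "\<And>z. poly (cpoly Q) z = 0 \<Longrightarrow> poly (cpoly (pderiv Q)) z \<noteq> 0"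
    and roots: "\<And>z. poly (cpoly Q) z = 0 \<Longrightarrow> norm z \<le> 1"
  shows "\<exists>i j. i < j \<and> Q dvd Polynomial.monom 1 j - Polynomial.monom 1 i"
proof -
  define R where "R j = Polynomial.monom 1 j mod Q" for j :: nat
  define n where "n = Polynomial.degree P"
  have Q0: "Q \<noteq> 0" using Q by auto
  \<comment> \<open>With simple roots only, \<open>Q\<close> has as many distinct roots as its
    degree, and a remainder modulo \<open>Q\<close> is determined by its values there.\<close>
  define A where "A = {z. poly (cpoly Q) z = 0}"
  have finA: "finite A" using poly_roots_finite[of "cpoly Q"] Q0 by (simp add: A_def)
  have "rsquarefree (cpoly Q)" using sf by (auto simp: rsquarefree_roots cpoly_pderiv)
  then have "Polynomial.smult (Polynomial.lead_coeff (cpoly Q)) (\<Prod>z\<in>A. [:- z, 1:]) = cpoly Q"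
    unfolding A_def by (rule complex_poly_decompose_rsquarefree)
  then have "Polynomial.degree (cpoly Q) = Polynomial.degree (\<Prod>z\<in>A. [:- z, 1:])"
    using Q0 by (metis degree_smult_eq cpoly_eq_0 leading_coeff_0_iff)
  also have "\<dots> = (\<Sum>z\<in>A. Polynomial.degree [:- z, 1:])" by (rule degree_prod_eq_sum_degree) simp
  also have "\<dots> = card A" by simp
  finally have cardA: "card A = Polynomial.degree Q" by simp
  have degR: "Polynomial.degree (R j) < Polynomial.degree Q" for j
    unfolding R_def using Q Q0 degree_mod_less'[of Q "Polynomial.monom 1 j"] by (cases "Polynomial.monom 1 j mod Q = 0") auto
  have valR: "poly (cpoly (R j)) z = z ^ j" if "z \<in> A" for z j
  proof -
    have "Polynomial.monom 1 j = Polynomial.monom 1 j div Q * Q + R j" by (simp add: R_def)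
    then have "cpoly (Polynomial.monom 1 j) = cpoly (Polynomial.monom 1 j div Q) * cpoly Q + cpoly (R j)" by (metis cpoly_add cpoly_mult)
    then show ?thesis using that by (simp add: A_def cpoly_monom poly_monom) (metis add_0 mult_zero_right poly_add poly_monom poly_mult mult_1)
  qed
  obtain K where K: "\<And>p l. Polynomial.degree p < card A \<Longrightarrow> (\<forall>z\<in>A. norm (poly p z) \<le> 1) \<Longrightarrow> norm (Polynomial.coeff p l) \<le> K"
    using interpolation_bound[OF finA] by blast
  \<comment> \<open>At each root \<open>z\<close> the remainder of the \<open>j\<close>-th power has
    the value \<open>z ^ j\<close>, of modulus at most 1, so interpolation bounds its coefficients
    uniformly in \<open>j\<close>.\<close>
  have bound: "\<bar>Polynomial.coeff (R j) l\<bar> \<le> of_int (\<lceil>K\<rceil>)" for j l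
  proof -
    have "norm (Polynomial.coeff (cpoly (R j)) l) \<le> K"
    proof (rule K)
      show "Polynomial.degree (cpoly (R j)) < card A" using degR cardA by simp
      show "\<forall>z\<in>A. norm (poly (cpoly (R j)) z) \<le> 1" using valR roots by (auto simp: A_def norm_power power_le_one)
    qed
    then have "norm (of_rat (Polynomial.coeff (R j) l) :: complex) \<le> K" by (simp add: coeff_map_poly)
    then have "\<bar>real_of_rat (Polynomial.coeff (R j) l)\<bar> \<le> K" by (simp only: complex_of_rat norm_of_real)
    then have "real_of_rat \<bar>Polynomial.coeff (R j) l\<bar> \<le> real_of_rat (of_int \<lceil>K\<rceil>)" by (simp add: abs_of_rat) linarith
    then show ?thesis by (simp only: of_rat_less_eq)
  qed
  have "finite (\<Union>i<n. (\<lambda>l. Polynomial.coeff (R i) l) ` {..Polynomial.degree (R i)})" by auto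
  from common_denominator[OF this] obtain N :: nat where N': "N \<ge> 1"
      "\<forall>x\<in>(\<Union>i<n. (\<lambda>l. Polynomial.coeff (R i) l) ` {..Polynomial.degree (R i)}). of_nat N * x \<in> \<int>" by (elim exE conjE)
  have N: "N \<ge> 1" "of_nat N * Polynomial.coeff (R i) l \<in> \<int>" if "i < n" "l \<le> Polynomial.degree (R i)" for i l
    using N' that by auto
  have rec: "(\<Sum>i\<le>n. Polynomial.smult (Polynomial.coeff P i) (R (j + i))) = 0" for j
  proof -
    have "(\<Sum>i\<le>n. Polynomial.smult (Polynomial.coeff P i) (R (j + i))) = (\<Sum>i\<le>n. Polynomial.monom (Polynomial.coeff P i) (j + i) mod Q)"
      by (rule sum.cong) (simp_all add: R_def smult_monom flip: mod_smult_left)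
    also have "\<dots> = (\<Sum>i\<le>n. Polynomial.monom (Polynomial.coeff P i) (j + i)) mod Q"
      using sum_comp_morphism[of "\<lambda>p. p mod Q" "\<lambda>i. Polynomial.monom (Polynomial.coeff P i) (j + i)" "{..n}"]
      by (simp add: poly_mod_add_left o_def)
    also have "(\<Sum>i\<le>n. Polynomial.monom (Polynomial.coeff P i) (j + i)) = Polynomial.monom 1 j * (\<Sum>i\<le>n. Polynomial.monom (Polynomial.coeff P i) i)"
      by (simp add: sum_distrib_left mult_monom)
    also have "(\<Sum>i\<le>n. Polynomial.monom (Polynomial.coeff P i) i) = P" by (simp add: n_def poly_as_sum_of_monoms)
    also have "Polynomial.monom 1 j * P mod Q = 0" using dvd_mult[OF P(1)] by (simp only: dvd_eq_mod_eq_0)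
    finally show ?thesis .
  qed
  have int: "of_nat N * Polynomial.coeff (R j) l \<in> \<int>" for j l
  proof (induction j rule: less_induct)
    case (less j)
    show ?case
    proof (cases "j < n")
      case True
      then show ?thesis using N(2)[of j l] by (cases "l \<le> Polynomial.degree (R j)") (auto simp: coeff_eq_0)
    next
      case False
      have "{..n} = insert n {..<n}" by auto
      then have "Polynomial.smult (Polynomial.coeff P n) (R j) = - (\<Sum>i<n. Polynomial.smult (Polynomial.coeff P i) (R (j - n + i)))"
        using rec[of "j - n"] False by (simp add: eq_neg_iff_add_eq_0)
      then have "Polynomial.coeff P n * Polynomial.coeff (R j) l = - (\<Sum>i<n. Polynomial.coeff P i * Polynomial.coeff (R (j - n + i)) l)"
        by (metis (mono_tags, lifting) coeff_minus coeff_smult coeff_sum sum.cong)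
      then have "Polynomial.coeff P n * (of_nat N * Polynomial.coeff (R j) l) = - (\<Sum>i<n. Polynomial.coeff P i * (of_nat N * Polynomial.coeff (R (j - n + i)) l))"
        by (simp add: sum_distrib_left mult.left_commute)
      moreover have "- (\<Sum>i<n. Polynomial.coeff P i * (of_nat N * Polynomial.coeff (R (j - n + i)) l)) \<in> \<int>"
        using False by (intro Ints_minus Ints_sum Ints_mult P(3) less) auto
      ultimately show ?thesis using P(2) by (auto simp: n_def)
    qed
  qed
  \<comment> \<open>Bounded coefficients with a common denominator leave finitely many remainders,
    so two powers share one.\<close>
  define B where "B = {- (int N * \<lceil>K\<rceil>)..int N * \<lceil>K\<rceil>}"
  define f where "f j = (\<lambda>l\<in>{..<Polynomial.degree Q}. \<lfloor>of_nat N * Polynomial.coeff (R j) l\<rfloor>)" for j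
  have f_eq: "of_int (f j l) = of_nat N * Polynomial.coeff (R j) l" if "l < Polynomial.degree Q" for j l
    using int[of j l] that by (simp add: f_def)
  have "f j \<in> (\<Pi>\<^sub>E l\<in>{..<Polynomial.degree Q}. B)" for j
  proof -
    have "\<lfloor>of_nat N * Polynomial.coeff (R j) l\<rfloor> \<in> B" if "l < Polynomial.degree Q" for l
    proof -
      have "\<bar>of_int (f j l)\<bar> \<le> (of_int (int N * \<lceil>K\<rceil>) :: rat)"
        using mult_left_mono[OF bound[of j l], of "of_nat N"] f_eq[OF that, of j] by (simp add: abs_mult)
      then have "\<bar>f j l\<bar> \<le> int N * \<lceil>K\<rceil>" by (metis of_int_abs of_int_le_iff)
      then show ?thesis using that by (simp add: f_def B_def abs_le_iff)
    qed
    then show ?thesis by (auto simp: f_def)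
  qed
  then have "range f \<subseteq> (\<Pi>\<^sub>E l\<in>{..<Polynomial.degree Q}. B)" by blast
  moreover have "finite (\<Pi>\<^sub>E l\<in>{..<Polynomial.degree Q}. B)" by (intro finite_PiE) (auto simp: B_def)
  ultimately have "finite (range f)" by (rule finite_subset)
  then have "\<not> inj f" using finite_imageD[of f UNIV] infinite_UNIV_nat by blast
  then obtain i j where ij: "i < j" "f i = f j" unfolding inj_def by (metis linorder_neqE_nat)
  have "R i = R j"
  proof (rule poly_eqI)
    fix l
    show "Polynomial.coeff (R i) l = Polynomial.coeff (R j) l"
    proof (cases "l < Polynomial.degree Q")
      case True
      then show ?thesis using f_eq[OF True, of i] f_eq[OF True, of j] ij(2) N'(1) by simp
    next
      case False
      then show ?thesis using degR[of i] degR[of j] by (simp add: coeff_eq_0)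
    qed
  qed
  then have "Q dvd Polynomial.monom 1 j - Polynomial.monom 1 i" unfolding R_def by (metis mod_eq_dvd_iff)
  then show ?thesis using ij(1) by blast
qed

text \<open>Let \<open>D\<close> be of least degree among the nonzero rational polynomials with root
  \<open>z\<close>; it divides \<open>Q\<close>, say \<open>Q = D * S\<close>. As \<open>S\<close>
  has smaller degree than \<open>Q\<close>, it does not annihilate \<open>u\<close>, and then
  \<open>D\<close> annihilates the nonzero function \<open>pact c S u\<close>, against minimality of
  \<open>Q\<close>. Applied to the derivative of \<open>Q\<close>, this shows that the roots are
  simple.\<close>

lemma eigen_no_small_multiple:
  fixes Q :: "rat poly"
  assumes min: "\<And>p u. u \<in> U \<Longrightarrow> u \<noteq> (\<lambda>_. 0) \<Longrightarrow> p \<noteq> 0 \<Longrightarrow> pact c p u = (\<lambda>_. 0) \<Longrightarrow> Polynomial.degree Q \<le> Polynomial.degree p"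
    and U: "\<And>p u. u \<in> U \<Longrightarrow> pact c p u \<in> U"
    and u: "u \<in> U" "u \<noteq> (\<lambda>_. 0)" "pact c Q u = (\<lambda>_. 0)" and Q: "Q \<noteq> 0"
    and z: "poly (cpoly Q) z = 0" and p: "p \<noteq> 0" "Polynomial.degree p < Polynomial.degree Q"
  shows "poly (cpoly p) z \<noteq> 0"
proof
  assume "poly (cpoly p) z = 0"
  define P where "P p \<longleftrightarrow> p \<noteq> 0 \<and> poly (cpoly p) z = 0" for p
  have "P p" using \<open>poly (cpoly p) z = 0\<close> p by (simp add: P_def)
  then obtain D where D: "P D" "\<And>p. P p \<Longrightarrow> Polynomial.degree D \<le> Polynomial.degree p"
    using ex_has_least_nat[of P p Polynomial.degree] by blast
  have D0: "D \<noteq> 0" and Dz: "poly (cpoly D) z = 0" using D(1) by (auto simp: P_def)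
  have degD: "Polynomial.degree D < Polynomial.degree Q" using D(2)[OF \<open>P p\<close>] p(2) by simp
  have "Q = Q div D * D + Q mod D" by simp
  then have "poly (cpoly Q) z = poly (cpoly (Q div D)) z * poly (cpoly D) z + poly (cpoly (Q mod D)) z"
    by (metis cpoly_add cpoly_mult poly_add poly_mult)
  then have "poly (cpoly (Q mod D)) z = 0" using z Dz by simp
  then have "Q mod D = 0" using D(2)[of "Q mod D"] degree_mod_less[OF D0, of Q] by (force simp: P_def)
  then obtain S where S: "Q = D * S" by (metis dvd_def mod_0_imp_dvd)
  have S0: "S \<noteq> 0" using S Q by auto
  have "Polynomial.degree Q = Polynomial.degree D + Polynomial.degree S" using S D0 S0 by (simp add: degree_mult_eq)
  moreover have "Polynomial.degree D > 0"
  proof (rule ccontr)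
    assume "\<not> Polynomial.degree D > 0"
    then obtain a where "D = [:a:]" by (metis degree_eq_zeroE neq0_conv)
    then show False using D0 Dz by (simp add: map_poly_pCons)
  qed
  ultimately have "pact c S u \<noteq> (\<lambda>_. 0)" using min[OF u(1,2) S0] by auto
  moreover have "pact c D (pact c S u) = (\<lambda>_. 0)" using u(3) by (simp add: S pact_mult)
  ultimately show False using min[OF U[OF u(1)] _ D0, of S] degD by auto
qed

text \<open>Take \<open>Q\<close> of least degree among the rational polynomials that annihilate some nonzero \<open>u \<in> U\<close>. By the
  relations its roots lie in the unit disc, and by minimality they are simple, so the powers of the
  indeterminate take finitely many values modulo \<open>Q\<close>.\<close>

theorem exists_periodic_function:
  fixes c :: "'x \<Rightarrow> 'x" and U :: "('x \<Rightarrow> real) set"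
  assumes c: "surj c" and U_add: "\<And>u v. u \<in> U \<Longrightarrow> v \<in> U \<Longrightarrow> (\<lambda>x. u x + v x) \<in> U"
    and U_scale: "\<And>u a. u \<in> U \<Longrightarrow> (\<lambda>x. a * u x) \<in> U" and U_comp: "\<And>u. u \<in> U \<Longrightarrow> (\<lambda>x. u (c x)) \<in> U"
    and rel: "\<And>k::nat. k \<ge> 1 \<Longrightarrow> \<exists>E E'. finite E \<and> finite E' \<and> E \<noteq> E' \<and>
      (\<forall>u\<in>U. \<forall>x. (\<Sum>i\<in>E. u ((c ^^ (k * i)) x)) = (\<Sum>i\<in>E'. u ((c ^^ (k * i)) x)))"
    and nz: "u0 \<in> U" "u0 \<noteq> (\<lambda>_. 0)"
  obtains m u where "m \<ge> 1" "u \<in> U" "u \<noteq> (\<lambda>_. 0)" "\<And>x. u ((c ^^ m) x) = u x"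
proof -
  have pactU: "pact c p u \<in> U" if u: "u \<in> U" for p u
  proof (induction p)
    case 0
    have "(\<lambda>x. 0 * u x) \<in> U" by (rule U_scale[OF u])
    then show ?case by (simp add: pact_def)
  next
    case (pCons a p)
    have "(\<lambda>x. of_rat a * u x + pact c p u (c x)) \<in> U" by (rule U_add[OF U_scale[OF u] U_comp[OF pCons(2)]])
    then show ?case by (simp only: pact_pCons[abs_def])
  qed
  have pow_surj: "surj (c ^^ n)" for n using c by (rule surj_fn)
  define rl where "rl k E E' \<longleftrightarrow> finite E \<and> finite E' \<and> E \<noteq> E' \<and>
      (\<forall>u\<in>U. \<forall>x. (\<Sum>i\<in>E. u ((c ^^ (k * i)) x)) = (\<Sum>i\<in>E'. u ((c ^^ (k * i)) x)))" for k :: nat and E E'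
  define Pk where "Pk k E E' = (\<Sum>i\<in>E. Polynomial.monom (1::rat) (k * i)) - (\<Sum>i\<in>E'. Polynomial.monom 1 (k * i))" for k :: nat and E E'
  have Pk: "pact c (Pk k E E') u = (\<lambda>_. 0)" if "rl k E E'" "u \<in> U" for k E E' u
    using that by (auto simp: Pk_def rl_def pact_sum_monom fun_eq_iff)
  have Pk_coeff: "Polynomial.coeff (Pk 1 E E') i = (if i \<in> E then 1 else 0) - (if i \<in> E' then 1 else 0)" if "rl k E E'" for i k E E'
    using that by (simp add: Pk_def rl_def coeff_sum sum.delta')
  obtain E1 E1' where E1: "rl 1 E1 E1'" using rel[of 1] unfolding rl_def by blast
  define P where "P = Pk 1 E1 E1'"
  have P0: "P \<noteq> 0"
  proof
    assume "P = 0"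
    then have "(if i \<in> E1 then 1 else 0 :: rat) - (if i \<in> E1' then 1 else 0) = 0" for i
      using Pk_coeff[OF E1, of i] by (simp add: P_def)
    then have "i \<in> E1 \<longleftrightarrow> i \<in> E1'" for i by (metis diff_0 diff_self eq_iff_diff_eq_0 neg_equal_0_iff_equal zero_neq_one)
    then show False using E1 unfolding rl_def by blast
  qed
  define A where "A p \<longleftrightarrow> p \<noteq> 0 \<and> (\<exists>u\<in>U. u \<noteq> (\<lambda>_. 0) \<and> pact c p u = (\<lambda>_. 0))" for p
  have "A P" using P0 Pk[OF E1 nz(1)] nz by (auto simp: A_def P_def)
  then obtain Q where Q: "A Q" "\<And>p. A p \<Longrightarrow> Polynomial.degree Q \<le> Polynomial.degree p"
    using ex_has_least_nat[of A P Polynomial.degree] by blast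
  obtain u where u: "u \<in> U" "u \<noteq> (\<lambda>_. 0)" "pact c Q u = (\<lambda>_. 0)" and Q0: "Q \<noteq> 0" using Q(1) by (auto simp: A_def)
  have min: "Polynomial.degree Q \<le> Polynomial.degree p" if "v \<in> U" "v \<noteq> (\<lambda>_. 0)" "p \<noteq> 0" "pact c p v = (\<lambda>_. 0)" for p v
    using Q(2)[of p] that by (auto simp: A_def)
  have degQ: "Polynomial.degree Q \<ge> 1"
  proof (rule ccontr)
    assume "\<not> Polynomial.degree Q \<ge> 1"
    then obtain a where "Q = [:a:]" by (metis degree_eq_zeroE less_one linorder_not_le)
    then show False using u(2,3) Q0 by (auto simp: fun_eq_iff)
  qed
  have dvd: "Q dvd p" if "pact c p u = (\<lambda>_. 0)" for p
  proof -
    have "p mod Q = p - p div Q * Q" by (simp add: minus_div_mult_eq_mod)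
    then have "pact c (p mod Q) u x = pact c p u x - pact c (p div Q) (pact c Q u) x" for x
      by (simp add: pact_mult)
    then have "pact c (p mod Q) u = (\<lambda>_. 0)" unfolding that u(3) by (simp add: fun_eq_iff)
    then have "p mod Q = 0" using min[OF u(1,2), of "p mod Q"] degree_mod_less[OF Q0, of p] by force
    then show ?thesis by auto
  qed
  \<comment> \<open>The relations are available for the iterates of \<open>c ^^ k\<close> for every
    \<open>k \<ge> 1\<close>, so all powers \<open>z ^ k\<close> have modulus at most 2.\<close>
  have roots: "norm z \<le> 1" if z: "poly (cpoly Q) z = 0" for z
  proof (rule norm_le_1_from_powers)
    fix k :: nat assume k: "k \<ge> 1"
    obtain E E' where E: "rl k E E'" using rel[OF k] unfolding rl_def by blast
    obtain S where "Pk k E E' = Q * S" using dvd[OF Pk[OF E u(1)]] by auto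
    then have "poly (cpoly (Pk k E E')) z = 0" using z by (simp add: cpoly_mult)
    then have "(\<Sum>i\<in>E. (z ^ k) ^ i) = (\<Sum>i\<in>E'. (z ^ k) ^ i)"
      using E unfolding rl_def Pk_def by (simp add: cpoly_diff cpoly_sum_monom power_mult)
    then have "norm (z ^ k) \<le> 2" using E equal_power_sums_bound[of E E' "z ^ k"] unfolding rl_def by blast
    then show "norm z ^ k \<le> 2" by (simp add: norm_power)
  qed
  have sf: "poly (cpoly (pderiv Q)) z \<noteq> 0" if z: "poly (cpoly Q) z = 0" for z
  proof (rule eigen_no_small_multiple[OF min pactU u Q0 z])
    show "pderiv Q \<noteq> 0" using degQ by (simp add: pderiv_eq_0_iff)
    show "Polynomial.degree (pderiv Q) < Polynomial.degree Q" using degQ by (simp add: degree_pderiv)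
  qed
  have "\<exists>i j. i < j \<and> Q dvd Polynomial.monom 1 j - Polynomial.monom 1 i"
  proof (rule powers_mod_eq[OF dvd _ _ degQ sf roots])
    show "pact c P u = (\<lambda>_. 0)" unfolding P_def by (rule Pk[OF E1 u(1)])
    have "Polynomial.lead_coeff P \<noteq> 0" using P0 by simp
    then show "Polynomial.lead_coeff P = 1 \<or> Polynomial.lead_coeff P = - 1"
      using Pk_coeff[OF E1, of "Polynomial.degree P"] by (auto simp: P_def split: if_splits)
    show "Polynomial.coeff P i \<in> \<int>" for i using Pk_coeff[OF E1, of i] by (simp add: P_def)
  qed
  then obtain i j S where ij: "i < j" "Polynomial.monom 1 j - Polynomial.monom 1 i = Q * S" unfolding dvd_def by blast
  have eq: "u ((c ^^ j) x) = u ((c ^^ i) x)" for x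
  proof -
    have "Polynomial.monom 1 j - Polynomial.monom 1 i = S * Q" using ij(2) by (simp add: mult.commute)
    then have "pact c (Polynomial.monom 1 j - Polynomial.monom 1 i) u x = pact c S (pact c Q u) x" by (simp only: pact_mult)
    then show ?thesis by (simp add: u(3))
  qed
  define m where "m = j - i"
  show ?thesis
  proof
    show "m \<ge> 1" using ij(1) by (simp add: m_def)
    show "(\<lambda>x. u x) \<in> U" using u(1) by simp
    show "(\<lambda>x. u x) \<noteq> (\<lambda>_. 0)" using u(2) by simp
    fix x
    \<comment> \<open>Surjectivity of \<open>c\<close> cancels the \<open>i\<close> common
      iterates.\<close>
    obtain y where y: "x = (c ^^ i) y" using pow_surj[of i] by blast
    have "(c ^^ m) x = (c ^^ (m + i)) y" by (simp add: y funpow_add)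
    then show "u ((c ^^ m) x) = u x" using eq[of y] ij(1) by (simp add: m_def y)
  qed
qed

section \<open>The space of virtual homomorphisms\<close>

text \<open>Conjugation acts on functions from the right: \<open>cj_mult\<close> reverses the order
  of factors.\<close>

definition cj :: "'g::grp \<Rightarrow> ('g \<Rightarrow> 'b) \<Rightarrow> 'g \<Rightarrow> 'b" where
  "cj h \<phi> = (\<lambda>g. \<phi> (h * g * inverse h))"

lemma cj_one [simp]: "cj 1 \<phi> = \<phi>"
  by (simp add: cj_def)

lemma cj_mult: "cj (g * h) \<phi> = cj h (cj g \<phi>)"
  by (simp add: cj_def grp_inv_mult mult.assoc)

lemma cj_inv: "cj (inverse h) (cj h \<phi>) = \<phi>" "cj h (cj (inverse h) \<phi>) = \<phi>"
  by (simp_all flip: cj_mult)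

lemma cj_powi:
  assumes "cj h \<phi> = \<phi>" shows "cj (power_int h k) \<phi> = \<phi>"
proof -
  have pow: "cj h \<phi> = \<phi> \<Longrightarrow> cj (h ^ n) \<phi> = \<phi>" for h :: 'a and n
    by (induction n) (simp_all add: cj_mult)
  have "cj (inverse h) \<phi> = \<phi>" using cj_inv(1)[of h \<phi>] assms by simp
  then show ?thesis using pow assms by (auto simp: power_int_def)
qed

lemma funpow_conj: "((\<lambda>g. t * g * inverse t) ^^ n) g = t ^ n * g * inverse (t ^ n)" for t :: "'g::grp"
  by (induction n) (simp_all add: grp_inv_mult mult.assoc)

definition normalizes :: "'g::grp set \<Rightarrow> 'g set \<Rightarrow> bool" where
  "normalizes H1 L \<longleftrightarrow> sgrp H1 \<and> (\<forall>h\<in>H1. \<forall>g\<in>L. h * g * inverse h \<in> L)"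

lemma normalizes_iff: "normalizes H1 L \<Longrightarrow> h \<in> H1 \<Longrightarrow> h * g * inverse h \<in> L \<longleftrightarrow> g \<in> L"
proof
  assume n: "normalizes H1 L" "h \<in> H1" and "h * g * inverse h \<in> L"
  then have "inverse h * (h * g * inverse h) * inverse (inverse h) \<in> L" using sgrp_inv[of H1 h] unfolding normalizes_def by blast
  then show "g \<in> L" by (simp add: mult.assoc)
qed (auto simp: normalizes_def)

primrec words :: "(nat \<Rightarrow> 'g::grp) \<Rightarrow> nat \<Rightarrow> (nat \<Rightarrow> nat) \<Rightarrow> 'g" where
  "words x 0 a = 1"
| "words x (Suc k) a = words x k a * x k ^ a k"

lemma triangular_unique:
  fixes m :: "nat \<Rightarrow> nat \<Rightarrow> real"
  assumes "\<And>i. i < k \<Longrightarrow> m i i \<noteq> 0" "\<And>i j. i < k \<Longrightarrow> j < i \<Longrightarrow> m i j = 0"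
    and "\<And>i. i < k \<Longrightarrow> (\<Sum>j<k. a j * m i j) = (\<Sum>j<k. a' j * m i j)"
  shows "j < k \<Longrightarrow> a j = a' j"
  using assms
proof (induction k arbitrary: j)
  case (Suc k)
  have "(\<Sum>j<k. a j * m k j) = 0" "(\<Sum>j<k. a' j * m k j) = 0" using Suc.prems(3)[of k] by simp_all
  then have eq: "a k = a' k" using Suc.prems(4)[of k] Suc.prems(2)[of k] by simp
  have "(\<Sum>j<k. a j * m i j) = (\<Sum>j<k. a' j * m i j)" if "i < k" for i
    using Suc.prems(4)[of i] that eq by simp
  then have "j < k \<Longrightarrow> a j = a' j" using Suc.IH[of j] Suc.prems(2,3) by simp
  then show ?case using eq Suc.prems(1) by (cases "j = k") auto
qed simp

section \<open>Rank of the space of virtual homomorphisms\<close>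

context growth_action
begin

text \<open>Homogeneity makes a virtual homomorphism determined by its restriction to any subgroup of finite
  index; outside \<open>L\<close> it is \<open>0\<close> by convention.\<close>

definition vh :: "'g set \<Rightarrow> ('g \<Rightarrow> real) set" where
  "vh L = {\<phi>. (\<forall>g. g \<notin> L \<longrightarrow> \<phi> g = 0) \<and> (\<forall>g\<in>L. \<forall>n. \<phi> (g ^ n) = real n * \<phi> g) \<and>
    (\<exists>M. sgrp M \<and> M \<subseteq> L \<and> fi M L \<and> add_hom M \<phi>) \<and> (\<forall>g\<in>stab L. \<phi> g = 0)}"

lemma vh_out: "\<phi> \<in> vh L \<Longrightarrow> g \<notin> L \<Longrightarrow> \<phi> g = 0"
  and vh_power: "\<phi> \<in> vh L \<Longrightarrow> g \<in> L \<Longrightarrow> \<phi> (g ^ n) = real n * \<phi> g"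
  and vh_stab: "\<phi> \<in> vh L \<Longrightarrow> g \<in> stab L \<Longrightarrow> \<phi> g = 0"
  by (auto simp: vh_def)

lemma vh_hom:
  assumes "\<phi> \<in> vh L" obtains M where "sgrp M" "M \<subseteq> L" "fi M L" "add_hom M \<phi>"
  using assms by (auto simp: vh_def)

lemma vh_add:
  assumes p: "\<phi> \<in> vh L" and q: "\<psi> \<in> vh L" shows "(\<lambda>g. \<phi> g + \<psi> g) \<in> vh L"
proof -
  obtain M where M: "sgrp M" "M \<subseteq> L" "fi M L" "add_hom M \<phi>" by (rule vh_hom[OF p])
  obtain M' where M': "sgrp M'" "M' \<subseteq> L" "fi M' L" "add_hom M' \<psi>" by (rule vh_hom[OF q])
  have "sgrp (M \<inter> M')" "M \<inter> M' \<subseteq> L" "fi (M \<inter> M') L" using M M' sgrp_Int fi_Int by blast+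
  moreover have "add_hom (M \<inter> M') (\<lambda>g. \<phi> g + \<psi> g)" using M(4) M'(4) by (simp add: add_hom_def)
  ultimately show ?thesis unfolding vh_def
    using vh_out[OF p] vh_out[OF q] vh_power[OF p] vh_power[OF q] vh_stab[OF p] vh_stab[OF q]
    by (auto simp: algebra_simps)
qed

lemma vh_scale:
  assumes p: "\<phi> \<in> vh L" shows "(\<lambda>g. a * \<phi> g) \<in> vh L"
proof -
  obtain M where M: "sgrp M" "M \<subseteq> L" "fi M L" "add_hom M \<phi>" by (rule vh_hom[OF p])
  have "add_hom M (\<lambda>g. a * \<phi> g)" using M(4) by (simp add: add_hom_def distrib_left)
  then show ?thesis unfolding vh_def using vh_out[OF p] vh_power[OF p] vh_stab[OF p] M(1-3) by auto
qed

lemma bounded_power: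
  assumes g: "g \<in> H" and R: "\<And>n. ell (g ^ n) \<le> R"
  shows "\<exists>n\<ge>1. (g ^ n) \<star> b = b"
proof -
  have "finite (orb (range (\<lambda>n::nat. g ^ n)))"
    by (rule orb_fin[of _ R]) (use R sgrp_power[OF H g] in auto)
  then have "finite (range (\<lambda>n::nat. g ^ n \<star> b))" by (simp add: orb_def image_image)
  then have "\<not> inj (\<lambda>n::nat. g ^ n \<star> b)" using finite_imageD[of _ UNIV] infinite_UNIV_nat by blast
  then obtain i j :: nat where ij: "i < j" "g ^ i \<star> b = g ^ j \<star> b" unfolding inj_def by (metis linorder_neqE_nat)
  then have "(inverse (g ^ i) * g ^ j) \<star> b = b" using same_point by blast
  moreover have "g ^ j = g ^ i * g ^ (j - i)" using ij(1) by (simp flip: power_add)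
  ultimately have "(g ^ (j - i)) \<star> b = b" by simp
  then show ?thesis using ij(1) by (intro exI[of _ "j - i"]) simp
qed

text \<open>The issue is vanishing on the stabilizer, which \<open>h\<close> need not normalize: the
  powers of a conjugate of a stabilizing element have displacement at most \<open>2 * ell h\<close>,
  so some positive power fixes \<open>b\<close>, and homogeneity transfers the zero.\<close>

lemma vh_cj:
  assumes L: "sgrp L" "L \<subseteq> H" and nm: "normalizes H1 L" and h: "h \<in> H1" "h \<in> H" and p: "\<phi> \<in> vh L"
  shows "cj h \<phi> \<in> vh L"
proof -
  obtain M where M: "sgrp M" "M \<subseteq> L" "fi M L" "add_hom M \<phi>" by (rule vh_hom[OF p])
  define M' where "M' = {g \<in> L. h * g * inverse h \<in> M}"
  have mult: "h * (g * g') * inverse h = (h * g * inverse h) * (h * g' * inverse h)" for g g' by (simp add: mult.assoc)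
  have inv: "h * inverse g * inverse h = inverse (h * g * inverse h)" for g by (simp add: grp_inv_mult mult.assoc)
  have iff: "h * g * inverse h \<in> L \<longleftrightarrow> g \<in> L" for g by (rule normalizes_iff[OF nm h(1)])
  have "sgrp M'"
  proof (rule sgrpI)
    show "1 \<in> M'" using sgrp_one[OF L(1)] sgrp_one[OF M(1)] by (simp add: M'_def)
    show "g * g' \<in> M'" if "g \<in> M'" "g' \<in> M'" for g g'
      using that sgrp_mult[OF L(1)] sgrp_mult[OF M(1)] unfolding M'_def mem_Collect_eq mult by blast
    show "inverse g \<in> M'" if "g \<in> M'" for g
      using that sgrp_inv[OF L(1)] sgrp_inv[OF M(1)] unfolding M'_def mem_Collect_eq inv by blast
  qed
  moreover have "fi M' L"
  proof -
    obtain f :: "'g \<Rightarrow> 'g" where f: "finite (f ` L)" "\<And>g h. g \<in> L \<Longrightarrow> h \<in> L \<Longrightarrow> f g = f h \<Longrightarrow> inverse g * h \<in> M"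
      using fi_invariant[OF M(3,1)] by blast
    show ?thesis
    proof (rule fiI[of "\<lambda>g. f (h * g * inverse h)"])
      show "finite ((\<lambda>g. f (h * g * inverse h)) ` L)" by (rule finite_subset[OF _ f(1)]) (use iff in auto)
      fix g g' assume g: "g \<in> L" "g' \<in> L" "f (h * g * inverse h) = f (h * g' * inverse h)"
      then have "inverse (h * g * inverse h) * (h * g' * inverse h) \<in> M" by (intro f(2)) (auto simp: iff)
      moreover have "inverse g * g' \<in> L" using g sgrp_mult[OF L(1) sgrp_inv[OF L(1)]] by blast
      ultimately show "inverse g * g' \<in> M'" unfolding M'_def mem_Collect_eq mult inv by blast
    qed
  qed
  moreover have "add_hom M' (cj h \<phi>)"
    unfolding add_hom_def cj_def mult using add_hom_mult[OF M(4)] by (auto simp: M'_def)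
  moreover have "cj h \<phi> g = 0" if "g \<in> stab L" for g
  proof -
    let ?g = "h * g * inverse h"
    have g: "g \<in> L" "g \<in> H" using that stab_L L(2) by blast+
    have gL: "?g \<in> L" using g iff by blast
    have "ell (?g ^ n) \<le> 2 * ell h" for n
    proof -
      have "g ^ n \<in> stab L" by (rule sgrp_power[OF sgrp_stab[OF L(1)] that])
      then have "ell (g ^ n) = 0" using ell_stab L(2) unfolding stab_def by blast
      then show ?thesis using ell_conj[OF sgrp_power[OF H g(2), of n] h(2)] by (simp add: grp_conj_power)
    qed
    then obtain n where n: "n \<ge> 1" "(?g ^ n) \<star> b = b" using bounded_power[of ?g "2 * ell h"] gL L(2) by blast
    then have "\<phi> (?g ^ n) = 0" by (intro vh_stab[OF p]) (simp add: stab_def sgrp_power[OF L(1) gL])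
    then show ?thesis using vh_power[OF p gL, of n] n(1) by (simp add: cj_def)
  qed
  ultimately show ?thesis unfolding vh_def
    using vh_out[OF p] vh_power[OF p] iff M'_def by (auto simp: cj_def grp_conj_power[symmetric])
qed

text \<open>Each \<open>g \<in> L\<close> has a power in \<open>M\<close>, where the values are
  those of a homomorphism to an abelian group; homogeneity divides the exponent out again.\<close>

lemma vh_hom_invariant:
  assumes L: "sgrp L" and p: "\<phi> \<in> vh L" and M: "sgrp M" "M \<subseteq> L" "fi M L" "add_hom M \<phi>" and m: "m \<in> M"
  shows "cj m \<phi> = \<phi>"
proof
  fix g
  obtain e where e: "e \<ge> 1" "\<And>g. g \<in> L \<Longrightarrow> g ^ e \<in> M" using fi_exponent[OF M(3) L M(1)] by blast
  have nm: "normalizes L L" using L sgrp_conj[OF L] by (simp add: normalizes_def)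
  have mL: "m \<in> L" using m M(2) by blast
  show "cj m \<phi> g = \<phi> g"
  proof (cases "g \<in> L")
    case True
    then have gL: "m * g * inverse m \<in> L" using normalizes_iff[OF nm mL] by blast
    have "\<phi> ((m * g * inverse m) ^ e) = \<phi> (m * g ^ e * inverse m)" by (simp add: grp_conj_power)
    also have "\<dots> = \<phi> (g ^ e)"
      using m e(2)[OF True] sgrp_mult[OF M(1)] sgrp_inv[OF M(1)] by (simp add: add_hom_mult[OF M(4)] add_hom_inv[OF M(4,1)])
    finally show ?thesis using vh_power[OF p gL] vh_power[OF p True] e(1) by (simp add: cj_def)
  next
    case False
    then show ?thesis using vh_out[OF p] normalizes_iff[OF nm mL] by (simp add: cj_def)
  qed
qed

text \<open>The homogeneous extension takes the value \<open>\<theta> (g ^ e) / e\<close>, where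
  \<open>e\<close> is an exponent of \<open>M\<close> in \<open>L\<close>.\<close>

lemma exists_vh:
  fixes \<theta> :: "'g \<Rightarrow> int"
  assumes L: "sgrp L" and M: "sgrp M" "M \<subseteq> L" "fi M L" and \<theta>: "add_hom M \<theta>"
    and st: "\<And>g. g \<in> stab M \<Longrightarrow> \<theta> g = 0" and nz: "g \<in> M" "\<theta> g \<noteq> 0"
  shows "\<exists>\<phi>\<in>vh L. \<phi> \<noteq> (\<lambda>_. 0)"
proof -
  obtain e where e: "e \<ge> 1" "\<And>g. g \<in> L \<Longrightarrow> g ^ e \<in> M" using fi_exponent[OF M(3) L M(1)] by blast
  define \<phi> where "\<phi> g = (if g \<in> L then real_of_int (\<theta> (g ^ e)) / real e else 0)" for g
  have \<phi>M: "\<phi> g = real_of_int (\<theta> g)" if "g \<in> M" for g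
    using that M(2) e(1) add_hom_power[OF \<theta> M(1) that, of e] by (auto simp: \<phi>_def)
  have "\<phi> (g ^ n) = real n * \<phi> g" if "g \<in> L" for g n
  proof -
    have "(g ^ n) ^ e = (g ^ e) ^ n" by (simp add: mult.commute flip: power_mult)
    then show ?thesis using that sgrp_power[OF L that, of n] add_hom_power[OF \<theta> M(1) e(2)[OF that], of n] by (simp add: \<phi>_def)
  qed
  moreover have "add_hom M \<phi>" using \<phi>M add_hom_mult[OF \<theta>] sgrp_mult[OF M(1)] by (simp add: add_hom_def)
  moreover have "\<phi> g = 0" if "g \<in> stab L" for g
  proof -
    have "g ^ e \<in> stab L" by (rule sgrp_power[OF sgrp_stab[OF L] that])
    moreover have "g \<in> L" using that stab_L by blast
    ultimately have "g ^ e \<in> stab M" using e(2) by (simp add: stab_def)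
    then show ?thesis using st by (simp add: \<phi>_def)
  qed
  ultimately have "\<phi> \<in> vh L" unfolding vh_def using M by (auto simp: \<phi>_def)
  moreover have "\<phi> g \<noteq> 0" using \<phi>M[OF nz(1)] nz(2) by simp
  ultimately show ?thesis by (metis (full_types))
qed

text \<open>A witness of linear independence: the matrix of the values of the functions at the
  elements \<open>g j\<close> is triangular with nonzero diagonal.\<close>

definition tri :: "'g set \<Rightarrow> nat \<Rightarrow> (nat \<Rightarrow> 'g \<Rightarrow> real) \<Rightarrow> (nat \<Rightarrow> 'g) \<Rightarrow> bool" where
  "tri L k \<phi> g \<longleftrightarrow> (\<forall>i<k. \<phi> i \<in> vh L \<and> g i \<in> L \<and> \<phi> i (g i) \<noteq> 0) \<and> (\<forall>i<k. \<forall>j<i. \<phi> i (g j) = 0)"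

lemma common_hom:
  assumes L: "sgrp L"
  shows "(\<forall>i<k. \<phi> i \<in> vh L) \<Longrightarrow> \<exists>M. sgrp M \<and> M \<subseteq> L \<and> fi M L \<and> (\<forall>i<(k::nat). add_hom M (\<phi> i))"
proof (induction k)
  case 0
  then show ?case using L fi_refl by (intro exI[of _ L]) auto
next
  case (Suc k)
  then obtain M where M: "sgrp M" "M \<subseteq> L" "fi M L" "\<forall>i<k. add_hom M (\<phi> i)" by auto
  obtain M' where M': "sgrp M'" "M' \<subseteq> L" "fi M' L" "add_hom M' (\<phi> k)" using Suc.prems vh_hom[of "\<phi> k" L] by auto
  have "add_hom (M \<inter> M') (\<phi> i)" if "i < Suc k" for i
    using that M(4) M'(4) add_hom_subset[of M "\<phi> i" "M \<inter> M'"] add_hom_subset[of M' "\<phi> i" "M \<inter> M'"] by (cases "i = k") auto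
  then show ?case using M M' sgrp_Int[of M M'] fi_Int[of M L M'] by (intro exI[of _ "M \<inter> M'"]) auto
qed

lemma words_in: "sgrp M \<Longrightarrow> (\<And>i. i < k \<Longrightarrow> x i \<in> M) \<Longrightarrow> words x k a \<in> M"
  by (induction k) (auto intro!: sgrp_one sgrp_mult sgrp_power)

lemma words_hom:
  fixes \<phi> :: "'g \<Rightarrow> real"
  assumes "sgrp M" "add_hom M \<phi>"
  shows "(\<And>i. i < k \<Longrightarrow> x i \<in> M) \<Longrightarrow> \<phi> (words x k a) = (\<Sum>i<k. real (a i) * \<phi> (x i))"
proof (induction k)
  case 0
  then show ?case by (simp add: add_hom_one[OF assms(2,1)])
next
  case (Suc k)
  have "words x k a \<in> M" by (rule words_in[OF assms(1)]) (use Suc.prems in auto)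
  moreover have "x k ^ a k \<in> M" by (rule sgrp_power[OF assms(1)]) (use Suc.prems in auto)
  ultimately show ?case using Suc by (simp add: add_hom_mult[OF assms(2)] add_hom_power[OF assms(2,1)])
qed

lemma words_ell: "(\<And>i. i < k \<Longrightarrow> x i \<in> H) \<Longrightarrow> (\<And>i. i < k \<Longrightarrow> a i \<le> n) \<Longrightarrow> ell (words x k a) \<le> real n * (\<Sum>i<k. ell (x i))"
proof (induction k)
  case (Suc k)
  have w: "words x k a \<in> H" by (rule words_in[OF H]) (use Suc.prems in auto)
  have xk: "x k \<in> H" using Suc.prems by auto
  have "ell (x k ^ a k) \<le> real (a k) * ell (x k)" by (rule ell_power[OF xk])
  also have "\<dots> \<le> real n * ell (x k)" by (rule mult_right_mono) (use Suc.prems ell_nonneg[OF xk] in auto)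
  finally have "ell (x k ^ a k) \<le> real n * ell (x k)" .
  then show ?case using Suc ell_mult[OF w sgrp_power[OF H xk, of "a k"]] by (simp add: distrib_left)
qed (simp add: ell_one)

text \<open>The words in the \<open>g i\<close> with exponents up to \<open>n\<close> give \<open>(n + 1) ^ k\<close> orbit points in a ball of radius
  linear in \<open>n\<close>.\<close>

lemma tri_bound:
  assumes L: "sgrp L" "L \<subseteq> H" and tri: "tri L k \<phi> g"
  shows "k \<le> D"
proof (rule ccontr)
  assume "\<not> k \<le> D"
  have tr: "\<phi> i \<in> vh L" "g i \<in> L" "\<phi> i (g i) \<noteq> 0" "j < i \<Longrightarrow> \<phi> i (g j) = 0" if "i < k" for i j
    using tri that unfolding tri_def by auto
  obtain M where M: "sgrp M" "M \<subseteq> L" "fi M L" "\<forall>i<k. add_hom M (\<phi> i)" using common_hom[OF L(1), of k \<phi>] tr(1) by auto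
  obtain e where e: "e \<ge> 1" "\<And>g. g \<in> L \<Longrightarrow> g ^ e \<in> M" using fi_exponent[OF M(3) L(1) M(1)] by blast
  define x where "x i = g i ^ e" for i
  have xM: "x i \<in> M" if "i < k" for i using e(2) tr(2)[OF that] by (simp add: x_def)
  have xH: "x i \<in> H" if "i < k" for i using xM[OF that] M(2) L(2) by blast
  have \<phi>x: "\<phi> i (x j) = real e * \<phi> i (g j)" if "i < k" "j < k" for i j
    using vh_power[OF tr(1)[OF that(1)] tr(2)[OF that(2)]] by (simp add: x_def)
  define c where "c = (\<Sum>i<k. ell (x i))"
  have c0: "c \<ge> 0" unfolding c_def by (rule sum_nonneg) (use xH ell_nonneg in auto)
  have key: "real (n + 1) ^ k \<le> C * (1 + real n * c) ^ D" for n
  proof -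
    let ?W = "{..<k} \<rightarrow>\<^sub>E {..n}"
    have inj: "inj_on (\<lambda>a. words x k a \<star> b) ?W"
    proof (rule inj_onI)
      fix a a' assume a: "a \<in> ?W" "a' \<in> ?W" and eq: "words x k a \<star> b = words x k a' \<star> b"
      have wM: "words x k a \<in> M" "words x k a' \<in> M" using words_in[OF M(1) xM] by auto
      have "inverse (words x k a) * words x k a' \<in> M" using sgrp_mult[OF M(1) sgrp_inv[OF M(1)]] wM by blast
      then have st: "inverse (words x k a) * words x k a' \<in> stab L" using eq same_point M(2) unfolding stab_def by blast
      have "(\<Sum>j<k. real (a j) * \<phi> i (x j)) = (\<Sum>j<k. real (a' j) * \<phi> i (x j))" if i: "i < k" for i
      proof -
        have h: "add_hom M (\<phi> i)" using M(4) i by blast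
        have "\<phi> i (inverse (words x k a) * words x k a') = 0" by (rule vh_stab[OF tr(1)[OF i] st])
        then have "\<phi> i (words x k a) = \<phi> i (words x k a')"
          using wM sgrp_inv[OF M(1)] by (simp add: add_hom_mult[OF h] add_hom_inv[OF h M(1)])
        then show ?thesis using words_hom[OF M(1) h xM] by simp
      qed
      note sums = this
      have "real (a j) = real (a' j)" if "j < k" for j
      proof (rule triangular_unique[where m = "\<lambda>i j. \<phi> i (x j)" and a = "\<lambda>j. real (a j)" and a' = "\<lambda>j. real (a' j)", OF _ _ sums that])
        show "\<phi> i (x i) \<noteq> 0" if "i < k" for i using \<phi>x[OF that that] tr(3)[OF that] e(1) by simp
        show "\<phi> i (x j) = 0" if "i < k" "j < i" for i j using \<phi>x[of i j] tr(4)[OF that] that by simp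
      qed
      then show "a = a'" using a by (intro PiE_ext[OF a]) auto
    qed
    have "card ?W = card ((\<lambda>a. words x k a \<star> b) ` ?W)" by (simp add: card_image[OF inj])
    also have "(\<lambda>a. words x k a \<star> b) ` ?W = orb (words x k ` ?W)" by (simp add: orb_def image_image)
    finally have "real ((n + 1) ^ k) = real (card (orb (words x k ` ?W)))" by (simp add: card_PiE)
    also have "\<dots> \<le> C * (1 + real n * c) ^ D"
    proof (rule orb_card)
      show "words x k ` ?W \<subseteq> H" by (rule image_subsetI, rule words_in[OF H xH])
      show "ell w \<le> real n * c" if w: "w \<in> words x k ` ?W" for w
      proof -
        obtain a where a: "a \<in> ?W" "w = words x k a" using w by blast
        have "a i \<le> n" if "i < k" for i using PiE_mem[OF a(1), of i] that by simp
        then show ?thesis using words_ell[where x = x and k = k and a = a and n = n, OF xH] unfolding c_def a(2) by blast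
      qed
      show "0 \<le> real n * c" using c0 by simp
    qed
    finally show ?thesis by (simp only: of_nat_power)
  qed
  obtain n :: nat where n: "real n > \<bar>C\<bar> * (1 + c) ^ D" using reals_Archimedean2 by blast
  have "real (n + 1) ^ D * real (n + 1) = real (n + 1) ^ Suc D" by simp
  also have "\<dots> \<le> real (n + 1) ^ k" using \<open>\<not> k \<le> D\<close> by (intro power_increasing) auto
  also have "\<dots> \<le> C * (1 + real n * c) ^ D" by (rule key)
  also have "\<dots> \<le> \<bar>C\<bar> * ((1 + c) * real (n + 1)) ^ D"
    using c0 by (intro mult_mono power_mono) (auto simp: algebra_simps)
  also have "\<dots> = real (n + 1) ^ D * (\<bar>C\<bar> * (1 + c) ^ D)" by (simp only: power_mult_distrib mult_ac)
  finally have "real (n + 1) \<le> \<bar>C\<bar> * (1 + c) ^ D" by (rule mult_left_le_imp_le) simp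
  then show False using n by simp
qed

text \<open>Triangular systems have length at most \<open>D\<close>. A longest one spans:
  elimination at the elements \<open>g i\<close> leaves a function vanishing at all of them, which
  would extend the system unless it is 0. So a common domain of the finitely many
  \<open>\<phi> i\<close> serves the whole space.\<close>

lemma vh_common_hom:
  assumes L: "sgrp L" "L \<subseteq> H"
  obtains M where "sgrp M" "M \<subseteq> L" "fi M L" "\<And>\<phi>. \<phi> \<in> vh L \<Longrightarrow> add_hom M \<phi>"
proof -
  define P where "P k \<longleftrightarrow> (\<exists>\<phi> g. tri L k \<phi> g)" for k
  have "P 0" by (simp add: P_def tri_def)
  have bound: "\<forall>k. P k \<longrightarrow> k \<le> D" using tri_bound[OF L] by (auto simp: P_def)
  define k where "k = (GREATEST k. P k)"
  have k: "P k" "\<And>k'. P k' \<Longrightarrow> k' \<le> k"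
    unfolding k_def using GreatestI_nat[of P 0 D] Greatest_le_nat[of P _ D] \<open>P 0\<close> bound by blast+
  obtain \<phi> g where tri: "tri L k \<phi> g" using k(1) by (auto simp: P_def)
  have tr: "\<phi> i \<in> vh L" "g i \<in> L" "\<phi> i (g i) \<noteq> 0" "j < i \<Longrightarrow> \<phi> i (g j) = 0" if "i < k" for i j
    using tri that unfolding tri_def by auto
  obtain M where M: "sgrp M" "M \<subseteq> L" "fi M L" "\<forall>i<k. add_hom M (\<phi> i)" using common_hom[OF L(1), of k \<phi>] tr(1) by auto
  \<comment> \<open>Downward induction on the number of elements \<open>g i\<close> at which the
    function is already known to vanish.\<close>
  have "\<forall>\<psi>\<in>vh L. (\<forall>i<0. \<psi> (g i) = 0) \<longrightarrow> add_hom M \<psi>"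
  proof (rule inc_induct[where i = 0 and j = k])
    show "\<forall>\<psi>\<in>vh L. (\<forall>i<k. \<psi> (g i) = 0) \<longrightarrow> add_hom M \<psi>"
    proof (intro ballI impI)
      fix \<psi> assume \<psi>: "\<psi> \<in> vh L" "\<forall>i<k. \<psi> (g i) = 0"
      have "\<psi> x = 0" for x
      proof (rule ccontr)
        assume x: "\<psi> x \<noteq> 0"
        then have "x \<in> L" using vh_out[OF \<psi>(1)] by blast
        then have "tri L (Suc k) (\<phi>(k := \<psi>)) (g(k := x))" using tri \<psi> x unfolding tri_def by (auto simp: less_Suc_eq)
        then show False using k(2)[of "Suc k"] by (auto simp: P_def)
      qed
      then show "add_hom M \<psi>" by (simp add: add_hom_def)
    qed
    fix j assume j: "0 \<le> j" "j < k" and IH: "\<forall>\<psi>\<in>vh L. (\<forall>i<Suc j. \<psi> (g i) = 0) \<longrightarrow> add_hom M \<psi>"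
    show "\<forall>\<psi>\<in>vh L. (\<forall>i<j. \<psi> (g i) = 0) \<longrightarrow> add_hom M \<psi>"
    proof (intro ballI impI)
      fix \<psi> assume \<psi>: "\<psi> \<in> vh L" "\<forall>i<j. \<psi> (g i) = 0"
      define a where "a = - \<psi> (g j) / \<phi> j (g j)"
      define \<psi>' where "\<psi>' = (\<lambda>x. \<psi> x + a * \<phi> j x)"
      have "\<psi>' \<in> vh L" unfolding \<psi>'_def by (rule vh_add[OF \<psi>(1) vh_scale[OF tr(1)[OF j(2)]]])
      moreover have "\<forall>i<Suc j. \<psi>' (g i) = 0" using \<psi>(2) tr[OF j(2)] by (auto simp: less_Suc_eq \<psi>'_def a_def)
      ultimately have "add_hom M \<psi>'" using IH by blast
      moreover have "add_hom M (\<phi> j)" using M(4) j by blast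
      moreover have "\<psi> = (\<lambda>x. \<psi>' x - a * \<phi> j x)" by (simp add: \<psi>'_def)
      ultimately show "add_hom M \<psi>" unfolding add_hom_def by (simp add: algebra_simps)
    qed
  qed simp
  then show ?thesis using that[OF M(1-3)] by blast
qed

text \<open>On the largest subgroup that fixes all of \<open>vh L\<close> under conjugation, the elements of \<open>vh L\<close> are
  homomorphisms by \<open>add_hom_extend\<close>; there the colliding words of its generators yield the relation.\<close>

lemma vh_relation:
  assumes L: "sgrp L" "L \<subseteq> H" and r: "conn L r" and nm: "normalizes H1 L" "H1 \<subseteq> H" and t: "t \<in> H1"
  shows "\<exists>E E'. finite E \<and> finite E' \<and> E \<noteq> E' \<and>
    (\<forall>\<phi>\<in>vh L. \<forall>g. (\<Sum>i\<in>E. \<phi> (t ^ i * g * inverse (t ^ i))) = (\<Sum>i\<in>E'. \<phi> (t ^ i * g * inverse (t ^ i))))"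
proof -
  have H1: "sgrp H1" using nm(1) by (simp add: normalizes_def)
  have tH: "t \<in> H" using t nm(2) by blast
  have cj_vh: "cj h \<phi> \<in> vh L" if "h \<in> H1" "\<phi> \<in> vh L" for h \<phi>
    by (rule vh_cj[OF L nm(1)]) (use that nm(2) in auto)
  have nL: "normalizes L L" using L(1) sgrp_conj[OF L(1)] by (simp add: normalizes_def)
  obtain M where M: "sgrp M" "M \<subseteq> L" "fi M L" "\<And>\<phi>. \<phi> \<in> vh L \<Longrightarrow> add_hom M \<phi>" using vh_common_hom[OF L] by blast
  \<comment> \<open>Unlike \<open>M\<close>, this subgroup is determined by \<open>vh L\<close> as a
    whole and hence normalized by \<open>H1\<close>, so conjugates of its elements by powers of
    \<open>t\<close> stay where the functions are homomorphisms.\<close>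
  define K where "K = {l \<in> L. \<forall>\<phi>\<in>vh L. cj l \<phi> = \<phi>}"
  have K: "sgrp K"
  proof (rule sgrpI)
    show "1 \<in> K" using sgrp_one[OF L(1)] by (simp add: K_def)
    show "g * h \<in> K" if "g \<in> K" "h \<in> K" for g h using that sgrp_mult[OF L(1)] by (simp add: K_def cj_mult)
    show "inverse g \<in> K" if "g \<in> K" for g
      using that sgrp_inv[OF L(1)] cj_inv(1)[of g] unfolding K_def mem_Collect_eq by metis
  qed
  have KL: "K \<subseteq> L" by (auto simp: K_def)
  have MK: "M \<subseteq> K" using vh_hom_invariant[OF L(1) _ M(1-3) M(4)] M(2) unfolding K_def by blast
  have fiK: "fi K L" by (rule fi_mono[OF M(3) MK])
  have fiMK: "fi M K" using fi_restrict[OF M(3,1) K KL] MK by (simp add: Int_absorb2)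
  have homK: "add_hom K \<phi>" if p: "\<phi> \<in> vh L" for \<phi>
  proof (rule add_hom_extend[OF K M(1) MK fiMK M(4)[OF p]])
    show "\<phi> (g ^ n) = real n * \<phi> g" if "g \<in> K" for g n using vh_power[OF p] that KL by blast
    show "\<phi> (l * g * inverse l) = \<phi> g" if "g \<in> K" "l \<in> K" for g l
    proof -
      have "cj l \<phi> = \<phi>" using that(2) p by (simp add: K_def)
      then show ?thesis unfolding cj_def by (rule fun_cong)
    qed
  qed
  have conjK: "h * g * inverse h \<in> K" if h: "h \<in> H1" and g: "g \<in> K" for h g
  proof -
    have "cj (h * g * inverse h) \<phi> = \<phi>" if p: "\<phi> \<in> vh L" for \<phi>
    proof -
      have "cj g (cj h \<phi>) = cj h \<phi>" using g cj_vh[OF h p] by (simp add: K_def)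
      then show ?thesis by (simp add: cj_mult cj_inv)
    qed
    then show ?thesis using g normalizes_iff[OF nm(1) h, of g] by (simp add: K_def)
  qed
  obtain rK where rK: "conn K rK" using conn_fi[OF L K KL fiK r] by blast
  have KH: "K \<subseteq> H" using KL L(2) by blast
  obtain T where T: "finite T" "T \<subseteq> K" "K \<subseteq> gen (T \<union> stab K)" using finite_gen[OF K KH rK] by blast
  obtain n E E' where E: "E \<subseteq> {1..n}" "E' \<subseteq> {1..n}" "E \<noteq> E'" "\<And>f. f \<in> T \<Longrightarrow> aw t f n E \<star> b = aw t f n E' \<star> b"
    by (rule words_collide[OF tH T(1) order_trans[OF T(2) KH]]) (rule that)
  have fin: "finite E" "finite E'" using E(1,2) finite_subset by blast+
  have ti: "t ^ i \<in> H1" for i by (rule sgrp_power[OF H1 t])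
  have awK: "aw t f m A \<in> K" if f: "f \<in> K" for f m A
  proof (induction m)
    case (Suc m)
    then show ?case using sgrp_mult[OF K conjK[OF ti f, of "Suc m"] Suc] by (simp del: power_Suc)
  qed (simp add: sgrp_one[OF K])
  have aw_sum: "\<phi> (aw t f m A) = (\<Sum>i\<in>A \<inter> {1..m}. \<phi> (t ^ i * f * inverse (t ^ i)))" if p: "\<phi> \<in> vh L" and f: "f \<in> K" for \<phi> f m A
  proof (induction m)
    case 0
    then show ?case by (simp add: add_hom_one[OF homK[OF p] K])
  next
    case (Suc m)
    have "A \<inter> {1..Suc m} = (if Suc m \<in> A then insert (Suc m) (A \<inter> {1..m}) else A \<inter> {1..m})"
      by (auto simp: le_Suc_eq)
    then show ?case using Suc add_hom_mult[OF homK[OF p] conjK[OF ti f, of "Suc m"] awK[OF f, of m A]] by (simp del: power_Suc)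
  qed
  have "(\<Sum>i\<in>E. \<phi> (t ^ i * g * inverse (t ^ i))) = (\<Sum>i\<in>E'. \<phi> (t ^ i * g * inverse (t ^ i)))" if p: "\<phi> \<in> vh L" for \<phi> g
  proof -
    define \<psi> where "\<psi> g = (\<Sum>i\<in>E. cj (t ^ i) \<phi> g) - (\<Sum>i\<in>E'. cj (t ^ i) \<phi> g)" for g
    have cjp: "cj (t ^ i) \<phi> \<in> vh L" for i by (rule cj_vh[OF ti p])
    have \<psi>K: "add_hom K \<psi>" unfolding add_hom_def \<psi>_def
      using add_hom_mult[OF homK[OF cjp]] by (simp add: sum.distrib)
    have "T \<union> stab K \<subseteq> {g \<in> K. \<psi> g = 0}"
    proof
      fix f assume "f \<in> T \<union> stab K"
      then show "f \<in> {g \<in> K. \<psi> g = 0}"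
      proof
        assume "f \<in> stab K"
        then have "f \<in> stab L" "f \<in> K" using KL by (auto simp: stab_def)
        then show ?thesis using vh_stab[OF cjp] by (simp add: \<psi>_def)
      next
        assume f: "f \<in> T"
        then have fK: "f \<in> K" using T(2) by blast
        have "inverse (aw t f n E) * aw t f n E' \<in> stab L"
          using same_point[of "aw t f n E" "aw t f n E'"] E(4)[OF f] sgrp_mult[OF K sgrp_inv[OF K awK[OF fK]] awK[OF fK]] KL
          unfolding stab_def by blast
        then have "\<phi> (inverse (aw t f n E) * aw t f n E') = 0" by (rule vh_stab[OF p])
        then have "\<phi> (aw t f n E) = \<phi> (aw t f n E')"
          using add_hom_mult[OF homK[OF p] sgrp_inv[OF K awK[OF fK]] awK[OF fK]] add_hom_inv[OF homK[OF p] K awK[OF fK]] by simp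
        then show ?thesis using aw_sum[OF p fK, of n] E(1,2) fK by (simp add: \<psi>_def cj_def Int_absorb2)
      qed
    qed
    then have "K \<subseteq> {g \<in> K. \<psi> g = 0}" using T(3) gen_least[OF sgrp_kernel[OF \<psi>K K]] by blast
    then have \<psi>0: "\<psi> g = 0" if "g \<in> K" for g using that by blast
    obtain e where e: "e \<ge> 1" "\<And>g. g \<in> L \<Longrightarrow> g ^ e \<in> K" using fi_exponent[OF fiK L(1) K] by blast
    have "\<psi> g = 0"
    proof (cases "g \<in> L")
      case True
      have "real e * \<psi> g = \<psi> (g ^ e)" using vh_power[OF cjp True, of _ e] by (simp add: \<psi>_def sum_distrib_left right_diff_distrib)
      then show ?thesis using \<psi>0[OF e(2)[OF True]] e(1) by simp
    qed (simp add: \<psi>_def vh_out[OF cjp])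
    then show ?thesis by (simp add: \<psi>_def cj_def)
  qed
  then show ?thesis using fin E(3) by blast
qed

end

section \<open>Central series\<close>

lemma grp_powi_mult: "power_int (a ^ m) q = power_int a (int m * q)" for a :: "'g::grp"
proof -
  have nat: "power_int (a ^ m) (int n) = power_int a (int m * int n)" for n
    using grp_powi_power[of a "int m" n] by simp
  show ?thesis
  proof (cases q)
    case (neg n)
    then have "q = - int (Suc n)" by simp
    then show ?thesis using nat[of "Suc n"] by (simp only: grp_powi_minus mult_minus_right)
  qed (simp only: nat)
qed

context growth_action
begin

text \<open>The invariance of \<open>\<theta>\<close> under conjugation says that \<open>M\<close> is central modulo the kernel of \<open>\<theta>\<close>.\<close>

inductive nilchain :: "'g set \<Rightarrow> 'g set \<Rightarrow> bool" for H1 where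
  base: "nilchain H1 H1"
| step: "nilchain H1 M \<Longrightarrow> add_hom M (\<theta>::'g \<Rightarrow> int) \<Longrightarrow> (\<And>h m. h \<in> H1 \<Longrightarrow> m \<in> M \<Longrightarrow> \<theta> (h * m * inverse h) = \<theta> m) \<Longrightarrow>
    (\<And>m. m \<in> stab M \<Longrightarrow> \<theta> m = 0) \<Longrightarrow> nilchain H1 {m \<in> M. \<theta> m = 0}"

lemma nilchain_sgrp:
  assumes "nilchain H1 L" "sgrp H1"
  shows "sgrp L \<and> L \<subseteq> H1 \<and> normalizes H1 L \<and> stab H1 \<subseteq> L"
  using assms
proof (induction rule: nilchain.induct)
  case base
  then show ?case using sgrp_conj[of H1] stab_L by (auto simp: normalizes_def)
next
  case (step M \<theta>)
  then have M: "sgrp M" "M \<subseteq> H1" "normalizes H1 M" "stab H1 \<subseteq> M" by auto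
  have "stab H1 \<subseteq> stab M" using M(4) by (auto simp: stab_def)
  then show ?case using sgrp_kernel[OF step(2) M(1)] M step(3,4,6) by (auto simp: normalizes_def)
qed

text \<open>Allows the acting group to shrink to a finite index subgroup at every stage without
  losing the chain built so far.\<close>

lemma nilchain_restrict:
  assumes "nilchain H1 L" "H2 \<subseteq> H1" shows "nilchain H2 (L \<inter> H2)"
  using assms
proof (induction rule: nilchain.induct)
  case base
  then show ?case using nilchain.base by (simp add: Int_absorb1)
next
  case (step M \<theta>)
  have "{m \<in> M. \<theta> m = 0} \<inter> H2 = {m \<in> M \<inter> H2. \<theta> m = 0}" by auto
  moreover have "nilchain H2 {m \<in> M \<inter> H2. \<theta> m = 0}"
    by (rule nilchain.step) (use step in \<open>auto simp: stab_def intro: add_hom_subset\<close>)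
  ultimately show ?case by simp
qed

text \<open>A finite index subgroup on which the function is a homomorphism fixes it, so its cosets
  index the orbit.\<close>

lemma finite_orbit_self:
  assumes L: "sgrp L" and p: "\<phi> \<in> vh L" shows "finite ((\<lambda>h. cj h \<phi>) ` L)"
proof -
  obtain M where M: "sgrp M" "M \<subseteq> L" "fi M L" "add_hom M \<phi>" by (rule vh_hom[OF p])
  obtain C0 where C0: "finite C0" "C0 \<subseteq> L" "\<And>g. g \<in> L \<Longrightarrow> \<exists>c\<in>C0. g * inverse c \<in> M"
    using fi_right_reps[OF M(3) L M(1)] by blast
  have "(\<lambda>h. cj h \<phi>) ` L \<subseteq> (\<lambda>h. cj h \<phi>) ` C0"
  proof (rule image_subsetI)
    fix g assume "g \<in> L"
    then obtain c where c: "c \<in> C0" "g * inverse c \<in> M" using C0(3) by blast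
    have "cj g \<phi> = cj ((g * inverse c) * c) \<phi>" by (simp add: mult.assoc)
    also have "\<dots> = cj c \<phi>" by (simp only: cj_mult[of "g * inverse c" c] vh_hom_invariant[OF L p M c(2)])
    finally show "cj g \<phi> \<in> (\<lambda>h. cj h \<phi>) ` C0" using c(1) by blast
  qed
  then show ?thesis using C0(1) finite_subset by blast
qed

text \<open>One step up the chain, from the kernel of \<open>\<theta>\<close> to \<open>M\<close>.
  The functions with finite orbit under the kernel form a space stable under \<open>t\<close>, whose
  value generates the image of \<open>\<theta>\<close>; by \<open>vh_relation\<close> for every
  power of \<open>t\<close>, this space contains a nonzero function fixed by some
  \<open>t ^ m\<close>. Every element of \<open>M\<close> is a power of \<open>t\<close> times a
  kernel element, so the orbit under \<open>M\<close> is finite.\<close>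

lemma finite_orbit_step:
  fixes \<theta> :: "'g \<Rightarrow> int"
  assumes L: "sgrp L" "L \<subseteq> H" and r: "conn L r" and nm: "normalizes M L" "M \<subseteq> H" and \<theta>: "add_hom M \<theta>"
    and p: "\<phi> \<in> vh L" "\<phi> \<noteq> (\<lambda>_. 0)" and fin: "finite ((\<lambda>h. cj h \<phi>) ` {m \<in> M. \<theta> m = 0})"
  shows "\<exists>\<phi>\<in>vh L. \<phi> \<noteq> (\<lambda>_. 0) \<and> finite ((\<lambda>h. cj h \<phi>) ` M)"
proof (cases "\<forall>m\<in>M. \<theta> m = 0")
  case True
  then have "{m \<in> M. \<theta> m = 0} = M" by blast
  then show ?thesis using p fin by auto
next
  case False
  have M: "sgrp M" using nm(1) by (simp add: normalizes_def)
  obtain t where t: "t \<in> M" "\<theta> t > 0" "\<And>g. g \<in> M \<Longrightarrow> \<theta> t dvd \<theta> g" using int_hom_generator[OF \<theta> M] False by blast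
  let ?N = "{m \<in> M. \<theta> m = 0}"
  define U where "U = {\<phi> \<in> vh L. finite ((\<lambda>h. cj h \<phi>) ` ?N)}"
  have cj_vh: "cj h \<phi> \<in> vh L" if "h \<in> M" "\<phi> \<in> vh L" for h \<phi>
    by (rule vh_cj[OF L nm(1)]) (use that nm(2) in auto)
  have U_cj: "cj h \<phi> \<in> U" if h: "h \<in> M" and u: "\<phi> \<in> U" for h \<phi>
  proof -
    have "(\<lambda>g. cj g (cj h \<phi>)) ` ?N \<subseteq> cj h ` (\<lambda>g. cj g \<phi>) ` ?N"
    proof (rule image_subsetI)
      fix g assume g: "g \<in> ?N"
      have "h * g * inverse h \<in> ?N"
        using g h by (simp add: add_hom_mult[OF \<theta>] add_hom_inv[OF \<theta> M] sgrp_mult[OF M] sgrp_inv[OF M])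
      moreover have "cj g (cj h \<phi>) = cj h (cj (h * g * inverse h) \<phi>)" by (simp add: mult.assoc flip: cj_mult)
      ultimately show "cj g (cj h \<phi>) \<in> cj h ` (\<lambda>g. cj g \<phi>) ` ?N" by blast
    qed
    moreover have "finite (cj h ` (\<lambda>g. cj g \<phi>) ` ?N)" using u by (auto simp: U_def)
    ultimately have "finite ((\<lambda>g. cj g (cj h \<phi>)) ` ?N)" by (rule finite_subset)
    then show ?thesis using u cj_vh[OF h] unfolding U_def by blast
  qed
  have conj_iter: "((\<lambda>g. t * g * inverse t) ^^ n) g = t ^ n * g * inverse (t ^ n)" for n g by (rule funpow_conj)
  obtain m u where m: "m \<ge> 1" and u: "u \<in> U" "u \<noteq> (\<lambda>_. 0)" and per: "\<And>g. u (((\<lambda>g. t * g * inverse t) ^^ m) g) = u g"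
  proof (rule exists_periodic_function[where c = "\<lambda>g. t * g * inverse t" and U = U])
    show "surj (\<lambda>g. t * g * inverse t)"
    proof (rule surjI)
      fix g show "t * (inverse t * g * t) * inverse t = g" by (simp add: mult.assoc)
    qed
    show "(\<lambda>x. u x + v x) \<in> U" if "u \<in> U" "v \<in> U" for u v
    proof -
      have "(\<lambda>h. cj h (\<lambda>x. u x + v x)) ` ?N \<subseteq> (\<lambda>(p, q). \<lambda>x. p x + q x) ` ((\<lambda>h. cj h u) ` ?N \<times> (\<lambda>h. cj h v) ` ?N)"
      proof (rule image_subsetI)
        fix h assume "h \<in> ?N"
        then have "(cj h u, cj h v) \<in> (\<lambda>h. cj h u) ` ?N \<times> (\<lambda>h. cj h v) ` ?N" by blast
        moreover have "cj h (\<lambda>x. u x + v x) = (\<lambda>(p, q). \<lambda>x. p x + q x) (cj h u, cj h v)" by (simp add: cj_def)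
        ultimately show "cj h (\<lambda>x. u x + v x) \<in> (\<lambda>(p, q). \<lambda>x. p x + q x) ` ((\<lambda>h. cj h u) ` ?N \<times> (\<lambda>h. cj h v) ` ?N)"
          by (rule rev_image_eqI)
      qed
      moreover have "finite ((\<lambda>(p, q). \<lambda>x. p x + q x) ` ((\<lambda>h. cj h u) ` ?N \<times> (\<lambda>h. cj h v) ` ?N))"
        using that unfolding U_def by blast
      ultimately have "finite ((\<lambda>h. cj h (\<lambda>x. u x + v x)) ` ?N)" by (rule finite_subset)
      then show ?thesis using that vh_add[of u L v] unfolding U_def by blast
    qed
    show "(\<lambda>x. a * u x) \<in> U" if "u \<in> U" for u a
    proof -
      have "(\<lambda>h. cj h (\<lambda>x. a * u x)) ` ?N = (\<lambda>p x. a * p x) ` (\<lambda>h. cj h u) ` ?N" by (simp add: image_image cj_def)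
      then show ?thesis using that vh_scale[of u L a] unfolding U_def by auto
    qed
    show "(\<lambda>x. u (t * x * inverse t)) \<in> U" if "u \<in> U" for u
      using U_cj[OF t(1) that] by (simp add: cj_def)
    show "\<exists>E E'. finite E \<and> finite E' \<and> E \<noteq> E' \<and>
      (\<forall>u\<in>U. \<forall>x. (\<Sum>i\<in>E. u (((\<lambda>g. t * g * inverse t) ^^ (k * i)) x)) = (\<Sum>i\<in>E'. u (((\<lambda>g. t * g * inverse t) ^^ (k * i)) x)))" for k
    proof -
      obtain E E' where "finite E" "finite E'" "E \<noteq> E'" and
        eq: "\<forall>\<phi>\<in>vh L. \<forall>g. (\<Sum>i\<in>E. \<phi> ((t ^ k) ^ i * g * inverse ((t ^ k) ^ i))) = (\<Sum>i\<in>E'. \<phi> ((t ^ k) ^ i * g * inverse ((t ^ k) ^ i)))"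
        using vh_relation[OF L r nm sgrp_power[OF M t(1)], of k] by blast
      then show ?thesis unfolding conj_iter power_mult U_def by blast
    qed
    show "\<phi> \<in> U" using p(1) fin by (simp add: U_def)
    show "\<phi> \<noteq> (\<lambda>_. 0)" by (rule p(2))
  qed (rule that)
  have tm: "cj (t ^ m) u = u" using per by (simp add: conj_iter cj_def)
  have "(\<lambda>h. cj h u) ` M \<subseteq> (\<Union>j<m. (\<lambda>x. cj x (cj (t ^ j) u)) ` ?N)"
  proof (rule image_subsetI)
    fix g assume g: "g \<in> M"
    obtain k where k: "\<theta> g = \<theta> t * k" using t(3)[OF g] by (auto elim: dvdE)
    define q where "q = k div int m"
    define j where "j = nat (k mod int m)"
    have j: "j < m" "int j = k mod int m" using m by (auto simp: j_def nat_less_iff)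
    define x where "x = inverse (power_int t k) * g"
    have "\<theta> x = 0"
      using g t(1) k by (simp add: x_def add_hom_mult[OF \<theta>] add_hom_inv[OF \<theta> M] add_hom_powi[OF \<theta> M] sgrp_inv[OF M] sgrp_powi[OF M])
    then have x: "x \<in> ?N" using g t(1) sgrp_mult[OF M] sgrp_inv[OF M] sgrp_powi[OF M] by (simp add: x_def)
    have "k = int m * q + int j" by (simp add: q_def j(2))
    then have "power_int t k = power_int (t ^ m) q * t ^ j"
      using grp_powi_add[of t "int m * q" "int j"] grp_powi_mult[of t m q] by simp
    then have "g = power_int (t ^ m) q * t ^ j * x" by (simp add: x_def mult.assoc flip: \<open>power_int t k = _\<close>)
    then have "cj g u = cj x (cj (t ^ j) u)" by (simp add: cj_mult cj_powi[OF tm])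
    then show "cj g u \<in> (\<Union>j<m. (\<lambda>x. cj x (cj (t ^ j) u)) ` ?N)" using j(1) x by blast
  qed
  moreover have "finite (\<Union>j<m. (\<lambda>x. cj x (cj (t ^ j) u)) ` ?N)"
    using U_cj[OF sgrp_power[OF M t(1)] u(1)] by (auto simp: U_def)
  ultimately have "finite ((\<lambda>h. cj h u) ` M)" by (rule finite_subset)
  then show ?thesis using u by (auto simp: U_def)
qed

lemma finite_orbit_chain:
  assumes L: "sgrp L" "L \<subseteq> H" and r: "conn L r" and nm: "normalizes H1 L" "H1 \<subseteq> H" and ch: "nilchain H1 M"
    and ex: "\<exists>\<phi>\<in>vh L. \<phi> \<noteq> (\<lambda>_. 0) \<and> finite ((\<lambda>h. cj h \<phi>) ` M)"
  shows "\<exists>\<phi>\<in>vh L. \<phi> \<noteq> (\<lambda>_. 0) \<and> finite ((\<lambda>h. cj h \<phi>) ` H1)"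
  using ch ex
proof (induction rule: nilchain.induct)
  case base
  then show ?case .
next
  case (step M \<theta>)
  have H1: "sgrp H1" using nm(1) by (simp add: normalizes_def)
  have M: "sgrp M" "M \<subseteq> H1" using nilchain_sgrp[OF step(1) H1] by auto
  have "normalizes M L" using M nm(1) by (auto simp: normalizes_def)
  then have "\<exists>\<phi>\<in>vh L. \<phi> \<noteq> (\<lambda>_. 0) \<and> finite ((\<lambda>h. cj h \<phi>) ` M)"
    using finite_orbit_step[OF L r _ _ step(2)] M(2) nm(2) step.prems by blast
  then show ?case by (rule step.IH)
qed

text \<open>A nonzero virtual homomorphism on \<open>L\<close> with finite orbit under
  \<open>H1\<close> is fixed by a finite index subgroup \<open>H2\<close>, and on
  \<open>K = L \<inter> H2\<close> it is a homomorphism. Its integer replacement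
  \<open>\<theta>'\<close> kills the kernel of \<open>\<phi>\<close>, in particular the elements
  \<open>h * g * inverse h * inverse g\<close>, and so inherits the invariance that
  \<open>nilchain\<close> asks for.\<close>

lemma chain_extend:
  assumes H1: "sgrp H1" "H1 \<subseteq> H" and ch: "nilchain H1 L" and gr: "growing L e" and inf: "infinite (orb L)"
  shows "\<exists>H2 L2 e'. sgrp H2 \<and> H2 \<subseteq> H1 \<and> fi H2 H1 \<and> nilchain H2 L2 \<and> growing L2 e' \<and> e = Suc e'"
proof -
  have L: "sgrp L" "L \<subseteq> H1" "normalizes H1 L" using nilchain_sgrp[OF ch H1(1)] by auto
  have LH: "L \<subseteq> H" using L(2) H1(2) by blast
  obtain r where r: "conn L r" using gr by (auto simp: growing_def)
  obtain M and \<theta> :: "'g \<Rightarrow> int" where M: "sgrp M" "M \<subseteq> L" "fi M L" "add_hom M \<theta>"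
    "\<And>g. g \<in> stab M \<Longrightarrow> \<theta> g = 0" "\<exists>g\<in>M. \<theta> g \<noteq> 0"
    using exists_virtual_int_hom[OF L(1) LH gr inf] by blast
  then have "\<exists>\<phi>\<in>vh L. \<phi> \<noteq> (\<lambda>_. 0)" using exists_vh[OF L(1) M(1-5)] by blast
  then have "\<exists>\<phi>\<in>vh L. \<phi> \<noteq> (\<lambda>_. 0) \<and> finite ((\<lambda>h. cj h \<phi>) ` L)" using finite_orbit_self[OF L(1)] by blast
  then obtain \<phi> where p: "\<phi> \<in> vh L" "\<phi> \<noteq> (\<lambda>_. 0)" "finite ((\<lambda>h. cj h \<phi>) ` H1)"
    using finite_orbit_chain[OF L(1) LH r L(3) H1(2) ch] by blast
  define H2 where "H2 = {h \<in> H1. cj h \<phi> = \<phi>}"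
  have H2: "sgrp H2"
  proof (rule sgrpI)
    show "1 \<in> H2" using sgrp_one[OF H1(1)] by (simp add: H2_def)
    show "g * h \<in> H2" if "g \<in> H2" "h \<in> H2" for g h using that sgrp_mult[OF H1(1)] by (simp add: H2_def cj_mult)
    show "inverse g \<in> H2" if "g \<in> H2" for g
      using that sgrp_inv[OF H1(1)] cj_inv(1)[of g] unfolding H2_def mem_Collect_eq by metis
  qed
  have H2H1: "H2 \<subseteq> H1" by (auto simp: H2_def)
  have fiH2: "fi H2 H1"
  \<comment> \<open>The inverse is there because \<open>cj\<close> is a right action while
    \<open>fi\<close> speaks of left cosets.\<close>
  proof (rule fiI[of "\<lambda>h. cj (inverse h) \<phi>"])
    show "finite ((\<lambda>h. cj (inverse h) \<phi>) ` H1)"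
      by (rule finite_subset[OF _ p(3)]) (use sgrp_inv[OF H1(1)] in auto)
    fix g h assume gh: "g \<in> H1" "h \<in> H1" "cj (inverse g) \<phi> = cj (inverse h) \<phi>"
    then have "cj (inverse g * h) \<phi> = \<phi>" by (simp add: cj_mult cj_inv)
    then show "inverse g * h \<in> H2" using gh sgrp_mult[OF H1(1) sgrp_inv[OF H1(1)]] by (simp add: H2_def)
  qed
  define K where "K = L \<inter> H2"
  have K: "sgrp K" "K \<subseteq> L" "K \<subseteq> H" using sgrp_Int[OF L(1) H2] LH by (auto simp: K_def)
  have fiK: "fi K L" unfolding K_def using fi_restrict[OF fiH2 H2 L(1,2)] by (simp add: Int_commute)
  obtain M' where M': "sgrp M'" "M' \<subseteq> L" "fi M' L" "add_hom M' \<phi>" by (rule vh_hom[OF p(1)])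
  have homK: "add_hom K \<phi>"
  proof (rule add_hom_extend[OF K(1)])
    show "sgrp (M' \<inter> K)" "M' \<inter> K \<subseteq> K" "fi (M' \<inter> K) K" using sgrp_Int[OF M'(1) K(1)] fi_restrict[OF M'(3,1) K(1,2)] by auto
    show "add_hom (M' \<inter> K) \<phi>" by (rule add_hom_subset[OF M'(4)]) simp
    show "\<phi> (g ^ n) = real n * \<phi> g" if "g \<in> K" for g n using vh_power[OF p(1)] that K(2) by blast
    show "\<phi> (l * g * inverse l) = \<phi> g" if "g \<in> K" "l \<in> K" for g l
    proof -
      have "cj l \<phi> = \<phi>" using that(2) by (simp add: K_def H2_def)
      then show ?thesis unfolding cj_def by (rule fun_cong)
    qed
  qed
  obtain rK where rK: "conn K rK" using conn_fi[OF L(1) LH K(1,2) fiK r] by blast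
  have stK: "\<phi> g = 0" if "g \<in> stab K" for g using vh_stab[OF p(1), of g] that K(2) by (auto simp: stab_def)
  have nzK: "\<exists>g\<in>K. \<phi> g \<noteq> 0"
  proof -
    obtain g where g: "\<phi> g \<noteq> 0" using p(2) by auto
    then have gL: "g \<in> L" using vh_out[OF p(1)] by blast
    obtain k where k: "k \<ge> 1" "\<And>g. g \<in> L \<Longrightarrow> g ^ k \<in> K" using fi_exponent[OF fiK L(1) K(1)] by blast
    have "\<phi> (g ^ k) \<noteq> 0" using vh_power[OF p(1) gL, of k] g k(1) by simp
    then show ?thesis using k(2)[OF gL] by blast
  qed
  obtain \<theta>' :: "'g \<Rightarrow> int" where \<theta>': "add_hom K \<theta>'" "\<And>g. g \<in> K \<Longrightarrow> \<phi> g = 0 \<Longrightarrow> \<theta>' g = 0" "\<exists>g\<in>K. \<theta>' g \<noteq> 0"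
    using real_hom_int_hom[OF K(1,3) rK homK stK nzK] by blast
  have st': "\<theta>' g = 0" if "g \<in> stab K" for g using \<theta>'(2)[of g] stK[OF that] that stab_L by blast
  have chK: "nilchain H2 K" unfolding K_def by (rule nilchain_restrict[OF ch H2H1])
  have nmK: "normalizes H2 K" using nilchain_sgrp[OF chK H2] by blast
  have "nilchain H2 {g \<in> K. \<theta>' g = 0}"
  proof (rule nilchain.step[OF chK \<theta>'(1) _ st'])
    fix h g assume h: "h \<in> H2" and g: "g \<in> K"
    have hg: "h * g * inverse h \<in> K" using normalizes_iff[OF nmK h] g by blast
    have "\<phi> (h * g * inverse h) = \<phi> g"
    proof -
      have "cj h \<phi> = \<phi>" using h by (simp add: H2_def)
      then show ?thesis unfolding cj_def by (rule fun_cong)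
    qed
    then have "\<phi> (h * g * inverse h * inverse g) = 0"
      using add_hom_mult[OF homK hg sgrp_inv[OF K(1) g]] add_hom_inv[OF homK K(1) g] by simp
    then have "\<theta>' (h * g * inverse h * inverse g) = 0" by (intro \<theta>'(2) sgrp_mult[OF K(1) hg sgrp_inv[OF K(1) g]])
    then show "\<theta>' (h * g * inverse h) = \<theta>' g"
      using add_hom_mult[OF \<theta>'(1) hg sgrp_inv[OF K(1) g]] add_hom_inv[OF \<theta>'(1) K(1) g] by simp
  qed
  moreover have "growing K e" by (rule growing_fi[OF L(1) LH K(1,2) fiK gr])
  then obtain e' where "e = Suc e'" "growing {g \<in> K. \<theta>' g = 0} e'"
    using growing_kernel[OF K(1,3) _ \<theta>'(1) st' \<theta>'(3)] by blast
  ultimately show ?thesis using H2 H2H1 fiH2 by blast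
qed

text \<open>Each application of \<open>chain_extend\<close> lowers the degree by one, and it
  exhibits the degree of an infinite orbit as a successor; in degree 0 the orbit is therefore
  finite.\<close>

lemma chain_exists:
  assumes "sgrp H1" "H1 \<subseteq> H" "nilchain H1 L" "growing L e"
  shows "\<exists>H2 N. sgrp H2 \<and> H2 \<subseteq> H1 \<and> fi H2 H1 \<and> nilchain H2 N \<and> finite (orb N)"
  using assms
proof (induction e arbitrary: H1 L)
  case 0
  then have "finite (orb L)" using chain_extend by blast
  then show ?case using 0 fi_refl by blast
next
  case (Suc e)
  show ?case
  proof (cases "finite (orb L)")
    case True
    then show ?thesis using Suc.prems fi_refl by blast
  next
    case False
    obtain H2 L2 where H2: "sgrp H2" "H2 \<subseteq> H1" "fi H2 H1" "nilchain H2 L2" "growing L2 e"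
      using chain_extend[OF Suc.prems False] by auto
    then obtain H3 N where "sgrp H3" "H3 \<subseteq> H2" "fi H3 H2" "nilchain H3 N" "finite (orb N)"
      using Suc.IH[of H2 L2] Suc.prems(2) by blast
    then show ?thesis using H2 fi_trans[of H3 H2 H1] Suc.prems(1) by blast
  qed
qed

theorem virtually_nilpotent:
  assumes r: "conn H r"
  obtains H0 N T where "sgrp H0" "H0 \<subseteq> H" "fi H0 H" "nilchain H0 N" "finite (orb N)"
    "finite T" "T \<subseteq> H0" "H0 \<subseteq> gen (T \<union> N)"
proof -
  have r0: "r \<ge> 0" using r by (simp add: conn_def)
  have C0: "C \<ge> 0"
  proof -
    have "0 \<le> C * (1 + (0::real)) ^ D" by (rule order_trans[OF _ ball_card]) auto
    then show ?thesis by simp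
  qed
  \<comment> \<open>A word of length \<open>n\<close> has displacement at most \<open>n * r\<close>,
    so the growth of the orbit bounds the growth of words.\<close>
  have "real (card (orb (pw (sph H r) n))) \<le> (C * (1 + r) ^ D) * (real n + 1) ^ D" for n
  proof -
    have "real (card (orb (pw (sph H r) n))) \<le> C * (1 + real n * r) ^ D"
      by (rule orb_card) (use pw_sph_L[OF H] pw_sph_ell[OF H subset_refl] r0 in auto)
    also have "\<dots> \<le> C * ((1 + r) * (real n + 1)) ^ D"
      using r0 C0 by (intro mult_left_mono power_mono) (auto simp: algebra_simps)
    finally show ?thesis by (simp add: power_mult_distrib mult.assoc)
  qed
  then have "growing H D" using r by (auto simp: growing_def)
  then obtain H0 N where H0: "sgrp H0" "H0 \<subseteq> H" "fi H0 H" "nilchain H0 N" "finite (orb N)"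
    using chain_exists[OF H subset_refl nilchain.base] by blast
  obtain r' where r': "conn H0 r'" using conn_fi[OF H subset_refl H0(1-3) r] by blast
  obtain T where T: "finite T" "T \<subseteq> H0" "H0 \<subseteq> gen (T \<union> stab H0)" using finite_gen[OF H0(1,2) r'] by blast
  have "T \<union> stab H0 \<subseteq> T \<union> N" using nilchain_sgrp[OF H0(4,1)] by blast
  then have "H0 \<subseteq> gen (T \<union> N)" using T(3) gen_mono by blast
  then show ?thesis using that[OF H0 T(1,2)] by blast
qed

end

section \<open>Nilpotent quotients\<close>

lemma grp_hom_one_inv:
  fixes tr :: "'c \<Rightarrow> 'g::grp"
  assumes "group B" and tr: "\<And>x y. x \<in> carrier B \<Longrightarrow> y \<in> carrier B \<Longrightarrow> tr (x \<otimes>\<^bsub>B\<^esub> y) = tr x * tr y"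
  shows "tr \<one>\<^bsub>B\<^esub> = 1" "x \<in> carrier B \<Longrightarrow> tr (inv\<^bsub>B\<^esub> x) = inverse (tr x)"
proof -
  interpret B: group B by (rule assms(1))
  have "tr \<one>\<^bsub>B\<^esub> * tr \<one>\<^bsub>B\<^esub> = tr \<one>\<^bsub>B\<^esub> * 1" using tr[of "\<one>\<^bsub>B\<^esub>" "\<one>\<^bsub>B\<^esub>"] by simp
  then show one: "tr \<one>\<^bsub>B\<^esub> = 1" by (simp only: grp_cancel_left)
  show "tr (inv\<^bsub>B\<^esub> x) = inverse (tr x)" if "x \<in> carrier B"
  proof -
    have "tr (inv\<^bsub>B\<^esub> x) * tr x = inverse (tr x) * tr x" using tr[of "inv\<^bsub>B\<^esub> x" x] that one by simp
    then show ?thesis by (simp only: grp_cancel_right)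
  qed
qed

context growth_action
begin

text \<open>\<open>tr\<close> carries a record style group faithfully onto \<open>H0\<close>, and
  everything is pulled back along it. A step of the chain takes the lower central series one term
  further: for \<open>x\<close> over \<open>M\<close> and \<open>y\<close> over \<open>H0\<close>,
  invariance of \<open>\<theta>\<close> makes it vanish on their commutator.\<close>

lemma nilchain_quotient:
  fixes B (structure) and tr :: "'c \<Rightarrow> 'g"
  assumes B: "group B" and tr: "\<And>x y. x \<in> carrier B \<Longrightarrow> y \<in> carrier B \<Longrightarrow> tr (x \<otimes> y) = tr x * tr y"
    and inj: "inj_on tr (carrier B)" and H0: "sgrp H0" "tr ` carrier B = H0" and ch: "nilchain H0 N"
    and T: "finite T" "T \<subseteq> H0" "H0 \<subseteq> gen (T \<union> N)"
  defines "N0 \<equiv> {x \<in> carrier B. tr x \<in> N}"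
  shows "normal N0 B" "finitely_generated_group (B Mod N0)" "nilpotent_group (B Mod N0)"
proof -
  interpret B: group B by (rule B)
  note tr_one = grp_hom_one_inv(1)[OF B tr] and tr_inv = grp_hom_one_inv(2)[OF B tr]
  have sub: "subgroup {x \<in> carrier B. tr x \<in> L} B" if L: "sgrp L" for L
    by (rule B.subgroupI) (use sgrp_one[OF L] sgrp_mult[OF L] sgrp_inv[OF L] in \<open>auto simp: tr tr_one tr_inv intro!: exI[of _ "\<one>"]\<close>)
  have N: "sgrp N" "N \<subseteq> H0" "normalizes H0 N" using nilchain_sgrp[OF ch H0(1)] by auto
  have trH: "tr x \<in> H0" if "x \<in> carrier B" for x using that H0(2) by blast
  show nor: "normal N0 B"
    unfolding B.normal_inv_iff N0_def
    using sub[OF N(1)] N(3) trH unfolding normalizes_def by (auto simp: tr tr_inv)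
  interpret N0: normal N0 B by (rule nor)
  let ?Q = "B Mod N0"
  define \<pi> where "\<pi> x = N0 #> x" for x
  interpret Q: group ?Q by (rule N0.factorgroup_is_group)
  have "\<pi> \<in> hom B ?Q" unfolding \<pi>_def by (rule N0.r_coset_hom_Mod)
  then interpret P: group_hom B ?Q \<pi> by unfold_locales
  have car: "carrier ?Q = \<pi> ` carrier B" by (auto simp: FactGroup_def RCOSETS_def \<pi>_def)
  have ker: "\<pi> x = \<one>\<^bsub>?Q\<^esub>" if "x \<in> N0" for x
    using that N0.rcos_const[OF B, of x] by (simp add: \<pi>_def FactGroup_def)
  define S where "S = \<pi> ` {x \<in> carrier B. tr x \<in> T}"
  have Sfin: "finite S"
  proof -
    have "finite {x \<in> carrier B. tr x \<in> T}"
    proof (rule finite_imageD)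
      show "finite (tr ` {x \<in> carrier B. tr x \<in> T})" by (rule finite_subset[OF _ T(1)]) auto
      show "inj_on tr {x \<in> carrier B. tr x \<in> T}" by (rule inj_on_subset[OF inj]) auto
    qed
    then show ?thesis by (simp add: S_def)
  qed
  have Scar: "S \<subseteq> carrier ?Q" unfolding S_def car by auto
  interpret GS: subgroup "generate ?Q S" ?Q by (rule Q.generate_is_subgroup[OF Scar])
  have seed: "\<pi> y \<in> generate ?Q S" if "y \<in> carrier B" "tr y \<in> T \<union> N" for y
  proof (cases "tr y \<in> T")
    case True
    then show ?thesis using that by (intro generate.incl) (auto simp: S_def)
  next
    case False
    then have "y \<in> N0" using that unfolding N0_def by blast
    then show ?thesis by (simp only: ker GS.one_closed)
  qed
  have pre: "\<exists>y\<in>carrier B. s = tr y" if "s \<in> T \<union> N" for s using that T(2) N(2) H0(2) by blast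
  have "\<forall>x\<in>carrier B. tr x = g \<longrightarrow> \<pi> x \<in> generate ?Q S" if "g \<in> gen (T \<union> N)" for g
    using that
  proof (induction rule: gen.induct)
    case gen_one
    show ?case
    proof (intro ballI impI)
      fix x assume x: "x \<in> carrier B" "tr x = 1"
      have "tr x \<in> N" unfolding x(2) by (rule sgrp_one[OF N(1)])
      then have "x \<in> N0" using x(1) unfolding N0_def by blast
      then show "\<pi> x \<in> generate ?Q S" by (simp only: ker GS.one_closed)
    qed
  next
    case (gen_step g s)
    show ?case
    proof (intro ballI impI)
      fix x assume x: "x \<in> carrier B" "tr x = g * s"
      obtain y where y: "y \<in> carrier B" "s = tr y" using pre[OF gen_step(2)] by blast
      have "tr (x \<otimes> inv y) = g" using x y by (simp add: tr tr_inv mult.assoc)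
      then have "\<pi> (x \<otimes> inv y) \<in> generate ?Q S" using gen_step(3) B.m_closed[OF x(1) B.inv_closed[OF y(1)]] by blast
      moreover have "\<pi> y \<in> generate ?Q S" using seed y gen_step(2) by blast
      ultimately have "\<pi> (x \<otimes> inv y) \<otimes>\<^bsub>?Q\<^esub> \<pi> y \<in> generate ?Q S" by (rule GS.m_closed)
      moreover have eq: "x \<otimes> inv y \<otimes> y = x" using x y by (simp add: B.m_assoc)
      ultimately show "\<pi> x \<in> generate ?Q S"
        using P.hom_mult[OF B.m_closed[OF x(1) B.inv_closed[OF y(1)]] y(1)] unfolding eq by metis
    qed
  next
    case (gen_step_inv g s)
    show ?case
    proof (intro ballI impI)
      fix x assume x: "x \<in> carrier B" "tr x = g * inverse s"
      obtain y where y: "y \<in> carrier B" "s = tr y" using pre[OF gen_step_inv(2)] by blast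
      have "tr (x \<otimes> y) = g" using x y by (simp add: tr mult.assoc)
      then have "\<pi> (x \<otimes> y) \<in> generate ?Q S" using gen_step_inv(3) B.m_closed[OF x(1) y(1)] by blast
      moreover have "inv\<^bsub>?Q\<^esub> \<pi> y \<in> generate ?Q S" using seed y gen_step_inv(2) by (intro GS.m_inv_closed) blast
      ultimately have "\<pi> (x \<otimes> y) \<otimes>\<^bsub>?Q\<^esub> inv\<^bsub>?Q\<^esub> \<pi> y \<in> generate ?Q S" by (rule GS.m_closed)
      moreover have eq: "x \<otimes> y \<otimes> inv y = x" using x y by (simp add: B.m_assoc)
      ultimately show "\<pi> x \<in> generate ?Q S"
        using P.hom_mult[OF B.m_closed[OF x(1) y(1)] B.inv_closed[OF y(1)]] unfolding eq P.hom_inv[OF y(1)] by metis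
    qed
  qed
  then have "carrier ?Q \<subseteq> generate ?Q S" unfolding car using trH T(3) by blast
  then have "generate ?Q S = carrier ?Q" using GS.subset by blast
  then show "finitely_generated_group ?Q"
    unfolding finitely_generated_group_def using Q.group_axioms Sfin Scar by blast
  have lc: "\<exists>n. lower_central ?Q n \<subseteq> \<pi> ` {x \<in> carrier B. tr x \<in> L}" if "nilchain H0 L" for L
    using that
  proof (induction rule: nilchain.induct)
    case base
    have "lower_central ?Q 0 \<subseteq> \<pi> ` {x \<in> carrier B. tr x \<in> H0}" using trH by (auto simp: car)
    then show ?case by blast
  next
    case (step M \<theta>)
    obtain n where n: "lower_central ?Q n \<subseteq> \<pi> ` {x \<in> carrier B. tr x \<in> M}" using step by blast
    have M: "sgrp M" "normalizes H0 M" using nilchain_sgrp[OF step(1) H0(1)] by auto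
    let ?K = "{x \<in> carrier B. tr x \<in> {m \<in> M. \<theta> m = 0}}"
    have "subgroup (\<pi> ` ?K) ?Q" by (rule P.subgroup_img_is_subgroup[OF sub[OF sgrp_kernel[OF step(2) M(1)]]])
    moreover have "h \<otimes>\<^bsub>?Q\<^esub> g \<otimes>\<^bsub>?Q\<^esub> inv\<^bsub>?Q\<^esub> h \<otimes>\<^bsub>?Q\<^esub> inv\<^bsub>?Q\<^esub> g \<in> \<pi> ` ?K" if h: "h \<in> lower_central ?Q n" and g: "g \<in> carrier ?Q" for h g
    proof -
      obtain x where x: "x \<in> carrier B" "tr x \<in> M" "h = \<pi> x" using h n by blast
      obtain y where y: "y \<in> carrier B" "g = \<pi> y" using g car by blast
      have eq: "h \<otimes>\<^bsub>?Q\<^esub> g \<otimes>\<^bsub>?Q\<^esub> inv\<^bsub>?Q\<^esub> h \<otimes>\<^bsub>?Q\<^esub> inv\<^bsub>?Q\<^esub> g = \<pi> (x \<otimes> y \<otimes> inv x \<otimes> inv y)" using x y by simp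
      have "tr (x \<otimes> y \<otimes> inv x \<otimes> inv y) = tr x * (tr y * inverse (tr x) * inverse (tr y))"
        using x y by (simp add: tr tr_inv mult.assoc)
      moreover have "tr y * inverse (tr x) * inverse (tr y) \<in> M"
        using M(2) trH[OF y(1)] sgrp_inv[OF M(1) x(2)] unfolding normalizes_def by blast
      moreover have "\<theta> (tr y * inverse (tr x) * inverse (tr y)) = - \<theta> (tr x)"
        using step(3)[OF trH[OF y(1)] sgrp_inv[OF M(1) x(2)]] add_hom_inv[OF step(2) M(1) x(2)] by simp
      ultimately have "x \<otimes> y \<otimes> inv x \<otimes> inv y \<in> ?K"
        using x y sgrp_mult[OF M(1) x(2)] add_hom_mult[OF step(2) x(2)] by auto
      then show ?thesis unfolding eq by (rule imageI)
    qed
    ultimately have "lower_central ?Q (Suc n) \<subseteq> \<pi> ` ?K"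
      unfolding lower_central.simps by (intro Q.generate_subgroup_incl) auto
    then show ?case by blast
  qed
  then obtain n where "lower_central ?Q n \<subseteq> \<pi> ` N0" using ch unfolding N0_def by blast
  then have "lower_central ?Q n \<subseteq> {\<one>\<^bsub>?Q\<^esub>}" using ker by blast
  moreover have "\<one>\<^bsub>?Q\<^esub> \<in> lower_central ?Q n"
    by (cases n) (simp_all add: generate.one del: one_FactGroup)
  ultimately show "nilpotent_group ?Q" unfolding nilpotent_group_def using Q.group_axioms by blast
qed

end

section \<open>The metric on compact open subgroups\<close>

lemma card_image_eq:
  assumes "h ` A = B" "\<And>a a'. a \<in> A \<Longrightarrow> a' \<in> A \<Longrightarrow> f a = f a' \<longleftrightarrow> g (h a) = g (h a')"
  shows "card (f ` A) = card (g ` B)"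
proof (rule bij_betw_same_card[of "\<lambda>y. g (h (inv_into A f y))"])
  have inv: "inv_into A f (f a) \<in> A" "f (inv_into A f (f a)) = f a" if "a \<in> A" for a
    using that by (auto intro: inv_into_into f_inv_into_f)
  have eq: "g (h (inv_into A f (f a))) = g (h a)" if "a \<in> A" for a
    using assms(2)[OF inv(1)[OF that] that] inv(2)[OF that] by blast
  show "bij_betw (\<lambda>y. g (h (inv_into A f y))) (f ` A) (g ` B)"
    unfolding bij_betw_def
  proof
    show "inj_on (\<lambda>y. g (h (inv_into A f y))) (f ` A)"
    proof (rule inj_onI, elim imageE)
      fix x y a a' assume "g (h (inv_into A f x)) = g (h (inv_into A f y))" "x = f a" "a \<in> A" "y = f a'" "a' \<in> A"
      then show "x = y" using eq[of a] eq[of a'] assms(2)[of a a'] by simp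
    qed
    show "(\<lambda>y. g (h (inv_into A f y))) ` f ` A = g ` B"
      unfolding assms(1)[symmetric] image_image using eq by (intro image_cong) auto
  qed
qed

section \<open>Indices as numbers of cosets\<close>

context group
begin

lemma rcos_eq_iff:
  assumes "subgroup W G" "a \<in> carrier G" "b \<in> carrier G"
  shows "W #> a = W #> b \<longleftrightarrow> b \<otimes> inv a \<in> W"
proof
  assume "W #> a = W #> b"
  then have "b \<in> W #> a" using rcos_self[OF assms(3,1)] by simp
  then obtain w where "w \<in> W" "b = w \<otimes> a" by (auto simp: r_coset_def)
  moreover from this have "w \<in> carrier G" using subgroup.subset[OF assms(1)] by blast
  ultimately show "b \<otimes> inv a \<in> W" using assms by (simp add: m_assoc)
next
  assume "b \<otimes> inv a \<in> W"
  moreover have "b = (b \<otimes> inv a) \<otimes> a" using assms by (simp add: m_assoc)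
  ultimately have "b \<in> W #> a" by (auto simp: r_coset_def)
  then show "W #> a = W #> b" using repr_independence assms by blast
qed

text \<open>The index of \<open>V \<inter> W\<close> in \<open>V\<close>, as the number of right
  cosets of \<open>W\<close> that meet \<open>V\<close> (\<open>sg_index_eq\<close>). Without the
  intersection, the triangle inequality and the invariance under automorphisms become statements
  about cosets.\<close>

definition idx :: "'a set \<Rightarrow> 'a set \<Rightarrow> nat" where "idx V W = card ((\<lambda>a. W #> a) ` V)"

lemma sg_index_eq:
  assumes V: "subgroup V G" and W: "subgroup W G" shows "sg_index G V W = idx V W"
proof -
  have Vc: "V \<subseteq> carrier G" by (rule subgroup.subset[OF V])
  have "rcosets\<^bsub>G\<lparr>carrier := V\<rparr>\<^esub> (V \<inter> W) = (\<lambda>a. (V \<inter> W) #> a) ` V"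
    by (auto simp: RCOSETS_def r_coset_def)
  moreover have "card ((\<lambda>a. (V \<inter> W) #> a) ` V) = card ((\<lambda>a. W #> a) ` V)"
  proof (rule card_image_eq[of id])
    fix a a' assume a: "a \<in> V" "a' \<in> V"
    have "a' \<otimes> inv a \<in> V" using a subgroup.m_closed[OF V] subgroup.m_inv_closed[OF V] by blast
    then show "(V \<inter> W) #> a = (V \<inter> W) #> a' \<longleftrightarrow> W #> id a = W #> id a'"
      using rcos_eq_iff[OF subgroups_Inter_pair[OF V W], of a a'] rcos_eq_iff[OF W, of a a'] a Vc by auto
  qed simp
  ultimately show ?thesis by (simp add: sg_index_def idx_def)
qed

text \<open>Modulo \<open>W\<close>, an element \<open>a\<close> of \<open>V\<close> is determined
  by its coset of \<open>Y\<close> and by the \<open>W\<close>-coset of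
  \<open>a \<otimes> inv r a \<in> Y\<close>, where \<open>r a\<close> is the chosen representative
  of the former.\<close>

lemma idx_triangle:
  assumes V: "subgroup V G" and Y: "subgroup Y G" and W: "subgroup W G"
    and fin: "finite ((\<lambda>a. Y #> a) ` V)" "finite ((\<lambda>a. W #> a) ` Y)"
  shows "idx V W \<le> idx V Y * idx Y W"
proof -
  have c: "V \<subseteq> carrier G" "Y \<subseteq> carrier G" using V Y subgroup.subset by blast+
  define r where "r a = inv_into V (\<lambda>a. Y #> a) (Y #> a)" for a
  have r: "r a \<in> V" "Y #> r a = Y #> a" if "a \<in> V" for a
    unfolding r_def using that inv_into_into[of "Y #> a" "\<lambda>a. Y #> a" V] f_inv_into_f[of "Y #> a" "\<lambda>a. Y #> a" V]
    by simp_all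
  have rX: "a \<otimes> inv r a \<in> Y" if "a \<in> V" for a
    using rcos_eq_iff[OF Y, of "r a" a] r[OF that] c that by blast
  let ?f = "\<lambda>a. (Y #> a, W #> (a \<otimes> inv r a))"
  have "card ((\<lambda>a. W #> a) ` V) \<le> card (?f ` V)"
  proof -
    have eq: "(\<lambda>a. W #> a) ` V = (\<lambda>y. W #> inv_into V ?f y) ` ?f ` V"
      unfolding image_image
    proof (rule image_cong[OF refl])
      fix a assume a: "a \<in> V"
      define a' where "a' = inv_into V ?f (?f a)"
      have mem: "?f a \<in> ?f ` V" using a by (rule imageI)
      have a'V: "a' \<in> V" unfolding a'_def by (rule inv_into_into[OF mem])
      have "?f a' = ?f a" unfolding a'_def by (rule f_inv_into_f[OF mem])
      note a' = a'V this
      have req: "r a' = r a" using a'(2) by (simp add: r_def)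
      have ac: "a \<in> carrier G" "a' \<in> carrier G" "r a \<in> carrier G" using a a' r c by auto
      have "W #> (a \<otimes> inv r a) = W #> (a' \<otimes> inv r a)" using a'(2) req by simp
      then have "a' \<otimes> inv r a \<otimes> inv (a \<otimes> inv r a) \<in> W" using rcos_eq_iff[OF W, of "a \<otimes> inv r a" "a' \<otimes> inv r a"] ac by simp
      moreover have "a' \<otimes> inv r a \<otimes> inv (a \<otimes> inv r a) = a' \<otimes> inv a"
        using ac by (simp add: inv_mult_group m_assoc inv_solve_left) (simp flip: m_assoc)
      ultimately show "W #> a = W #> inv_into V ?f (?f a)" using rcos_eq_iff[OF W ac(1,2)] by (simp add: a'_def)
    qed
    have finf: "finite (?f ` V)"
      by (rule finite_subset[of _ "((\<lambda>a. Y #> a) ` V) \<times> ((\<lambda>a. W #> a) ` Y)"]) (use fin rX in auto)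
    show ?thesis unfolding eq by (rule card_image_le[OF finf])
  qed
  also have "\<dots> \<le> card (((\<lambda>a. Y #> a) ` V) \<times> ((\<lambda>a. W #> a) ` Y))"
    by (rule card_mono) (use fin rX in auto)
  finally show ?thesis by (simp add: idx_def card_cartesian_product)
qed

lemma idx_self: "subgroup V G \<Longrightarrow> idx V V = 1"
proof -
  assume V: "subgroup V G"
  then have "(\<lambda>a. V #> a) ` V = {V}"
    using coset_join2[OF _ V] subgroup.subset[OF V] subgroup.one_closed[OF V] by auto
  then show ?thesis by (simp add: idx_def)
qed

end

section \<open>The isometric action on compact open subgroups\<close>

locale tgroup =
  fixes G :: "('a, 'b) monoid_scheme" (structure) and T :: "'a topology"
  assumes tg: "topological_group G T"

sublocale tgroup \<subseteq> group G
  using tg by (simp add: topological_group_def)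

context tgroup
begin

abbreviation "cosubs \<equiv> compact_open_subgroups G T"

lemma topspace_eq: "topspace T = carrier G"
  using tg by (simp add: topological_group_def)

lemma cosD: "V \<in> cosubs \<Longrightarrow> subgroup V G" "V \<in> cosubs \<Longrightarrow> compactin T V" "V \<in> cosubs \<Longrightarrow> openin T V"
  by (auto simp: compact_open_subgroups_def)

lemma right_mult_continuous:
  assumes "c \<in> carrier G" shows "continuous_map T T (\<lambda>x. x \<otimes> c)"
proof -
  have "continuous_map T (prod_topology T T) (\<lambda>x. (x, c))"
    using assms by (intro continuous_map_pairedI) (auto simp: topspace_eq)
  then have "continuous_map T T ((\<lambda>(x, y). x \<otimes> y) \<circ> (\<lambda>x. (x, c)))"
    by (rule continuous_map_compose) (use tg in \<open>simp add: topological_group_def\<close>)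
  then show ?thesis by (simp add: o_def)
qed

lemma open_rcos:
  assumes W: "subgroup W G" "openin T W" and a: "a \<in> carrier G"
  shows "openin T (W #> a)"
proof -
  have "openin T {x \<in> topspace T. x \<otimes> inv a \<in> W}"
    by (rule openin_continuous_map_preimage[OF right_mult_continuous W(2)]) (use a in simp)
  moreover have "{x \<in> topspace T. x \<otimes> inv a \<in> W} = W #> a"
  proof
    show "{x \<in> topspace T. x \<otimes> inv a \<in> W} \<subseteq> W #> a"
    proof
      fix x assume x: "x \<in> {x \<in> topspace T. x \<otimes> inv a \<in> W}"
      then have "x = (x \<otimes> inv a) \<otimes> a" using a by (simp add: topspace_eq m_assoc)
      then show "x \<in> W #> a" using x by (auto simp: r_coset_def)
    qed
    show "W #> a \<subseteq> {x \<in> topspace T. x \<otimes> inv a \<in> W}"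
      using a subgroup.subset[OF W(1)] by (auto simp: r_coset_def topspace_eq m_assoc)
  qed
  ultimately show ?thesis by simp
qed

text \<open>The cosets of the open subgroup \<open>W\<close> are open and disjoint, so the compact
  set \<open>V\<close> meets finitely many of them.\<close>

lemma finite_rcos:
  assumes V: "V \<in> cosubs" and W: "W \<in> cosubs" shows "finite ((\<lambda>a. W #> a) ` V)"
proof -
  have Vc: "V \<subseteq> carrier G" using subgroup.subset[OF cosD(1)[OF V]] .
  note Ws = cosD(1)[OF W]
  have "V \<subseteq> \<Union> ((\<lambda>a. W #> a) ` V)" using rcos_self[OF _ Ws] Vc by blast
  moreover have "\<And>Y. Y \<in> (\<lambda>a. W #> a) ` V \<Longrightarrow> openin T Y" using open_rcos[OF Ws cosD(3)[OF W]] Vc by blast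
  ultimately obtain F where F: "finite F" "F \<subseteq> (\<lambda>a. W #> a) ` V" "V \<subseteq> \<Union> F"
    using cosD(2)[OF V] unfolding compactin_def by meson
  have "(\<lambda>a. W #> a) ` V \<subseteq> F"
  proof (rule image_subsetI)
    fix a assume a: "a \<in> V"
    then obtain f where f: "f \<in> F" "a \<in> f" using F(3) by blast
    obtain c where c: "c \<in> V" "f = W #> c" using F(2) f(1) by blast
    have "W #> c = W #> a" by (rule repr_independence) (use f c Vc Ws in auto)
    then show "W #> a \<in> F" using f c by simp
  qed
  then show ?thesis using F(1) finite_subset by blast
qed

lemma idx_pos: "V \<in> cosubs \<Longrightarrow> W \<in> cosubs \<Longrightarrow> idx V W > 0"
  using finite_rcos[of V W] subgroup.one_closed[OF cosD(1)[of V]] by (auto simp: idx_def card_gt_0_iff)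

lemma cos_dist_eq: "V \<in> cosubs \<Longrightarrow> W \<in> cosubs \<Longrightarrow> cos_dist G V W = ln (real (idx V W)) + ln (real (idx W V))"
  using idx_pos[of V W] idx_pos[of W V] cosD(1) by (simp add: cos_dist_def sg_index_eq ln_mult)

lemma cos_dist_sym: "cos_dist G V W = cos_dist G W V"
  by (simp add: cos_dist_def mult.commute)

lemma cos_dist_self: "V \<in> cosubs \<Longrightarrow> cos_dist G V V = 0"
  by (simp add: cos_dist_eq idx_self cosD(1))

lemma cos_dist_triangle:
  assumes "V \<in> cosubs" "Y \<in> cosubs" "W \<in> cosubs"
  shows "cos_dist G V W \<le> cos_dist G V Y + cos_dist G Y W"
proof -
  have "ln (real (idx V W)) \<le> ln (real (idx V Y)) + ln (real (idx Y W))" if "V \<in> cosubs" "Y \<in> cosubs" "W \<in> cosubs" for V Y W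
  proof -
    have "idx V W \<le> idx V Y * idx Y W" by (rule idx_triangle) (use that cosD(1) finite_rcos in auto)
    then have "real (idx V W) \<le> real (idx V Y) * real (idx Y W)" by (metis of_nat_le_iff of_nat_mult)
    then have "ln (real (idx V W)) \<le> ln (real (idx V Y) * real (idx Y W))"
      using idx_pos[of V W] that by simp
    then show ?thesis using idx_pos that by (simp add: ln_mult)
  qed
  from this[of V Y W] this[of W Y V] show ?thesis using assms by (simp add: cos_dist_eq)
qed

lemma top_auto_hom: "\<phi> \<in> top_auto G T \<Longrightarrow> group_hom G G \<phi>"
  by unfold_locales (simp add: top_auto_def auto_def)

lemma top_auto_bij: "\<phi> \<in> top_auto G T \<Longrightarrow> bij_betw \<phi> (carrier G) (carrier G)"
  by (simp add: top_auto_def auto_def Bij_def)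

lemma top_auto_cos:
  assumes p: "\<phi> \<in> top_auto G T" and V: "V \<in> cosubs" shows "\<phi> ` V \<in> cosubs"
proof -
  interpret group_hom G G \<phi> by (rule top_auto_hom[OF p])
  have hm: "homeomorphic_map T T \<phi>" using p by (simp add: top_auto_def)
  have "subgroup (\<phi> ` V) G" by (rule subgroup_img_is_subgroup[OF cosD(1)[OF V]])
  moreover have "compactin T (\<phi> ` V)"
    by (rule image_compactin[OF cosD(2)[OF V] homeomorphic_imp_continuous_map[OF hm]])
  moreover have "openin T (\<phi> ` V)"
    using homeomorphic_imp_open_map[OF hm] cosD(3)[OF V] by (simp add: open_map_def)
  ultimately show ?thesis by (simp add: compact_open_subgroups_def)
qed

lemma idx_image:
  assumes p: "\<phi> \<in> top_auto G T" and V: "subgroup V G" and W: "subgroup W G"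
  shows "idx (\<phi> ` V) (\<phi> ` W) = idx V W"
proof -
  interpret group_hom G G \<phi> by (rule top_auto_hom[OF p])
  have c: "V \<subseteq> carrier G" "W \<subseteq> carrier G" using V W subgroup.subset by blast+
  have inj: "inj_on \<phi> (carrier G)" using top_auto_bij[OF p] by (simp add: bij_betw_def)
  show ?thesis unfolding idx_def
  proof (rule card_image_eq[of \<phi>, symmetric])
    fix a a' assume a: "a \<in> V" "a' \<in> V"
    then have ac: "a \<in> carrier G" "a' \<in> carrier G" using c by auto
    have "\<phi> (a' \<otimes> inv a) \<in> \<phi> ` W \<longleftrightarrow> a' \<otimes> inv a \<in> W" by (rule inj_on_image_mem_iff[OF inj]) (use ac c in auto)
    then show "W #> a = W #> a' \<longleftrightarrow> \<phi> ` W #> \<phi> a = \<phi> ` W #> \<phi> a'"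
      using rcos_eq_iff[OF W ac] rcos_eq_iff[OF subgroup_img_is_subgroup[OF W], of "\<phi> a" "\<phi> a'"] ac by simp
  qed simp
qed

lemma cos_dist_image:
  assumes "\<phi> \<in> top_auto G T" "V \<in> cosubs" "W \<in> cosubs" shows "cos_dist G (\<phi> ` V) (\<phi> ` W) = cos_dist G V W"
  using assms by (simp add: cos_dist_eq top_auto_cos idx_image cosD(1))

text \<open>The space need not be Hausdorff, but an open subgroup is closed since its cosets are open.\<close>

lemma Inter_cos:
  assumes F: "finite F" "F \<noteq> {}" "F \<subseteq> cosubs" shows "\<Inter> F \<in> cosubs"
proof -
  obtain U where U: "U \<in> F" using F(2) by blast
  have sg: "subgroup (\<Inter> F) G" by (rule subgroups_Inter) (use F cosD(1) in auto)
  have op: "openin T (\<Inter> F)" by (rule openin_Inter) (use F cosD(3) in auto)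
  define O' where "O' = (\<Union>a\<in>U - \<Inter> F. \<Inter> F #> a)"
  have Uc: "U \<subseteq> carrier G" using U F(3) cosD(1) subgroup.subset by blast
  have "openin T O'" unfolding O'_def using open_rcos[OF sg op] Uc by blast
  then have "closedin T (topspace T - O')" by blast
  moreover have "compactin T U" using U F(3) cosD(2) by blast
  ultimately have "compactin T ((topspace T - O') \<inter> U)" by (rule closed_Int_compactin)
  moreover have "(topspace T - O') \<inter> U = \<Inter> F"
  proof
    show "(topspace T - O') \<inter> U \<subseteq> \<Inter> F"
    proof
      fix x assume x: "x \<in> (topspace T - O') \<inter> U"
      then have "x \<in> \<Inter> F #> x" using rcos_self[OF _ sg, of x] by (simp add: topspace_eq)
      then show "x \<in> \<Inter> F" using x unfolding O'_def by blast
    qed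
    show "\<Inter> F \<subseteq> (topspace T - O') \<inter> U"
    proof
      fix x assume x: "x \<in> \<Inter> F"
      have "x \<notin> O'"
      proof
        assume "x \<in> O'"
        then obtain a where a: "a \<in> U" "a \<notin> \<Inter> F" "x \<in> \<Inter> F #> a" unfolding O'_def by blast
        have ac: "a \<in> carrier G" using a Uc by blast
        have "\<Inter> F #> a = \<Inter> F #> x" by (rule repr_independence[OF a(3) ac sg])
        also have "\<dots> = \<Inter> F" using coset_join2[OF _ sg x] x subgroup.subset[OF sg] by blast
        finally show False using rcos_self[OF ac sg] a(2) by blast
      qed
      then show "x \<in> (topspace T - O') \<inter> U" using x U Uc by (auto simp: topspace_eq)
    qed
  qed
  ultimately show ?thesis using sg op by (simp add: compact_open_subgroups_def)
qed

end

section \<open>Groups of automorphisms\<close>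

text \<open>Automorphisms are extensional functions on the carrier of \<open>G\<close>; extended by the identity they become
  elements of a type of class \<open>grp\<close>.\<close>

typedef 'a bijn = "{f :: 'a \<Rightarrow> 'a. bij f}" morphisms bapp Bijn
  by (rule exI[of _ id]) simp

lemma bij_bapp: "bij (bapp p)"
  using bapp[of p] by simp

instantiation bijn :: (type) grp
begin

definition one_bijn :: "'a bijn" where "one_bijn = Bijn id"
definition times_bijn :: "'a bijn \<Rightarrow> 'a bijn \<Rightarrow> 'a bijn" where "times_bijn p q = Bijn (bapp p \<circ> bapp q)"
definition inverse_bijn :: "'a bijn \<Rightarrow> 'a bijn" where "inverse_bijn p = Bijn (inv_into UNIV (bapp p))"
definition divide_bijn :: "'a bijn \<Rightarrow> 'a bijn \<Rightarrow> 'a bijn" where "divide_bijn p q = p * inverse q"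

lemma bapp_ops: "bapp 1 = id" "bapp (p * q) = bapp p \<circ> bapp q" "bapp (inverse p) = inv_into UNIV (bapp p)"
  by (simp_all add: one_bijn_def times_bijn_def inverse_bijn_def Bijn_inverse bij_comp bij_bapp bij_imp_bij_inv)

instance
proof
  fix a b c :: "'a bijn"
  show "a * b * c = a * (b * c)" unfolding bapp_inject[symmetric] bapp_ops by (rule comp_assoc)
  show "1 * a = a" unfolding bapp_inject[symmetric] bapp_ops by simp
  show "a * 1 = a" unfolding bapp_inject[symmetric] bapp_ops by simp
  show "inverse a * a = 1" unfolding bapp_inject[symmetric] bapp_ops by (simp add: bij_bapp bij_is_inj)
qed

end

lemma bapp_mult: "bapp (p * q) x = bapp p (bapp q x)"
  by (simp add: bapp_ops)

lemma bapp_one: "bapp 1 x = x"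
  by (simp add: bapp_ops)

section \<open>Automorphisms as bijections of the whole type\<close>

context tgroup
begin

lemma top_auto_subgroup: "subgroup (top_auto G T) (BijGroup (carrier G))"
proof -
  interpret K: group "BijGroup (carrier G)" by (rule group_BijGroup)
  note A = subgroup_auto
  have Bij: "\<phi> \<in> Bij (carrier G)" if "\<phi> \<in> auto G" for \<phi> using that by (simp add: auto_def)
  show ?thesis
  proof (rule K.subgroupI)
    show "top_auto G T \<subseteq> carrier (BijGroup (carrier G))" using subgroup.subset[OF A] by (auto simp: top_auto_def)
    have "homeomorphic_map T T (\<lambda>x\<in>carrier G. x)"
      by (rule homeomorphic_map_eq[of _ _ id]) (simp_all add: topspace_eq)
    then have "(\<lambda>x\<in>carrier G. x) \<in> top_auto G T" using id_in_auto by (simp add: top_auto_def)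
    then show "top_auto G T \<noteq> {}" by blast
    fix \<phi> assume p: "\<phi> \<in> top_auto G T"
    then have pa: "\<phi> \<in> auto G" and hm: "homeomorphic_map T T \<phi>" by (auto simp: top_auto_def)
    obtain g where g: "homeomorphic_maps T T \<phi> g" using hm by (auto simp: homeomorphic_map_maps)
    have inj: "inj_on \<phi> (carrier G)" using top_auto_bij[OF p] by (simp add: bij_betw_def)
    have "homeomorphic_map T T (\<lambda>x\<in>carrier G. inv_into (carrier G) \<phi> x)"
    proof (rule homeomorphic_map_eq)
      show "homeomorphic_map T T g" using iffD1[OF homeomorphic_maps_sym g] unfolding homeomorphic_map_maps by blast
      fix x assume x: "x \<in> topspace T"
      then have gx: "\<phi> (g x) = x" "g x \<in> carrier G"
        using g by (auto simp: homeomorphic_maps_def continuous_map_def topspace_eq)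
      have "inv_into (carrier G) \<phi> (\<phi> (g x)) = g x" by (rule inv_into_f_f[OF inj gx(2)])
      then show "g x = (\<lambda>x\<in>carrier G. inv_into (carrier G) \<phi> x) x" using x gx(1) by (simp add: topspace_eq)
    qed
    then show "inv\<^bsub>BijGroup (carrier G)\<^esub> \<phi> \<in> top_auto G T"
      using subgroup.m_inv_closed[OF A pa] by (simp add: top_auto_def inv_BijGroup[OF Bij[OF pa]] del: restrict_apply)
    fix \<psi> assume q: "\<psi> \<in> top_auto G T"
    then have qa: "\<psi> \<in> auto G" and hm': "homeomorphic_map T T \<psi>" by (auto simp: top_auto_def)
    have "homeomorphic_map T T (compose (carrier G) \<phi> \<psi>)"
      by (rule homeomorphic_map_eq[OF homeomorphic_map_compose[OF hm' hm]]) (simp add: topspace_eq compose_def)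
    then show "\<phi> \<otimes>\<^bsub>BijGroup (carrier G)\<^esub> \<psi> \<in> top_auto G T"
      using subgroup.m_closed[OF A pa qa] Bij[OF pa] Bij[OF qa] by (simp add: top_auto_def BijGroup_def)
  qed
qed

lemma TopAutGroup_group: "group (TopAutGroup G T)"
  unfolding TopAutGroup_def by (rule subgroup.subgroup_is_group[OF top_auto_subgroup group_BijGroup])

lemma TopAutGroup_carrier: "carrier (TopAutGroup G T) = top_auto G T"
  by (simp add: TopAutGroup_def)

lemma TopAutGroup_mult: "\<phi> \<in> top_auto G T \<Longrightarrow> \<psi> \<in> top_auto G T \<Longrightarrow> \<phi> \<otimes>\<^bsub>TopAutGroup G T\<^esub> \<psi> = compose (carrier G) \<phi> \<psi>"
  by (simp add: TopAutGroup_def BijGroup_def top_auto_def auto_def)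

definition ext :: "('a \<Rightarrow> 'a) \<Rightarrow> 'a bijn" where
  "ext \<phi> = Bijn (\<lambda>x. if x \<in> carrier G then \<phi> x else x)"

lemma bapp_ext:
  assumes "\<phi> \<in> top_auto G T" shows "bapp (ext \<phi>) = (\<lambda>x. if x \<in> carrier G then \<phi> x else x)"
proof -
  have b: "bij_betw \<phi> (carrier G) (carrier G)" by (rule top_auto_bij[OF assms])
  have "bij_betw (\<lambda>x. if x \<in> carrier G then \<phi> x else x) (carrier G \<union> - carrier G) (carrier G \<union> - carrier G)"
  proof (rule bij_betw_combine)
    show "bij_betw (\<lambda>x. if x \<in> carrier G then \<phi> x else x) (carrier G) (carrier G)"
      using b by (subst bij_betw_cong[of _ _ \<phi>]) auto
    show "bij_betw (\<lambda>x. if x \<in> carrier G then \<phi> x else x) (- carrier G) (- carrier G)"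
      by (subst bij_betw_cong[of _ _ "\<lambda>x. x"]) (auto simp: bij_betw_def)
  qed simp
  then have "bij (\<lambda>x. if x \<in> carrier G then \<phi> x else x)" by simp
  then show ?thesis unfolding ext_def by (subst Bijn_inverse) auto
qed

lemma ext_mult:
  assumes p: "\<phi> \<in> top_auto G T" and q: "\<psi> \<in> top_auto G T"
  shows "ext (\<phi> \<otimes>\<^bsub>TopAutGroup G T\<^esub> \<psi>) = ext \<phi> * ext \<psi>"
proof -
  interpret A: group "TopAutGroup G T" by (rule TopAutGroup_group)
  have pq: "\<phi> \<otimes>\<^bsub>TopAutGroup G T\<^esub> \<psi> \<in> top_auto G T" using A.m_closed p q by (simp add: TopAutGroup_carrier)
  have "\<psi> x \<in> carrier G" if "x \<in> carrier G" for x using top_auto_bij[OF q] that by (auto simp: bij_betw_def)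
  then have "bapp (ext (\<phi> \<otimes>\<^bsub>TopAutGroup G T\<^esub> \<psi>)) = bapp (ext \<phi> * ext \<psi>)"
    unfolding bapp_ops bapp_ext[OF pq] bapp_ext[OF p] bapp_ext[OF q]
    by (auto simp: fun_eq_iff TopAutGroup_mult[OF p q] compose_def)
  then show ?thesis by (simp only: bapp_inject)
qed

lemma ext_inj: "inj_on ext (top_auto G T)"
proof (rule inj_onI)
  fix \<phi> \<psi> assume p: "\<phi> \<in> top_auto G T" "\<psi> \<in> top_auto G T" "ext \<phi> = ext \<psi>"
  have e: "\<phi> \<in> extensional (carrier G)" "\<psi> \<in> extensional (carrier G)"
    using p by (auto simp: top_auto_def auto_def Bij_def)
  show "\<phi> = \<psi>"
  proof (rule extensionalityI[OF e])
    fix x assume x: "x \<in> carrier G"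
    have "bapp (ext \<phi>) x = bapp (ext \<psi>) x" by (simp only: p(3))
    then show "\<phi> x = \<psi> x" using x by (simp add: bapp_ext[OF p(1)] bapp_ext[OF p(2)])
  qed
qed

lemma ext_image: "\<phi> \<in> top_auto G T \<Longrightarrow> V \<subseteq> carrier G \<Longrightarrow> bapp (ext \<phi>) ` V = \<phi> ` V"
  by (auto simp: bapp_ext image_def)

end

theorem theorem3:
  fixes G :: "('a, 'b) monoid_scheme" and T :: "'a topology"
    and H :: "('a \<Rightarrow> 'a) set" and U :: "'a set"
  assumes "topological_group G T"
    and "totally_disconnected_space T"
    and "locally_compact_space T"
    and "subgroup H (TopAutGroup G T)"
    and "U \<in> compact_open_subgroups G T"
    and "orbit_proper G (orbit_of H U)"
    and "coarsely_connected G (orbit_of H U)"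
    and "polynomial_growth G (orbit_of H U)"
  shows "\<exists>H0 N0 V.
           subgroup H0 (TopAutGroup G T) \<and> H0 \<subseteq> H \<and>
           finite (rcosets\<^bsub>(TopAutGroup G T)\<lparr>carrier := H\<rparr>\<^esub> H0) \<and>
           normal N0 ((TopAutGroup G T)\<lparr>carrier := H0\<rparr>) \<and>
           V \<in> compact_open_subgroups G T \<and>
           (\<forall>\<phi> \<in> N0. \<phi> ` V = V) \<and>
           finitely_generated_group (((TopAutGroup G T)\<lparr>carrier := H0\<rparr>) Mod N0) \<and>
           nilpotent_group (((TopAutGroup G T)\<lparr>carrier := H0\<rparr>) Mod N0)"
proof -
  interpret tgroup G T by (rule tgroup.intro[OF assms(1)])
  let ?A = "TopAutGroup G T"
  interpret A: group ?A by (rule TopAutGroup_group)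
  interpret HA: subgroup H ?A by (rule assms(4))
  have HT: "\<phi> \<in> top_auto G T" if "\<phi> \<in> H" for \<phi> using HA.subset that TopAutGroup_carrier by blast
  note Ucos = assms(5)
  have Uc: "U \<subseteq> carrier G" using subgroup.subset[OF cosD(1)[OF Ucos]] .
  have ext_one: "ext \<one>\<^bsub>?A\<^esub> = 1"
    by (rule grp_hom_one_inv(1)[OF TopAutGroup_group]) (simp add: ext_mult TopAutGroup_carrier)
  have ext_inv: "ext (inv\<^bsub>?A\<^esub> \<phi>) = inverse (ext \<phi>)" if "\<phi> \<in> top_auto G T" for \<phi>
    by (rule grp_hom_one_inv(2)[OF TopAutGroup_group]) (use that in \<open>simp_all add: ext_mult TopAutGroup_carrier\<close>)
  define act where "act p Y = bapp p ` Y" for p :: "'a bijn" and Y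
  define H' where "H' = ext ` H"
  have H': "sgrp H'"
  proof (rule sgrpI)
    show "1 \<in> H'" unfolding H'_def by (rule image_eqI[of _ _ "\<one>\<^bsub>?A\<^esub>"]) (simp_all add: ext_one)
    show "g * h \<in> H'" if "g \<in> H'" "h \<in> H'" for g h
      using that HT unfolding H'_def by (auto simp: ext_mult[symmetric])
    show "inverse g \<in> H'" if "g \<in> H'" for g
      using that HT unfolding H'_def by (auto simp: ext_inv[symmetric])
  qed
  define len where "len p = cos_dist G U (act p U)" for p
  have act_one: "act 1 Y = Y" for Y by (simp add: act_def bapp_one)
  have act_mult: "act (p * q) Y = act p (act q Y)" for p q Y by (simp add: act_def image_image bapp_mult)
  have act_cos: "act p Y \<in> cosubs" if p: "p \<in> H'" and Y: "Y \<in> cosubs" for p Y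
  proof -
    obtain \<phi> where \<phi>: "\<phi> \<in> H" "p = ext \<phi>" using p by (auto simp: H'_def)
    have "act p Y = \<phi> ` Y"
      unfolding act_def \<phi>(2) by (rule ext_image[OF HT[OF \<phi>(1)] subgroup.subset[OF cosD(1)[OF that(2)]]])
    then show ?thesis using top_auto_cos[OF HT[OF \<phi>(1)] Y] by simp
  qed
  have act_dist: "cos_dist G (act p Y) (act p Z) = cos_dist G Y Z" if p: "p \<in> H'" and YZ: "Y \<in> cosubs" "Z \<in> cosubs" for p Y Z
  proof -
    obtain \<phi> where \<phi>: "\<phi> \<in> H" "p = ext \<phi>" using p by (auto simp: H'_def)
    have "act p V = \<phi> ` V" if "V \<in> cosubs" for V
      unfolding act_def \<phi>(2) by (rule ext_image[OF HT[OF \<phi>(1)] subgroup.subset[OF cosD(1)[OF that]]])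
    then show ?thesis using cos_dist_image[OF HT[OF \<phi>(1)] YZ] YZ by simp
  qed
  have orbit: "orbit_of H U = (\<lambda>p. act p U) ` H'"
  proof -
    have "\<phi> ` U = act (ext \<phi>) U" if "\<phi> \<in> H" for \<phi> unfolding act_def by (rule ext_image[OF HT[OF that] Uc, symmetric])
    then show ?thesis unfolding orbit_of_def H'_def by (auto simp: image_image)
  qed
  have ball: "{act p U | p. p \<in> H' \<and> len p \<le> r} = {y \<in> orbit_of H U. cos_dist G U y \<le> r}" for r
    unfolding orbit len_def by auto
  have Uorb: "U \<in> orbit_of H U" unfolding orbit using sgrp_one[OF H'] by (rule rev_image_eqI) (simp add: act_one)
  have ball_fin: "finite {y \<in> orbit_of H U. cos_dist G x y \<le> r}" if "x \<in> orbit_of H U" for x r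
    using assms(6) that unfolding orbit_proper_def by blast
  obtain x0 C D where x0: "x0 \<in> orbit_of H U"
    and growth: "\<And>r. r \<ge> 0 \<Longrightarrow> real (card {y \<in> orbit_of H U. cos_dist G x0 y \<le> r}) \<le> C * (1 + r) ^ D"
    using assms(8) unfolding polynomial_growth_def by blast
  \<comment> \<open>The growth hypothesis is centred at \<open>x0\<close>; a group element moving
    \<open>U\<close> to \<open>x0\<close> maps balls around \<open>U\<close> injectively into balls
    around \<open>x0\<close>.\<close>
  have ball_card: "real (card {y \<in> orbit_of H U. cos_dist G U y \<le> r}) \<le> C * (1 + r) ^ D" if r: "r \<ge> 0" for r
  proof -
    obtain p where p: "p \<in> H'" "x0 = act p U" using x0 unfolding orbit by blast
    have "card {y \<in> orbit_of H U. cos_dist G U y \<le> r} \<le> card {y \<in> orbit_of H U. cos_dist G x0 y \<le> r}"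
    proof (rule card_inj_on_le)
      show "inj_on (act p) {y \<in> orbit_of H U. cos_dist G U y \<le> r}"
      proof (rule inj_onI)
        fix x y assume "act p x = act p y"
        then have "act (inverse p * p) x = act (inverse p * p) y" by (simp only: act_mult)
        then show "x = y" by (simp add: act_one)
      qed
      show "act p ` {y \<in> orbit_of H U. cos_dist G U y \<le> r} \<subseteq> {y \<in> orbit_of H U. cos_dist G x0 y \<le> r}"
      proof (rule image_subsetI)
        fix y assume y: "y \<in> {y \<in> orbit_of H U. cos_dist G U y \<le> r}"
        then obtain q where q: "q \<in> H'" "y = act q U" unfolding orbit by blast
        have "act p y = act (p * q) U" by (simp add: q act_mult)
        then have "act p y \<in> orbit_of H U" unfolding orbit using sgrp_mult[OF H' p(1) q(1)] by blast
        then show "act p y \<in> {y \<in> orbit_of H U. cos_dist G x0 y \<le> r}"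
          using y act_dist[OF p(1) Ucos act_cos[OF q(1) Ucos]] p(2) q(2) by simp
      qed
      show "finite {y \<in> orbit_of H U. cos_dist G x0 y \<le> r}" by (rule ball_fin[OF x0])
    qed
    then show ?thesis using growth[OF r] by linarith
  qed
  interpret growth_action act H' U len C D
  proof unfold_locales
    show "act 1 Y = Y" for Y by (rule act_one)
    show "act (g * h) Y = act g (act h Y)" for g h Y by (rule act_mult)
    show "sgrp H'" by (rule H')
    show "len (g * h) \<le> len g + len h" if g: "g \<in> H'" and h: "h \<in> H'" for g h
      using cos_dist_triangle[OF Ucos act_cos[OF g Ucos] act_cos[OF g act_cos[OF h Ucos]]] act_dist[OF g Ucos act_cos[OF h Ucos]]
      by (simp add: len_def act_mult)
    show "len (inverse g) = len g" if g: "g \<in> H'" for g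
    proof -
      have "cos_dist G (act g U) (act g (act (inverse g) U)) = cos_dist G U (act (inverse g) U)"
        by (rule act_dist[OF g Ucos act_cos[OF sgrp_inv[OF H' g] Ucos]])
      then show ?thesis by (simp add: len_def cos_dist_sym act_one flip: act_mult)
    qed
    show "len g = 0" if "act g U = U" for g using that cos_dist_self[OF Ucos] by (simp add: len_def)
    show "finite {act g U | g. g \<in> H' \<and> len g \<le> r}" for r unfolding ball by (rule ball_fin[OF Uorb])
    show "real (card {act g U | g. g \<in> H' \<and> len g \<le> r}) \<le> C * (1 + r) ^ D" if "r \<ge> 0" for r
      unfolding ball by (rule ball_card[OF that])
  qed
  obtain \<delta> where \<delta>: "\<delta> > 0" "delta_connected G \<delta> (orbit_of H U)" using assms(7) by (auto simp: coarsely_connected_def)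
  have "H' \<subseteq> gen (sph H' \<delta>)"
  proof
    fix p assume p: "p \<in> H'"
    then have pU: "act p U \<in> orbit_of H U" unfolding orbit by blast
    obtain ps where ps: "ps \<noteq> []" "hd ps = U" "last ps = act p U" "set ps \<subseteq> orbit_of H U"
      "\<forall>i < length ps - 1. cos_dist G (ps ! i) (ps ! Suc i) \<le> \<delta>"
      using \<delta>(2) Uorb pU unfolding delta_connected_def by meson
    \<comment> \<open>Along a chain of orbit points with jumps at most \<open>\<delta>\<close>,
      elements over consecutive points differ on the right by an element of displacement at most
      \<open>\<delta>\<close>. The claim covers all \<open>q\<close> over a point, since the
      stabilizer is among the generators.\<close>
    have path: "\<forall>q\<in>H'. act q U = ps ! i \<longrightarrow> q \<in> gen (sph H' \<delta>)" if "i < length ps" for i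
      using that
    proof (induction i)
      case 0
      then show ?case using ps(1,2) \<delta>(1) ell_stab by (auto simp: hd_conv_nth sph_def intro!: gen_incl)
    next
      case (Suc i)
      then have "ps ! i \<in> orbit_of H U" using ps(4) nth_mem[of i ps] by auto
      then obtain q' where q': "q' \<in> H'" "act q' U = ps ! i" unfolding orbit by auto
      show ?case
      proof (intro ballI impI)
        fix q assume q: "q \<in> H'" "act q U = ps ! Suc i"
        have r: "inverse q' * q \<in> H'" by (rule sgrp_mult[OF H' sgrp_inv[OF H' q'(1)] q(1)])
        have "len (inverse q' * q) = cos_dist G (act q' U) (act q' (act (inverse q' * q) U))"
          using act_dist[OF q'(1) Ucos act_cos[OF r Ucos]] by (simp add: len_def)
        also have "act q' (act (inverse q' * q) U) = act q U" by (simp flip: act_mult)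
        finally have "len (inverse q' * q) = cos_dist G (ps ! i) (ps ! Suc i)" using q'(2) q(2) by simp
        then have "inverse q' * q \<in> gen (sph H' \<delta>)" using ps(5) Suc.prems r by (intro gen_incl) (simp add: sph_def)
        moreover have "q' \<in> gen (sph H' \<delta>)" using Suc q' by simp
        ultimately have "q' * (inverse q' * q) \<in> gen (sph H' \<delta>)" by (rule gen_mult)
        then show "q \<in> gen (sph H' \<delta>)" by simp
      qed
    qed
    have "act p U = ps ! (length ps - 1)" using ps(1,3) by (simp add: last_conv_nth)
    then show "p \<in> gen (sph H' \<delta>)" using path[of "length ps - 1"] ps(1) p by simp
  qed
  then have conn: "conn H' \<delta>" using \<delta>(1) by (simp add: conn_def)
  obtain L N S where L: "sgrp L" "L \<subseteq> H'" "fi L H'" and N: "nilchain L N" "finite (orb N)"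
    and S: "finite S" "S \<subseteq> L" "L \<subseteq> gen (S \<union> N)"
    by (rule virtually_nilpotent[OF conn])
  have NL: "sgrp N" "N \<subseteq> L" using nilchain_sgrp[OF N(1) L(1)] by auto
  define H0 where "H0 = {\<phi> \<in> H. ext \<phi> \<in> L}"
  define N0 where "N0 = {\<phi> \<in> H0. ext \<phi> \<in> N}"
  have H0T: "\<phi> \<in> top_auto G T" if "\<phi> \<in> H0" for \<phi> using that HT by (simp add: H0_def)
  have H0L: "ext ` H0 = L" using L(2) by (auto simp: H0_def H'_def)
  have H0: "subgroup H0 ?A"
  proof (rule A.subgroupI)
    show "H0 \<subseteq> carrier ?A" using H0T by (auto simp: TopAutGroup_carrier)
    show "H0 \<noteq> {}" using H0L sgrp_one[OF L(1)] by blast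
    show "inv\<^bsub>?A\<^esub> \<phi> \<in> H0" if "\<phi> \<in> H0" for \<phi> using that sgrp_inv[OF L(1)] by (simp add: H0_def ext_inv HT)
    show "\<phi> \<otimes>\<^bsub>?A\<^esub> \<psi> \<in> H0" if "\<phi> \<in> H0" "\<psi> \<in> H0" for \<phi> \<psi> using that sgrp_mult[OF L(1)] by (simp add: H0_def ext_mult HT)
  qed
  have "finite (rcosets\<^bsub>?A\<lparr>carrier := H\<rparr>\<^esub> H0)"
  proof -
    obtain E where E: "finite E" "E \<subseteq> H'" "\<And>g. g \<in> H' \<Longrightarrow> \<exists>c\<in>E. g * inverse c \<in> L"
      using fi_right_reps[OF L(3) H' L(1)] by blast
    obtain F where F: "F \<subseteq> H" "finite F" "E = ext ` F" using finite_subset_image[OF E(1)] E(2) unfolding H'_def by metis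
    have "rcosets\<^bsub>?A\<lparr>carrier := H\<rparr>\<^esub> H0 \<subseteq> (\<lambda>c. H0 #>\<^bsub>?A\<^esub> c) ` F"
    proof
      fix R assume "R \<in> rcosets\<^bsub>?A\<lparr>carrier := H\<rparr>\<^esub> H0"
      then obtain \<phi> where \<phi>: "\<phi> \<in> H" "R = H0 #>\<^bsub>?A\<^esub> \<phi>" by (auto simp: RCOSETS_def r_coset_def)
      then obtain c where c: "c \<in> F" "ext \<phi> * inverse (ext c) \<in> L" using E(3)[of "ext \<phi>"] F(3) by (auto simp: H'_def)
      have cH: "c \<in> H" using c(1) F(1) by blast
      have k: "\<phi> \<otimes>\<^bsub>?A\<^esub> inv\<^bsub>?A\<^esub> c \<in> H0"
        using c(2) \<phi>(1) cH by (simp add: H0_def ext_mult ext_inv HT)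
      have mem: "\<phi> \<in> carrier ?A" "c \<in> carrier ?A" using HT \<phi>(1) cH by (auto simp: TopAutGroup_carrier)
      have "H0 #>\<^bsub>?A\<^esub> c = H0 #>\<^bsub>?A\<^esub> \<phi>" using A.rcos_eq_iff[OF H0 mem(2,1)] k by blast
      then show "R \<in> (\<lambda>c. H0 #>\<^bsub>?A\<^esub> c) ` F" using \<phi>(2) c(1) by blast
    qed
    then show ?thesis using F(2) finite_subset by blast
  qed
  moreover have "normal N0 (?A\<lparr>carrier := H0\<rparr>)" "finitely_generated_group (?A\<lparr>carrier := H0\<rparr> Mod N0)"
    "nilpotent_group (?A\<lparr>carrier := H0\<rparr> Mod N0)"
  proof -
    have B: "group (?A\<lparr>carrier := H0\<rparr>)" by (rule A.subgroup_imp_group[OF H0])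
    have eq: "N0 = {\<phi> \<in> carrier (?A\<lparr>carrier := H0\<rparr>). ext \<phi> \<in> N}" by (simp add: N0_def)
    have hom: "ext (\<phi> \<otimes>\<^bsub>?A\<lparr>carrier := H0\<rparr>\<^esub> \<psi>) = ext \<phi> * ext \<psi>"
      if "\<phi> \<in> carrier (?A\<lparr>carrier := H0\<rparr>)" "\<psi> \<in> carrier (?A\<lparr>carrier := H0\<rparr>)" for \<phi> \<psi>
      using that H0T by (simp add: ext_mult)
    have inj: "inj_on ext (carrier (?A\<lparr>carrier := H0\<rparr>))" by (rule inj_on_subset[OF ext_inj]) (use H0T in auto)
    have im: "ext ` carrier (?A\<lparr>carrier := H0\<rparr>) = L" using H0L by simp
    note q = nilchain_quotient[OF B hom inj L(1) im N(1) S]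
    show "normal N0 (?A\<lparr>carrier := H0\<rparr>)" unfolding eq by (rule q(1))
    show "finitely_generated_group (?A\<lparr>carrier := H0\<rparr> Mod N0)" unfolding eq by (rule q(2))
    show "nilpotent_group (?A\<lparr>carrier := H0\<rparr> Mod N0)" unfolding eq by (rule q(3))
  qed
  moreover define V where "V = \<Inter> (orb N)"
  have orbN: "orb N = (\<lambda>p. act p U) ` N" by (simp add: orb_def)
  have orb_cos: "orb N \<subseteq> cosubs" unfolding orbN using act_cos Ucos NL(2) L(2) by blast
  have V: "V \<in> cosubs" unfolding V_def
    by (rule Inter_cos[OF N(2) _ orb_cos]) (use sgrp_one[OF NL(1)] orbN in auto)
  moreover have "\<phi> ` V = V" if \<phi>: "\<phi> \<in> N0" for \<phi>
  proof -
    have p: "ext \<phi> \<in> N" "\<phi> \<in> top_auto G T" using \<phi> H0T by (auto simp: N0_def)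
    have "bapp (ext \<phi>) ` V = bapp (ext \<phi>) ` (\<Inter>q\<in>N. act q U)" by (simp add: V_def orbN)
    \<comment> \<open>Images commute with intersections for injective maps; the extension to a
      bijection of the whole type provides this directly.\<close>
    also have "\<dots> = (\<Inter>q\<in>N. bapp (ext \<phi>) ` act q U)" by (rule bij_image_INT[OF bij_bapp])
    also have "\<dots> = \<Inter> ((\<lambda>p. act p U) ` ((*) (ext \<phi>) ` N))"
      by (simp add: image_image act_mult flip: act_def)
    also have "(*) (ext \<phi>) ` N = N"
    proof
      show "(*) (ext \<phi>) ` N \<subseteq> N" using sgrp_mult[OF NL(1) p(1)] by blast
      show "N \<subseteq> (*) (ext \<phi>) ` N"
      proof
        fix q assume "q \<in> N"
        then have "inverse (ext \<phi>) * q \<in> N" using sgrp_mult[OF NL(1) sgrp_inv[OF NL(1) p(1)]] by blast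
        then show "q \<in> (*) (ext \<phi>) ` N" by (rule rev_image_eqI) simp
      qed
    qed
    also have "\<Inter> ((\<lambda>p. act p U) ` N) = V" by (simp add: V_def orbN)
    finally show ?thesis using ext_image[OF p(2) subgroup.subset[OF cosD(1)[OF V]]] by simp
  qed
  ultimately show ?thesis using H0 unfolding H0_def by blast
qed

end
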